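(* Let $\mathcal{E}=(E,\sigma,a)$. Suppose that $s\neq 0$, $a\neq 0$, and the algebra $E=E(s)=F[h]/(h^n-s)$ is a field. Then $\mathcal{E}\simeq M_m(D)$ for some central division $F$-algebra $D$, $m\geq 1$, and $n=m\,\mathrm{Deg}(D)$. Let $U$ be a unique simple (left) $\mathcal{E}$-module, so that ${}_EU\simeq E^d$ where $d=\mathrm{Deg}(D)$. Then: 1. $d=\min\{d'\ge1\mid d'\mid n$ and there is a matrix $\mathbb{X}\in M_{d'}(E)$ such that $\mathbb{X}^{\sigma^{n-1}}\cdots\mathbb{X}^{\sigma}\mathbb{X}=a\}$ (necessarily $\mathbb{X}\in\mathrm{GL}_{d'}(E)$ since $a\neq 0$), and $m=\frac nd$. 2. Let $\mathbb{X}\in \mathrm{GL}_d(E)$ be the $\mathcal{E}$-module structure matrix of $U$ (so $\mathbb{X}^{\sigma^{n-1}}\cdots\mathbb{X}^{\sigma}\mathbb{X}=a$). The division algebra $D=\{\Lambda\in M_d(E)\mid\Lambda^\sigma=\mathbb{X}\Lambda\mathbb{X}^{-1}\}$ is an $F$-subalgebra of the matrix algebra $M_d(E)$, which is isomorphic to the fixed algebra $M_d(E)^{\omega_{\mathbb{X}^{-1}}\sigma}$ of the automorphism $\omega_{\mathbb{X}^{-1}}\sigma\in\mathrm{Aut}_F(M_d(E))$. 3. The automorphism group $\mathrm{Aut}_F(D)$ is isomorphic to the factor group $\mathcal{N}(D)/\mathcal{C}(D)$, where $\mathcal{N}(D)=\{\omega_{\mathbb{Y}}\mid\mathbb{Y}\in\mathrm{GL}_d(E),\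 \omega_{\mathbb{Y}}(D)=D\}$ and $\mathcal{C}(D)=\{\omega_{\mathbb{Y}}\mid\mathbb{Y}\in\mathrm{GL}_d(E),\ \omega_{\mathbb{Y}}(\Lambda)=\Lambda\text{ for all }\Lambda\in D\}$ are subgroups of $\mathrm{Inn}(M_d(E))$.
   Context: $F$ is a field containing a primitive $n$'th root of unity $q$ ($n\ge2$), $s,a\in F$, $E=E(s)=F[h]/(h^n-s)$, $\sigma$ is the $F$-automorphism of $E$ with $\sigma(h)=qh$, and $\mathcal{E}=(E,\sigma,a)=E[x;\sigma]/(x^n-a)$ is the $F$-algebra generated by $h,x$ with $xh=qhx$, $h^n=s$, $x^n=a$; it is a central simple $F$-algebra of dimension $n^2$ when $s,a\ne0$. $\mathrm{Deg}(A)=k$ if $A$ is central simple over $F$ with $\dim_F A=k^2$. For $\mathbb{Y}=(y_{ij})\in M_d(E)$, $\mathbb{Y}^{\sigma^k}=(\sigma^k(y_{ij}))$, and this extends $\sigma$ to an automorphism $\sigma$ of $M_d(E)$. For $\mathbb{Y}\in\mathrm{GL}_d(E)$, $\omega_{\mathbb{Y}}(\Lambda)=\mathbb{Y}\Lambda\mathbb{Y}^{-1}$ (it depends only on the class of $\mathbb{Y}$ in $\mathrm{GL}_d(E)/E^\times$). In matrix equations $a$ stands for the scalar matrix. Module structure matrix: choosing an $E$-basis $e=(e_1,\ldots,e_d)^t$ of $U$, write $xe_i=\sum_j x_{ij}e_j$; then $\mathbb{X}=(x_{ij})$, and $x\cdot(ue)=u^\sigma\mathbb{X}e$ for row vectors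 $u\in E^d$, where $u^\sigma=(\sigma(u_1),\ldots,\sigma(u_d))$. Endomorphisms of modules are written on the right: $\Lambda\in M_d(E)$ acts by $ue\mapsto u\Lambda e$. *)

theory Defs
  imports
    "Jordan_Normal_Form.VS_Connect"
    "HOL-Algebra.Bij"
    "HOL-Algebra.QuotRing"
    "HOL-Algebra.Subrings"
begin

hide_const (open) Multiset.mult Polynomial.smult

section \<open>Algebras over a field\<close>

text \<open>The ground field is a type of class \<^class>\<open>field\<close>. An algebra over it is a
  \<^type>\<open>module\<close> record, whose ring fields carry the (possibly noncommutative) ring structure; the
  locale \<^locale>\<open>algebra\<close> of the library covers commutative algebras only.\<close>

definition F_algebra :: "('f::field, 'a) module \<Rightarrow> bool" where
  "F_algebra A \<longleftrightarrow> ring A \<and> Module.module (class_ring :: 'f ring) A \<and>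
     (\<forall>c. \<forall>x\<in>carrier A. \<forall>y\<in>carrier A.
        (c \<odot>\<^bsub>A\<^esub> x) \<otimes>\<^bsub>A\<^esub> y = c \<odot>\<^bsub>A\<^esub> (x \<otimes>\<^bsub>A\<^esub> y) \<and>
        x \<otimes>\<^bsub>A\<^esub> (c \<odot>\<^bsub>A\<^esub> y) = c \<odot>\<^bsub>A\<^esub> (x \<otimes>\<^bsub>A\<^esub> y))"

definition F_subalgebra :: "'a set \<Rightarrow> ('f::field, 'a) module \<Rightarrow> bool" where
  "F_subalgebra S A \<longleftrightarrow> subring S A \<and> Module.submodule S (class_ring :: 'f ring) A"

definition alg_hom :: "('f::field, 'a) module \<Rightarrow> ('f, 'b) module \<Rightarrow> ('a \<Rightarrow> 'b) set" where
  "alg_hom A B = {f \<in> Ring.ring_hom A B. \<forall>c. \<forall>x\<in>carrier A. f (c \<odot>\<^bsub>A\<^esub> x) = c \<odot>\<^bsub>B\<^esub> f x}"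

definition alg_iso :: "('f::field, 'a) module \<Rightarrow> ('f, 'b) module \<Rightarrow> ('a \<Rightarrow> 'b) set" where
  "alg_iso A B = {f \<in> alg_hom A B. bij_betw f (carrier A) (carrier B)}"

definition is_alg_iso :: "('f::field, 'a) module \<Rightarrow> ('f, 'b) module \<Rightarrow> bool"
    (infix \<open>\<simeq>\<^sub>a\<close> 50) where
  "A \<simeq>\<^sub>a B \<longleftrightarrow> alg_iso A B \<noteq> {}"

text \<open>As in \<^const>\<open>BijGroup\<close>, automorphisms are extensional functions, so that equality in the
  group is equality on the carrier.\<close>

definition alg_Aut :: "('f::field, 'a) module \<Rightarrow> ('a \<Rightarrow> 'a) monoid" where
  "alg_Aut A = BijGroup (carrier A) \<lparr>carrier := Bij (carrier A) \<inter> alg_hom A A\<rparr>"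

definition central :: "('f::field, 'a) module \<Rightarrow> bool" where
  "central A \<longleftrightarrow>
     {z \<in> carrier A. \<forall>y\<in>carrier A. z \<otimes>\<^bsub>A\<^esub> y = y \<otimes>\<^bsub>A\<^esub> z} = range (\<lambda>c. c \<odot>\<^bsub>A\<^esub> \<one>\<^bsub>A\<^esub>)"

definition central_simple :: "('f::field, 'a) module \<Rightarrow> bool" where
  "central_simple A \<longleftrightarrow> F_algebra A \<and> central A \<and> carrier A \<noteq> {\<zero>\<^bsub>A\<^esub>} \<and>
     (\<forall>I. ideal I A \<longrightarrow> I = {\<zero>\<^bsub>A\<^esub>} \<or> I = carrier A)"

definition central_division :: "('f::field, 'a) module \<Rightarrow> bool" where
  "central_division A \<longleftrightarrow> F_algebra A \<and> central A \<and> Units A = carrier A - {\<zero>\<^bsub>A\<^esub>}"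

text \<open>\<open>has_Deg A k\<close> says that the degree of \<open>A\<close> is defined and equal to \<open>k\<close>.\<close>

definition has_Deg :: "('f::field, 'a) module \<Rightarrow> nat \<Rightarrow> bool" where
  "has_Deg A k \<longleftrightarrow> central_simple A \<and> vectorspace.fin_dim (class_ring :: 'f ring) A \<and>
     vectorspace.dim (class_ring :: 'f ring) A = k\<^sup>2"

definition mat_alg :: "('f::field, 'd) module \<Rightarrow> nat \<Rightarrow> ('f, 'd mat) module" where
  "mat_alg D m =
    \<lparr>carrier = {A \<in> carrier_mat m m. \<forall>i<m. \<forall>j<m. A $$ (i, j) \<in> carrier D},
     mult = \<lambda>A B. mat m m (\<lambda>(i, j). \<Oplus>\<^bsub>D\<^esub>k\<in>{..<m}. A $$ (i, k) \<otimes>\<^bsub>D\<^esub> B $$ (k, j)),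
     one = mat m m (\<lambda>(i, j). if i = j then \<one>\<^bsub>D\<^esub> else \<zero>\<^bsub>D\<^esub>),
     zero = mat m m (\<lambda>_. \<zero>\<^bsub>D\<^esub>),
     add = \<lambda>A B. mat m m (\<lambda>(i, j). A $$ (i, j) \<oplus>\<^bsub>D\<^esub> B $$ (i, j)),
     smult = \<lambda>c A. mat m m (\<lambda>(i, j). c \<odot>\<^bsub>D\<^esub> A $$ (i, j))\<rparr>"

section \<open>Inner automorphisms\<close>

definition inner_aut :: "('f::field, 'a) module \<Rightarrow> 'a \<Rightarrow> 'a \<Rightarrow> 'a" where
  "inner_aut A y = (\<lambda>x\<in>carrier A. y \<otimes>\<^bsub>A\<^esub> x \<otimes>\<^bsub>A\<^esub> inv\<^bsub>A\<^esub> y)"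

definition Inn :: "('f::field, 'a) module \<Rightarrow> ('a \<Rightarrow> 'a) monoid" where
  "Inn A = BijGroup (carrier A) \<lparr>carrier := inner_aut A ` Units A\<rparr>"

definition inn_stabilizer :: "('f::field, 'a) module \<Rightarrow> 'a set \<Rightarrow> ('a \<Rightarrow> 'a) set" where
  "inn_stabilizer A S = {inner_aut A y |y. y \<in> Units A \<and> inner_aut A y ` S = S}"

definition inn_fixer :: "('f::field, 'a) module \<Rightarrow> 'a set \<Rightarrow> ('a \<Rightarrow> 'a) set" where
  "inn_fixer A S = {inner_aut A y |y. y \<in> Units A \<and> (\<forall>x\<in>S. inner_aut A y x = x)}"

section \<open>Left modules over noncommutative rings\<close>

text \<open>The library locale \<^locale>\<open>module\<close> requires a commutative base ring.\<close>

locale left_module = R?: ring R + M?: abelian_group M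
  for R :: "('r, 'x) ring_scheme" (structure) and M :: "('r, 'u, 'y) module_scheme" (structure) +
  assumes smult_closed: "\<lbrakk>r \<in> carrier R; u \<in> carrier M\<rbrakk> \<Longrightarrow> r \<odot>\<^bsub>M\<^esub> u \<in> carrier M"
    and smult_l_distr: "\<lbrakk>r \<in> carrier R; r' \<in> carrier R; u \<in> carrier M\<rbrakk> \<Longrightarrow>
      (r \<oplus> r') \<odot>\<^bsub>M\<^esub> u = r \<odot>\<^bsub>M\<^esub> u \<oplus>\<^bsub>M\<^esub> r' \<odot>\<^bsub>M\<^esub> u"
    and smult_r_distr: "\<lbrakk>r \<in> carrier R; u \<in> carrier M; v \<in> carrier M\<rbrakk> \<Longrightarrow>
      r \<odot>\<^bsub>M\<^esub> (u \<oplus>\<^bsub>M\<^esub> v) = r \<odot>\<^bsub>M\<^esub> u \<oplus>\<^bsub>M\<^esub> r \<odot>\<^bsub>M\<^esub> v"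
    and smult_assoc: "\<lbrakk>r \<in> carrier R; r' \<in> carrier R; u \<in> carrier M\<rbrakk> \<Longrightarrow>
      (r \<otimes> r') \<odot>\<^bsub>M\<^esub> u = r \<odot>\<^bsub>M\<^esub> (r' \<odot>\<^bsub>M\<^esub> u)"
    and smult_one: "u \<in> carrier M \<Longrightarrow> \<one> \<odot>\<^bsub>M\<^esub> u = u"

definition simple_module :: "('r, 'x) ring_scheme \<Rightarrow> ('r, 'u) module \<Rightarrow> bool" where
  "simple_module R U \<longleftrightarrow> left_module R U \<and> carrier U \<noteq> {\<zero>\<^bsub>U\<^esub>} \<and>
     (\<forall>H. Module.submodule H R U \<longrightarrow> H = {\<zero>\<^bsub>U\<^esub>} \<or> H = carrier U)"

definition module_iso ::
    "('r, 'x) ring_scheme \<Rightarrow> ('r, 'u) module \<Rightarrow> ('r, 'v) module \<Rightarrow> bool" where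
  "module_iso R U V \<longleftrightarrow>
     (\<exists>f \<in> LinearCombinations.module_hom R U V. bij_betw f (carrier U) (carrier V))"

definition restrict_scalars :: "('e \<Rightarrow> 'r) \<Rightarrow> ('r, 'u) module \<Rightarrow> ('e, 'u) module" where
  "restrict_scalars f U =
    \<lparr>carrier = carrier U, mult = monoid.mult U, one = one U, zero = zero U, add = add U,
     smult = \<lambda>e u. f e \<odot>\<^bsub>U\<^esub> u\<rparr>"

text \<open>Endomorphisms are written on the right, so \<open>f g\<close> means first \<open>f\<close>, then \<open>g\<close>.\<close>

definition End_right :: "('f::field, 'r) module \<Rightarrow> ('r, 'u) module \<Rightarrow> ('f, 'u \<Rightarrow> 'u) module" where
  "End_right R U =
    \<lparr>carrier = LinearCombinations.module_hom R U U \<inter> extensional (carrier U),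
     mult = \<lambda>f g. compose (carrier U) g f,
     one = \<lambda>u\<in>carrier U. u,
     zero = \<lambda>u\<in>carrier U. \<zero>\<^bsub>U\<^esub>,
     add = \<lambda>f g. \<lambda>u\<in>carrier U. f u \<oplus>\<^bsub>U\<^esub> g u,
     smult = \<lambda>c f. \<lambda>u\<in>carrier U. (c \<odot>\<^bsub>R\<^esub> \<one>\<^bsub>R\<^esub>) \<odot>\<^bsub>U\<^esub> f u\<rparr>"

section \<open>The algebra \<open>F[h]/(h\<^sup>n - s)\<close>\<close>

definition kummer_ideal :: "nat \<Rightarrow> 'f::field \<Rightarrow> 'f poly set" where
  "kummer_ideal n s = PIdl\<^bsub>class_ring :: 'f poly ring\<^esub> (Polynomial.monom 1 n - [:s:])"

definition kummer_quot :: "nat \<Rightarrow> 'f::field \<Rightarrow> 'f poly set ring" where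
  "kummer_quot n s = (class_ring :: 'f poly ring) Quot kummer_ideal n s"

definition kummer_class :: "nat \<Rightarrow> 'f::field \<Rightarrow> 'f poly \<Rightarrow> 'f poly set" where
  "kummer_class n s p = kummer_ideal n s +>\<^bsub>class_ring :: 'f poly ring\<^esub> p"

text \<open>Below \<open>E\<close> is a type of class \<^class>\<open>field\<close> that is identified with \<^const>\<open>kummer_quot\<close> by a
  ring isomorphism \<open>\<Phi>\<close>, and \<open>\<iota> c = \<Phi> (kummer_class n s [:c:])\<close> is the structure map of
  \<open>E\<close> as an algebra over \<open>F\<close>.\<close>

definition E_alg :: "('f::field \<Rightarrow> 'e::field) \<Rightarrow> ('f, 'e) module" where
  "E_alg \<iota> =
    \<lparr>carrier = UNIV, mult = (*), one = 1, zero = 0, add = (+),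
     smult = \<lambda>c e. \<iota> c * e\<rparr>"

definition E_mat_alg :: "('f::field \<Rightarrow> 'e::field) \<Rightarrow> nat \<Rightarrow> ('f, 'e mat) module" where
  "E_mat_alg \<iota> d =
    \<lparr>carrier = carrier_mat d d, mult = (*), one = 1\<^sub>m d, zero = 0\<^sub>m d d, add = (+),
     smult = \<lambda>c A. \<iota> c \<cdot>\<^sub>m A\<rparr>"

section \<open>The cyclic algebra \<open>E[x;\<sigma>]/(x\<^sup>n - a)\<close>\<close>

text \<open>Elements of \<open>E[x;\<sigma>]\<close> are written with the coefficients on the left of the powers of \<open>x\<close>;
  multiplication is determined by \<open>x e = \<sigma> e x\<close>.\<close>

definition skew_mult :: "('e::field \<Rightarrow> 'e) \<Rightarrow> 'e poly \<Rightarrow> 'e poly \<Rightarrow> 'e poly" where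
  "skew_mult \<sigma> p r = (\<Sum>i\<le>Polynomial.degree p. \<Sum>j\<le>Polynomial.degree r.
     Polynomial.monom (Polynomial.coeff p i * (\<sigma> ^^ i) (Polynomial.coeff r j)) (i + j))"

definition skew_poly_ring :: "('e::field \<Rightarrow> 'e) \<Rightarrow> 'e poly ring" where
  "skew_poly_ring \<sigma> =
    \<lparr>carrier = UNIV, mult = skew_mult \<sigma>, one = 1, zero = 0, add = (+)\<rparr>"

definition cyclic_ideal :: "('e::field \<Rightarrow> 'e) \<Rightarrow> nat \<Rightarrow> 'e \<Rightarrow> 'e poly set" where
  "cyclic_ideal \<sigma> n a = Idl\<^bsub>skew_poly_ring \<sigma>\<^esub> {Polynomial.monom 1 n - [:a:]}"

definition cyclic_class :: "('e::field \<Rightarrow> 'e) \<Rightarrow> nat \<Rightarrow> 'e \<Rightarrow> 'e poly \<Rightarrow> 'e poly set" where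
  "cyclic_class \<sigma> n a p = cyclic_ideal \<sigma> n a +>\<^bsub>skew_poly_ring \<sigma>\<^esub> p"

definition cyclic_algebra ::
    "('f::field \<Rightarrow> 'e::field) \<Rightarrow> ('e \<Rightarrow> 'e) \<Rightarrow> nat \<Rightarrow> 'f \<Rightarrow> ('f, 'e poly set) module" where
  "cyclic_algebra \<iota> \<sigma> n a =
    (let Q = skew_poly_ring \<sigma> Quot cyclic_ideal \<sigma> n (\<iota> a) in
     \<lparr>carrier = carrier Q, mult = monoid.mult Q, one = one Q, zero = zero Q, add = add Q,
      smult = \<lambda>c y. cyclic_class \<sigma> n (\<iota> a) [:\<iota> c:] \<otimes>\<^bsub>Q\<^esub> y\<rparr>)"

section \<open>Modules in coordinates\<close>

text \<open>In this section \<open>V\<close> is a module over the field \<open>E\<close> and \<open>b 0, \<dots>, b (d - 1)\<close> is an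
  ordered basis; \<open>comb V d b u\<close> is the element \<open>u e\<close> with row vector of coordinates \<open>u\<close>.\<close>

definition ordered_basis :: "('e::field, 'u) module \<Rightarrow> nat \<Rightarrow> (nat \<Rightarrow> 'u) \<Rightarrow> bool" where
  "ordered_basis V d b \<longleftrightarrow> inj_on b {..<d} \<and>
     vectorspace.basis (class_ring :: 'e ring) V (b ` {..<d})"

definition comb :: "('e::field, 'u) module \<Rightarrow> nat \<Rightarrow> (nat \<Rightarrow> 'u) \<Rightarrow> 'e vec \<Rightarrow> 'u" where
  "comb V d b u = (\<Oplus>\<^bsub>V\<^esub>i\<in>{..<d}. (u $ i) \<odot>\<^bsub>V\<^esub> b i)"

text \<open>\<open>T\<close> is the action of \<open>x\<close> on the module.\<close>

definition is_structure_matrix ::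
    "('e::field, 'u) module \<Rightarrow> ('u \<Rightarrow> 'u) \<Rightarrow> nat \<Rightarrow> (nat \<Rightarrow> 'u) \<Rightarrow> 'e mat \<Rightarrow> bool" where
  "is_structure_matrix V T d b X \<longleftrightarrow>
     X \<in> carrier_mat d d \<and> (\<forall>i<d. T (b i) = comb V d b (row X i))"

text \<open>The map \<open>u e \<mapsto> u \<Lambda> e\<close>; the row vector \<open>u \<Lambda>\<close> is \<open>transpose_mat \<Lambda> *\<^sub>v u\<close>.\<close>

definition right_act ::
    "('e::field, 'u) module \<Rightarrow> nat \<Rightarrow> (nat \<Rightarrow> 'u) \<Rightarrow> 'e mat \<Rightarrow> 'u \<Rightarrow> 'u" where
  "right_act V d b \<Lambda> = (\<lambda>w\<in>carrier V.
     comb V d b (transpose_mat \<Lambda> *\<^sub>v inv_into (carrier_vec d) (comb V d b) w))"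

text \<open>\<open>twisted_norm \<sigma> n X\<close> is the product of the matrices \<open>\<sigma>\<^sup>k(X)\<close> for \<open>k = n - 1, \<dots>, 1, 0\<close>,
  in this order.\<close>

primrec twisted_norm :: "('e::field \<Rightarrow> 'e) \<Rightarrow> nat \<Rightarrow> 'e mat \<Rightarrow> 'e mat" where
  "twisted_norm \<sigma> 0 X = 1\<^sub>m (dim_row X)"
| "twisted_norm \<sigma> (Suc k) X = map_mat (\<sigma> ^^ k) X * twisted_norm \<sigma> k X"

definition D_set :: "('f::field \<Rightarrow> 'e::field) \<Rightarrow> ('e \<Rightarrow> 'e) \<Rightarrow> nat \<Rightarrow> 'e mat \<Rightarrow> 'e mat set" where
  "D_set \<iota> \<sigma> d X =
     {\<Lambda> \<in> carrier_mat d d. map_mat \<sigma> \<Lambda> = X * \<Lambda> * inv\<^bsub>E_mat_alg \<iota> d\<^esub> X}"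

definition D_alg ::
    "('f::field \<Rightarrow> 'e::field) \<Rightarrow> ('e \<Rightarrow> 'e) \<Rightarrow> nat \<Rightarrow> 'e mat \<Rightarrow> ('f, 'e mat) module" where
  "D_alg \<iota> \<sigma> d X = (E_mat_alg \<iota> d) \<lparr>carrier := D_set \<iota> \<sigma> d X\<rparr>"

text \<open>The automorphism \<open>\<omega>\<^bsub>Y\<^esub> \<sigma>\<close> with \<open>Y\<close> the inverse of \<open>X\<close>, and its fixed algebra.\<close>

definition omega_sigma ::
    "('f::field \<Rightarrow> 'e::field) \<Rightarrow> ('e \<Rightarrow> 'e) \<Rightarrow> nat \<Rightarrow> 'e mat \<Rightarrow> 'e mat \<Rightarrow> 'e mat" where
  "omega_sigma \<iota> \<sigma> d X =
     compose (carrier_mat d d) (inner_aut (E_mat_alg \<iota> d) (inv\<^bsub>E_mat_alg \<iota> d\<^esub> X)) (map_mat \<sigma>)"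

definition fixed_alg :: "('f::field, 'a) module \<Rightarrow> ('a \<Rightarrow> 'a) \<Rightarrow> ('f, 'a) module" where
  "fixed_alg A \<tau> = A \<lparr>carrier := {x \<in> carrier A. \<tau> x = x}\<rparr>"

end

theory Submission
  imports Defs
begin

text \<open>An \<open>\<E>\<close>-module is an \<open>E\<close>-space with a \<open>\<sigma>\<close>-semilinear operator \<open>T\<close> such that \<open>T\<^sup>n = a\<close>; in
  coordinates \<open>T\<close> is a matrix of twisted norm \<open>a\<close>. Take such a matrix \<open>X\<close> of minimal size \<open>d\<close>. By
  minimality \<open>E\<^sup>d\<close> is a simple module, so \<open>D\<close>, the algebra of its endomorphisms, is a division
  algebra. Since \<open>F\<close> contains the \<open>n\<close>-th roots of unity, Fourier inversion over the conjugates by \<open>h\<close>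
  gives Galois descent (an \<open>F\<close>-basis of \<open>D\<close> is an \<open>E\<close>-basis of \<open>M\<^sub>d(E)\<close>) and the double centralizer
  property: every additive map of \<open>E\<^sup>d\<close> that commutes with \<open>D\<close> is the action of a unique element of
  \<open>\<E>\<close>. With a basis of \<open>E\<^sup>d\<close> over \<open>D\<close> this yields \<open>\<E> \<simeq> M\<^sub>m(D)\<close>. Conversely, an arbitrary isomorphism
  \<open>\<E> \<simeq> M\<^sub>m(D')\<close> provides a primitive idempotent; hence all simple modules are isomorphic to \<open>E\<^sup>d\<close>, their
  endomorphism algebra is \<open>D'\<close>, and counting dimensions over \<open>F\<close> gives \<open>n = m d\<close>. By descent an
  automorphism of \<open>D\<close> extends to an \<open>E\<close>-linear automorphism of \<open>M\<^sub>d(E)\<close>, which is inner; this is the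
  last part.\<close>


section \<open>Vector spaces and families\<close>

text \<open>The minimum in part 1 runs over divisors of \<open>n\<close>, but \<open>X\<close> is
  chosen of least size among all positive integers: the dimension of a proper submodule of
  \<open>E^d\<close> is not known to divide \<open>n\<close>. That \<open>d\<close> divides
  \<open>n\<close> comes out of the final dimension count, and then both minima agree. Some size
  occurs because \<open>x\<close> acts on \<E> itself by a companion matrix of size
  \<open>n\<close>. Two division algebras are kept apart: the one cut out of matrices by
  \<open>X\<close>, and an arbitrary one, of any type, with \<E> isomorphic to matrices over it. No
  uniqueness theorem for such presentations is invoked; both are identified with the endomorphisms
  of one simple module. A nonzero vector fixed by the corner idempotent \<open>e\<close> has the
  same annihilator as \<open>e\<close> itself, whatever the module, so simple modules can be
  matched. Fourier inversion divides by \<open>n\<close>, which is nonzero in \<open>F\<close>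
  because of the primitive root. It also replaces the theory of \<open>h^n - s\<close>: that the
  powers of \<open>h\<close> are independent, that \<sigma> has fixed field \<open>F\<close> and
  that \<E> acts faithfully all come from the distinct eigenvalues \<open>q^j\<close>.\<close>

locale vspace =
  fixes V :: "('k::field, 'v) module" (structure)
  assumes V_module: "Module.module (class_ring :: 'k ring) V"
begin

text \<open>The rewrites replace the operations of \<open>class_ring\<close> by those of the field
  type, so that scalars are computed with ordinary arithmetic.\<close>

sublocale vectorspace "class_ring :: 'k ring" V
  rewrites "carrier (class_ring :: 'k ring) = UNIV"
    and "monoid.mult (class_ring :: 'k ring) = (*)"
    and "add (class_ring :: 'k ring) = (+)"
    and "one (class_ring :: 'k ring) = 1"
    and "zero (class_ring :: 'k ring) = 0"
    and "a_inv (class_ring :: 'k ring) = uminus"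
    and "a_minus (class_ring :: 'k ring) = (-)"
    and "pow (class_ring :: 'k ring) = (^)"
    and "finsum (class_ring :: 'k ring) = sum"
    and "finprod (class_ring :: 'k ring) = prod"
    and "\<And>X. X \<subseteq> UNIV = True"
    and "\<And>x. x \<in> UNIV = True"
    and "\<And>a A. a \<in> A \<rightarrow> UNIV \<equiv> True"
    and "\<And>P. P \<and> True \<equiv> P"
    and "\<And>P. (True \<Longrightarrow> P) \<equiv> Trueprop P"
  using V_module class_field.field_axioms
  by (auto simp: class_ring_simps vectorspace_def)

lemma finsum_scale:
  "f \<in> I \<rightarrow> carrier V \<Longrightarrow> c \<odot> (\<Oplus>i\<in>I. f i) = (\<Oplus>i\<in>I. c \<odot> f i)"
  by (induct I rule: infinite_finite_induct) (auto simp: smult_r_distr Pi_def)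

lemma finsum_scale_left:
  "v \<in> carrier V \<Longrightarrow> (\<Sum>i\<in>I. c i) \<odot> v = (\<Oplus>i\<in>I. c i \<odot> v)"
  by (induct I rule: infinite_finite_induct) (auto simp: smult_l_distr Pi_def)

lemma finsum_swap:
  assumes "finite I" "finite J" "\<And>i j. i \<in> I \<Longrightarrow> j \<in> J \<Longrightarrow> f i j \<in> carrier V"
  shows "(\<Oplus>i\<in>I. \<Oplus>j\<in>J. f i j) = (\<Oplus>j\<in>J. \<Oplus>i\<in>I. f i j)"
  using assms(1,3)
proof (induct I)
  case (insert k I)
  have "(\<Oplus>j\<in>J. \<Oplus>i\<in>insert k I. f i j) = (\<Oplus>j\<in>J. f k j \<oplus> (\<Oplus>i\<in>I. f i j))"
    using insert by (intro finsum_cong') (auto intro!: finsum_closed)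
  also have "\<dots> = (\<Oplus>j\<in>J. f k j) \<oplus> (\<Oplus>j\<in>J. \<Oplus>i\<in>I. f i j)"
    using insert by (intro finsum_addf) (auto intro!: finsum_closed)
  finally show ?case using insert by (simp add: Pi_def)
qed (use assms(2) in auto)

lemma finsum_Times:
  assumes "finite I" "finite J" "\<And>i j. i \<in> I \<Longrightarrow> j \<in> J \<Longrightarrow> f i j \<in> carrier V"
  shows "(\<Oplus>p\<in>I \<times> J. f (fst p) (snd p)) = (\<Oplus>i\<in>I. \<Oplus>j\<in>J. f i j)"
  using assms(1,3)
proof (induct I)
  case (insert k I)
  have eq: "insert k I \<times> J = {k} \<times> J \<union> I \<times> J" by auto
  have "(\<Oplus>p\<in>insert k I \<times> J. f (fst p) (snd p)) =
      (\<Oplus>p\<in>{k} \<times> J. f (fst p) (snd p)) \<oplus> (\<Oplus>p\<in>I \<times> J. f (fst p) (snd p))"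
    unfolding eq using insert assms(2) by (intro finsum_Un_disjoint) auto
  also have "(\<Oplus>p\<in>{k} \<times> J. f (fst p) (snd p)) = (\<Oplus>j\<in>J. f k j)"
  proof -
    have "(\<Oplus>p\<in>Pair k ` J. f (fst p) (snd p)) = (\<Oplus>j\<in>J. f (fst (k, j)) (snd (k, j)))"
      using insert by (intro finsum_reindex) (auto simp: inj_on_def)
    moreover have "Pair k ` J = {k} \<times> J" by auto
    ultimately show ?thesis by simp
  qed
  finally show ?case using insert by (simp add: Pi_def)
qed auto

lemma minus_null: "\<ominus> \<zero> = \<zero>"
  using r_neg[OF M.zero_closed] by simp

lemma finsum_minus:
  "f \<in> I \<rightarrow> carrier V \<Longrightarrow> (\<Oplus>i\<in>I. \<ominus> f i) = \<ominus> (\<Oplus>i\<in>I. f i)"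
  by (induct I rule: infinite_finite_induct) (auto simp: minus_add Pi_def minus_null)

lemma finsum_delta:
  "finite I \<Longrightarrow> i \<in> I \<Longrightarrow> v \<in> carrier V \<Longrightarrow> (\<Oplus>j\<in>I. if j = i then v else \<zero>) = v"
  using finsum_singleton[of i I "\<lambda>_. v"] by (auto simp: eq_commute cong: if_cong)

lemma scale_eq_zero:
  assumes "c \<odot> v = \<zero>" "v \<in> carrier V" "c \<noteq> 0" shows "v = \<zero>"
proof -
  have "v = inverse c \<odot> (c \<odot> v)"
    using assms(2,3) smult_assoc1[where a = "inverse c" and b = c and x = v] by simp
  with assms show ?thesis by simp
qed

end

text \<open>Bases are indexed families rather than sets: products of index sets, images under maps
  and coordinate vectors then need no reindexing, and injectivity is a consequence.\<close>

definition family_basis :: "('k::field, 'v) module \<Rightarrow> 'i set \<Rightarrow> ('i \<Rightarrow> 'v) \<Rightarrow> bool" where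
  "family_basis V I b \<longleftrightarrow> finite I \<and> b \<in> I \<rightarrow> carrier V \<and>
     (\<forall>v\<in>carrier V. \<exists>c. v = (\<Oplus>\<^bsub>V\<^esub>i\<in>I. c i \<odot>\<^bsub>V\<^esub> b i)) \<and>
     (\<forall>c. (\<Oplus>\<^bsub>V\<^esub>i\<in>I. c i \<odot>\<^bsub>V\<^esub> b i) = \<zero>\<^bsub>V\<^esub> \<longrightarrow> (\<forall>i\<in>I. c i = 0))"

lemma family_basisD:
  assumes "family_basis V I b"
  shows "finite I" "\<And>i. i \<in> I \<Longrightarrow> b i \<in> carrier V"
    "\<And>v. v \<in> carrier V \<Longrightarrow> \<exists>c. v = (\<Oplus>\<^bsub>V\<^esub>i\<in>I. c i \<odot>\<^bsub>V\<^esub> b i)"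
    "\<And>c i. (\<Oplus>\<^bsub>V\<^esub>i\<in>I. c i \<odot>\<^bsub>V\<^esub> b i) = \<zero>\<^bsub>V\<^esub> \<Longrightarrow> i \<in> I \<Longrightarrow> c i = 0"
  using assms by (auto simp: family_basis_def)

context vspace
begin

lemma family_basis_eq:
  assumes "family_basis V I b" "(\<Oplus>i\<in>I. c i \<odot> b i) = (\<Oplus>i\<in>I. c' i \<odot> b i)" "i \<in> I"
  shows "c i = c' i"
proof -
  note D = family_basisD[OF assms(1)]
  have "(\<Oplus>i\<in>I. (c i + - c' i) \<odot> b i) = (\<Oplus>i\<in>I. c i \<odot> b i \<oplus> (\<ominus> (c' i \<odot> b i)))"
    using D(2) smult_l_distr[where a = "c i" and b = "- c' i" for i] smult_l_minus
    by (intro finsum_cong') auto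
  also have "\<dots> = (\<Oplus>i\<in>I. c i \<odot> b i) \<oplus> (\<Oplus>i\<in>I. \<ominus> (c' i \<odot> b i))"
    using D(1,2) by (intro finsum_addf) auto
  also have "(\<Oplus>i\<in>I. \<ominus> (c' i \<odot> b i)) = \<ominus> (\<Oplus>i\<in>I. c' i \<odot> b i)"
    using D(1,2) by (intro finsum_minus) auto
  finally have "(\<Oplus>i\<in>I. (c i + - c' i) \<odot> b i) = \<zero>"
    using assms(2) D(2) by (auto simp: r_neg intro!: finsum_closed)
  from D(4)[OF this assms(3)] show ?thesis by simp
qed

text \<open>If two members coincide, one vector has the coefficients of two different indicator
  functions.\<close>

lemma family_basis_inj:
  assumes "family_basis V I b" shows "inj_on b I"
proof (rule inj_onI)
  note D = family_basisD[OF assms]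
  fix i j assume ij: "i \<in> I" "j \<in> I" "b i = b j"
  have *: "(\<Oplus>k\<in>I. (if k = l then 1 else 0) \<odot> b k) = b l" if "l \<in> I" for l
  proof -
    have "(\<Oplus>k\<in>I. (if k = l then 1 else 0) \<odot> b k) = (\<Oplus>k\<in>I. if k = l then b l else \<zero>)"
      using D(2) that by (intro finsum_cong') auto
    with that D(1,2) show ?thesis by (simp add: finsum_delta)
  qed
  have "(if i = i then 1 else 0 :: 'k) = (if i = j then 1 else 0)"
    using family_basis_eq[OF assms, of "\<lambda>k. if k = i then 1 else 0" "\<lambda>k. if k = j then 1 else 0" i]
      * ij by simp
  then show "i = j" by (simp split: if_splits)
qed

lemma lincomb_image:
  "inj_on b I \<Longrightarrow> b \<in> I \<rightarrow> carrier V \<Longrightarrow> lincomb a (b ` I) = (\<Oplus>i\<in>I. a (b i) \<odot> b i)"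
  unfolding lincomb_def by (subst finsum_reindex) auto

lemma family_basis_iff:
  assumes "finite I"
  shows "family_basis V I b \<longleftrightarrow> inj_on b I \<and> basis (b ` I)"
proof
  assume fb: "family_basis V I b"
  note D = family_basisD[OF fb]
  have inj: "inj_on b I" by (rule family_basis_inj[OF fb])
  have sub: "b ` I \<subseteq> carrier V" using D(2) by auto
  have li: "lin_indpt (b ` I)"
  proof (rule finite_lin_indpt2)
    fix a assume "lincomb a (b ` I) = \<zero>"
    then have "(\<Oplus>i\<in>I. a (b i) \<odot> b i) = \<zero>"
      using lincomb_image[OF inj] D(2) by auto
    from D(4)[OF this] show "\<forall>v\<in>b ` I. a v = 0" by auto
  qed (use assms sub in auto)
  have "carrier V \<subseteq> span (b ` I)"
  proof
    fix v assume "v \<in> carrier V"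
    from D(3)[OF this] obtain c where c: "v = (\<Oplus>i\<in>I. c i \<odot> b i)" by auto
    \<comment> \<open>Library combinations carry coefficients on vectors; by injectivity a
      coefficient on an index becomes one on a vector.\<close>
    have "v = lincomb (c \<circ> the_inv_into I b) (b ` I)"
      using lincomb_image[OF inj] D(2) c
      by (auto intro!: finsum_cong' simp: the_inv_into_f_f[OF inj])
    then show "v \<in> span (b ` I)" using assms by (auto simp: span_def)
  qed
  with sub have "span (b ` I) = carrier V" using span_is_subset2 by auto
  with li sub inj show "inj_on b I \<and> basis (b ` I)" unfolding basis_def by auto
next
  assume *: "inj_on b I \<and> basis (b ` I)"
  then have inj: "inj_on b I" and sub: "b ` I \<subseteq> carrier V" and li: "lin_indpt (b ` I)"
    and sp: "span (b ` I) = carrier V" unfolding basis_def by auto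
  have b: "b \<in> I \<rightarrow> carrier V" using sub by auto
  show "family_basis V I b" unfolding family_basis_def
  proof (intro conjI ballI allI impI)
    fix v assume "v \<in> carrier V"
    with sp have "v \<in> span (b ` I)" by simp
    from finite_in_span[OF _ sub this] assms obtain a where "lincomb a (b ` I) = v" by auto
    then have "v = (\<Oplus>i\<in>I. a (b i) \<odot> b i)" using lincomb_image[OF inj b] by simp
    then show "\<exists>c. v = (\<Oplus>i\<in>I. c i \<odot> b i)" by (intro exI[of _ "a \<circ> b"]) simp
  next
    fix c i assume c: "(\<Oplus>i\<in>I. c i \<odot> b i) = \<zero>" and i: "i \<in> I"
    have "lincomb (c \<circ> the_inv_into I b) (b ` I) = \<zero>"
      unfolding lincomb_image[OF inj b] c[symmetric] using b
      by (intro finsum_cong') (auto simp: the_inv_into_f_f[OF inj])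
    with li assms i have "(c \<circ> the_inv_into I b) (b i) = 0"
      unfolding lin_dep_def by blast
    with i inj show "c i = 0" by (simp add: the_inv_into_f_f)
  qed (use assms b in auto)
qed

lemma family_basis_dim:
  assumes "family_basis V I b" shows "fin_dim" "dim = card I"
proof -
  from family_basisD(1)[OF assms] family_basis_iff assms have
    "finite I" "inj_on b I" "basis (b ` I)" by auto
  then show "fin_dim" "dim = card I"
    using dim_basis[of "b ` I"] unfolding fin_dim_def basis_def by (auto simp: card_image)
qed

lemma ordered_basis_iff: "ordered_basis V d b \<longleftrightarrow> family_basis V {..<d} b"
  unfolding ordered_basis_def by (subst family_basis_iff) auto

lemma fin_dim_ordered_basis:
  assumes fin_dim shows "\<exists>b. family_basis V {..<dim} b"
proof -
  from finite_basis_exists[OF assms] obtain B where B: "finite B" "basis B" by auto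
  then have "card B = dim" using dim_basis by auto
  then obtain b where b: "bij_betw b {..<dim} B"
    using ex_bij_betw_nat_finite[OF B(1)] by (auto simp: atLeast0LessThan)
  then have "inj_on b {..<dim}" "b ` {..<dim} = B" by (auto simp: bij_betw_def)
  then show ?thesis using B family_basis_iff[of "{..<dim}" b] by auto
qed

lemma subspace_vspace:
  assumes "Module.submodule H (class_ring :: 'k ring) V"
  shows "vspace (V\<lparr>carrier := H\<rparr>)"
  using submodule.submodule_is_module[OF assms V_module] by (rule vspace.intro)

lemma finsum_subspace:
  assumes "Module.submodule H (class_ring :: 'k ring) V" "f \<in> I \<rightarrow> H"
  shows "finsum (V\<lparr>carrier := H\<rparr>) f I = finsum V f I"
proof -
  interpret H: vspace "V\<lparr>carrier := H\<rparr>" by (rule subspace_vspace[OF assms(1)])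
  have H: "H \<subseteq> carrier V" using submoduleE(1)[of H] assms(1) by auto
  show ?thesis using assms(2)
  proof (induct I rule: infinite_finite_induct)
    case (insert x F)
    then have "f \<in> F \<rightarrow> carrier V" "f x \<in> carrier V" using H by auto
    with insert show ?case using H by (auto simp: Pi_def)
  qed (auto simp: finsum_infinite H.finsum_infinite)
qed

text \<open>A maximal independent subset of \<open>H\<close> is a basis of \<open>H\<close>;
  independence means the same in \<open>H\<close> and in \<open>V\<close>, which bounds its size by
  \<open>dim\<close>. The last clause, that full dimension forces equality, later excludes proper
  submodules.\<close>

lemma subspace_basis:
  assumes H: "Module.submodule H (class_ring :: 'k ring) V" and fd: fin_dim
  shows "\<exists>k b. k \<le> dim \<and> family_basis (V\<lparr>carrier := H\<rparr>) {..<k} b \<and> (k = dim \<longrightarrow> H = carrier V)"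
proof -
  interpret H: vspace "V\<lparr>carrier := H\<rparr>" by (rule subspace_vspace[OF H])
  have HV: "H \<subseteq> carrier V" using submoduleE(1)[of H] H by auto
  have lin: "H.lincomb a A = lincomb a A" if "A \<subseteq> H" for a A
    unfolding H.lincomb_def lincomb_def
    using finsum_subspace[OF H, of "\<lambda>v. a v \<odot> v" A] that Module.submodule.smult_closed[OF H]
    by (auto simp: class_ring_simps)
  have dep: "H.lin_dep A = lin_dep A" if "A \<subseteq> H" for A
  proof -
    have "finite B \<and> B \<subseteq> A \<and> H.lincomb a B = \<zero> \<and> v \<in> B \<and> a v \<noteq> 0 \<longleftrightarrow>
        finite B \<and> B \<subseteq> A \<and> lincomb a B = \<zero> \<and> v \<in> B \<and> a v \<noteq> 0" for B a v
      using lin[of B a] that by auto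
    then show ?thesis by (simp add: H.lin_dep_def lin_dep_def)
  qed
  have bnd: "finite A \<and> card A \<le> dim" if "A \<subseteq> H \<and> H.lin_indpt A" for A
    using li_le_dim[OF fd, of A] that dep HV by auto
  have "\<exists>A. finite A \<and> maximal A (\<lambda>S. S \<subseteq> H \<and> H.lin_indpt S)"
  proof (rule maximal_exists[where N = dim and B = "{}"])
    show "{} \<subseteq> H \<and> H.lin_indpt {}" unfolding H.lin_dep_def by auto
  qed (rule bnd)
  then obtain A where A: "finite A" "maximal A (\<lambda>S. S \<subseteq> H \<and> H.lin_indpt S)" by auto
  have bA: "H.basis A" using H.max_li_is_basis[of A] A(2) by simp
  have AH: "A \<subseteq> H" "H.lin_indpt A" using A(2) by (auto simp: maximal_def)
  have "H.fin_dim" using bA A(1) unfolding H.fin_dim_def H.basis_def by auto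
  from H.fin_dim_ordered_basis[OF this] obtain b where
    b: "family_basis (V\<lparr>carrier := H\<rparr>) {..<H.dim} b" by auto
  have dimA: "H.dim = card A" using H.dim_basis[OF A(1) bA] .
  have "H = carrier V" if eq: "H.dim = dim"
  proof -
    have "basis A" using dim_li_is_basis[OF fd A(1)] AH dep HV dimA eq by auto
    then have sp: "span A = carrier V" by (simp add: basis_def)
    have "span A = H.span A" unfolding span_def H.span_def using lin AH
      by (intro Collect_cong) (metis order_trans)
    with bA sp show ?thesis by (simp add: H.basis_def)
  qed
  moreover have "H.dim \<le> dim" using bnd[of A] AH dimA by simp
  ultimately show ?thesis using b by blast
qed

end

text \<open>\<open>V\<close> is an internal direct sum of copies of \<open>W\<close>, one for each
  map \<open>f i\<close>. It is applied to a simple module, seen as columns over a division algebra,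
  to count dimensions over the ground field.\<close>

lemma (in vspace) family_basis_sum:
  fixes W :: "('k, 'w) module"
  assumes W: "vspace W" and fb: "family_basis W J c" and I: "finite I"
    and f: "\<And>i. i \<in> I \<Longrightarrow> f i \<in> LinearCombinations.module_hom class_ring W V"
    and span: "\<And>v. v \<in> carrier V \<Longrightarrow> \<exists>w. w \<in> I \<rightarrow> carrier W \<and> v = (\<Oplus>i\<in>I. f i (w i))"
    and indep: "\<And>w i. w \<in> I \<rightarrow> carrier W \<Longrightarrow> (\<Oplus>i\<in>I. f i (w i)) = \<zero> \<Longrightarrow> i \<in> I \<Longrightarrow> w i = \<zero>\<^bsub>W\<^esub>"
  shows "family_basis V (I \<times> J) (\<lambda>p. f (fst p) (c (snd p)))"
proof -
  interpret W: vspace W by fact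
  note D = family_basisD[OF fb]
  have f_closed: "f i w \<in> carrier V" if "i \<in> I" "w \<in> carrier W" for i w
    using f[OF that(1)] that(2) by (auto simp: LinearCombinations.module_hom_def)
  have f_add: "f i (w \<oplus>\<^bsub>W\<^esub> w') = f i w \<oplus> f i w'"
    if "i \<in> I" "w \<in> carrier W" "w' \<in> carrier W" for i w w'
    using f[OF that(1)] that(2-) by (auto simp: LinearCombinations.module_hom_def)
  have f_smult: "f i (a \<odot>\<^bsub>W\<^esub> w) = a \<odot> f i w" if "i \<in> I" "w \<in> carrier W" for i w a
    using f[OF that(1)] that(2-) by (auto simp: LinearCombinations.module_hom_def class_ring_simps)
  have f0: "f i \<zero>\<^bsub>W\<^esub> = \<zero>" if "i \<in> I" for i
  proof -
    have "f i (0 \<odot>\<^bsub>W\<^esub> \<zero>\<^bsub>W\<^esub>) = 0 \<odot> f i \<zero>\<^bsub>W\<^esub>" using f_smult[OF that W.zero_closed] .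
    then show ?thesis using f_closed[OF that W.zero_closed] by simp
  qed
  have fsum: "f i (\<Oplus>\<^bsub>W\<^esub>j\<in>J. a j \<odot>\<^bsub>W\<^esub> c j) = (\<Oplus>j\<in>J. a j \<odot> f i (c j))" if "i \<in> I" for i a
    using D(1,2)
  proof (induct J)
    case (insert j J')
    have S: "(\<Oplus>\<^bsub>W\<^esub>j\<in>J'. a j \<odot>\<^bsub>W\<^esub> c j) \<in> carrier W"
      using insert by (auto intro!: W.finsum_closed)
    have "(\<Oplus>j\<in>insert j J'. a j \<odot> f i (c j)) = a j \<odot> f i (c j) \<oplus> (\<Oplus>j\<in>J'. a j \<odot> f i (c j))"
      using insert that f_closed by (intro finsum_insert) auto
    moreover have "(\<Oplus>\<^bsub>W\<^esub>j\<in>insert j J'. a j \<odot>\<^bsub>W\<^esub> c j) = a j \<odot>\<^bsub>W\<^esub> c j \<oplus>\<^bsub>W\<^esub> (\<Oplus>\<^bsub>W\<^esub>j\<in>J'. a j \<odot>\<^bsub>W\<^esub> c j)"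
      using insert by (intro W.finsum_insert) auto
    ultimately show ?case using insert S that f_add f_smult by simp
  qed (use f0 that in auto)
  have sumIJ: "(\<Oplus>p\<in>I \<times> J. a p \<odot> f (fst p) (c (snd p))) =
      (\<Oplus>i\<in>I. f i (\<Oplus>\<^bsub>W\<^esub>j\<in>J. a (i, j) \<odot>\<^bsub>W\<^esub> c j))" for a
  proof -
    have "(\<Oplus>p\<in>I \<times> J. a p \<odot> f (fst p) (c (snd p))) = (\<Oplus>i\<in>I. \<Oplus>j\<in>J. a (i, j) \<odot> f i (c j))"
      using finsum_Times[OF I D(1), of "\<lambda>i j. a (i, j) \<odot> f i (c j)"] f_closed D(2) by simp
    also have "\<dots> = (\<Oplus>i\<in>I. f i (\<Oplus>\<^bsub>W\<^esub>j\<in>J. a (i, j) \<odot>\<^bsub>W\<^esub> c j))"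
      using fsum f_closed D(2) by (intro finsum_cong') (auto intro!: W.finsum_closed)
    finally show ?thesis .
  qed
  show ?thesis unfolding family_basis_def
  proof (intro conjI ballI allI impI)
    fix v assume "v \<in> carrier V"
    from span[OF this] obtain w where w: "w \<in> I \<rightarrow> carrier W" "v = (\<Oplus>i\<in>I. f i (w i))" by auto
    have "\<forall>i\<in>I. \<exists>a. w i = (\<Oplus>\<^bsub>W\<^esub>j\<in>J. a j \<odot>\<^bsub>W\<^esub> c j)" using D(3) w(1) by auto
    then obtain a where a: "\<And>i. i \<in> I \<Longrightarrow> w i = (\<Oplus>\<^bsub>W\<^esub>j\<in>J. a i j \<odot>\<^bsub>W\<^esub> c j)" by metis
    have "v = (\<Oplus>p\<in>I \<times> J. a (fst p) (snd p) \<odot> f (fst p) (c (snd p)))"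
      unfolding w(2) sumIJ using w(1)
      by (intro finsum_cong') (auto simp flip: a intro!: f_closed)
    then show "\<exists>b. v = (\<Oplus>p\<in>I \<times> J. b p \<odot> f (fst p) (c (snd p)))"
      by (intro exI[of _ "\<lambda>p. a (fst p) (snd p)"])
  next
    fix a p assume "(\<Oplus>p\<in>I \<times> J. a p \<odot> f (fst p) (c (snd p))) = \<zero>" and p: "p \<in> I \<times> J"
    then have "(\<Oplus>i\<in>I. f i (\<Oplus>\<^bsub>W\<^esub>j\<in>J. a (i, j) \<odot>\<^bsub>W\<^esub> c j)) = \<zero>" by (simp add: sumIJ)
    from indep[OF _ this, of "fst p"] p have "(\<Oplus>\<^bsub>W\<^esub>j\<in>J. a (fst p, j) \<odot>\<^bsub>W\<^esub> c j) = \<zero>\<^bsub>W\<^esub>"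
      using D(2) by (auto intro!: W.finsum_closed)
    from D(4)[OF this, of "snd p"] p show "a p = 0" by auto
  qed (use I D f_closed in auto)
qed


section \<open>Discrete Fourier inversion\<close>

text \<open>If \<open>n\<close> vanished in the field, then \<open>1\<close> would be a root of
  \<open>1 + X + ... + X^(n - 1)\<close>, like all other powers of \<open>q\<close>; these
  \<open>n\<close> distinct roots are too many for degree \<open>n - 1\<close>.\<close>

lemma of_nat_neq_zero_if_root_of_unity:
  fixes q :: "'k::field"
  assumes n: "0 < n" and q: "q ^ n = 1" "\<And>k. 0 < k \<Longrightarrow> k < n \<Longrightarrow> q ^ k \<noteq> 1"
  shows "of_nat n \<noteq> (0 :: 'k)"
proof
  assume n0: "of_nat n = (0 :: 'k)"
  have q0: "q \<noteq> 0" using q(1) n by (cases "q = 0") (auto simp: power_0_left)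
  define p :: "'k poly" where "p = (\<Sum>k<n. Polynomial.monom 1 k)"
  have poly_p: "poly p y = (\<Sum>k<n. y ^ k)" for y by (simp add: p_def poly_sum poly_monom)
  have deg: "Polynomial.degree p \<le> n - 1"
    unfolding p_def by (rule degree_sum_le) (auto intro: order_trans[OF degree_monom_le])
  have "Polynomial.coeff p 0 = 1" using n by (simp add: p_def coeff_sum)
  then have p0: "p \<noteq> 0" by auto
  have inj: "inj_on (\<lambda>j. q ^ j) {..<n}"
  proof (rule linorder_inj_onI')
    fix i j assume ij: "i \<in> {..<n}" "j \<in> {..<n}" "i < j"
    show "q ^ i \<noteq> q ^ j"
    proof
      assume "q ^ i = q ^ j"
      moreover have "q ^ j = q ^ i * q ^ (j - i)"
        using ij(3) by (metis le_add_diff_inverse less_imp_le power_add)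
      moreover have "q ^ (j - i) \<noteq> 1" using ij by (intro q(2)) auto
      ultimately show False using q0 by simp
    qed
  qed
  have root: "poly p (q ^ j) = 0" if "j < n" for j
  proof (cases "j = 0")
    case True
    then show ?thesis using n0 by (simp add: poly_p)
  next
    case False
    then have "q ^ j \<noteq> 1" using q(2) that by auto
    moreover have "(q ^ j) ^ n = 1" using q(1) by (simp flip: power_mult add: mult.commute[of j] power_mult)
    ultimately show ?thesis by (simp add: poly_p geometric_sum)
  qed
  have "n = card ((\<lambda>j. q ^ j) ` {..<n})" by (simp add: card_image[OF inj])
  also have "\<dots> \<le> card {y. poly p y = 0}"
    using root poly_roots_finite[OF p0] by (intro card_mono) auto
  also have "\<dots> \<le> n - 1" using card_poly_roots_bound[OF p0] deg by simp
  finally show False using n by simp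
qed

locale root_of_unity =
  fixes n :: nat and \<zeta> :: "'k::field"
  assumes n_pos: "0 < n" and root: "\<zeta> ^ n = 1"
    and prim: "\<And>k. 0 < k \<Longrightarrow> k < n \<Longrightarrow> \<zeta> ^ k \<noteq> 1"
begin

lemma n_neq_zero: "of_nat n \<noteq> (0 :: 'k)"
  using of_nat_neq_zero_if_root_of_unity n_pos root prim by blast

lemma root_neq_zero: "\<zeta> \<noteq> 0"
  using root n_pos by (cases "\<zeta> = 0") (auto simp: power_0_left)

text \<open>The summands are powers of \<open>w = \<zeta>^i / \<zeta>^j\<close>, an
  \<open>n\<close>-th root of unity that differs from \<open>1\<close> unless \<open>i = j\<close>,
  so the geometric sum vanishes off the diagonal.\<close>

lemma orthogonality:
  assumes "i < n" "j < n"
  shows "(\<Sum>k<n. \<zeta> ^ (i * k) * inverse (\<zeta> ^ (j * k))) = (if i = j then of_nat n else 0)"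
proof -
  define w where "w = \<zeta> ^ i * inverse (\<zeta> ^ j)"
  have w: "\<zeta> ^ (i * k) * inverse (\<zeta> ^ (j * k)) = w ^ k" for k
    by (simp add: w_def power_mult_distrib power_mult power_inverse)
  have "w ^ n = 1"
    unfolding w[symmetric] using root by (simp add: mult.commute[of _ n] power_mult)
  moreover have "w = 1 \<longleftrightarrow> i = j"
  proof
    assume "w = 1"
    then have eq: "\<zeta> ^ i = \<zeta> ^ j" using root_neq_zero by (simp add: w_def field_simps)
    show "i = j"
    proof (rule ccontr)
      assume "i \<noteq> j"
      then consider "i < j" | "j < i" by linarith
      then show False
      proof cases
        case 1
        then have "\<zeta> ^ j = \<zeta> ^ i * \<zeta> ^ (j - i)" by (simp flip: power_add)
        with eq root_neq_zero prim[of "j - i"] 1 assms show False by simp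
      next
        case 2
        then have "\<zeta> ^ i = \<zeta> ^ j * \<zeta> ^ (i - j)" by (simp flip: power_add)
        with eq root_neq_zero prim[of "i - j"] 2 assms show False by simp
      qed
    qed
  qed (use root_neq_zero in \<open>simp add: w_def\<close>)
  ultimately show ?thesis unfolding w by (auto simp: geometric_sum)
qed

end

locale fourier = vspace V + root_of_unity n \<zeta>
  for V :: "('k::field, 'v) module" (structure) and n and \<zeta> :: 'k
begin

text \<open>For the orbit \<open>y k = T^k v\<close> of an operator with \<open>T^n = 1\<close>,
  this is the component of \<open>v\<close> in the eigenspace of \<open>T\<close> for
  \<open>\<zeta>^j\<close>. Orbits under conjugation by \<open>h\<close> are decomposed in the same
  way.\<close>

definition dft :: "(nat \<Rightarrow> 'v) \<Rightarrow> nat \<Rightarrow> 'v" where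
  "dft y j = (\<Oplus>k\<in>{..<n}. (inverse (\<zeta> ^ (j * k)) / of_nat n) \<odot> y k)"

lemma dft_closed: "y \<in> {..<n} \<rightarrow> carrier V \<Longrightarrow> dft y j \<in> carrier V"
  unfolding dft_def by (rule finsum_closed) auto

text \<open>Summing over \<open>j\<close> first, orthogonality leaves only the term
  \<open>k = 0\<close>: a vector is the sum of its eigencomponents.\<close>

lemma dft_inversion:
  assumes y: "y \<in> {..<n} \<rightarrow> carrier V"
  shows "(\<Oplus>j\<in>{..<n}. dft y j) = y 0"
proof -
  have "(\<Oplus>j\<in>{..<n}. dft y j)
      = (\<Oplus>k\<in>{..<n}. \<Oplus>j\<in>{..<n}. (inverse (\<zeta> ^ (j * k)) / of_nat n) \<odot> y k)"
    unfolding dft_def using y by (intro finsum_swap) auto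
  also have "\<dots> = (\<Oplus>k\<in>{..<n}. (\<Sum>j<n. inverse (\<zeta> ^ (j * k)) / of_nat n) \<odot> y k)"
    using y by (intro finsum_cong') (auto simp: finsum_scale_left Pi_def)
  also have "\<dots> = (\<Oplus>k\<in>{..<n}. if k = 0 then y 0 else \<zero>)"
  proof (intro finsum_cong')
    fix k assume k: "k \<in> {..<n}"
    have "(\<Sum>j<n. inverse (\<zeta> ^ (j * k)) / of_nat n) = (\<Sum>j<n. inverse (\<zeta> ^ (k * j))) / of_nat n"
      by (simp add: sum_divide_distrib mult.commute)
    also have "\<dots> = (if k = 0 then 1 else 0)"
      using orthogonality[of 0 k] n_pos k n_neq_zero by auto
    finally show "(\<Sum>j<n. inverse (\<zeta> ^ (j * k)) / of_nat n) \<odot> y k = (if k = 0 then y 0 else \<zero>)"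
      using y k by (auto simp: Pi_def)
  qed (use y n_pos in auto)
  also have "\<dots> = y 0" using y n_pos by (intro finsum_delta) auto
  finally show ?thesis .
qed

lemma finsum_lessThan_shift:
  assumes "g \<in> {..m} \<rightarrow> carrier V"
  shows "(\<Oplus>k\<in>{..<m}. g (Suc k)) \<oplus> g 0 = (\<Oplus>k\<in>{..<Suc m}. g k)"
  using assms
proof (induct m)
  case (Suc m)
  have IH: "(\<Oplus>k\<in>{..<m}. g (Suc k)) \<oplus> g 0 = (\<Oplus>k\<in>{..<Suc m}. g k)"
    by (rule Suc(1)) (use Suc(2) in auto)
  have c: "(\<Oplus>k\<in>{..<m}. g (Suc k)) \<in> carrier V" "g 0 \<in> carrier V" "g (Suc m) \<in> carrier V"
    using Suc(2) by (auto intro!: finsum_closed)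
  have "(\<Oplus>k\<in>{..<Suc (Suc m)}. g k) = g (Suc m) \<oplus> (\<Oplus>k\<in>{..<Suc m}. g k)"
    using Suc(2) by (subst lessThan_Suc, intro finsum_insert) auto
  moreover have "(\<Oplus>k\<in>{..<Suc m}. g (Suc k)) = g (Suc m) \<oplus> (\<Oplus>k\<in>{..<m}. g (Suc k))"
    using Suc(2) by (subst lessThan_Suc, intro finsum_insert) auto
  ultimately show ?case using c by (simp add: IH[symmetric] a_assoc)
qed (auto simp: lessThan_Suc)

text \<open>For an orbit this is the eigenvalue equation of the component.\<close>

lemma dft_shift:
  assumes y: "y \<in> {..n} \<rightarrow> carrier V" and per: "y n = y 0"
  shows "dft (\<lambda>k. y (Suc k)) j = \<zeta> ^ j \<odot> dft y j"
proof -
  \<comment> \<open>The factor \<open>\<zeta>^j\<close> makes the weight of \<open>y k\<close> the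
    one that the shifted sum gives it, namely that of position \<open>k - 1\<close>.\<close>
  define g where "g k = (\<zeta> ^ j * inverse (\<zeta> ^ (j * k)) / of_nat n) \<odot> y k" for k
  have g: "g \<in> {..n} \<rightarrow> carrier V" using y by (auto simp: g_def Pi_def)
  have gn: "g n = g 0"
    using per root by (simp add: g_def mult.commute[of j] power_mult)
  have gS: "g (Suc k) = (inverse (\<zeta> ^ (j * k)) / of_nat n) \<odot> y (Suc k)" for k
    using root_neq_zero by (simp add: g_def power_add field_simps)
  obtain m where m: "n = Suc m" using n_pos by (cases n) auto
  have c: "(\<Oplus>k\<in>{..<m}. g (Suc k)) \<in> carrier V" "g 0 \<in> carrier V"
    using g m by (auto intro!: finsum_closed)
  have "dft (\<lambda>k. y (Suc k)) j = (\<Oplus>k\<in>{..<n}. g (Suc k))"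
    unfolding dft_def gS ..
  also have "\<dots> = (\<Oplus>k\<in>{..<Suc m}. g (Suc k))" by (simp add: m)
  also have "\<dots> = g (Suc m) \<oplus> (\<Oplus>k\<in>{..<m}. g (Suc k))"
    using g m by (subst lessThan_Suc, intro finsum_insert) auto
  \<comment> \<open>By periodicity the last term \<open>g n\<close> may be replaced by
    \<open>g 0\<close>, which closes the cycle.\<close>
  also have "\<dots> = (\<Oplus>k\<in>{..<Suc m}. g k)"
  proof -
    have "g \<in> {..m} \<rightarrow> carrier V" using g m by auto
    from finsum_lessThan_shift[OF this] show ?thesis using m gn c by (simp add: a_comm)
  qed
  also have "\<dots> = \<zeta> ^ j \<odot> dft y j"
  proof -
    have yc: "y k \<in> carrier V" if "k < n" for k using y that by auto
    then have "\<zeta> ^ j \<odot> dft y j = (\<Oplus>k\<in>{..<n}. \<zeta> ^ j \<odot> ((inverse (\<zeta> ^ (j * k)) / of_nat n) \<odot> y k))"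
      unfolding dft_def by (intro finsum_scale) auto
    also have "\<dots> = (\<Oplus>k\<in>{..<n}. g k)"
      using yc by (intro finsum_cong') (auto simp: g_def smult_assoc1[symmetric])
    finally show ?thesis by (simp add: m)
  qed
  finally show ?thesis .
qed

text \<open>The hypotheses form a Vandermonde system in the \<open>z j\<close> with nodes
  \<open>\<zeta>^j\<close>. The inverse transform solves it explicitly and yields
  \<open>n z i = 0\<close>. In applications the \<open>z j\<close> are eigenvectors, and the system
  arises by applying powers of the operator to one relation.\<close>

lemma eigen_indep:
  assumes z: "z \<in> {..<n} \<rightarrow> carrier V" and i: "i < n"
    and eq: "\<And>k. k < n \<Longrightarrow> (\<Oplus>j\<in>{..<n}. \<zeta> ^ (j * k) \<odot> z j) = \<zero>"
  shows "z i = \<zero>"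
proof -
  have "(\<Oplus>k\<in>{..<n}. inverse (\<zeta> ^ (i * k)) \<odot> (\<Oplus>j\<in>{..<n}. \<zeta> ^ (j * k) \<odot> z j))
      = (\<Oplus>k\<in>{..<n}. \<zero>)"
    using eq by (intro finsum_cong') auto
  then have "\<zero> = (\<Oplus>k\<in>{..<n}. inverse (\<zeta> ^ (i * k)) \<odot> (\<Oplus>j\<in>{..<n}. \<zeta> ^ (j * k) \<odot> z j))"
    by simp
  also have "\<dots> = (\<Oplus>k\<in>{..<n}. \<Oplus>j\<in>{..<n}. (\<zeta> ^ (j * k) * inverse (\<zeta> ^ (i * k))) \<odot> z j)"
  proof (intro finsum_cong' refl)
    fix k
    have "inverse (\<zeta> ^ (i * k)) \<odot> (\<Oplus>j\<in>{..<n}. \<zeta> ^ (j * k) \<odot> z j)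
        = (\<Oplus>j\<in>{..<n}. inverse (\<zeta> ^ (i * k)) \<odot> (\<zeta> ^ (j * k) \<odot> z j))"
      using z by (intro finsum_scale) auto
    also have "\<dots> = (\<Oplus>j\<in>{..<n}. (\<zeta> ^ (j * k) * inverse (\<zeta> ^ (i * k))) \<odot> z j)"
      using z by (intro finsum_cong') (auto simp: smult_assoc1[symmetric] mult.commute Pi_def)
    finally show "inverse (\<zeta> ^ (i * k)) \<odot> (\<Oplus>j\<in>{..<n}. \<zeta> ^ (j * k) \<odot> z j)
        = (\<Oplus>j\<in>{..<n}. (\<zeta> ^ (j * k) * inverse (\<zeta> ^ (i * k))) \<odot> z j)" .
  qed (use z in \<open>auto intro!: finsum_closed\<close>)
  also have "\<dots> = (\<Oplus>j\<in>{..<n}. \<Oplus>k\<in>{..<n}. (\<zeta> ^ (j * k) * inverse (\<zeta> ^ (i * k))) \<odot> z j)"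
    using z by (intro finsum_swap) auto
  also have "\<dots> = (\<Oplus>j\<in>{..<n}. if j = i then of_nat n \<odot> z i else \<zero>)"
    using z i by (intro finsum_cong') (auto simp: finsum_scale_left[symmetric] orthogonality Pi_def)
  also have "\<dots> = of_nat n \<odot> z i" using z i by (intro finsum_delta) auto
  finally have "of_nat n \<odot> z i = \<zero>" ..
  then show ?thesis using scale_eq_zero n_neq_zero z i by auto
qed

end


section \<open>Kummer extensions and semilinear operators\<close>

text \<open>\<open>E\<close> as a vector space over itself lets the Fourier lemmas apply to
  identities between scalars.\<close>

lemma E_alg_id_vspace: "vspace (E_alg (\<lambda>x :: 'e::field. x))"
proof -
  have "\<exists>y. y + x = 0" for x :: 'e by (rule exI[of _ "- x"]) simp
  then show ?thesis
    by unfold_locales (auto simp: E_alg_def class_ring_simps Units_def algebra_simps)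
qed

lemma E_alg_finsum: "finsum (E_alg (\<lambda>x :: 'e::field. x)) f I = sum f I"
proof -
  interpret vspace "E_alg (\<lambda>x :: 'e. x)" by (rule E_alg_id_vspace)
  show ?thesis
  proof (induct I rule: infinite_finite_induct)
    case (insert x F)
    then have "finsum (E_alg (\<lambda>x. x)) f (insert x F) = f x \<oplus>\<^bsub>E_alg (\<lambda>x. x)\<^esub> finsum (E_alg (\<lambda>x. x)) f F"
      by (intro finsum_insert) (auto simp: E_alg_def)
    with insert show ?case by (simp add: E_alg_def)
  qed (simp_all add: finsum_infinite, simp_all add: E_alg_def)
qed

text \<open>The facts about the quotient \<open>F[h]/(h^n - s)\<close> from which the rest proceeds:
  the powers of \<open>h\<close> below \<open>n\<close> span, and \<sigma> scales \<open>h\<close>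
  by \<open>q\<close>. Linear independence of these powers is derived, not assumed.\<close>

locale kummer =
  fixes n :: nat and q s a :: "'f::field" and \<iota> :: "'f \<Rightarrow> 'e::field"
    and h :: 'e and \<sigma> :: "'e \<Rightarrow> 'e"
  assumes n_ge_2: "2 \<le> n"
    and q_root: "q ^ n = 1" and q_prim: "\<And>k. 0 < k \<Longrightarrow> k < n \<Longrightarrow> q ^ k \<noteq> 1"
    and s_neq_0: "s \<noteq> 0" and a_neq_0: "a \<noteq> 0"
    and \<iota>_one: "\<iota> 1 = 1" and \<iota>_add: "\<iota> (c + c') = \<iota> c + \<iota> c'" and \<iota>_mult: "\<iota> (c * c') = \<iota> c * \<iota> c'"
    and \<sigma>_one: "\<sigma> 1 = 1" and \<sigma>_add: "\<sigma> (e + e') = \<sigma> e + \<sigma> e'" and \<sigma>_mult: "\<sigma> (e * e') = \<sigma> e * \<sigma> e'"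
    and \<sigma>_\<iota>: "\<sigma> (\<iota> c) = \<iota> c"
    and h_pow: "h ^ n = \<iota> s" and \<sigma>_h: "\<sigma> h = \<iota> q * h"
    and h_span: "\<exists>c. e = (\<Sum>j<n. \<iota> (c j) * h ^ j)"
begin

lemma \<iota>_zero: "\<iota> 0 = 0" by (metis \<iota>_add add.right_neutral add_left_cancel)

lemma \<iota>_eq_0: "\<iota> c = 0 \<longleftrightarrow> c = 0"
proof
  assume "\<iota> c = 0"
  then have "\<iota> (c * inverse c) = 0" by (simp add: \<iota>_mult)
  then show "c = 0" using \<iota>_one by (cases "c = 0") auto
qed (simp add: \<iota>_zero)

lemma \<iota>_minus: "\<iota> (- c) = - \<iota> c"
  using \<iota>_add[of c "- c"] by (simp add: \<iota>_zero eq_neg_iff_add_eq_0 add.commute)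

lemma \<iota>_inj: "\<iota> c = \<iota> c' \<longleftrightarrow> c = c'"
  using \<iota>_eq_0[of "c + - c'"] unfolding \<iota>_add \<iota>_minus by simp

lemma \<iota>_power: "\<iota> (c ^ k) = \<iota> c ^ k" by (induct k) (auto simp: \<iota>_one \<iota>_mult)

lemma \<iota>_inverse: "\<iota> (inverse c) = inverse (\<iota> c)"
proof (cases "c = 0")
  case False
  then have "\<iota> c * \<iota> (inverse c) = 1" by (simp add: \<iota>_one flip: \<iota>_mult)
  then show ?thesis by (simp add: inverse_unique)
qed (simp add: \<iota>_zero)

lemma \<iota>_of_nat: "\<iota> (of_nat k) = of_nat k" by (induct k) (auto simp: \<iota>_zero \<iota>_add \<iota>_one)

lemma \<sigma>_zero: "\<sigma> 0 = 0" by (metis \<sigma>_add add.right_neutral add_left_cancel)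

lemma \<sigma>_pow_hom:
  "(\<sigma> ^^ k) 0 = 0" "(\<sigma> ^^ k) 1 = 1" "(\<sigma> ^^ k) (e + e') = (\<sigma> ^^ k) e + (\<sigma> ^^ k) e'"
  "(\<sigma> ^^ k) (e * e') = (\<sigma> ^^ k) e * (\<sigma> ^^ k) e'" "(\<sigma> ^^ k) (\<iota> c) = \<iota> c"
  by (induct k) (auto simp: \<sigma>_zero \<sigma>_one \<sigma>_add \<sigma>_mult \<sigma>_\<iota>)

lemma \<sigma>_pow_power: "(\<sigma> ^^ k) (e ^ j) = (\<sigma> ^^ k) e ^ j"
  by (induct j) (auto simp: \<sigma>_pow_hom)

lemma \<sigma>_pow_sum: "(\<sigma> ^^ k) (sum f I) = (\<Sum>i\<in>I. (\<sigma> ^^ k) (f i))"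
  by (induct I rule: infinite_finite_induct) (auto simp: \<sigma>_pow_hom)

lemma \<sigma>_pow_inverse: "(\<sigma> ^^ k) (inverse e) = inverse ((\<sigma> ^^ k) e)"
proof (cases "e = 0")
  case False
  then have "(\<sigma> ^^ k) e * (\<sigma> ^^ k) (inverse e) = 1" by (simp add: \<sigma>_pow_hom(2) flip: \<sigma>_pow_hom(4))
  then show ?thesis by (simp add: inverse_unique)
qed (simp add: \<sigma>_pow_hom)

lemma \<sigma>_sum: "\<sigma> (sum f I) = (\<Sum>i\<in>I. \<sigma> (f i))" using \<sigma>_pow_sum[of 1] by simp
lemma \<sigma>_power: "\<sigma> (e ^ j) = \<sigma> e ^ j" using \<sigma>_pow_power[of 1] by simp
lemma \<sigma>_inverse: "\<sigma> (inverse e) = inverse (\<sigma> e)" using \<sigma>_pow_inverse[of 1] by simp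

lemma n_pos: "0 < n" using n_ge_2 by simp

lemma h_neq_0: "h \<noteq> 0"
  using h_pow s_neq_0 n_pos \<iota>_eq_0 by (cases "h = 0") (auto simp: power_0_left)

lemma \<sigma>_pow_h: "(\<sigma> ^^ k) h = \<iota> q ^ k * h"
  by (induct k) (auto simp: \<sigma>_h \<sigma>_mult \<sigma>_power \<sigma>_\<iota> algebra_simps)

lemma \<sigma>_pow_h_pow: "(\<sigma> ^^ k) (h ^ j) = \<iota> q ^ (j * k) * h ^ j"
  by (simp add: \<sigma>_pow_power \<sigma>_pow_h power_mult_distrib mult.commute[of j] power_mult)

lemma \<iota>q_root: "\<iota> q ^ n = 1" using q_root by (simp add: \<iota>_one flip: \<iota>_power)

text \<open>\<open>\<sigma>^n\<close> multiplies \<open>h^j\<close> by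
  \<open>q^(j n) = 1\<close>.\<close>

lemma \<sigma>_pow_n: "(\<sigma> ^^ n) e = e"
proof -
  obtain c where c: "e = (\<Sum>j<n. \<iota> (c j) * h ^ j)" using h_span by blast
  have "(\<sigma> ^^ n) (\<iota> (c j) * h ^ j) = \<iota> (c j) * h ^ j" for j
    using \<iota>q_root by (simp add: \<sigma>_pow_hom \<sigma>_pow_h_pow mult.commute[of j] power_mult)
  then show ?thesis unfolding c by (simp add: \<sigma>_pow_sum)
qed

end

sublocale kummer \<subseteq> root_of_unity n "\<iota> q"
proof
  fix k assume "0 < k" "k < n"
  from q_prim[OF this] show "\<iota> q ^ k \<noteq> 1" by (simp add: \<iota>_one \<iota>_inj flip: \<iota>_power)
      (metis \<iota>_inj \<iota>_one \<iota>_power)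
qed (auto simp: n_pos \<iota>q_root)

context kummer
begin

text \<open>\<open>h^j\<close> is an eigenvector of \<sigma> with eigenvalue \<open>q^j\<close>, and
  these eigenvalues are distinct. Applying the powers of \<sigma> to a relation gives the system of
  \<open>eigen_indep\<close>.\<close>

lemma h_indep:
  assumes "(\<Sum>j<n. \<iota> (c j) * h ^ j) = 0" "i < n"
  shows "c i = 0"
proof -
  interpret E: vspace "E_alg (\<lambda>x :: 'e. x)" by (rule E_alg_id_vspace)
  interpret E: fourier "E_alg (\<lambda>x :: 'e. x)" n "\<iota> q" by unfold_locales
  have "\<iota> (c i) * h ^ i = \<zero>\<^bsub>E_alg (\<lambda>x. x)\<^esub>"
  proof (rule E.eigen_indep[where i = i and z = "\<lambda>j. \<iota> (c j) * h ^ j"])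
    fix k
    have "(\<Sum>j<n. \<iota> q ^ (j * k) * (\<iota> (c j) * h ^ j)) = (\<sigma> ^^ k) (\<Sum>j<n. \<iota> (c j) * h ^ j)"
      by (simp add: \<sigma>_pow_sum \<sigma>_pow_hom \<sigma>_pow_h_pow algebra_simps)
    then show "(\<Oplus>\<^bsub>E_alg (\<lambda>x. x)\<^esub>j\<in>{..<n}. \<iota> q ^ (j * k) \<odot>\<^bsub>E_alg (\<lambda>x. x)\<^esub> (\<iota> (c j) * h ^ j))
        = \<zero>\<^bsub>E_alg (\<lambda>x. x)\<^esub>"
      using assms(1) by (simp add: E_alg_finsum \<sigma>_pow_hom) (simp add: E_alg_def)
  qed (use assms(2) in \<open>auto simp: E_alg_def\<close>)
  then show ?thesis using h_neq_0 by (simp add: E_alg_def \<iota>_eq_0)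
qed

text \<open>\<sigma> multiplies the \<open>j\<close>-th coordinate by \<open>q^j\<close>, so by
  independence a fixed element has only its constant coordinate.\<close>

lemma fixed_field:
  assumes "\<sigma> e = e" shows "e \<in> range \<iota>"
proof -
  obtain c where c: "e = (\<Sum>j<n. \<iota> (c j) * h ^ j)" using h_span by blast
  have "\<sigma> (\<iota> (c j) * h ^ j) = \<iota> (q ^ j * c j) * h ^ j" for j
    using \<sigma>_pow_h_pow[of 1 j] by (simp add: \<sigma>_mult \<sigma>_\<iota> \<iota>_mult \<iota>_power algebra_simps)
  then have "(\<Sum>j<n. \<iota> (q ^ j * c j) * h ^ j) = (\<Sum>j<n. \<iota> (c j) * h ^ j)"
    using assms unfolding c by (simp add: \<sigma>_sum)
  moreover have "\<iota> ((q ^ j + - 1) * c j) * h ^ j = \<iota> (q ^ j * c j) * h ^ j + - (\<iota> (c j) * h ^ j)" for j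
    unfolding distrib_right \<iota>_add by (simp add: \<iota>_minus algebra_simps)
  ultimately have *: "(\<Sum>j<n. \<iota> ((q ^ j + - 1) * c j) * h ^ j) = 0"
    by (simp add: sum_subtractf)
  have "c j = 0" if "0 < j" "j < n" for j
    using h_indep[OF * that(2)] q_prim[OF that] by auto
  then have "(\<Sum>j<n. \<iota> (c j) * h ^ j) = (\<Sum>j<n. if j = 0 then \<iota> (c 0) else 0)"
    by (intro sum.cong) (auto simp: \<iota>_zero)
  then show ?thesis using c n_pos by simp
qed

end

text \<open>Modules over the algebra generated by \<open>E\<close> and \<open>x\<close> with \<open>x e = \<sigma> e x\<close> and
  \<open>x\<^sup>n = t\<close>: the operator \<open>T\<close> is the action of \<open>x\<close>.\<close>

locale semilinear = kummer n q s a \<iota> h \<sigma> + vspace V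
  for n and q s a :: "'f::field" and \<iota> :: "'f \<Rightarrow> 'e::field" and h \<sigma>
    and V :: "('e, 'v) module" (structure) +
  fixes T :: "'v \<Rightarrow> 'v" and t :: 'e
  assumes t_neq_0: "t \<noteq> 0"
    and T_closed: "v \<in> carrier V \<Longrightarrow> T v \<in> carrier V"
    and T_add: "v \<in> carrier V \<Longrightarrow> w \<in> carrier V \<Longrightarrow> T (v \<oplus> w) = T v \<oplus> T w"
    and T_smult: "v \<in> carrier V \<Longrightarrow> T (e \<odot> v) = \<sigma> e \<odot> T v"
    and T_pow: "v \<in> carrier V \<Longrightarrow> (T ^^ n) v = t \<odot> v"

sublocale semilinear \<subseteq> fourier V n "\<iota> q" by unfold_locales

context semilinear
begin

lemma T_zero: "T \<zero> = \<zero>"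
  using T_smult[of \<zero> 0] T_closed[of \<zero>] by (simp add: \<sigma>_zero)

lemma T_finsum: "f \<in> I \<rightarrow> carrier V \<Longrightarrow> T (\<Oplus>i\<in>I. f i) = (\<Oplus>i\<in>I. T (f i))"
proof (induct I rule: infinite_finite_induct)
  case (insert x F)
  then have "f \<in> F \<rightarrow> carrier V" "f x \<in> carrier V" "(\<lambda>i. T (f i)) \<in> F \<rightarrow> carrier V"
    by (auto intro: T_closed)
  with insert show ?case by (simp add: T_add T_closed)
qed (auto simp: T_zero finsum_infinite)

lemma T_pow_closed: "v \<in> carrier V \<Longrightarrow> (T ^^ k) v \<in> carrier V"
  by (induct k) (auto simp: T_closed)

lemma T_pow_add:
  "v \<in> carrier V \<Longrightarrow> w \<in> carrier V \<Longrightarrow> (T ^^ k) (v \<oplus> w) = (T ^^ k) v \<oplus> (T ^^ k) w"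
  by (induct k) (auto simp: T_add T_pow_closed)

lemma T_pow_smult: "v \<in> carrier V \<Longrightarrow> (T ^^ k) (e \<odot> v) = (\<sigma> ^^ k) e \<odot> (T ^^ k) v"
  by (induct k) (auto simp: T_smult T_pow_closed)

lemma T_pow_zero: "(T ^^ k) \<zero> = \<zero>"
  by (induct k) (auto simp: T_zero)

text \<open>\<open>T\<close> is injective, since \<open>T^n\<close> is multiplication by the nonzero
  scalar \<open>t\<close>.\<close>

lemma T_pow_eq_zero:
  assumes "(T ^^ k) v = \<zero>" "v \<in> carrier V" shows "v = \<zero>"
proof -
  have *: "w = \<zero>" if "T w = \<zero>" "w \<in> carrier V" for w
  proof -
    have "t \<odot> w = (T ^^ (n - 1)) (T w)"
      using T_pow[OF that(2)] n_pos by (cases n) (auto simp: funpow_swap1)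
    with that show ?thesis using scale_eq_zero t_neq_0 by (simp add: T_pow_zero)
  qed
  show ?thesis using assms by (induct k) (auto dest!: * simp: T_pow_closed)
qed

text \<open>On \<open>h^k v\<close> the operator \<open>T^j\<close> produces the extra factor
  \<open>q^(j k) h^k\<close>. Letting \<open>k\<close> vary separates the terms
  \<open>e j T^j v\<close>, and \<open>T^j v\<close> is nonzero. A single nonzero vector
  \<open>v\<close> therefore suffices.\<close>

lemma faithful:
  assumes v: "v \<in> carrier V" "v \<noteq> \<zero>"
    and eq: "\<And>w. w \<in> carrier V \<Longrightarrow> (\<Oplus>i\<in>{..<n}. e i \<odot> (T ^^ i) w) = \<zero>" and i: "i < n"
  shows "e i = 0"
proof -
  have "e i \<odot> (T ^^ i) v = \<zero>"
  proof (rule eigen_indep[where i = i and z = "\<lambda>i. e i \<odot> (T ^^ i) v"])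
    fix k
    have "h ^ k \<odot> (\<Oplus>j\<in>{..<n}. \<iota> q ^ (j * k) \<odot> (e j \<odot> (T ^^ j) v))
        = (\<Oplus>j\<in>{..<n}. h ^ k \<odot> (\<iota> q ^ (j * k) \<odot> (e j \<odot> (T ^^ j) v)))"
      using v by (intro finsum_scale) (auto simp: T_pow_closed)
    also have "\<dots> = (\<Oplus>j\<in>{..<n}. e j \<odot> (T ^^ j) (h ^ k \<odot> v))"
      using v by (intro finsum_cong')
        (auto simp: T_pow_closed T_pow_smult \<sigma>_pow_h_pow smult_assoc1[symmetric] ac_simps)
    also have "\<dots> = \<zero>" using eq v by simp
    finally show "(\<Oplus>j\<in>{..<n}. \<iota> q ^ (j * k) \<odot> (e j \<odot> (T ^^ j) v)) = \<zero>"
      by (rule scale_eq_zero) (use v h_neq_0 in \<open>auto intro!: finsum_closed simp: T_pow_closed\<close>)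
  qed (use v i in \<open>auto simp: T_pow_closed\<close>)
  then show ?thesis using scale_eq_zero[of "e i"] T_pow_eq_zero v T_pow_closed by blast
qed

text \<open>The eigencomponents \<open>z j\<close> of \<open>v\<close> satisfy
  \<open>T (z j) = q^j z j\<close>. As \<sigma> scales \<open>h^j\<close> by the same factor, the
  semilinear \<open>T\<close> fixes \<open>z j / h^j\<close>.\<close>

lemma descent:
  assumes t: "t = 1" and v: "v \<in> carrier V"
  shows "\<exists>w. (\<forall>j. w j \<in> carrier V \<and> T (w j) = w j) \<and> v = (\<Oplus>j\<in>{..<n}. h ^ j \<odot> w j)"
proof -
  define y where "y k = (T ^^ k) v" for k
  have y: "y \<in> A \<rightarrow> carrier V" for A using v by (auto simp: y_def T_pow_closed)
  define z where "z = dft y"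
  have z: "z j \<in> carrier V" for j unfolding z_def by (rule dft_closed[OF y])
  \<comment> \<open>Although \<open>T\<close> is only semilinear, the weights of the transform lie
    in the ground field, so \<open>T\<close> passes through them.\<close>
  have "T (z j) = dft (\<lambda>k. y (Suc k)) j" for j
    unfolding z_def dft_def using v
    by (subst T_finsum) (auto simp: y_def T_pow_closed T_smult \<sigma>_power \<sigma>_inverse \<sigma>_\<iota>
        \<sigma>_mult divide_inverse \<sigma>_pow_hom \<iota>_of_nat[symmetric] T_closed intro!: finsum_cong')
  moreover have "y n = y 0" using T_pow[OF v] v t by (simp add: y_def)
  ultimately have Tz: "T (z j) = \<iota> q ^ j \<odot> z j" for j
    using dft_shift[OF y] by (simp add: z_def)
  define w where "w j = inverse (h ^ j) \<odot> z j" for j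
  have "T (w j) = w j" for j
  proof -
    have "\<sigma> (inverse (h ^ j)) * \<iota> q ^ j = inverse (h ^ j)"
      using root_neq_zero h_neq_0 \<sigma>_pow_h_pow[of 1 j] by (simp add: \<sigma>_inverse)
    then show ?thesis using z[of j] by (simp add: w_def T_smult Tz smult_assoc1[symmetric])
  qed
  moreover have "v = (\<Oplus>j\<in>{..<n}. h ^ j \<odot> w j)"
  proof -
    have "(\<Oplus>j\<in>{..<n}. h ^ j \<odot> w j) = (\<Oplus>j\<in>{..<n}. z j)"
      using z h_neq_0 by (intro finsum_cong') (auto simp: w_def smult_assoc1[symmetric])
    also have "\<dots> = y 0" unfolding z_def by (rule dft_inversion[OF y])
    finally show ?thesis by (simp add: y_def)
  qed
  ultimately show ?thesis using z by (intro exI[of _ w]) (auto simp: w_def)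
qed

text \<open>Applying \<open>T^k\<close> to the relation leaves \<open>w j\<close> alone and
  multiplies its coefficient \<open>h^j\<close> by \<open>q^(j k)\<close>.\<close>

lemma descent_indep:
  assumes w: "\<And>j. j < n \<Longrightarrow> w j \<in> carrier V" "\<And>j. j < n \<Longrightarrow> T (w j) = w j"
    and eq: "(\<Oplus>j\<in>{..<n}. h ^ j \<odot> w j) = \<zero>" and i: "i < n"
  shows "w i = \<zero>"
proof -
  have fix_pow: "(T ^^ k) (w j) = w j" if "j < n" for j k
    by (induct k) (auto simp: w(2)[OF that])
  have T_pow_finsum: "(T ^^ k) (\<Oplus>j\<in>{..<n}. h ^ j \<odot> w j) = (\<Oplus>j\<in>{..<n}. (T ^^ k) (h ^ j \<odot> w j))" for k
    by (induct k) (use w(1) in \<open>auto simp: T_finsum T_pow_closed\<close>)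
  have "h ^ i \<odot> w i = \<zero>"
  proof (rule eigen_indep[where i = i and z = "\<lambda>j. h ^ j \<odot> w j"])
    fix k
    have "(\<Oplus>j\<in>{..<n}. \<iota> q ^ (j * k) \<odot> (h ^ j \<odot> w j)) = (T ^^ k) (\<Oplus>j\<in>{..<n}. h ^ j \<odot> w j)"
      unfolding T_pow_finsum using w(1)
      by (intro finsum_cong') (auto simp: T_pow_smult fix_pow \<sigma>_pow_h_pow smult_assoc1[symmetric])
    then show "(\<Oplus>j\<in>{..<n}. \<iota> q ^ (j * k) \<odot> (h ^ j \<odot> w j)) = \<zero>" by (simp add: eq T_pow_zero)
  qed (use w(1) i in auto)
  then show ?thesis using scale_eq_zero w(1)[OF i] h_neq_0 by simp
qed

text \<open>The conjugates \<open>h\<^sup>k G h\<^sup>-\<^sup>k\<close> split \<open>G\<close> into operators \<open>G i\<close> with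
  \<open>G i h = q\<^sup>i h G i\<close>, so that \<open>T\<^sup>n\<^sup>-\<^sup>i \<circ> G i\<close> commutes with \<open>h\<close>.\<close>

lemma centralizer:
  fixes \<Delta> :: "('v \<Rightarrow> 'v) set"
  assumes \<Delta>: "\<And>\<delta> v. \<delta> \<in> \<Delta> \<Longrightarrow> v \<in> carrier V \<Longrightarrow> \<delta> v \<in> carrier V"
      "\<And>\<delta> v w. \<delta> \<in> \<Delta> \<Longrightarrow> v \<in> carrier V \<Longrightarrow> w \<in> carrier V \<Longrightarrow> \<delta> (v \<oplus> w) = \<delta> v \<oplus> \<delta> w"
      "\<And>\<delta> e v. \<delta> \<in> \<Delta> \<Longrightarrow> v \<in> carrier V \<Longrightarrow> \<delta> (e \<odot> v) = e \<odot> \<delta> v"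
      "\<And>\<delta> v. \<delta> \<in> \<Delta> \<Longrightarrow> v \<in> carrier V \<Longrightarrow> \<delta> (T v) = T (\<delta> v)"
    and scalar: "\<And>S. (\<And>v. v \<in> carrier V \<Longrightarrow> S v \<in> carrier V) \<Longrightarrow>
      (\<And>v w. v \<in> carrier V \<Longrightarrow> w \<in> carrier V \<Longrightarrow> S (v \<oplus> w) = S v \<oplus> S w) \<Longrightarrow>
      (\<And>v. v \<in> carrier V \<Longrightarrow> S (h \<odot> v) = h \<odot> S v) \<Longrightarrow>
      (\<And>\<delta> v. \<delta> \<in> \<Delta> \<Longrightarrow> v \<in> carrier V \<Longrightarrow> S (\<delta> v) = \<delta> (S v)) \<Longrightarrow>
      \<exists>e. \<forall>v\<in>carrier V. S v = e \<odot> v"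
    and G: "\<And>v. v \<in> carrier V \<Longrightarrow> G v \<in> carrier V"
      "\<And>v w. v \<in> carrier V \<Longrightarrow> w \<in> carrier V \<Longrightarrow> G (v \<oplus> w) = G v \<oplus> G w"
      "\<And>c v. v \<in> carrier V \<Longrightarrow> G (\<iota> c \<odot> v) = \<iota> c \<odot> G v"
      "\<And>\<delta> v. \<delta> \<in> \<Delta> \<Longrightarrow> v \<in> carrier V \<Longrightarrow> G (\<delta> v) = \<delta> (G v)"
  shows "\<exists>e. \<forall>v\<in>carrier V. G v = (\<Oplus>i\<in>{..<n}. e i \<odot> (T ^^ i) v)"
proof -
  \<comment> \<open>A component with \<open>G_i h = q^i h G_i\<close> satisfies
    \<open>h^k G_i h^(-k) = q^(-i k) G_i\<close>, hence the transform is taken with the inverse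
    root.\<close>
  interpret inv: fourier V n "inverse (\<iota> q)"
    by unfold_locales (auto simp: n_pos root prim power_inverse)
  define y where "y v k = h ^ k \<odot> G (inverse (h ^ k) \<odot> v)" for v k
  define Gi where "Gi i v = inv.dft (y v) i" for i v
  have y: "y v \<in> A \<rightarrow> carrier V" if "v \<in> carrier V" for v A
    using that by (auto simp: y_def G)
  have Gi_closed: "Gi i v \<in> carrier V" if "v \<in> carrier V" for i v
    unfolding Gi_def by (rule inv.dft_closed[OF y[OF that]])
  have G_sum: "G v = (\<Oplus>i\<in>{..<n}. Gi i v)" if "v \<in> carrier V" for v
    unfolding Gi_def using inv.dft_inversion[OF y[OF that]] that by (simp add: y_def G)
  have Gi_add: "Gi i (v \<oplus> w) = Gi i v \<oplus> Gi i w" if "v \<in> carrier V" "w \<in> carrier V" for i v w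
    unfolding Gi_def inv.dft_def using that y
    by (subst finsum_addf[symmetric]) (auto simp: y_def G smult_r_distr intro!: finsum_cong')
  have Gi_\<delta>: "Gi i (\<delta> v) = \<delta> (Gi i v)" if \<delta>: "\<delta> \<in> \<Delta>" and v: "v \<in> carrier V" for i v \<delta>
  proof -
    have \<delta>0: "\<delta> \<zero> = \<zero>" using \<Delta>(3)[OF \<delta>, of \<zero> 0] \<Delta>(1)[OF \<delta>, of \<zero>] by simp
    have \<delta>_sum: "\<delta> (\<Oplus>k\<in>I. f k) = (\<Oplus>k\<in>I. \<delta> (f k))" if "f \<in> I \<rightarrow> carrier V" for f and I :: "nat set"
      using that
    proof (induct I rule: infinite_finite_induct)
      case (insert x F)
      then have "f \<in> F \<rightarrow> carrier V" "f x \<in> carrier V" "(\<lambda>i. \<delta> (f i)) \<in> F \<rightarrow> carrier V"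
        using \<Delta>(1)[OF \<delta>] by auto
      with insert show ?case using \<Delta>(1,2)[OF \<delta>] by simp
    qed (auto simp: \<delta>0 finsum_infinite)
    have \<delta>y: "\<delta> (y v k) = y (\<delta> v) k" for k
      using v G(4)[OF \<delta>, of "inverse (h ^ k) \<odot> v", symmetric]
      by (simp add: y_def \<Delta>(1,3)[OF \<delta>] G(1))
    have yc: "y v k \<in> carrier V" "y (\<delta> v) k \<in> carrier V" for k
      using v \<Delta>(1)[OF \<delta> v] by (auto simp: y_def G(1))
    have "\<delta> (Gi i v) = (\<Oplus>k\<in>{..<n}. \<delta> ((inverse (inverse (\<iota> q) ^ (i * k)) / of_nat n) \<odot> y v k))"
      unfolding Gi_def inv.dft_def using yc by (intro \<delta>_sum) auto
    also have "\<dots> = Gi i (\<delta> v)"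
      unfolding Gi_def inv.dft_def using yc
      by (intro finsum_cong') (auto simp: \<Delta>(3)[OF \<delta>] \<delta>y)
    finally show ?thesis ..
  qed
  have Gi_h: "Gi i (h \<odot> v) = (\<iota> q ^ i * h) \<odot> Gi i v" if v: "v \<in> carrier V" for i v
  proof -
    have y_Suc: "y (h \<odot> v) (Suc k) = h \<odot> y v k" for k
    proof -
      have "inverse (h ^ Suc k) * h = inverse (h ^ k)" using h_neq_0 by simp
      then show ?thesis using v by (simp only: y_def smult_assoc1[symmetric] G(1) smult_closed power_Suc)
    qed
    \<comment> \<open>The conjugates are periodic because \<open>h^n\<close> is the scalar
      \<open>s\<close> of the ground field, with which \<open>G\<close> commutes.\<close>
    have "y (h \<odot> v) n = y (h \<odot> v) 0"
      using v G(3)[of "h \<odot> v" "inverse s"] s_neq_0 \<iota>_eq_0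
      by (simp add: y_def h_pow \<iota>_inverse G smult_assoc1[symmetric])
    then have "inv.dft (\<lambda>k. y (h \<odot> v) (Suc k)) i = inverse (\<iota> q) ^ i \<odot> Gi i (h \<odot> v)"
      unfolding Gi_def using v by (intro inv.dft_shift y) auto
    moreover have "inv.dft (\<lambda>k. y (h \<odot> v) (Suc k)) i = h \<odot> Gi i v"
    proof -
      have yc: "y v k \<in> carrier V" for k using v by (auto simp: y_def G(1))
      show ?thesis
        unfolding y_Suc Gi_def inv.dft_def using yc
        by (subst finsum_scale) (auto simp: smult_assoc1[symmetric] mult.commute intro!: finsum_cong')
    qed
    ultimately have "\<iota> q ^ i \<odot> (inverse (\<iota> q) ^ i \<odot> Gi i (h \<odot> v)) = \<iota> q ^ i \<odot> (h \<odot> Gi i v)" by simp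
    then show ?thesis
      using v root_neq_zero by (simp add: smult_assoc1[symmetric] Gi_closed power_inverse)
  qed
  have "\<exists>e. \<forall>v\<in>carrier V. (T ^^ (n - i)) (Gi i v) = e \<odot> v" if i: "i < n" for i
  proof (rule scalar)
    fix v assume v: "v \<in> carrier V"
    \<comment> \<open>Moved past \<open>h\<close>, the component \<open>Gi i\<close> contributes
      \<open>q^i\<close> and \<open>T^(n - i)\<close> contributes \<open>q^(n - i)\<close>; the
      product is \<open>q^n\<close>.\<close>
    have "\<iota> q ^ (n - i) * \<iota> q ^ i = 1"
      using i by (simp add: \<iota>q_root flip: power_add)
    then show "(T ^^ (n - i)) (Gi i (h \<odot> v)) = h \<odot> (T ^^ (n - i)) (Gi i v)"
      using v by (simp add: Gi_h T_pow_smult Gi_closed \<sigma>_pow_hom \<sigma>_pow_power \<sigma>_pow_h ac_simps)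
  next
    fix \<delta> v assume \<delta>: "\<delta> \<in> \<Delta>" and v: "v \<in> carrier V"
    have "(T ^^ k) (\<delta> w) = \<delta> ((T ^^ k) w)" if "w \<in> carrier V" for k w
      using that by (induct k) (auto simp: \<Delta>(4)[OF \<delta>] T_pow_closed)
    then show "(T ^^ (n - i)) (Gi i (\<delta> v)) = \<delta> ((T ^^ (n - i)) (Gi i v))"
      using v \<delta> by (simp add: Gi_\<delta> Gi_closed)
  qed (auto simp: T_pow_closed Gi_closed Gi_add T_pow_add)
  then obtain e where e: "(T ^^ (n - i)) (Gi i v) = e i \<odot> v" if "i < n" "v \<in> carrier V" for i v
    by metis
  have Gi_eq: "Gi i v = (inverse t * (\<sigma> ^^ i) (e i)) \<odot> (T ^^ i) v" if "i < n" "v \<in> carrier V" for i v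
  proof -
    \<comment> \<open>Applying \<open>T^i\<close> completes \<open>T^(n - i)\<close> to
      \<open>T^n\<close>, which is multiplication by \<open>t\<close>; this recovers
      \<open>Gi i\<close> from the scalar \<open>e i\<close>.\<close>
    have "t \<odot> Gi i v = (T ^^ i) ((T ^^ (n - i)) (Gi i v))"
    proof -
      have "(T ^^ i) ((T ^^ (n - i)) (Gi i v)) = (T ^^ (i + (n - i))) (Gi i v)"
        by (simp only: funpow_add o_apply)
      also have "i + (n - i) = n" using that(1) by simp
      finally show ?thesis by (simp only: T_pow[OF Gi_closed[OF that(2)]])
    qed
    also have "\<dots> = (\<sigma> ^^ i) (e i) \<odot> (T ^^ i) v"
      unfolding e[OF that] by (rule T_pow_smult[OF that(2)])
    finally have *: "t \<odot> Gi i v = (\<sigma> ^^ i) (e i) \<odot> (T ^^ i) v" .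
    have "Gi i v = inverse t \<odot> (t \<odot> Gi i v)"
      using Gi_closed[OF that(2)] t_neq_0 by (simp add: smult_assoc1[symmetric])
    also have "\<dots> = (inverse t * (\<sigma> ^^ i) (e i)) \<odot> (T ^^ i) v"
      unfolding * using T_pow_closed[OF that(2)] by (simp add: smult_assoc1)
    finally show ?thesis .
  qed
  have "G v = (\<Oplus>i\<in>{..<n}. (inverse t * (\<sigma> ^^ i) (e i)) \<odot> (T ^^ i) v)" if v: "v \<in> carrier V" for v
    unfolding G_sum[OF v]
  proof (rule finsum_cong'[OF refl])
    show "(\<lambda>i. (inverse t * (\<sigma> ^^ i) (e i)) \<odot> (T ^^ i) v) \<in> {..<n} \<rightarrow> carrier V"
      using T_pow_closed[OF v] by simp
    fix i assume "i \<in> {..<n}"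
    then show "Gi i v = (inverse t * (\<sigma> ^^ i) (e i)) \<odot> (T ^^ i) v"
      by (intro Gi_eq v) simp
  qed
  then show ?thesis by (intro exI[of _ "\<lambda>i. inverse t * (\<sigma> ^^ i) (e i)"] ballI)
qed

end


section \<open>The cyclic algebra and its modules\<close>

context kummer
begin

text \<open>The summation bound depends only on \<open>k\<close>, not on degrees, so that linearity
  in each argument can be checked coefficientwise.\<close>

lemma coeff_skew_mult:
  "Polynomial.coeff (skew_mult \<sigma> p r) k
    = (\<Sum>i\<le>k. Polynomial.coeff p i * (\<sigma> ^^ i) (Polynomial.coeff r (k - i)))"
proof -
  let ?f = "\<lambda>i. Polynomial.coeff p i * (\<sigma> ^^ i) (Polynomial.coeff r (k - i))"
  have "Polynomial.coeff (skew_mult \<sigma> p r) k = (\<Sum>i\<le>Polynomial.degree p. \<Sum>j\<le>Polynomial.degree r.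
      if i + j = k then Polynomial.coeff p i * (\<sigma> ^^ i) (Polynomial.coeff r j) else 0)"
    by (simp add: skew_mult_def coeff_sum)
  also have "\<dots> = (\<Sum>i\<le>Polynomial.degree p. if i \<le> k then ?f i else 0)"
  proof (intro sum.cong refl)
    fix i
    have "(\<Sum>j\<le>Polynomial.degree r. if i + j = k then Polynomial.coeff p i * (\<sigma> ^^ i) (Polynomial.coeff r j) else 0)
        = (\<Sum>j\<le>Polynomial.degree r. if j = k - i then (if i \<le> k then ?f i else 0) else 0)"
      by (intro sum.cong) auto
    also have "\<dots> = (if i \<le> k then ?f i else 0)"
      by (auto simp: coeff_eq_0 \<sigma>_pow_hom)
    finally show "(\<Sum>j\<le>Polynomial.degree r. if i + j = k then Polynomial.coeff p i * (\<sigma> ^^ i) (Polynomial.coeff r j) else 0)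
        = (if i \<le> k then ?f i else 0)" .
  qed
  also have "\<dots> = sum ?f ({..Polynomial.degree p} \<inter> {..k})"
    by (simp add: sum.If_cases Int_def atMost_def)
  also have "\<dots> = sum ?f {..k}"
    by (intro sum.mono_neutral_left) (auto simp: coeff_eq_0)
  finally show ?thesis .
qed

text \<open>Left multiplication by \<open>x\<close>: each coefficient passes \<open>x\<close> at the
  price of \<sigma>.\<close>

definition shift :: "'e poly \<Rightarrow> 'e poly" where
  "shift r = pCons 0 (map_poly \<sigma> r)"

lemma coeff_shift: "Polynomial.coeff (shift r) k = (case k of 0 \<Rightarrow> 0 | Suc m \<Rightarrow> \<sigma> (Polynomial.coeff r m))"
  by (simp add: shift_def coeff_pCons coeff_map_poly \<sigma>_zero split: nat.split)

lemma skew_mult_add_left: "skew_mult \<sigma> (p + p') r = skew_mult \<sigma> p r + skew_mult \<sigma> p' r"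
  by (rule poly_eqI) (simp add: coeff_skew_mult distrib_right sum.distrib)

lemma skew_mult_add_right: "skew_mult \<sigma> p (r + r') = skew_mult \<sigma> p r + skew_mult \<sigma> p r'"
  by (rule poly_eqI) (simp add: coeff_skew_mult distrib_left sum.distrib \<sigma>_pow_hom)

lemma skew_mult_0: "skew_mult \<sigma> 0 r = 0" "skew_mult \<sigma> p 0 = 0"
  by (rule poly_eqI, simp add: coeff_skew_mult \<sigma>_pow_hom)+

text \<open>Horner step \<open>(e + p x) r = e r + p (x r)\<close>. It reduces facts about products
  to induction on the left factor, with the right factor arbitrary.\<close>

lemma skew_mult_pCons:
  "skew_mult \<sigma> (pCons e p) r = Polynomial.smult e r + skew_mult \<sigma> p (shift r)"
proof (rule poly_eqI)
  fix k
  show "Polynomial.coeff (skew_mult \<sigma> (pCons e p) r) k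
      = Polynomial.coeff (Polynomial.smult e r + skew_mult \<sigma> p (shift r)) k"
  proof (cases k)
    case (Suc m)
    have "(\<Sum>i\<le>Suc m. Polynomial.coeff p i * (\<sigma> ^^ i) (Polynomial.coeff (shift r) (Suc m - i)))
        = (\<Sum>i\<le>m. Polynomial.coeff p i * (\<sigma> ^^ i) (\<sigma> (Polynomial.coeff r (m - i))))"
      by (simp add: coeff_shift \<sigma>_pow_hom \<sigma>_zero Suc_diff_le)
    then show ?thesis unfolding Suc coeff_skew_mult coeff_add
      by (subst sum.atMost_Suc_shift) (simp add: funpow_swap1 coeff_skew_mult)
  qed (simp add: coeff_skew_mult coeff_shift)
qed

lemma skew_mult_const: "skew_mult \<sigma> [:e:] r = Polynomial.smult e r"
  by (simp add: skew_mult_pCons skew_mult_0)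

lemma skew_mult_smult: "skew_mult \<sigma> (Polynomial.smult e p) r = Polynomial.smult e (skew_mult \<sigma> p r)"
  by (rule poly_eqI) (simp add: coeff_skew_mult sum_distrib_left mult.assoc)

lemma skew_mult_shift: "skew_mult \<sigma> (shift p) r = shift (skew_mult \<sigma> p r)"
proof (rule poly_eqI)
  fix k
  show "Polynomial.coeff (skew_mult \<sigma> (shift p) r) k = Polynomial.coeff (shift (skew_mult \<sigma> p r)) k"
  proof (cases k)
    case (Suc m)
    show ?thesis unfolding Suc coeff_skew_mult
      by (subst sum.atMost_Suc_shift)
        (simp add: coeff_shift coeff_skew_mult \<sigma>_sum \<sigma>_mult)
  qed (simp add: coeff_skew_mult coeff_shift)
qed

text \<open>Besides linearity, the Horner step needs that left multiplication by \<open>x\<close>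
  commutes with right multiplications, which is \<open>skew_mult_shift\<close>.\<close>

lemma skew_mult_assoc: "skew_mult \<sigma> (skew_mult \<sigma> p r) u = skew_mult \<sigma> p (skew_mult \<sigma> r u)"
  by (induct p arbitrary: r)
    (simp_all add: skew_mult_0 skew_mult_pCons skew_mult_add_left skew_mult_smult skew_mult_shift)

lemma skew_mult_one: "skew_mult \<sigma> 1 r = r" "skew_mult \<sigma> p 1 = p"
proof -
  show "skew_mult \<sigma> 1 r = r" by (simp add: one_pCons skew_mult_const)
  show "skew_mult \<sigma> p 1 = p"
  proof (rule poly_eqI)
    fix k
    have "(\<Sum>i\<le>k. Polynomial.coeff p i * (\<sigma> ^^ i) (Polynomial.coeff 1 (k - i)))
        = (\<Sum>i\<le>k. if i = k then Polynomial.coeff p k else 0)"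
      by (intro sum.cong) (auto simp: \<sigma>_pow_hom coeff_1)
    then show "Polynomial.coeff (skew_mult \<sigma> p 1) k = Polynomial.coeff p k"
      by (simp add: coeff_skew_mult)
  qed
qed

lemma skew_mult_x: "skew_mult \<sigma> p [:0, 1:] = pCons 0 p"
proof (rule poly_eqI)
  fix k
  show "Polynomial.coeff (skew_mult \<sigma> p [:0, 1:]) k = Polynomial.coeff (pCons 0 p) k"
  proof (cases k)
    case (Suc m)
    have "(\<Sum>i\<le>k. Polynomial.coeff p i * (\<sigma> ^^ i) (Polynomial.coeff [:0, 1:] (k - i)))
        = (\<Sum>i\<le>k. if i = m then Polynomial.coeff p m else 0)"
      by (intro sum.cong) (auto simp: \<sigma>_pow_hom \<sigma>_zero Suc coeff_pCons split: nat.split)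
    then show ?thesis by (simp add: coeff_skew_mult Suc)
  qed (simp add: coeff_skew_mult \<sigma>_pow_hom)
qed

lemma x_skew_mult: "skew_mult \<sigma> [:0, 1:] r = shift r"
  using skew_mult_pCons[of 0 "[:1:]" r] by (simp add: skew_mult_const)

lemma skew_poly_ring: "ring (skew_poly_ring \<sigma>)"
proof (intro ringI abelian_groupI monoidI)
  fix x :: "'e poly"
  show "\<exists>y\<in>carrier (skew_poly_ring \<sigma>). y \<oplus>\<^bsub>skew_poly_ring \<sigma>\<^esub> x = \<zero>\<^bsub>skew_poly_ring \<sigma>\<^esub>"
    by (rule bexI[of _ "- x"]) (auto simp: skew_poly_ring_def)
qed (auto simp: skew_poly_ring_def skew_mult_add_left skew_mult_add_right skew_mult_assoc
    skew_mult_one)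

lemma skew_poly_ring_simps:
  "carrier (skew_poly_ring \<sigma>) = UNIV" "monoid.mult (skew_poly_ring \<sigma>) = skew_mult \<sigma>"
  "one (skew_poly_ring \<sigma>) = 1" "zero (skew_poly_ring \<sigma>) = 0" "add (skew_poly_ring \<sigma>) = (+)"
  "a_inv (skew_poly_ring \<sigma>) r = - r"
proof -
  interpret R: ring "skew_poly_ring \<sigma>" by (rule skew_poly_ring)
  show "\<ominus>\<^bsub>skew_poly_ring \<sigma>\<^esub> r = - r"
    by (rule R.add.inv_equality) (auto simp: skew_poly_ring_def)
qed (auto simp: skew_poly_ring_def)

definition J :: "'e poly set" where "J = cyclic_ideal \<sigma> n (\<iota> a)"
definition cls :: "'e poly \<Rightarrow> 'e poly set" where "cls = cyclic_class \<sigma> n (\<iota> a)"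
definition alg :: "('f, 'e poly set) module" where "alg = cyclic_algebra \<iota> \<sigma> n a"
definition aemb :: "'e \<Rightarrow> 'e poly set" where "aemb e = cls [:e:]"
definition ax :: "'e poly set" where "ax = cls [:0, 1:]"

lemma J_ideal: "ideal J (skew_poly_ring \<sigma>)"
  unfolding J_def cyclic_ideal_def
  by (rule ring.genideal_ideal[OF skew_poly_ring]) (auto simp: skew_poly_ring_def)

lemma alg_simps:
  "carrier alg = range cls" "\<one>\<^bsub>alg\<^esub> = cls 1" "\<zero>\<^bsub>alg\<^esub> = cls 0"
  "cls p \<otimes>\<^bsub>alg\<^esub> cls r = cls (skew_mult \<sigma> p r)" "cls p \<oplus>\<^bsub>alg\<^esub> cls r = cls (p + r)"
  "c \<odot>\<^bsub>alg\<^esub> y = aemb (\<iota> c) \<otimes>\<^bsub>alg\<^esub> y"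
proof -
  interpret J: ideal J "skew_poly_ring \<sigma>" by (rule J_ideal)
  have cls: "cls = a_r_coset (skew_poly_ring \<sigma>) J" by (simp add: cls_def cyclic_class_def J_def fun_eq_iff)
  note hom = J.rcos_ring_hom[folded cls]
  have alg: "carrier alg = carrier (skew_poly_ring \<sigma> Quot J)"
    "mult alg = mult (skew_poly_ring \<sigma> Quot J)" "one alg = one (skew_poly_ring \<sigma> Quot J)"
    "zero alg = zero (skew_poly_ring \<sigma> Quot J)" "add alg = add (skew_poly_ring \<sigma> Quot J)"
    by (simp_all add: alg_def cyclic_algebra_def J_def Let_def)
  show "carrier alg = range cls"
    unfolding alg by (auto simp: FactRing_def A_RCOSETS_def' cls) (auto simp: skew_poly_ring_def)
  show "\<one>\<^bsub>alg\<^esub> = cls 1" using ring_hom_one[OF hom] by (simp add: alg skew_poly_ring_simps)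
  have "\<zero>\<^bsub>alg\<^esub> = J" by (simp add: alg FactRing_def)
  also have "J = cls \<zero>\<^bsub>skew_poly_ring \<sigma>\<^esub>" using J.a_coset_add_zero J.a_subset by (simp add: cls)
  finally show "\<zero>\<^bsub>alg\<^esub> = cls 0" by (simp add: skew_poly_ring_def)
  show "cls p \<otimes>\<^bsub>alg\<^esub> cls r = cls (skew_mult \<sigma> p r)" "cls p \<oplus>\<^bsub>alg\<^esub> cls r = cls (p + r)"
    using ring_hom_mult[OF hom, of p r] ring_hom_add[OF hom, of p r]
    by (simp_all add: alg skew_poly_ring_simps)
  show "c \<odot>\<^bsub>alg\<^esub> y = aemb (\<iota> c) \<otimes>\<^bsub>alg\<^esub> y"
    by (simp add: alg_def cyclic_algebra_def Let_def aemb_def cls_def)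
qed

lemma cls_eq_iff: "cls p = cls r \<longleftrightarrow> p - r \<in> J"
proof -
  interpret J: ideal J "skew_poly_ring \<sigma>" by (rule J_ideal)
  interpret R: ring "skew_poly_ring \<sigma>" by (rule skew_poly_ring)
  have cls: "cls r = a_r_coset (skew_poly_ring \<sigma>) J r" for r
    by (simp add: cls_def cyclic_class_def J_def)
  have cls_eq: "cls r = {j + r |j. j \<in> J}" for r
    by (auto simp: cls a_r_coset_def' skew_poly_ring_simps)
  have "0 \<in> J"
    using additive_subgroup.zero_closed[OF ideal.axioms(1)[OF J_ideal]]
    by (simp add: skew_poly_ring_simps)
  show ?thesis
  proof
    assume eq: "cls p = cls r"
    have "0 + p \<in> cls p" using \<open>0 \<in> J\<close> by (auto simp only: cls_eq)
    then have "p \<in> cls r" using eq by simp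
    then show "p - r \<in> J" by (auto simp: cls_eq)
  next
    assume "p - r \<in> J"
    then have "p - r + r \<in> cls r" by (auto simp only: cls_eq)
    then have "p \<in> J +>\<^bsub>skew_poly_ring \<sigma>\<^esub> r" by (simp add: cls)
    from J.a_repr_independence[OF this _ J.a_subgroup] show "cls p = cls r"
      by (simp add: cls skew_poly_ring_simps)
  qed
qed

lemma alg_ring: "ring alg"
proof (intro ringI abelian_groupI monoidI)
  fix x assume "x \<in> carrier alg"
  then obtain p where "x = cls p" by (auto simp: alg_simps)
  then show "\<exists>y\<in>carrier alg. y \<oplus>\<^bsub>alg\<^esub> x = \<zero>\<^bsub>alg\<^esub>"
    by (intro bexI[of _ "cls (- p)"]) (auto simp: alg_simps)
qed (auto simp: alg_simps skew_mult_add_left skew_mult_add_right skew_mult_assoc skew_mult_one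
    ac_simps)

lemma modulus_in_J: "Polynomial.monom 1 n - [:\<iota> a:] \<in> J"
  unfolding J_def cyclic_ideal_def
  using ring.genideal_self[OF skew_poly_ring, of "{Polynomial.monom 1 n - [:\<iota> a:]}"]
  by (auto simp: skew_poly_ring_def)

lemma cls_pCons: "cls (pCons e p) = aemb e \<oplus>\<^bsub>alg\<^esub> (cls p \<otimes>\<^bsub>alg\<^esub> ax)"
  by (simp add: aemb_def ax_def alg_simps skew_mult_x)

lemma ax_aemb: "ax \<otimes>\<^bsub>alg\<^esub> aemb e = aemb (\<sigma> e) \<otimes>\<^bsub>alg\<^esub> ax"
  by (simp add: ax_def aemb_def alg_simps x_skew_mult skew_mult_x shift_def map_poly_pCons \<sigma>_zero)

lemma aemb_simps:
  "aemb e \<in> carrier alg" "ax \<in> carrier alg" "cls p \<in> carrier alg" "aemb 1 = \<one>\<^bsub>alg\<^esub>"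
  "aemb (e + e') = aemb e \<oplus>\<^bsub>alg\<^esub> aemb e'" "aemb (e * e') = aemb e \<otimes>\<^bsub>alg\<^esub> aemb e'" "aemb 0 = \<zero>\<^bsub>alg\<^esub>"
  by (simp_all add: aemb_def ax_def alg_simps skew_mult_const one_pCons)

text \<open>Division by \<open>x^n - a\<close>, one Horner step at a time: multiplying a reduced
  polynomial by \<open>x\<close> creates at most one coefficient in degree \<open>n\<close>.\<close>

lemma alg_normal_form:
  assumes "r \<in> carrier alg"
  shows "\<exists>p. r = cls p \<and> (\<forall>i\<ge>n. Polynomial.coeff p i = 0)"
proof -
  have "\<exists>r. cls p = cls r \<and> (\<forall>i\<ge>n. Polynomial.coeff r i = 0)" for p
  proof (induct p)
    case (pCons e p)
    then obtain r where r: "cls p = cls r" "\<And>i. i \<ge> n \<Longrightarrow> Polynomial.coeff r i = 0" by auto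
    \<comment> \<open>The coefficient that reaches degree \<open>n\<close> after multiplication by
      \<open>x\<close>; it is removed by subtracting \<open>c (x^n - a)\<close>, a left multiple of
      the generator.\<close>
    define c where "c = Polynomial.coeff r (n - 1)"
    define r' where "r' = pCons e r - (Polynomial.monom c n - [:c * \<iota> a:])"
    have "Polynomial.monom c n - [:c * \<iota> a:] = skew_mult \<sigma> [:c:] (Polynomial.monom 1 n - [:\<iota> a:])"
      by (simp add: skew_mult_const smult_diff_right smult_monom)
    moreover have "\<dots> \<in> J"
      using ideal.I_l_closed[OF J_ideal modulus_in_J, of "[:c:]"] by (simp add: skew_poly_ring_def)
    ultimately have "cls (pCons e r) = cls r'" by (simp add: cls_eq_iff r'_def)
    then have "cls (pCons e p) = cls r'" using r(1) by (simp add: cls_pCons)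
    moreover have "Polynomial.coeff r' i = 0" if "i \<ge> n" for i
      using that n_pos r(2)[of "i - 1"] by (cases "i = n") (auto simp: r'_def c_def coeff_pCons split: nat.splits)
    ultimately show ?case by blast
  qed (rule exI[of _ 0], auto)
  then show ?thesis using assms by (auto simp: alg_simps)
qed

end

section \<open>From semilinear operators to modules over the quotient\<close>

context semilinear
begin

definition act :: "'e poly \<Rightarrow> 'v \<Rightarrow> 'v" where
  "act p v = (\<Oplus>i\<in>{..<Suc (Polynomial.degree p)}. Polynomial.coeff p i \<odot> (T ^^ i) v)"

lemma act_eq:
  assumes v: "v \<in> carrier V" and N: "\<And>i. i \<ge> N \<Longrightarrow> Polynomial.coeff p i = 0"
  shows "act p v = (\<Oplus>i\<in>{..<N}. Polynomial.coeff p i \<odot> (T ^^ i) v)"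
proof -
  have aux: "(\<Oplus>i\<in>{..<N + k}. Polynomial.coeff p i \<odot> (T ^^ i) v)
      = (\<Oplus>i\<in>{..<N}. Polynomial.coeff p i \<odot> (T ^^ i) v)"
    if "\<And>i. i \<ge> N \<Longrightarrow> Polynomial.coeff p i = 0" for N k
  proof (induct k)
    case (Suc k)
    have "(\<Oplus>i\<in>insert (N + k) {..<N + k}. Polynomial.coeff p i \<odot> (T ^^ i) v)
        = Polynomial.coeff p (N + k) \<odot> (T ^^ (N + k)) v \<oplus> (\<Oplus>i\<in>{..<N + k}. Polynomial.coeff p i \<odot> (T ^^ i) v)"
      using v by (intro finsum_insert) (auto simp: T_pow_closed)
    then show ?case using that v Suc by (simp add: T_pow_closed lessThan_Suc finsum_closed Pi_def)
  qed simp
  let ?D = "Suc (Polynomial.degree p)"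
  have D: "Polynomial.coeff p i = 0" if "i \<ge> ?D" for i using that by (simp add: coeff_eq_0)
  have "(\<Oplus>i\<in>{..<N + ?D}. Polynomial.coeff p i \<odot> (T ^^ i) v)
      = (\<Oplus>i\<in>{..<N}. Polynomial.coeff p i \<odot> (T ^^ i) v)" by (rule aux[OF N])
  moreover have "(\<Oplus>i\<in>{..<?D + N}. Polynomial.coeff p i \<odot> (T ^^ i) v) = act p v"
    unfolding act_def by (rule aux[OF D])
  ultimately show ?thesis by (simp add: add.commute)
qed

lemma act_closed: "v \<in> carrier V \<Longrightarrow> act p v \<in> carrier V"
  unfolding act_def by (rule finsum_closed) (auto simp: T_pow_closed)

lemma act_0: "v \<in> carrier V \<Longrightarrow> act 0 v = \<zero>"
  by (subst act_eq[of _ 0]) auto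

lemma act_pCons:
  assumes v: "v \<in> carrier V" shows "act (pCons e p) v = e \<odot> v \<oplus> act p (T v)"
proof -
  let ?D = "Suc (Polynomial.degree p)"
  let ?g = "\<lambda>i. Polynomial.coeff (pCons e p) i \<odot> (T ^^ i) v"
  have g: "?g \<in> A \<rightarrow> carrier V" for A using v by (auto simp: T_pow_closed)
  have "act (pCons e p) v = (\<Oplus>i\<in>{..<Suc ?D}. ?g i)"
    by (rule act_eq[OF v]) (auto simp: coeff_pCons coeff_eq_0 split: nat.split)
  also have "\<dots> = (\<Oplus>i\<in>{..<?D}. ?g (Suc i)) \<oplus> ?g 0"
    by (rule finsum_lessThan_shift[OF g, symmetric])
  also have "(\<Oplus>i\<in>{..<?D}. ?g (Suc i)) = act p (T v)"
    unfolding act_def by (simp add: funpow_swap1)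
  finally show ?thesis using v by (simp add: a_comm act_closed T_closed)
qed

lemma act_const: "v \<in> carrier V \<Longrightarrow> act [:e:] v = e \<odot> v"
  by (simp add: act_pCons act_0 T_closed)

lemma act_x: "v \<in> carrier V \<Longrightarrow> act [:0, 1:] v = T v"
  by (simp add: act_pCons act_0 T_closed)

lemma act_add_right:
  "v \<in> carrier V \<Longrightarrow> w \<in> carrier V \<Longrightarrow> act p (v \<oplus> w) = act p v \<oplus> act p w"
  unfolding act_def
  by (subst finsum_addf[symmetric]) (auto simp: T_pow_closed T_pow_add smult_r_distr intro!: finsum_cong')

lemma act_add: "v \<in> carrier V \<Longrightarrow> act (p + r) v = act p v \<oplus> act r v"
proof (induct p arbitrary: r v)
  case (pCons e p)
  obtain e' r' where r: "r = pCons e' r'" by (cases r)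
  from pCons show ?case
    by (simp add: r act_pCons T_closed act_closed smult_l_distr a_ac)
qed (simp add: act_0 act_closed)

lemma act_smult: "v \<in> carrier V \<Longrightarrow> act (Polynomial.smult e p) v = e \<odot> act p v"
  by (induct p arbitrary: v)
    (simp_all add: act_0 act_pCons T_closed act_closed smult_r_distr smult_assoc1)

lemma act_shift: "v \<in> carrier V \<Longrightarrow> act (shift p) v = T (act p v)"
proof (induct p arbitrary: v)
  case (pCons e p)
  have "act (map_poly \<sigma> p) (T (T v)) = T (act p (T v))"
    using pCons(2)[of "T v"] pCons(3) by (simp add: shift_def act_pCons T_closed act_closed)
  with pCons show ?case
    by (simp add: shift_def map_poly_pCons \<sigma>_zero act_pCons T_closed act_closed T_add T_smult)
qed (simp add: shift_def act_0 T_zero)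

lemma act_skew_mult: "v \<in> carrier V \<Longrightarrow> act (skew_mult \<sigma> p r) v = act p (act r v)"
  by (induct p arbitrary: r v)
    (simp_all add: skew_mult_0 act_0 act_closed skew_mult_pCons act_add act_smult act_pCons act_shift)

lemma T_pow_act: "v \<in> carrier V \<Longrightarrow> act (Polynomial.monom 1 k) v = (T ^^ k) v"
  by (induct k arbitrary: v) (simp_all add: monom_0 monom_Suc act_0 act_pCons T_closed T_pow_closed funpow_swap1)

text \<open>The polynomials that annihilate \<open>V\<close> form a two-sided ideal. It contains
  \<open>x^n - a\<close> because \<open>T^n = a\<close>, hence it contains all of
  \<open>J\<close>.\<close>

lemma act_eq_if_cls_eq:
  assumes t: "t = \<iota> a" and eq: "cls p = cls r" and v: "v \<in> carrier V"
  shows "act p v = act r v"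
proof -
  interpret R: ring "skew_poly_ring \<sigma>" by (rule skew_poly_ring)
  define K where "K = {p. \<forall>v\<in>carrier V. act p v = \<zero>}"
  have minus: "act (- p) v = \<ominus> act p v" if "v \<in> carrier V" for p v
    using act_add[OF that, of "- p" p] act_0[OF that] that
    by (intro minus_equality[symmetric]) (auto simp: act_closed)
  have "ideal K (skew_poly_ring \<sigma>)"
  proof (rule idealI[OF skew_poly_ring])
    show "subgroup K (add_monoid (skew_poly_ring \<sigma>))"
    proof (rule R.add.subgroupI)
      fix p assume "p \<in> K"
      then show "\<ominus>\<^bsub>skew_poly_ring \<sigma>\<^esub> p \<in> K"
        by (simp add: K_def minus minus_null skew_poly_ring_simps)
    next
      show "K \<noteq> {}" using act_0 by (auto simp: K_def)
    qed (auto simp: K_def skew_poly_ring_simps act_add)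
  next
    fix p r assume "p \<in> K"
    moreover have "act r \<zero> = \<zero>"
      unfolding act_def by (subst finsum_cong'[where g = "\<lambda>_. \<zero>"]) (auto simp: T_pow_zero)
    ultimately show "r \<otimes>\<^bsub>skew_poly_ring \<sigma>\<^esub> p \<in> K" "p \<otimes>\<^bsub>skew_poly_ring \<sigma>\<^esub> r \<in> K"
      by (auto simp: K_def skew_poly_ring_simps act_skew_mult act_closed)
  qed
  moreover have "Polynomial.monom 1 n - [:\<iota> a:] \<in> K"
    using act_add[of _ "Polynomial.monom 1 n" "- [:\<iota> a:]"]
    by (auto simp: K_def T_pow_act T_pow t minus act_const r_neg simp del: minus_pCons)
  ultimately have "J \<subseteq> K"
    unfolding J_def cyclic_ideal_def by (intro R.genideal_minimal) (auto simp: skew_poly_ring_simps)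
  with eq have "act (p - r) v = \<zero>" using v by (auto simp: cls_eq_iff K_def)
  moreover have "act p v = act (p - r) v \<oplus> act r v"
    using act_add[OF v, of "p - r" r] by simp
  ultimately show ?thesis using v by (simp add: act_closed)
qed

text \<open>An element of the quotient acts through a chosen representative; for
  \<open>t = \<iota> a\<close> the choice does not affect the result, by
  \<open>act_eq_if_cls_eq\<close>.\<close>

definition umod :: "('e poly set, 'v) module" where
  "umod = \<lparr>carrier = carrier V, mult = mult V, one = one V, zero = zero V, add = add V,
     smult = \<lambda>r v. act (SOME p. r = cls p) v\<rparr>"

lemma umod_simps:
  "carrier umod = carrier V" "\<zero>\<^bsub>umod\<^esub> = \<zero>" "u \<oplus>\<^bsub>umod\<^esub> w = u \<oplus> w"
  by (simp_all add: umod_def)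

lemma umod_smult:
  assumes "t = \<iota> a" "v \<in> carrier V" shows "cls p \<odot>\<^bsub>umod\<^esub> v = act p v"
proof -
  have "cls p = cls (SOME r. cls p = cls r)" by (rule someI_ex) blast
  from act_eq_if_cls_eq[OF assms(1) this assms(2)] show ?thesis by (simp add: umod_def)
qed

lemma umod_left_module:
  assumes t: "t = \<iota> a" shows "left_module alg umod"
proof -
  interpret R: ring alg by (rule alg_ring)
  have "abelian_group umod"
  proof (rule abelian_groupI)
    fix x assume "x \<in> carrier umod"
    then show "\<exists>y\<in>carrier umod. y \<oplus>\<^bsub>umod\<^esub> x = \<zero>\<^bsub>umod\<^esub>"
      by (intro bexI[of _ "\<ominus> x"]) (auto simp: umod_simps l_neg)
  qed (auto simp: umod_simps a_ac)
  then interpret M: abelian_group umod .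
  show ?thesis
    by unfold_locales
      (auto simp: umod_simps alg_simps umod_smult[OF t] act_closed act_add act_add_right
        act_skew_mult one_pCons act_const)
qed

end

section \<open>From modules over the quotient to semilinear operators\<close>

locale cyclic_module = kummer n q s a \<iota> h \<sigma> + left_module "kummer.alg n a \<iota> \<sigma>" U
  for n and q s a :: "'f::field" and \<iota> :: "'f \<Rightarrow> 'e::field" and h \<sigma>
    and U :: "('e poly set, 'u) module"
begin

abbreviation "V \<equiv> restrict_scalars aemb U"
abbreviation "xact \<equiv> \<lambda>u. ax \<odot>\<^bsub>U\<^esub> u"

lemma V_vspace: "vspace V"
proof (rule vspace.intro)
  have "abelian_group V"
  proof (rule abelian_groupI)
    fix x assume "x \<in> carrier V"
    then show "\<exists>y\<in>carrier V. y \<oplus>\<^bsub>V\<^esub> x = \<zero>\<^bsub>V\<^esub>"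
      by (intro bexI[of _ "\<ominus>\<^bsub>U\<^esub> x"]) (auto simp: restrict_scalars_def M.l_neg)
  qed (auto simp: restrict_scalars_def M.a_ac)
  then interpret V: abelian_group V .
  show "Module.module (class_ring :: 'e ring) V"
    by unfold_locales
      (auto simp: restrict_scalars_def class_ring_simps aemb_simps smult_closed smult_l_distr
        smult_r_distr smult_assoc smult_one)
qed

end

sublocale cyclic_module \<subseteq> Vsp: vspace "restrict_scalars (kummer.aemb n a \<iota> \<sigma>) U" by (rule V_vspace)

context cyclic_module
begin

lemma cls_smult_pCons:
  "u \<in> carrier U \<Longrightarrow> cls (pCons e p) \<odot>\<^bsub>U\<^esub> u = aemb e \<odot>\<^bsub>U\<^esub> u \<oplus>\<^bsub>U\<^esub> cls p \<odot>\<^bsub>U\<^esub> (ax \<odot>\<^bsub>U\<^esub> u)"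
  by (simp add: cls_pCons smult_l_distr smult_assoc aemb_simps)

lemma smult_zero: "u \<in> carrier U \<Longrightarrow> \<zero>\<^bsub>alg\<^esub> \<odot>\<^bsub>U\<^esub> u = \<zero>\<^bsub>U\<^esub>"
  using smult_l_distr[of "\<zero>\<^bsub>alg\<^esub>" "\<zero>\<^bsub>alg\<^esub>" u] smult_closed[of "\<zero>\<^bsub>alg\<^esub>" u]
  by (simp add: M.add.r_cancel_one')

lemma monom_smult: "u \<in> carrier U \<Longrightarrow> cls (Polynomial.monom 1 k) \<odot>\<^bsub>U\<^esub> u = (xact ^^ k) u"
proof (induct k arbitrary: u)
  case 0
  then show ?case using aemb_simps(4) by (simp add: monom_0 smult_one flip: aemb_def)
next
  case (Suc k)
  have "(xact ^^ k) w \<in> carrier U" if "w \<in> carrier U" for w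
    using that by (induct k) (auto simp: smult_closed aemb_simps)
  with Suc show ?case
    by (simp add: monom_Suc cls_smult_pCons aemb_simps smult_zero smult_closed funpow_swap1)
qed

text \<open>Semilinearity is the rule \<open>x e = \<sigma>(e) x\<close>, and the power condition is
  \<open>x^n = a\<close> in the quotient. Every module thus becomes accessible to
  coordinates.\<close>

lemma semilinear: "semilinear n q s a \<iota> h \<sigma> V xact (\<iota> a)"
proof unfold_locales
  fix v assume v: "v \<in> carrier V"
  have "cls (Polynomial.monom 1 n) = cls [:\<iota> a:]" by (simp add: cls_eq_iff modulus_in_J)
  with v monom_smult[of v n] show "(xact ^^ n) v = \<iota> a \<odot>\<^bsub>V\<^esub> v"
    by (simp add: restrict_scalars_def aemb_def)
  fix e
  show "ax \<odot>\<^bsub>U\<^esub> (e \<odot>\<^bsub>V\<^esub> v) = \<sigma> e \<odot>\<^bsub>V\<^esub> (ax \<odot>\<^bsub>U\<^esub> v)"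
    using v by (simp add: restrict_scalars_def smult_assoc[symmetric] aemb_simps ax_aemb)
qed (auto simp: a_neq_0 \<iota>_eq_0 restrict_scalars_def smult_closed smult_r_distr aemb_simps)

end

sublocale cyclic_module \<subseteq> sl: semilinear n q s a \<iota> h \<sigma> "restrict_scalars (kummer.aemb n a \<iota> \<sigma>) U"
  "\<lambda>u. kummer.ax n a \<iota> \<sigma> \<odot>\<^bsub>U\<^esub> u" "\<iota> a"
  by (rule semilinear)

context cyclic_module
begin

lemma V_simps:
  "carrier V = carrier U" "zero V = zero U" "add V = add U" "e \<odot>\<^bsub>V\<^esub> u = aemb e \<odot>\<^bsub>U\<^esub> u"
  by (simp_all add: restrict_scalars_def)

end


section \<open>Row vectors, matrices and coordinates\<close>

text \<open>The row vector \<open>v A\<close>, in the form that \<open>right_act\<close>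
  uses.\<close>

definition rvm :: "'e::field vec \<Rightarrow> 'e mat \<Rightarrow> 'e vec" where
  "rvm v A = transpose_mat A *\<^sub>v v"

lemma rvm_closed: "A \<in> carrier_mat d d \<Longrightarrow> rvm v A \<in> carrier_vec d"
  unfolding rvm_def by (rule carrier_vecI) simp

lemma rvm_index:
  "A \<in> carrier_mat d d \<Longrightarrow> v \<in> carrier_vec d \<Longrightarrow> j < d \<Longrightarrow> rvm v A $ j = (\<Sum>i<d. v $ i * A $$ (i, j))"
  by (simp add: rvm_def scalar_prod_def atLeast0LessThan mult.commute)

lemma rvm_simps:
  assumes "A \<in> carrier_mat d d" "B \<in> carrier_mat d d" "v \<in> carrier_vec d" "w \<in> carrier_vec d"
  shows "rvm (v + w) A = rvm v A + rvm w A" "rvm v (A + B) = rvm v A + rvm v B"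
    "rvm (e \<cdot>\<^sub>v v) A = e \<cdot>\<^sub>v rvm v A" "rvm v (e \<cdot>\<^sub>m A) = e \<cdot>\<^sub>v rvm v A"
    "rvm (rvm v A) B = rvm v (A * B)" "rvm v (1\<^sub>m d) = v" "rvm v (0\<^sub>m d d) = 0\<^sub>v d"
    "rvm (0\<^sub>v d) A = 0\<^sub>v d" "rvm v (- A) = - rvm v A"
proof -
  show "rvm (rvm v A) B = rvm v (A * B)"
    using assms by (simp add: rvm_def transpose_mult[of A d d B d])
  show "rvm v (1\<^sub>m d) = v" using assms by (simp add: rvm_def)
qed (use assms in \<open>auto intro!: eq_vecI simp: rvm_index[of _ d] distrib_left distrib_right
      sum.distrib sum_distrib_left sum_negf ac_simps carrier_vecD[OF rvm_closed[of _ d]]\<close>)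

lemma rvm_add_left:
  "A \<in> carrier_mat d d \<Longrightarrow> v \<in> carrier_vec d \<Longrightarrow> w \<in> carrier_vec d \<Longrightarrow> rvm (v + w) A = rvm v A + rvm w A"
  by (rule rvm_simps(1))

lemma rvm_smult_left:
  "A \<in> carrier_mat d d \<Longrightarrow> v \<in> carrier_vec d \<Longrightarrow> rvm (e \<cdot>\<^sub>v v) A = e \<cdot>\<^sub>v rvm v A"
  by (rule rvm_simps(3))

lemma rvm_unit:
  assumes "A \<in> carrier_mat d d" "i < d" shows "rvm (unit_vec d i) A = row A i"
proof (rule eq_vecI)
  fix j assume "j < dim_vec (row A i)"
  with assms show "rvm (unit_vec d i) A $ j = row A i $ j"
    by (simp add: rvm_index[of _ d] if_distrib if_distribR cong: if_cong)
qed (use assms in \<open>simp add: carrier_vecD[OF rvm_closed[of _ d]]\<close>)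

lemma rvm_ext:
  assumes "A \<in> carrier_mat d d" "B \<in> carrier_mat d d"
    and "\<And>v. v \<in> carrier_vec d \<Longrightarrow> rvm v A = rvm v B"
  shows "A = B"
proof (rule eq_rowI)
  fix i assume "i < dim_row B"
  then show "row A i = row B i"
    using assms rvm_unit[of A d i] rvm_unit[of B d i] by auto
qed (use assms in auto)

lemma module_vec_vspace: "vspace (module_vec TYPE('e::field) d)"
proof (rule vspace.intro)
  interpret vec_module "TYPE('e)" d .
  show "Module.module (class_ring :: 'e ring) (module_vec TYPE('e) d)" by unfold_locales
qed

lemma module_mat_vspace: "vspace (module_mat TYPE('e::field) nr nc)"
  using matrix_vs[where 'a = 'e, of nr nc] by (auto simp: vspace_def vectorspace_def)

lemma finsum_module_vec:
  assumes "f \<in> I \<rightarrow> carrier_vec d"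
  shows "finsum (module_vec TYPE('e::field) d) f I = vec d (\<lambda>j. \<Sum>i\<in>I. f i $ j)"
proof -
  interpret vspace "module_vec TYPE('e) d" by (rule module_vec_vspace)
  show ?thesis using assms
  proof (induct I rule: infinite_finite_induct)
    case (insert x F)
    then have "f \<in> F \<rightarrow> carrier (module_vec TYPE('e) d)" "f x \<in> carrier (module_vec TYPE('e) d)"
      by (auto simp: module_vec_simps)
    with insert show ?case by (auto simp: module_vec_simps intro!: eq_vecI)
  qed (auto simp: finsum_infinite, auto simp: module_vec_simps)
qed

lemma finsum_module_mat:
  assumes "f \<in> I \<rightarrow> carrier_mat nr nc"
  shows "finsum (module_mat TYPE('e::field) nr nc) f I = mat nr nc (\<lambda>p. \<Sum>i\<in>I. f i $$ p)"
proof -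
  interpret vspace "module_mat TYPE('e) nr nc" by (rule module_mat_vspace)
  show ?thesis using assms
  proof (induct I rule: infinite_finite_induct)
    case (insert x F)
    then have "f \<in> F \<rightarrow> carrier (module_mat TYPE('e) nr nc)" "f x \<in> carrier (module_mat TYPE('e) nr nc)"
      by (auto simp: module_mat_simps)
    with insert show ?case by (auto simp: module_mat_simps intro!: eq_matI)
  qed (auto simp: finsum_infinite, auto simp: module_mat_simps)
qed

lemma family_basis_module_vec:
  "family_basis (module_vec TYPE('e::field) d) {..<d} (unit_vec d)"
proof -
  have "finsum (module_vec TYPE('e) d) (\<lambda>i. c i \<odot>\<^bsub>module_vec TYPE('e) d\<^esub> unit_vec d i) {..<d} = vec d c" for c
    by (subst finsum_module_vec)
      (auto simp: module_vec_simps if_distrib if_distribR intro!: eq_vecI cong: if_cong)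
  then show ?thesis unfolding family_basis_def
    by (auto simp: module_vec_simps vec_eq_iff intro!: exI[of _ "\<lambda>i. v $ i" for v])
qed

definition mat_unit :: "nat \<Rightarrow> nat \<Rightarrow> nat \<Rightarrow> 'e::field mat" where
  "mat_unit d i j = mat d d (\<lambda>p. if p = (i, j) then 1 else 0)"

lemma mat_unit_carrier: "mat_unit d i j \<in> carrier_mat d d"
  by (simp add: mat_unit_def)

lemma mat_mult_index:
  "A \<in> carrier_mat d d \<Longrightarrow> B \<in> carrier_mat d d \<Longrightarrow> i < d \<Longrightarrow> j < d \<Longrightarrow>
    (A * B) $$ (i, j) = (\<Sum>k<d. A $$ (i, k) * B $$ (k, j))"
  by (simp add: scalar_prod_def atLeast0LessThan)

lemma family_basis_module_mat:
  "family_basis (module_mat TYPE('e::field) d d) ({..<d} \<times> {..<d}) (\<lambda>p. mat_unit d (fst p) (snd p))"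
proof -
  have "finsum (module_mat TYPE('e) d d)
      (\<lambda>p. c p \<odot>\<^bsub>module_mat TYPE('e) d d\<^esub> mat_unit d (fst p) (snd p)) ({..<d} \<times> {..<d}) = mat d d c" for c
    by (subst finsum_module_mat)
      (auto simp: module_mat_simps mat_unit_def if_distrib if_distribR intro!: eq_matI cong: if_cong)
  then show ?thesis unfolding family_basis_def
    by (auto simp: module_mat_simps mat_unit_carrier mat_eq_iff intro!: exI[of _ "\<lambda>p. A $$ p" for A])
qed

lemma linear_vec_eq_rvm:
  assumes f: "\<And>v. v \<in> carrier_vec d \<Longrightarrow> f v \<in> carrier_vec d"
    "\<And>v w. v \<in> carrier_vec d \<Longrightarrow> w \<in> carrier_vec d \<Longrightarrow> f (v + w) = f v + f w"
    "\<And>e v. v \<in> carrier_vec d \<Longrightarrow> f (e \<cdot>\<^sub>v v) = e \<cdot>\<^sub>v f v"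
  shows "\<exists>A \<in> carrier_mat d d. \<forall>v\<in>carrier_vec d. f v = rvm (v :: 'e::field vec) A"
proof -
  interpret vspace "module_vec TYPE('e) d" by (rule module_vec_vspace)
  \<comment> \<open>Row \<open>i\<close> is the image of the \<open>i\<close>-th unit vector, since
    vectors are rows.\<close>
  define A where "A = mat d d (\<lambda>(i, j). f (unit_vec d i) $ j)"
  have z: "0 \<cdot>\<^sub>v w = 0\<^sub>v d" if "w \<in> carrier_vec d" for w :: "'e vec"
    using that by (intro eq_vecI) auto
  have f0: "f (0\<^sub>v d) = 0\<^sub>v d" using f(3)[of "0\<^sub>v d" 0] f(1)[of "0\<^sub>v d"] by (simp only: z zero_carrier_vec)
  have fsum: "f (finsum (module_vec TYPE('e) d) g I) = finsum (module_vec TYPE('e) d) (\<lambda>i. f (g i)) I"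
    if "g \<in> I \<rightarrow> carrier_vec d" for g and I :: "nat set"
    using that
  proof (induct I rule: infinite_finite_induct)
    case (insert x F)
    then have "g \<in> F \<rightarrow> carrier (module_vec TYPE('e) d)" "g x \<in> carrier (module_vec TYPE('e) d)"
      "(\<lambda>i. f (g i)) \<in> F \<rightarrow> carrier (module_vec TYPE('e) d)"
      using f(1) by (auto simp: module_vec_simps)
    moreover from this have "finsum (module_vec TYPE('e) d) g F \<in> carrier (module_vec TYPE('e) d)" by simp
    ultimately show ?case using insert f(1,2) by (simp add: module_vec_simps)
  qed (auto simp: finsum_infinite module_vec_simps f0)
  have "f v = rvm v A" if v: "v \<in> carrier_vec d" for v
  proof -
    have "v = finsum (module_vec TYPE('e) d) (\<lambda>i. v $ i \<cdot>\<^sub>v unit_vec d i) {..<d}"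
      using v by (subst finsum_module_vec) (auto intro!: eq_vecI simp: if_distrib if_distribR cong: if_cong)
    then have "f v = f (finsum (module_vec TYPE('e) d) (\<lambda>i. v $ i \<cdot>\<^sub>v unit_vec d i) {..<d})" by simp
    also have "\<dots> = finsum (module_vec TYPE('e) d) (\<lambda>i. f (v $ i \<cdot>\<^sub>v unit_vec d i)) {..<d}"
      by (rule fsum) simp
    also have "\<dots> = vec d (\<lambda>j. \<Sum>i<d. v $ i * f (unit_vec d i) $ j)"
    proof -
      have dim: "dim_vec (f (unit_vec d i)) = d" for i using f(1)[OF unit_vec_carrier] by (rule carrier_vecD)
      have *: "(\<lambda>i. f (v $ i \<cdot>\<^sub>v unit_vec d i)) \<in> {..<d} \<rightarrow> carrier_vec d" using f(1) by simp
      have "f (v $ i \<cdot>\<^sub>v unit_vec d i) $ j = v $ i * f (unit_vec d i) $ j" if "j < d" for i j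
        using that dim[of i] by (simp add: f(3))
      then show ?thesis unfolding finsum_module_vec[OF *] by (intro eq_vecI) simp_all
    qed
    also have "\<dots> = rvm v A"
      by (rule eq_vecI) (auto simp: A_def rvm_index[of _ d] v carrier_vecD[OF rvm_closed[of _ d]])
    finally show ?thesis .
  qed
  moreover have "A \<in> carrier_mat d d" by (simp add: A_def)
  ultimately show ?thesis by (intro bexI[of _ A] ballI)
qed

context vspace
begin

lemma comb_closed:
  assumes "family_basis V {..<d} b" shows "comb V d b u \<in> carrier V"
  unfolding comb_def by (rule finsum_closed) (use family_basisD(2)[OF assms] in auto)

lemma comb_bij:
  assumes "family_basis V {..<d} b" shows "bij_betw (comb V d b) (carrier_vec d) (carrier V)"
  unfolding bij_betw_def
proof
  show "inj_on (comb V d b) (carrier_vec d)"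
  proof (rule inj_onI)
    fix u w :: "'k vec"
    assume uw: "u \<in> carrier_vec d" "w \<in> carrier_vec d" "comb V d b u = comb V d b w"
    have "u $ i = w $ i" if "i < d" for i
      by (rule family_basis_eq[OF assms uw(3)[unfolded comb_def]]) (use that in simp)
    with uw(1,2) show "u = w" by (intro eq_vecI) auto
  qed
  show "comb V d b ` carrier_vec d = carrier V"
  proof
    show "carrier V \<subseteq> comb V d b ` carrier_vec d"
    proof
      fix v assume "v \<in> carrier V"
      then obtain c where c: "v = (\<Oplus>i\<in>{..<d}. c i \<odot> b i)" using family_basisD(3)[OF assms] by blast
      have "v = comb V d b (vec d c)"
        unfolding comb_def c using family_basisD(2)[OF assms] by (intro finsum_cong') auto
      then show "v \<in> comb V d b ` carrier_vec d" by (intro image_eqI[of _ _ "vec d c"]) auto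
    qed
  qed (use comb_closed[OF assms] in auto)
qed

lemma comb_add:
  assumes "family_basis V {..<d} b" "u \<in> carrier_vec d" "w \<in> carrier_vec d"
  shows "comb V d b (u + w) = comb V d b u \<oplus> comb V d b w"
proof -
  have "(\<Oplus>i\<in>{..<d}. (u + w) $ i \<odot> b i) = (\<Oplus>i\<in>{..<d}. u $ i \<odot> b i \<oplus> w $ i \<odot> b i)"
    using family_basisD(2)[OF assms(1)] assms(2,3) by (intro finsum_cong') (auto simp: smult_l_distr)
  also have "\<dots> = (\<Oplus>i\<in>{..<d}. u $ i \<odot> b i) \<oplus> (\<Oplus>i\<in>{..<d}. w $ i \<odot> b i)"
    using family_basisD(2)[OF assms(1)] by (intro finsum_addf) auto
  finally show ?thesis by (simp add: comb_def)
qed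

lemma comb_smult:
  assumes "family_basis V {..<d} b" "u \<in> carrier_vec d"
  shows "comb V d b (e \<cdot>\<^sub>v u) = e \<odot> comb V d b u"
  unfolding comb_def using family_basisD(2)[OF assms(1)] assms(2)
  by (subst finsum_scale) (auto simp: smult_assoc1 intro!: finsum_cong')

lemma comb_sum_rows:
  assumes b: "family_basis V {..<d} b" and A: "A \<in> carrier_mat d d" and u: "u \<in> carrier_vec d"
  shows "(\<Oplus>i\<in>{..<d}. u $ i \<odot> comb V d b (row A i)) = comb V d b (rvm u A)"
proof -
  note bc = family_basisD(2)[OF b]
  have "(\<Oplus>i\<in>{..<d}. u $ i \<odot> comb V d b (row A i))
      = (\<Oplus>i\<in>{..<d}. \<Oplus>j\<in>{..<d}. (u $ i * A $$ (i, j)) \<odot> b j)"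
  proof (rule finsum_cong'[OF refl])
    fix i assume i: "i \<in> {..<d}"
    have "u $ i \<odot> comb V d b (row A i) = (\<Oplus>j\<in>{..<d}. u $ i \<odot> (row A i $ j \<odot> b j))"
      unfolding comb_def using bc by (intro finsum_scale) auto
    also have "\<dots> = (\<Oplus>j\<in>{..<d}. (u $ i * A $$ (i, j)) \<odot> b j)"
      using bc A i by (intro finsum_cong') (auto simp: smult_assoc1)
    finally show "u $ i \<odot> comb V d b (row A i) = (\<Oplus>j\<in>{..<d}. (u $ i * A $$ (i, j)) \<odot> b j)" .
  qed (use bc in \<open>auto intro!: finsum_closed\<close>)
  also have "\<dots> = (\<Oplus>j\<in>{..<d}. \<Oplus>i\<in>{..<d}. (u $ i * A $$ (i, j)) \<odot> b j)"
    using bc by (intro finsum_swap) auto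
  also have "\<dots> = comb V d b (rvm u A)"
    unfolding comb_def using bc A u
    by (intro finsum_cong') (auto simp: finsum_scale_left[symmetric] rvm_index[of _ d])
  finally show ?thesis .
qed

end

section \<open>Twisted norms as powers of the operator of x\<close>

context kummer
begin

lemma map_mat_mult:
  "A \<in> carrier_mat d d \<Longrightarrow> B \<in> carrier_mat d d \<Longrightarrow>
    map_mat (\<sigma> ^^ k) (A * B) = map_mat (\<sigma> ^^ k) A * map_mat (\<sigma> ^^ k) B"
  by (rule eq_matI) (auto simp: scalar_prod_def \<sigma>_pow_sum \<sigma>_pow_hom)

lemma map_mat_mult': "A \<in> carrier_mat d d \<Longrightarrow> B \<in> carrier_mat d d \<Longrightarrow>
    map_mat \<sigma> (A * B) = map_mat \<sigma> A * map_mat \<sigma> B"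
  using map_mat_mult[of A d B 1] by simp

lemma map_mat_simps:
  "map_mat \<sigma> (1\<^sub>m d) = 1\<^sub>m d" "A \<in> carrier_mat d d \<Longrightarrow> B \<in> carrier_mat d d \<Longrightarrow> map_mat \<sigma> (A + B) = map_mat \<sigma> A + map_mat \<sigma> B"
  "map_mat \<sigma> (e \<cdot>\<^sub>m A) = \<sigma> e \<cdot>\<^sub>m map_mat \<sigma> A" "map_mat \<sigma> (map_mat (\<sigma> ^^ k) A) = map_mat (\<sigma> ^^ Suc k) A"
  "map_mat (\<sigma> ^^ n) A = A"
  by (auto intro!: eq_matI simp: \<sigma>_zero \<sigma>_one \<sigma>_add \<sigma>_mult \<sigma>_pow_n)

lemma map_vec_rvm:
  "A \<in> carrier_mat d d \<Longrightarrow> v \<in> carrier_vec d \<Longrightarrow> map_vec \<sigma> (rvm v A) = rvm (map_vec \<sigma> v) (map_mat \<sigma> A)"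
  by (rule eq_vecI) (auto simp: rvm_index[of _ d] \<sigma>_sum \<sigma>_mult carrier_vecD[OF rvm_closed[of _ d]])

lemma twisted_norm_closed: "A \<in> carrier_mat d d \<Longrightarrow> twisted_norm \<sigma> k A \<in> carrier_mat d d"
  by (induct k) auto

text \<open>The definition adds factors at the left end. This version adds the rightmost
  \<open>A\<close>, which is the factor contributed by one more application of
  \<open>Tm A\<close>.\<close>

lemma twisted_norm_Suc:
  "A \<in> carrier_mat d d \<Longrightarrow> twisted_norm \<sigma> (Suc k) A = map_mat \<sigma> (twisted_norm \<sigma> k A) * A"
proof (induct k)
  case 0
  have "map_mat (\<lambda>x. x) A = A" by (rule eq_matI) auto
  with 0 show ?case by (auto simp: map_mat_simps)
next
  case (Suc k)
  have "twisted_norm \<sigma> (Suc (Suc k)) A = map_mat (\<sigma> ^^ Suc k) A * (map_mat \<sigma> (twisted_norm \<sigma> k A) * A)"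
    using Suc by simp
  also have "\<dots> = map_mat \<sigma> (map_mat (\<sigma> ^^ k) A) * map_mat \<sigma> (twisted_norm \<sigma> k A) * A"
    unfolding map_mat_simps(4) using Suc(2) twisted_norm_closed[OF Suc(2), of k]
    by (intro assoc_mult_mat[symmetric]) auto
  also have "map_mat \<sigma> (map_mat (\<sigma> ^^ k) A) * map_mat \<sigma> (twisted_norm \<sigma> k A)
      = map_mat \<sigma> (twisted_norm \<sigma> (Suc k) A)"
    using Suc(2) twisted_norm_closed[OF Suc(2), of k] by (simp add: map_mat_mult'[of _ d])
  finally show ?case .
qed

text \<open>The action of \<open>x\<close> in coordinates,
  \<open>x (u e) = u^\<sigma> A e\<close>.\<close>

definition Tm :: "'e mat \<Rightarrow> 'e vec \<Rightarrow> 'e vec" where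
  "Tm A v = rvm (map_vec \<sigma> v) A"

lemma Tm_pow:
  assumes A: "A \<in> carrier_mat d d" and v: "v \<in> carrier_vec d"
  shows "(Tm A ^^ k) v = rvm (map_vec (\<sigma> ^^ k) v) (twisted_norm \<sigma> k A)"
proof (induct k)
  case 0
  have "map_vec (\<lambda>x. x) v = v" by (rule eq_vecI) auto
  with v A show ?case by (simp add: rvm_simps(6) carrier_matD)
next
  case (Suc k)
  have *: "map_vec \<sigma> (map_vec (\<sigma> ^^ k) v) = map_vec (\<sigma> ^^ Suc k) v" by (rule eq_vecI) auto
  show ?case unfolding twisted_norm_Suc[OF A] *[symmetric]
    using Suc v A twisted_norm_closed[OF A, of k]
    by (simp add: Tm_def map_vec_rvm[of _ d] rvm_simps(5)[of _ d])
qed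

lemma Tm_semilinear:
  assumes A: "A \<in> carrier_mat d d" and N: "twisted_norm \<sigma> n A = t \<cdot>\<^sub>m 1\<^sub>m d" and t: "t \<noteq> 0"
  shows "semilinear n q s a \<iota> h \<sigma> (module_vec TYPE('e) d) (Tm A) t"
proof -
  interpret vspace "module_vec TYPE('e) d" by (rule module_vec_vspace)
  have *: "map_vec (\<sigma> ^^ n) v = v" for v by (rule eq_vecI) (auto simp: \<sigma>_pow_n)
  have **: "map_vec \<sigma> (v + w) = map_vec \<sigma> v + map_vec \<sigma> w" "map_vec \<sigma> (e \<cdot>\<^sub>v v) = \<sigma> e \<cdot>\<^sub>v map_vec \<sigma> v"
    if "v \<in> carrier_vec d" "w \<in> carrier_vec d" for v w e
    using that by (auto intro!: eq_vecI simp: \<sigma>_add \<sigma>_mult)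
  show ?thesis
    by unfold_locales
      (use A t in \<open>auto simp: module_vec_simps Tm_pow[OF A] * N Tm_def ** rvm_closed rvm_simps[of _ d]\<close>)
qed

text \<open>A matrix is determined by its action on rows, and \<open>\<sigma>^n = 1\<close> removes
  the twist from the \<open>n\<close>-th power.\<close>

lemma twisted_norm_if_Tm_pow:
  assumes A: "A \<in> carrier_mat d d" and T: "\<And>v. v \<in> carrier_vec d \<Longrightarrow> (Tm A ^^ n) v = t \<cdot>\<^sub>v v"
  shows "twisted_norm \<sigma> n A = t \<cdot>\<^sub>m 1\<^sub>m d"
proof (rule rvm_ext)
  fix v :: "'e vec" assume v: "v \<in> carrier_vec d"
  have *: "map_vec (\<sigma> ^^ n) v = v" by (rule eq_vecI) (auto simp: \<sigma>_pow_n)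
  show "rvm v (twisted_norm \<sigma> n A) = rvm v (t \<cdot>\<^sub>m 1\<^sub>m d)"
    using T[OF v] v by (simp add: Tm_pow[OF A v] * rvm_simps(4,6)[of "1\<^sub>m d" d "1\<^sub>m d" v v])
qed (use A in \<open>auto simp: twisted_norm_closed\<close>)

end

lemma (in semilinear) comb_Tm:
  assumes b: "family_basis V {..<d} b" and A: "is_structure_matrix V T d b A" and u: "u \<in> carrier_vec d"
  shows "comb V d b (Tm A u) = T (comb V d b u)"
proof -
  note bc = family_basisD(2)[OF b]
  have A': "A \<in> carrier_mat d d" "\<And>i. i < d \<Longrightarrow> T (b i) = comb V d b (row A i)"
    using A by (auto simp: is_structure_matrix_def)
  have "T (comb V d b u) = (\<Oplus>i\<in>{..<d}. T (u $ i \<odot> b i))"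
    unfolding comb_def using bc by (intro T_finsum) auto
  also have "\<dots> = (\<Oplus>i\<in>{..<d}. map_vec \<sigma> u $ i \<odot> comb V d b (row A i))"
    using bc u by (intro finsum_cong') (auto simp: T_smult A' comb_closed[OF b])
  also have "\<dots> = comb V d b (Tm A u)"
    unfolding Tm_def using u by (intro comb_sum_rows[OF b A'(1)]) auto
  finally show ?thesis ..
qed

text \<open>Coordinates carry \<open>Tm A\<close> to \<open>T\<close>, so the norm condition is
  \<open>T^n = t\<close> read in coordinates.\<close>

lemma (in semilinear) structure_matrix_norm:
  assumes b: "family_basis V {..<d} b" and A: "is_structure_matrix V T d b A"
  shows "twisted_norm \<sigma> n A = t \<cdot>\<^sub>m 1\<^sub>m d"
proof (rule twisted_norm_if_Tm_pow)
  show Ac: "A \<in> carrier_mat d d" using A by (simp add: is_structure_matrix_def)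
  fix v :: "'e vec" assume v: "v \<in> carrier_vec d"
  have c: "(Tm A ^^ k) v \<in> carrier_vec d" for k
    using v Ac by (induct k) (auto simp: Tm_def rvm_closed)
  have "comb V d b ((Tm A ^^ k) v) = (T ^^ k) (comb V d b v)" for k
    by (induct k) (simp_all add: comb_Tm[OF b A c])
  then have "comb V d b ((Tm A ^^ n) v) = comb V d b (t \<cdot>\<^sub>v v)"
    using T_pow[OF comb_closed[OF b]] by (simp add: comb_smult[OF b v])
  then show "(Tm A ^^ n) v = t \<cdot>\<^sub>v v"
    using comb_bij[OF b] c[of n] v by (auto simp: bij_betw_def inj_on_def)
qed

lemma (in semilinear) structure_matrix_exists:
  assumes b: "family_basis V {..<d} b" shows "\<exists>A. is_structure_matrix V T d b A"
proof -
  have "\<exists>u. u \<in> carrier_vec d \<and> T (b i) = comb V d b u" if "i < d" for i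
    using comb_bij[OF b] T_closed[OF family_basisD(2)[OF b], of i] that
    by (force simp: bij_betw_def image_iff)
  then obtain u where u: "\<And>i. i < d \<Longrightarrow> u i \<in> carrier_vec d \<and> T (b i) = comb V d b (u i)" by metis
  define A where "A = mat d d (\<lambda>(i, j). u i $ j)"
  have "row A i = u i" if "i < d" for i using that u[OF that] by (intro eq_vecI) (auto simp: A_def)
  with u show ?thesis by (intro exI[of _ A]) (auto simp: is_structure_matrix_def A_def)
qed


section \<open>Matrices with twisted norm \<open>a\<close>\<close>

lemma F_algebraI_subalgebra:
  assumes "F_algebra A" "F_subalgebra S A" shows "F_algebra (A\<lparr>carrier := S\<rparr>)"
proof -
  interpret ring A using assms(1) by (simp add: F_algebra_def)
  have S: "subring S A" "Module.submodule S class_ring A" using assms(2) by (auto simp: F_subalgebra_def)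
  have "ring (A\<lparr>carrier := S\<rparr>)" by (rule subring_is_ring[OF S(1)])
  moreover have "Module.module class_ring (A\<lparr>carrier := S\<rparr>)"
    using submodule.submodule_is_module[OF S(2)] assms(1) by (simp add: F_algebra_def)
  ultimately show ?thesis
    using assms(1) subringE(1)[OF S(1)] unfolding F_algebra_def by (auto 0 4)
qed

context kummer
begin

lemma E_mat_alg_simps:
  "carrier (E_mat_alg \<iota> d) = carrier_mat d d" "M \<otimes>\<^bsub>E_mat_alg \<iota> d\<^esub> N = M * N"
  "\<one>\<^bsub>E_mat_alg \<iota> d\<^esub> = 1\<^sub>m d" "\<zero>\<^bsub>E_mat_alg \<iota> d\<^esub> = 0\<^sub>m d d" "M \<oplus>\<^bsub>E_mat_alg \<iota> d\<^esub> N = M + N"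
  "c \<odot>\<^bsub>E_mat_alg \<iota> d\<^esub> M = \<iota> c \<cdot>\<^sub>m M"
  by (simp_all add: E_mat_alg_def)

lemma E_mat_alg_F_algebra: "F_algebra (E_mat_alg \<iota> d)"
proof -
  have g: "abelian_group (E_mat_alg \<iota> d)"
  proof (rule abelian_groupI)
    fix M assume "M \<in> carrier (E_mat_alg \<iota> d)"
    then show "\<exists>N\<in>carrier (E_mat_alg \<iota> d). N \<oplus>\<^bsub>E_mat_alg \<iota> d\<^esub> M = \<zero>\<^bsub>E_mat_alg \<iota> d\<^esub>"
      by (intro bexI[of _ "- M"]) (auto simp: E_mat_alg_simps)
  qed (auto simp: E_mat_alg_simps intro: comm_add_mat assoc_add_mat)
  then interpret abelian_group "E_mat_alg \<iota> d" .
  have r: "ring (E_mat_alg \<iota> d)"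
    by (intro ringI g monoidI)
      (auto simp: E_mat_alg_simps add_mult_distrib_mat[of _ d d] mult_add_distrib_mat[of _ d d] assoc_mult_mat[of _ d d])
  have "Module.module (class_ring :: 'f ring) (E_mat_alg \<iota> d)"
    by unfold_locales
      (auto simp: E_mat_alg_simps class_ring_simps \<iota>_add \<iota>_mult \<iota>_one add_smult_distrib_right_mat
        add_smult_distrib_left_mat)
  with r show ?thesis
    by (auto simp: F_algebra_def E_mat_alg_simps mult_smult_assoc_mat[of _ d d] mult_smult_distrib[of _ d d])
qed

lemma E_mat_alg_ring: "ring (E_mat_alg \<iota> d)"
  using E_mat_alg_F_algebra by (simp add: F_algebra_def)

lemma E_mat_alg_vspace: "vspace (E_mat_alg \<iota> d)"
  using E_mat_alg_F_algebra by (simp add: F_algebra_def vspace_def)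

lemma E_mat_alg_uminus: "M \<in> carrier_mat d d \<Longrightarrow> \<ominus>\<^bsub>E_mat_alg \<iota> d\<^esub> M = - M"
proof -
  interpret ring "E_mat_alg \<iota> d" by (rule E_mat_alg_ring)
  show "M \<in> carrier_mat d d \<Longrightarrow> \<ominus>\<^bsub>E_mat_alg \<iota> d\<^esub> M = - M"
    by (rule minus_equality) (auto simp: E_mat_alg_simps)
qed

lemma E_mat_alg_UnitsI:
  assumes "M \<in> carrier_mat d d" "N \<in> carrier_mat d d" "N * M = 1\<^sub>m d"
  shows "M \<in> Units (E_mat_alg \<iota> d)"
  using assms mat_mult_left_right_inverse[OF assms(2,1,3)]
  by (auto simp: Units_def E_mat_alg_simps)

lemma finsum_E_mat_alg:
  assumes "f \<in> I \<rightarrow> carrier_mat d d"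
  shows "finsum (E_mat_alg \<iota> d) f I = mat d d (\<lambda>p. \<Sum>i\<in>I. f i $$ p)"
proof -
  interpret vspace "E_mat_alg \<iota> d" by (rule E_mat_alg_vspace)
  show ?thesis using assms
  proof (induct I rule: infinite_finite_induct)
    case (insert x F)
    then have "f \<in> F \<rightarrow> carrier (E_mat_alg \<iota> d)" "f x \<in> carrier (E_mat_alg \<iota> d)"
      by (auto simp: E_mat_alg_simps)
    with insert show ?case by (auto simp: E_mat_alg_simps intro!: eq_matI)
  qed (auto simp: finsum_infinite, auto simp: E_mat_alg_simps)
qed

text \<open>The norm factors as \<open>\<sigma>(N') A\<close> with \<open>N'\<close> the product of
  length \<open>n - 1\<close>, so \<open>\<sigma>(N') / a\<close> is a left inverse of
  \<open>A\<close>; for square matrices this is enough.\<close>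

lemma twisted_norm_unit:
  assumes A: "A \<in> carrier_mat d d" and N: "twisted_norm \<sigma> n A = \<iota> a \<cdot>\<^sub>m 1\<^sub>m d"
  shows "A \<in> Units (E_mat_alg \<iota> d)"
proof -
  obtain m where m: "n = Suc m" using n_pos by (cases n) auto
  let ?B = "map_mat \<sigma> (twisted_norm \<sigma> m A)"
  have B: "?B \<in> carrier_mat d d" using twisted_norm_closed[OF A] by simp
  have "inverse (\<iota> a) \<cdot>\<^sub>m ?B * A = inverse (\<iota> a) \<cdot>\<^sub>m twisted_norm \<sigma> (Suc m) A"
    using mult_smult_assoc_mat[OF B A] by (simp only: twisted_norm_Suc[OF A])
  also have "\<dots> = 1\<^sub>m d" using N m a_neq_0 \<iota>_eq_0 by (intro eq_matI) auto
  finally have "inverse (\<iota> a) \<cdot>\<^sub>m ?B * A = 1\<^sub>m d" .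
  then show ?thesis using B by (intro E_mat_alg_UnitsI[OF A, of "inverse (\<iota> a) \<cdot>\<^sub>m ?B"]) auto
qed

end

section \<open>The algebra attached to a matrix of norm a\<close>

locale norm_matrix = kummer n q s a \<iota> h \<sigma>
  for n and q s a :: "'f::field" and \<iota> :: "'f \<Rightarrow> 'e::field" and h \<sigma> +
  fixes d :: nat and A :: "'e mat"
  assumes d_pos: "0 < d" and A: "A \<in> carrier_mat d d" and norm_A: "twisted_norm \<sigma> n A = \<iota> a \<cdot>\<^sub>m 1\<^sub>m d"
begin

definition Ai :: "'e mat" where "Ai = inv\<^bsub>E_mat_alg \<iota> d\<^esub> A"

lemma A_unit: "A \<in> Units (E_mat_alg \<iota> d)" by (rule twisted_norm_unit[OF A norm_A])

lemma Ai: "Ai \<in> carrier_mat d d" "Ai * A = 1\<^sub>m d" "A * Ai = 1\<^sub>m d"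
proof -
  interpret ring "E_mat_alg \<iota> d" by (rule E_mat_alg_ring)
  show "Ai \<in> carrier_mat d d" "Ai * A = 1\<^sub>m d" "A * Ai = 1\<^sub>m d"
    using Units_inv_closed[OF A_unit] Units_l_inv[OF A_unit] Units_r_inv[OF A_unit]
    by (auto simp: Ai_def E_mat_alg_simps)
qed

abbreviation "D \<equiv> D_set \<iota> \<sigma> d A"

lemma mult_cancel:
  assumes "M \<in> carrier_mat d d"
  shows "M * Ai * A = M" "M * A * Ai = M" "Ai * (A * M) = M" "A * (Ai * M) = M"
proof -
  show "M * Ai * A = M" "M * A * Ai = M"
    using assms Ai A by (simp_all add: assoc_mult_mat[of _ d d _ d _ d])
  show "Ai * (A * M) = M" "A * (Ai * M) = M"
    using assms Ai A by (simp_all add: assoc_mult_mat[of _ d d _ d _ d, symmetric] del: assoc_mult_mat)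
qed

lemma D_iff: "M \<in> D \<longleftrightarrow> M \<in> carrier_mat d d \<and> map_mat \<sigma> M * A = A * M"
proof -
  have "map_mat \<sigma> M = A * M * Ai \<longleftrightarrow> map_mat \<sigma> M * A = A * M" if "M \<in> carrier_mat d d"
  proof
    assume "map_mat \<sigma> M = A * M * Ai"
    then show "map_mat \<sigma> M * A = A * M" using mult_cancel(1)[of "A * M"] A that by simp
  next
    assume "map_mat \<sigma> M * A = A * M"
    then show "map_mat \<sigma> M = A * M * Ai" using mult_cancel(2)[of "map_mat \<sigma> M"] that by simp
  qed
  then show ?thesis by (auto simp: D_set_def Ai_def)
qed

lemma D_closed:
  "D \<subseteq> carrier_mat d d" "1\<^sub>m d \<in> D" "0\<^sub>m d d \<in> D"
  "M \<in> D \<Longrightarrow> N \<in> D \<Longrightarrow> M * N \<in> D" "M \<in> D \<Longrightarrow> N \<in> D \<Longrightarrow> M + N \<in> D"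
  "M \<in> D \<Longrightarrow> \<iota> c \<cdot>\<^sub>m M \<in> D" "M \<in> D \<Longrightarrow> - M \<in> D"
proof -
  show sub: "D \<subseteq> carrier_mat d d" by (auto simp: D_iff)
  show "1\<^sub>m d \<in> D" using A by (simp add: D_iff map_mat_simps)
  show sm: "\<iota> c \<cdot>\<^sub>m M \<in> D" if "M \<in> D" for c M
    using that A by (auto simp: D_iff map_mat_simps \<sigma>_\<iota> mult_smult_assoc_mat[of _ d d] mult_smult_distrib[of _ d d])
  show "M * N \<in> D" if MN: "M \<in> D" "N \<in> D"
  proof -
    from MN have c: "M \<in> carrier_mat d d" "N \<in> carrier_mat d d" using sub by auto
    have "map_mat \<sigma> (M * N) * A = map_mat \<sigma> M * (map_mat \<sigma> N * A)"
      using c A by (simp add: map_mat_mult'[of _ d] assoc_mult_mat[of _ d d _ d _ d])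
    also have "\<dots> = map_mat \<sigma> M * A * N"
      using MN c A by (simp add: D_iff assoc_mult_mat[of _ d d _ d _ d, symmetric] del: assoc_mult_mat)
    also have "\<dots> = A * (M * N)"
      using MN c A by (simp add: D_iff assoc_mult_mat[of _ d d _ d _ d])
    finally show ?thesis using c by (simp add: D_iff)
  qed
  show "M + N \<in> D" if "M \<in> D" "N \<in> D"
    using that A by (auto simp: D_iff map_mat_simps(2)[of _ d] add_mult_distrib_mat[of _ d d] mult_add_distrib_mat[of _ d d])
  have "- M = \<iota> (- 1) \<cdot>\<^sub>m M" if "M \<in> D"
    using that by (intro eq_matI) (auto simp: \<iota>_minus \<iota>_one)
  with sm show "- M \<in> D" if "M \<in> D" using that by metis
  have "0\<^sub>m d d = \<iota> 0 \<cdot>\<^sub>m 1\<^sub>m d" by (intro eq_matI) (auto simp: \<iota>_zero)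
  with sm[OF \<open>1\<^sub>m d \<in> D\<close>, of 0] show "0\<^sub>m d d \<in> D" by simp
qed

lemma D_carrier: "M \<in> D \<Longrightarrow> M \<in> carrier_mat d d" using D_closed(1) by auto

lemma D_subalgebra: "F_subalgebra D (E_mat_alg \<iota> d)"
  unfolding F_subalgebra_def
proof
  interpret ring "E_mat_alg \<iota> d" by (rule E_mat_alg_ring)
  interpret V: vspace "E_mat_alg \<iota> d" by (rule E_mat_alg_vspace)
  show "subring D (E_mat_alg \<iota> d)"
    by (rule subringI) (auto simp: E_mat_alg_simps D_closed E_mat_alg_uminus D_carrier)
  show "Module.submodule D (class_ring :: 'f ring) (E_mat_alg \<iota> d)"
    using D_closed D_carrier
    by (intro Module.module.submoduleI[OF V.V_module]) (auto simp: E_mat_alg_simps E_mat_alg_uminus)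
qed

lemma D_alg_eq: "D_alg \<iota> \<sigma> d A = (E_mat_alg \<iota> d)\<lparr>carrier := D\<rparr>" by (simp add: D_alg_def)

lemma D_F_algebra: "F_algebra (D_alg \<iota> \<sigma> d A)"
  unfolding D_alg_eq by (rule F_algebraI_subalgebra[OF E_mat_alg_F_algebra D_subalgebra])

lemma D_alg_simps:
  "carrier (D_alg \<iota> \<sigma> d A) = D" "M \<otimes>\<^bsub>D_alg \<iota> \<sigma> d A\<^esub> N = M * N"
  "\<one>\<^bsub>D_alg \<iota> \<sigma> d A\<^esub> = 1\<^sub>m d" "\<zero>\<^bsub>D_alg \<iota> \<sigma> d A\<^esub> = 0\<^sub>m d d" "M \<oplus>\<^bsub>D_alg \<iota> \<sigma> d A\<^esub> N = M + N"
  "c \<odot>\<^bsub>D_alg \<iota> \<sigma> d A\<^esub> M = \<iota> c \<cdot>\<^sub>m M"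
  by (simp_all add: D_alg_def E_mat_alg_simps)

lemma D_vspace: "vspace (D_alg \<iota> \<sigma> d A)"
  using D_F_algebra by (simp add: F_algebra_def vspace_def)

lemma finsum_D_alg:
  assumes "f \<in> I \<rightarrow> D" shows "finsum (D_alg \<iota> \<sigma> d A) f I = mat d d (\<lambda>p. \<Sum>i\<in>I. f i $$ p)"
proof -
  interpret vspace "E_mat_alg \<iota> d" by (rule E_mat_alg_vspace)
  show ?thesis
    unfolding D_alg_eq using D_subalgebra assms D_carrier
    by (subst finsum_subspace) (auto simp: F_subalgebra_def intro!: finsum_E_mat_alg)
qed

text \<open>The automorphism of part 2 of the theorem, before restriction to its carrier;
  \<open>D\<close> is its set of fixed points.\<close>

definition \<tau> :: "'e mat \<Rightarrow> 'e mat" where "\<tau> M = Ai * map_mat \<sigma> M * A"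

lemma \<tau>_closed: "M \<in> carrier_mat d d \<Longrightarrow> \<tau> M \<in> carrier_mat d d"
  using Ai A by (simp add: \<tau>_def)

lemma D_iff_\<tau>: "M \<in> D \<longleftrightarrow> M \<in> carrier_mat d d \<and> \<tau> M = M"
proof -
  have "\<tau> M = M \<longleftrightarrow> map_mat \<sigma> M * A = A * M" if M: "M \<in> carrier_mat d d"
  proof
    assume "\<tau> M = M"
    then have "A * M = A * (Ai * (map_mat \<sigma> M * A))"
      using M Ai A by (simp add: \<tau>_def assoc_mult_mat[of _ d d _ d _ d])
    then show "map_mat \<sigma> M * A = A * M" using mult_cancel(4)[of "map_mat \<sigma> M * A"] M A by simp
  next
    assume "map_mat \<sigma> M * A = A * M"
    then have "\<tau> M = Ai * (A * M)" using M Ai A by (simp add: \<tau>_def assoc_mult_mat[of _ d d _ d _ d])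
    then show "\<tau> M = M" using mult_cancel(3)[OF M] by simp
  qed
  then show ?thesis by (auto simp: D_iff)
qed

text \<open>At \<open>k = n\<close> the norm is the scalar \<open>a\<close> and
  \<open>\<sigma>^n\<close> is the identity, so this relation gives
  \<open>\<tau>^n = 1\<close>.\<close>

lemma twisted_norm_\<tau>:
  assumes M: "M \<in> carrier_mat d d"
  shows "twisted_norm \<sigma> k A * (\<tau> ^^ k) M = map_mat (\<sigma> ^^ k) M * twisted_norm \<sigma> k A"
proof (induct k)
  case 0
  have "map_mat (\<lambda>x. x) M = M" by (rule eq_matI) auto
  then show ?case using A M by simp
next
  case (Suc k)
  have c: "(\<tau> ^^ k) M \<in> carrier_mat d d" for k using M by (induct k) (auto simp: \<tau>_closed)
  note N = twisted_norm_closed[OF A, of k]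
  let ?M = "(\<tau> ^^ k) M" and ?N = "map_mat \<sigma> (twisted_norm \<sigma> k A)"
  have "twisted_norm \<sigma> (Suc k) A * (\<tau> ^^ Suc k) M = ?N * A * (Ai * (map_mat \<sigma> ?M * A))"
    unfolding twisted_norm_Suc[OF A] using c[of k] Ai A by (simp add: \<tau>_def assoc_mult_mat[of _ d d _ d _ d])
  also have "\<dots> = ?N * (A * (Ai * (map_mat \<sigma> ?M * A)))"
    using c[of k] N Ai A by (simp add: assoc_mult_mat[of _ d d _ d _ d])
  also have "\<dots> = ?N * map_mat \<sigma> ?M * A"
    using mult_cancel(4)[of "map_mat \<sigma> ?M * A"] c[of k] N A by (simp add: assoc_mult_mat[of _ d d _ d _ d])
  also have "?N * map_mat \<sigma> ?M = map_mat \<sigma> (map_mat (\<sigma> ^^ k) M * twisted_norm \<sigma> k A)"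
    using Suc map_mat_mult'[OF N c[of k]] by simp
  also have "\<dots> = map_mat (\<sigma> ^^ Suc k) M * ?N"
    using M N by (subst map_mat_mult'[of _ d]) (auto simp: map_mat_simps(4) simp del: funpow.simps)
  also have "\<dots> * A = map_mat (\<sigma> ^^ Suc k) M * twisted_norm \<sigma> (Suc k) A"
    unfolding twisted_norm_Suc[OF A] using M N A by (intro assoc_mult_mat) auto
  finally show ?case .
qed

text \<open>\<open>M_d(E)\<close> is put in the situation of \<open>descent\<close>, with operator
  \<tau> and \<open>t = 1\<close>; the fixed vectors are then the elements of
  \<open>D\<close>.\<close>

lemma \<tau>_semilinear: "semilinear n q s a \<iota> h \<sigma> (module_mat TYPE('e) d d) \<tau> 1"
proof -
  interpret V: vspace "module_mat TYPE('e) d d" by (rule module_mat_vspace)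
  show ?thesis
  proof unfold_locales
    fix M assume "M \<in> carrier (module_mat TYPE('e) d d)"
    then have M: "M \<in> carrier_mat d d" by (simp add: module_mat_simps)
    then show "\<tau> M \<in> carrier (module_mat TYPE('e) d d)" by (simp add: module_mat_simps \<tau>_closed)
    show "\<tau> (e \<odot>\<^bsub>module_mat TYPE('e) d d\<^esub> M) = \<sigma> e \<odot>\<^bsub>module_mat TYPE('e) d d\<^esub> \<tau> M" for e
      using M Ai A by (simp add: module_mat_simps \<tau>_def map_mat_simps mult_smult_assoc_mat[of _ d d _ d] mult_smult_distrib[of _ d d _ d])
    have c: "(\<tau> ^^ k) M \<in> carrier_mat d d" for k using M by (induct k) (auto simp: \<tau>_closed)
    have "\<iota> a \<cdot>\<^sub>m (\<tau> ^^ n) M = \<iota> a \<cdot>\<^sub>m M"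
      using twisted_norm_\<tau>[OF M, of n] M c[of n]
      by (simp add: norm_A map_mat_simps mult_smult_assoc_mat[of _ d d _ d] mult_smult_distrib[of _ d d _ d])
    then have "inverse (\<iota> a) \<cdot>\<^sub>m (\<iota> a \<cdot>\<^sub>m (\<tau> ^^ n) M) = inverse (\<iota> a) \<cdot>\<^sub>m (\<iota> a \<cdot>\<^sub>m M)" by simp
    moreover have "inverse (\<iota> a) \<cdot>\<^sub>m (\<iota> a \<cdot>\<^sub>m N) = N" for N :: "'e mat"
      using a_neq_0 \<iota>_eq_0 by (intro eq_matI) auto
    ultimately show "(\<tau> ^^ n) M = 1 \<odot>\<^bsub>module_mat TYPE('e) d d\<^esub> M"
      using M V.smult_one[of M] by (simp add: module_mat_simps)
    fix N assume "N \<in> carrier (module_mat TYPE('e) d d)"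
    with M Ai A show "\<tau> (M \<oplus>\<^bsub>module_mat TYPE('e) d d\<^esub> N) = \<tau> M \<oplus>\<^bsub>module_mat TYPE('e) d d\<^esub> \<tau> N"
      by (simp add: module_mat_simps \<tau>_def map_mat_simps(2)[of _ d] add_mult_distrib_mat[of _ d d] mult_add_distrib_mat[of _ d d])
  qed simp
qed

lemma mat_decomp:
  assumes "M \<in> carrier_mat d d"
  shows "\<exists>w. (\<forall>j. w j \<in> D) \<and> M = finsum (module_mat TYPE('e) d d) (\<lambda>j. h ^ j \<cdot>\<^sub>m w j) {..<n}"
  using semilinear.descent[OF \<tau>_semilinear refl, of M] assms
  by (auto simp: module_mat_simps D_iff_\<tau>)

lemma mat_decomp_unique:
  assumes "\<And>j. j < n \<Longrightarrow> w j \<in> D"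
    and "finsum (module_mat TYPE('e) d d) (\<lambda>j. h ^ j \<cdot>\<^sub>m w j) {..<n} = 0\<^sub>m d d" "i < n"
  shows "w i = 0\<^sub>m d d"
  using semilinear.descent_indep[OF \<tau>_semilinear, of w i] assms
  by (simp add: module_mat_simps D_iff_\<tau>)

text \<open>\<open>M_d(E)\<close> is the sum of the \<open>h^j D\<close>, so it is generated by
  \<open>D\<close> under addition and multiplication by \<open>h\<close>. Properties stable under
  these two operations need checking on \<open>D\<close> only.\<close>

lemma mat_induct:
  assumes M: "M \<in> carrier_mat d d"
    and D: "\<And>M. M \<in> D \<Longrightarrow> P M"
    and add: "\<And>M N. M \<in> carrier_mat d d \<Longrightarrow> N \<in> carrier_mat d d \<Longrightarrow> P M \<Longrightarrow> P N \<Longrightarrow> P (M + N)"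
    and scale: "\<And>M. M \<in> carrier_mat d d \<Longrightarrow> P M \<Longrightarrow> P (h \<cdot>\<^sub>m M)"
  shows "P M"
proof -
  interpret V: vspace "module_mat TYPE('e) d d" by (rule module_mat_vspace)
  obtain w where w: "\<And>j. w j \<in> D" "M = finsum (module_mat TYPE('e) d d) (\<lambda>j. h ^ j \<cdot>\<^sub>m w j) {..<n}"
    using mat_decomp[OF M] by auto
  have hw: "P (h ^ k \<cdot>\<^sub>m w j)" for j k
  proof (induct k)
    case 0
    have "1 \<cdot>\<^sub>m w j = w j" by (rule eq_matI) auto
    with D[OF w(1)] show ?case by simp
  next
    case (Suc k)
    have "h ^ Suc k \<cdot>\<^sub>m w j = h \<cdot>\<^sub>m (h ^ k \<cdot>\<^sub>m w j)" by (rule eq_matI) auto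
    then show ?case using scale[of "h ^ k \<cdot>\<^sub>m w j"] Suc D_carrier[OF w(1)] by simp
  qed
  have "P (finsum (module_mat TYPE('e) d d) (\<lambda>j. h ^ j \<cdot>\<^sub>m w j) {..<k})" for k
  proof (induct k)
    case 0
    then show ?case using D[OF D_closed(3)] by (simp add: module_mat_simps)
  next
    case (Suc k)
    have c: "(\<lambda>j. h ^ j \<cdot>\<^sub>m w j) \<in> I \<rightarrow> carrier (module_mat TYPE('e) d d)" for I
      using D_carrier[OF w(1)] by (auto simp: module_mat_simps)
    have "finsum (module_mat TYPE('e) d d) (\<lambda>j. h ^ j \<cdot>\<^sub>m w j) {..<Suc k}
        = h ^ k \<cdot>\<^sub>m w k + finsum (module_mat TYPE('e) d d) (\<lambda>j. h ^ j \<cdot>\<^sub>m w j) {..<k}"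
      unfolding lessThan_Suc using c[of "{k}"] c[of "{..<k}"] by (subst V.finsum_insert) (auto simp: module_mat_simps)
    then show ?case
      using add[OF _ _ hw Suc] D_carrier[OF w(1)] V.finsum_closed[OF c[of "{..<k}"]]
      by (simp add: module_mat_simps)
  qed
  then show ?thesis using w(2) by simp
qed

end

text \<open>Commute \<open>z\<close> with the matrix unit at \<open>(i, 0)\<close> and compare
  entries \<open>(k, 0)\<close>: off the diagonal \<open>z\<close> vanishes, and on it all entries
  equal the corner entry.\<close>

lemma commutes_with_units_scalar:
  fixes z :: "'e::field mat"
  assumes z: "z \<in> carrier_mat d d" and d: "0 < d"
    and comm: "\<And>M. M \<in> carrier_mat d d \<Longrightarrow> z * M = M * z"
  shows "\<exists>e. z = e \<cdot>\<^sub>m 1\<^sub>m d"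
proof -
  define e where "e = z $$ (0, 0)"
  have "z $$ (k, i) = (if k = i then e else 0)" if ki: "k < d" "i < d" for k i
  proof -
    have "(z * mat_unit d i 0) $$ (k, 0) = (mat_unit d i 0 * z) $$ (k, 0)"
      using comm[OF mat_unit_carrier] by simp
    moreover have "(z * mat_unit d i 0) $$ (k, 0) = z $$ (k, i)"
      using z ki d by (subst mat_mult_index[of _ d])
        (auto simp: mat_unit_def if_distrib if_distribR cong: if_cong)
    moreover have "(mat_unit d i 0 * z) $$ (k, 0) = (if k = i then e else 0)"
      unfolding e_def using z ki d by (subst mat_mult_index[of _ d])
        (auto simp: mat_unit_def if_distrib if_distribR cong: if_cong)
    ultimately show ?thesis by simp
  qed
  then have "z = e \<cdot>\<^sub>m 1\<^sub>m d" using z by (intro eq_matI) auto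
  then show ?thesis ..
qed

context norm_matrix
begin

text \<open>An element central in \<open>D\<close> commutes with all matrices by
  \<open>mat_induct\<close>, so it is a scalar \<open>e\<close>. Membership in \<open>D\<close> then
  says \<open>\<sigma> e = e\<close>, and the fixed field is \<open>F\<close>.\<close>

lemma D_central: "central (D_alg \<iota> \<sigma> d A)"
  unfolding central_def D_alg_simps
proof (intro equalityI subsetI)
  fix z assume "z \<in> {z \<in> D. \<forall>y\<in>D. z * y = y * z}"
  then have z: "z \<in> D" "\<And>y. y \<in> D \<Longrightarrow> z * y = y * z" by auto
  note zc = D_carrier[OF z(1)]
  have comm: "z * M = M * z" if "M \<in> carrier_mat d d" for M
    using that
  proof (rule mat_induct)
    fix M assume "M \<in> D" then show "z * M = M * z" by (rule z(2))
  qed (use zc in \<open>auto simp: mult_add_distrib_mat[of _ d d] add_mult_distrib_mat[of _ d d]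
      mult_smult_assoc_mat[of _ d d _ d] mult_smult_distrib[of _ d d _ d]\<close>)
  obtain e where e: "z = e \<cdot>\<^sub>m 1\<^sub>m d" using commutes_with_units_scalar[OF zc d_pos comm] by auto
  have "\<tau> z = \<sigma> e \<cdot>\<^sub>m 1\<^sub>m d"
    using Ai A by (simp add: \<tau>_def e map_mat_simps mult_smult_assoc_mat[of _ d d _ d] mult_smult_distrib[of _ d d _ d])
  then have "(\<sigma> e \<cdot>\<^sub>m 1\<^sub>m d) $$ (0, 0) = (e \<cdot>\<^sub>m 1\<^sub>m d) $$ (0, 0)"
    using z(1) e by (simp add: D_iff_\<tau>)
  then have "\<sigma> e = e" using d_pos by simp
  then show "z \<in> range (\<lambda>c. \<iota> c \<cdot>\<^sub>m 1\<^sub>m d)" using fixed_field e by auto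
next
  fix z assume "z \<in> range (\<lambda>c. \<iota> c \<cdot>\<^sub>m 1\<^sub>m d)"
  then show "z \<in> {z \<in> D. \<forall>y\<in>D. z * y = y * z}"
    using D_closed(2,6) D_carrier left_mult_one_mat[OF D_carrier] right_mult_one_mat[OF D_carrier]
    by (auto simp: mult_smult_assoc_mat[of _ d d _ d] mult_smult_distrib[of _ d d _ d])
qed

text \<open>An additive map that commutes with \<open>h\<close> and \<open>D\<close> commutes with
  right multiplication by every matrix. This supplies the hypothesis \<open>scalar\<close> of
  \<open>centralizer\<close>.\<close>

lemma commutant_scalar:
  assumes S: "\<And>v. v \<in> carrier_vec d \<Longrightarrow> S v \<in> carrier_vec d"
    "\<And>v w. v \<in> carrier_vec d \<Longrightarrow> w \<in> carrier_vec d \<Longrightarrow> S (v + w) = S v + S w"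
    "\<And>v. v \<in> carrier_vec d \<Longrightarrow> S (h \<cdot>\<^sub>v v) = h \<cdot>\<^sub>v S v"
    "\<And>v M. v \<in> carrier_vec d \<Longrightarrow> M \<in> D \<Longrightarrow> S (rvm v M) = rvm (S v) M"
  shows "\<exists>e. \<forall>v\<in>carrier_vec d. S v = e \<cdot>\<^sub>v v"
proof -
  have comm: "\<forall>v\<in>carrier_vec d. S (rvm v M) = rvm (S v) M" if "M \<in> carrier_mat d d" for M
    using that
  proof (rule mat_induct)
    fix M N :: "'e mat" assume MN: "M \<in> carrier_mat d d" "N \<in> carrier_mat d d"
    assume *: "\<forall>v\<in>carrier_vec d. S (rvm v M) = rvm (S v) M" "\<forall>v\<in>carrier_vec d. S (rvm v N) = rvm (S v) N"
    show "\<forall>v\<in>carrier_vec d. S (rvm v (M + N)) = rvm (S v) (M + N)"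
    proof
      fix v :: "'e vec" assume v: "v \<in> carrier_vec d"
      have "S (rvm v (M + N)) = S (rvm v M) + S (rvm v N)"
        by (simp only: rvm_simps(2)[OF MN v v] S(2)[OF rvm_closed rvm_closed, OF MN])
      then show "S (rvm v (M + N)) = rvm (S v) (M + N)"
        using * v by (simp add: rvm_simps(2)[OF MN S(1) S(1), OF v v])
    qed
  next
    fix M :: "'e mat" assume M: "M \<in> carrier_mat d d"
    assume *: "\<forall>v\<in>carrier_vec d. S (rvm v M) = rvm (S v) M"
    show "\<forall>v\<in>carrier_vec d. S (rvm v (h \<cdot>\<^sub>m M)) = rvm (S v) (h \<cdot>\<^sub>m M)"
    proof
      fix v :: "'e vec" assume v: "v \<in> carrier_vec d"
      have "S (rvm v (h \<cdot>\<^sub>m M)) = h \<cdot>\<^sub>v S (rvm v M)"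
        by (simp only: rvm_simps(4)[OF M M v v] S(3)[OF rvm_closed[OF M]])
      then show "S (rvm v (h \<cdot>\<^sub>m M)) = rvm (S v) (h \<cdot>\<^sub>m M)"
        using * v by (simp add: rvm_simps(4)[OF M M S(1) S(1), OF v v])
    qed
  qed (use S(4) in auto)
  have "S w = S (unit_vec d 0) $ 0 \<cdot>\<^sub>v w" if w: "w \<in> carrier_vec d" for w
  proof -
    \<comment> \<open>The matrix that sends the first unit vector to \<open>w\<close>. Commutation
      with it makes \<open>S w\<close> depend only on the value of \<open>S\<close> at the first
      unit vector.\<close>
    define M where "M = mat d d (\<lambda>(i, j). if i = 0 then w $ j else 0)"
    have M: "M \<in> carrier_mat d d" by (simp add: M_def)
    have "row M 0 = w" using w d_pos by (intro eq_vecI) (auto simp: M_def)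
    then have "S w = rvm (S (unit_vec d 0)) M"
      using comm[OF M] rvm_unit[OF M d_pos] unit_vec_carrier by metis
    also have "\<dots> = S (unit_vec d 0) $ 0 \<cdot>\<^sub>v w"
    proof (rule eq_vecI)
      fix j assume "j < dim_vec (S (unit_vec d 0) $ 0 \<cdot>\<^sub>v w)"
      then have j: "j < d" using w by simp
      have "rvm (S (unit_vec d 0)) M $ j = (\<Sum>i<d. if i = 0 then S (unit_vec d 0) $ 0 * w $ j else 0)"
        unfolding rvm_index[OF M S(1)[OF unit_vec_carrier] j] using j by (intro sum.cong) (auto simp: M_def)
      then show "rvm (S (unit_vec d 0)) M $ j = (S (unit_vec d 0) $ 0 \<cdot>\<^sub>v w) $ j"
        using j w d_pos by simp
    qed (use w carrier_vecD[OF rvm_closed[OF M]] in auto)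
    finally show ?thesis .
  qed
  then show ?thesis by blast
qed

end


section \<open>Linear maps and bases\<close>

lemma module_homD:
  assumes "f \<in> LinearCombinations.module_hom (class_ring :: 'k::field ring) V W"
  shows "v \<in> carrier V \<Longrightarrow> f v \<in> carrier W"
    "v \<in> carrier V \<Longrightarrow> w \<in> carrier V \<Longrightarrow> f (v \<oplus>\<^bsub>V\<^esub> w) = f v \<oplus>\<^bsub>W\<^esub> f w"
    "v \<in> carrier V \<Longrightarrow> f (c \<odot>\<^bsub>V\<^esub> v) = c \<odot>\<^bsub>W\<^esub> f v"
  using assms by (auto simp: LinearCombinations.module_hom_def class_ring_simps)

lemma module_hom_zero:
  assumes "vspace V" "vspace W" "f \<in> LinearCombinations.module_hom (class_ring :: 'k::field ring) V W"
  shows "f \<zero>\<^bsub>V\<^esub> = \<zero>\<^bsub>W\<^esub>"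
proof -
  interpret V: vspace V by fact
  interpret W: vspace W by fact
  have "f (0 \<odot>\<^bsub>V\<^esub> \<zero>\<^bsub>V\<^esub>) = 0 \<odot>\<^bsub>W\<^esub> f \<zero>\<^bsub>V\<^esub>" by (rule module_homD[OF assms(3)]) simp
  then show ?thesis using module_homD(1)[OF assms(3) V.zero_closed] by simp
qed

lemma module_hom_finsum:
  assumes V: "vspace V" and W: "vspace W"
    and f: "f \<in> LinearCombinations.module_hom (class_ring :: 'k::field ring) V W"
    and g: "g \<in> I \<rightarrow> carrier V"
  shows "f (finsum V g I) = finsum W (\<lambda>i. f (g i)) I"
proof -
  interpret V: vspace V by fact
  interpret W: vspace W by fact
  show ?thesis using g
  proof (induct I rule: infinite_finite_induct)
    case (insert x F)
    then have g: "g \<in> F \<rightarrow> carrier V" "g x \<in> carrier V" by auto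
    have fg: "(\<lambda>i. f (g i)) \<in> F \<rightarrow> carrier W" "f (g x) \<in> carrier W"
      using g module_homD(1)[OF f] by auto
    have "f (finsum V g (insert x F)) = f (g x \<oplus>\<^bsub>V\<^esub> finsum V g F)"
      using insert g by (simp add: V.finsum_insert)
    also have "\<dots> = f (g x) \<oplus>\<^bsub>W\<^esub> f (finsum V g F)"
      by (rule module_homD(2)[OF f g(2) V.finsum_closed[OF g(1)]])
    also have "\<dots> = finsum W (\<lambda>i. f (g i)) (insert x F)"
      using insert g fg by (simp add: W.finsum_insert)
    finally show ?case .
  qed (auto simp: V.finsum_infinite W.finsum_infinite module_hom_zero[OF V W f])
qed

lemma module_hom_lincomb:
  assumes V: "vspace V" and W: "vspace W"
    and f: "f \<in> LinearCombinations.module_hom (class_ring :: 'k::field ring) V W"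
    and b: "\<And>i. i \<in> I \<Longrightarrow> b i \<in> carrier V"
  shows "f (\<Oplus>\<^bsub>V\<^esub>i\<in>I. c i \<odot>\<^bsub>V\<^esub> b i) = (\<Oplus>\<^bsub>W\<^esub>i\<in>I. c i \<odot>\<^bsub>W\<^esub> f (b i))"
proof -
  interpret V: vspace V by fact
  interpret W: vspace W by fact
  have "f (\<Oplus>\<^bsub>V\<^esub>i\<in>I. c i \<odot>\<^bsub>V\<^esub> b i) = (\<Oplus>\<^bsub>W\<^esub>i\<in>I. f (c i \<odot>\<^bsub>V\<^esub> b i))"
    using b by (intro module_hom_finsum[OF V W f]) auto
  also have "\<dots> = (\<Oplus>\<^bsub>W\<^esub>i\<in>I. c i \<odot>\<^bsub>W\<^esub> f (b i))"
    using b module_homD[OF f] by (intro W.finsum_cong') auto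
  finally show ?thesis .
qed

lemma family_basis_image:
  assumes V: "vspace V" and W: "vspace W"
    and f: "f \<in> LinearCombinations.module_hom (class_ring :: 'k::field ring) V W"
    and bij: "bij_betw f (carrier V) (carrier W)" and b: "family_basis V I b"
  shows "family_basis W I (\<lambda>i. f (b i))"
proof -
  interpret V: vspace V by fact
  interpret W: vspace W by fact
  note D = family_basisD[OF b]
  have sum: "f (\<Oplus>\<^bsub>V\<^esub>i\<in>I. c i \<odot>\<^bsub>V\<^esub> b i) = (\<Oplus>\<^bsub>W\<^esub>i\<in>I. c i \<odot>\<^bsub>W\<^esub> f (b i))" for c
    by (rule module_hom_lincomb[OF V W f]) (rule D(2))
  show ?thesis unfolding family_basis_def
  proof (intro conjI ballI allI impI)
    fix w assume "w \<in> carrier W"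
    then obtain v where v: "v \<in> carrier V" "w = f v" using bij by (auto simp: bij_betw_def)
    from D(3)[OF v(1)] obtain c where "v = (\<Oplus>\<^bsub>V\<^esub>i\<in>I. c i \<odot>\<^bsub>V\<^esub> b i)" by blast
    then have "w = (\<Oplus>\<^bsub>W\<^esub>i\<in>I. c i \<odot>\<^bsub>W\<^esub> f (b i))" using v(2) sum[of c] by simp
    then show "\<exists>c. w = (\<Oplus>\<^bsub>W\<^esub>i\<in>I. c i \<odot>\<^bsub>W\<^esub> f (b i))" by (intro exI[of _ c])
  next
    fix c i assume c: "(\<Oplus>\<^bsub>W\<^esub>i\<in>I. c i \<odot>\<^bsub>W\<^esub> f (b i)) = \<zero>\<^bsub>W\<^esub>" and i: "i \<in> I"
    have "(\<Oplus>\<^bsub>V\<^esub>i\<in>I. c i \<odot>\<^bsub>V\<^esub> b i) \<in> carrier V" using D(2) by (intro V.finsum_closed) auto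
    moreover have "f (\<Oplus>\<^bsub>V\<^esub>i\<in>I. c i \<odot>\<^bsub>V\<^esub> b i) = f \<zero>\<^bsub>V\<^esub>"
      unfolding sum c module_hom_zero[OF V W f] ..
    ultimately have "(\<Oplus>\<^bsub>V\<^esub>i\<in>I. c i \<odot>\<^bsub>V\<^esub> b i) = \<zero>\<^bsub>V\<^esub>"
      using bij by (auto simp: bij_betw_def inj_on_def)
    from D(4)[OF this i] show "c i = 0" .
  qed (use D(1,2) module_homD(1)[OF f] in auto)
qed

lemma linear_extension:
  fixes V :: "('k::field, 'v) module" and W :: "('k, 'w) module"
  assumes V: "vspace V" and W: "vspace W" and b: "family_basis V I b"
    and y: "\<And>i. i \<in> I \<Longrightarrow> y i \<in> carrier W"
  shows "\<exists>f \<in> LinearCombinations.module_hom class_ring V W.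
    \<forall>c. f (\<Oplus>\<^bsub>V\<^esub>i\<in>I. c i \<odot>\<^bsub>V\<^esub> b i) = (\<Oplus>\<^bsub>W\<^esub>i\<in>I. c i \<odot>\<^bsub>W\<^esub> y i)"
proof -
  interpret V: vspace V by fact
  interpret W: vspace W by fact
  note D = family_basisD[OF b]
  \<comment> \<open>Coefficients are chosen for each vector; on \<open>I\<close> they are unique, so
    the choice does not affect the value.\<close>
  define f where "f v = (\<Oplus>\<^bsub>W\<^esub>i\<in>I. (SOME c. v = (\<Oplus>\<^bsub>V\<^esub>i\<in>I. c i \<odot>\<^bsub>V\<^esub> b i)) i \<odot>\<^bsub>W\<^esub> y i)" for v
  have f: "f (\<Oplus>\<^bsub>V\<^esub>i\<in>I. c i \<odot>\<^bsub>V\<^esub> b i) = (\<Oplus>\<^bsub>W\<^esub>i\<in>I. c i \<odot>\<^bsub>W\<^esub> y i)" for c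
  proof -
    let ?c' = "SOME c'. (\<Oplus>\<^bsub>V\<^esub>i\<in>I. c i \<odot>\<^bsub>V\<^esub> b i) = (\<Oplus>\<^bsub>V\<^esub>i\<in>I. c' i \<odot>\<^bsub>V\<^esub> b i)"
    have "(\<Oplus>\<^bsub>V\<^esub>i\<in>I. c i \<odot>\<^bsub>V\<^esub> b i) = (\<Oplus>\<^bsub>V\<^esub>i\<in>I. ?c' i \<odot>\<^bsub>V\<^esub> b i)" by (rule someI[of _ c]) (rule refl)
    from V.family_basis_eq[OF b this] have eq: "?c' i = c i" if "i \<in> I" for i using that by simp
    show ?thesis unfolding f_def
      by (rule W.finsum_cong'[OF refl]) (use y eq in auto)
  qed
  have "f \<in> LinearCombinations.module_hom class_ring V W"
    unfolding LinearCombinations.module_hom_def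
  proof (intro CollectI conjI allI impI)
    show "f \<in> carrier V \<rightarrow> carrier W" unfolding f_def using y by (auto intro!: W.finsum_closed)
    fix v w assume "v \<in> carrier V \<and> w \<in> carrier V"
    then obtain c c' where v: "v = (\<Oplus>\<^bsub>V\<^esub>i\<in>I. c i \<odot>\<^bsub>V\<^esub> b i)" and w: "w = (\<Oplus>\<^bsub>V\<^esub>i\<in>I. c' i \<odot>\<^bsub>V\<^esub> b i)"
      using D(3) by metis
    have "v \<oplus>\<^bsub>V\<^esub> w = (\<Oplus>\<^bsub>V\<^esub>i\<in>I. c i \<odot>\<^bsub>V\<^esub> b i \<oplus>\<^bsub>V\<^esub> c' i \<odot>\<^bsub>V\<^esub> b i)"
      unfolding v w using D(2) by (intro V.finsum_addf[symmetric]) auto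
    also have "\<dots> = (\<Oplus>\<^bsub>V\<^esub>i\<in>I. (c i + c' i) \<odot>\<^bsub>V\<^esub> b i)"
      using D(2) by (intro V.finsum_cong') (auto simp: V.smult_l_distr)
    finally have "f (v \<oplus>\<^bsub>V\<^esub> w) = (\<Oplus>\<^bsub>W\<^esub>i\<in>I. (c i + c' i) \<odot>\<^bsub>W\<^esub> y i)" by (simp add: f)
    also have "\<dots> = (\<Oplus>\<^bsub>W\<^esub>i\<in>I. c i \<odot>\<^bsub>W\<^esub> y i \<oplus>\<^bsub>W\<^esub> c' i \<odot>\<^bsub>W\<^esub> y i)"
      using y by (intro W.finsum_cong') (auto simp: W.smult_l_distr)
    also have "\<dots> = f v \<oplus>\<^bsub>W\<^esub> f w"
      unfolding v w f using y by (intro W.finsum_addf) auto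
    finally show "f (v \<oplus>\<^bsub>V\<^esub> w) = f v \<oplus>\<^bsub>W\<^esub> f w" .
  next
    fix e v assume "e \<in> carrier (class_ring :: 'k ring) \<and> v \<in> carrier V"
    then obtain c where v: "v = (\<Oplus>\<^bsub>V\<^esub>i\<in>I. c i \<odot>\<^bsub>V\<^esub> b i)" using D(3) by metis
    have "e \<odot>\<^bsub>V\<^esub> v = (\<Oplus>\<^bsub>V\<^esub>i\<in>I. e \<odot>\<^bsub>V\<^esub> (c i \<odot>\<^bsub>V\<^esub> b i))"
      unfolding v using D(2) by (intro V.finsum_scale) auto
    also have "\<dots> = (\<Oplus>\<^bsub>V\<^esub>i\<in>I. (e * c i) \<odot>\<^bsub>V\<^esub> b i)"
      using D(2) by (intro V.finsum_cong') (auto simp: V.smult_assoc1)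
    finally have "f (e \<odot>\<^bsub>V\<^esub> v) = (\<Oplus>\<^bsub>W\<^esub>i\<in>I. (e * c i) \<odot>\<^bsub>W\<^esub> y i)" by (simp add: f)
    also have "\<dots> = (\<Oplus>\<^bsub>W\<^esub>i\<in>I. e \<odot>\<^bsub>W\<^esub> (c i \<odot>\<^bsub>W\<^esub> y i))"
      using y by (intro W.finsum_cong') (auto simp: W.smult_assoc1)
    also have "\<dots> = e \<odot>\<^bsub>W\<^esub> f v"
      unfolding v f using y by (intro W.finsum_scale[symmetric]) auto
    finally show "f (e \<odot>\<^bsub>V\<^esub> v) = e \<odot>\<^bsub>W\<^esub> f v" .
  qed
  with f show ?thesis by (intro bexI[of _ f] allI)
qed

lemma finsum_restrict_scalars: "finsum (restrict_scalars f V) = finsum V"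
  by (simp add: fun_eq_iff finsum_def finprod_def restrict_scalars_def)

context kummer
begin

lemma restrict_vspace:
  fixes V :: "('e, 'v) module"
  assumes "vspace V" shows "vspace (restrict_scalars \<iota> V)"
proof (rule vspace.intro)
  interpret vspace V by fact
  have "abelian_group (restrict_scalars \<iota> V)"
  proof (rule abelian_groupI)
    fix x assume "x \<in> carrier (restrict_scalars \<iota> V)"
    then show "\<exists>y\<in>carrier (restrict_scalars \<iota> V). y \<oplus>\<^bsub>restrict_scalars \<iota> V\<^esub> x = \<zero>\<^bsub>restrict_scalars \<iota> V\<^esub>"
      by (intro bexI[of _ "\<ominus>\<^bsub>V\<^esub> x"]) (auto simp: restrict_scalars_def l_neg)
  qed (auto simp: restrict_scalars_def a_ac)
  then interpret F: abelian_group "restrict_scalars \<iota> V" .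
  show "Module.module (class_ring :: 'f ring) (restrict_scalars \<iota> V)"
    by unfold_locales
      (auto simp: restrict_scalars_def class_ring_simps \<iota>_add \<iota>_mult \<iota>_one
        smult_l_distr smult_r_distr smult_assoc1)
qed

text \<open>Tower law, with the powers of \<open>h\<close> as a basis of \<open>E\<close> over
  \<open>F\<close>.\<close>

lemma family_basis_restrict:
  fixes V :: "('e, 'v) module"
  assumes V: "vspace V" and b: "family_basis V I b"
  shows "family_basis (restrict_scalars \<iota> V) (I \<times> {..<n}) (\<lambda>p. h ^ snd p \<odot>\<^bsub>V\<^esub> b (fst p))"
proof -
  interpret vspace V by fact
  note D = family_basisD[OF b]
  have sum: "(\<Oplus>\<^bsub>V\<^esub>p\<in>I \<times> {..<n}. \<iota> (c p) \<odot>\<^bsub>V\<^esub> (h ^ snd p \<odot>\<^bsub>V\<^esub> b (fst p)))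
      = (\<Oplus>\<^bsub>V\<^esub>i\<in>I. (\<Sum>j<n. \<iota> (c (i, j)) * h ^ j) \<odot>\<^bsub>V\<^esub> b i)" for c
  proof -
    have "(\<Oplus>\<^bsub>V\<^esub>p\<in>I \<times> {..<n}. \<iota> (c p) \<odot>\<^bsub>V\<^esub> (h ^ snd p \<odot>\<^bsub>V\<^esub> b (fst p)))
        = (\<Oplus>\<^bsub>V\<^esub>i\<in>I. \<Oplus>\<^bsub>V\<^esub>j\<in>{..<n}. \<iota> (c (i, j)) \<odot>\<^bsub>V\<^esub> (h ^ j \<odot>\<^bsub>V\<^esub> b i))"
      using finsum_Times[OF D(1), of "{..<n}" "\<lambda>i j. \<iota> (c (i, j)) \<odot>\<^bsub>V\<^esub> (h ^ j \<odot>\<^bsub>V\<^esub> b i)"] D(2) by simp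
    also have "\<dots> = (\<Oplus>\<^bsub>V\<^esub>i\<in>I. (\<Sum>j<n. \<iota> (c (i, j)) * h ^ j) \<odot>\<^bsub>V\<^esub> b i)"
      using D(2) by (intro finsum_cong') (auto simp: finsum_scale_left smult_assoc1[symmetric])
    finally show ?thesis .
  qed
  show ?thesis unfolding family_basis_def finsum_restrict_scalars
  proof (intro conjI ballI allI impI)
    fix v assume "v \<in> carrier (restrict_scalars \<iota> V)"
    then have "v \<in> carrier V" by (simp add: restrict_scalars_def)
    from D(3)[OF this] obtain e where e: "v = (\<Oplus>\<^bsub>V\<^esub>i\<in>I. e i \<odot>\<^bsub>V\<^esub> b i)" by blast
    have "\<forall>i. \<exists>c. e i = (\<Sum>j<n. \<iota> (c j) * h ^ j)" using h_span by blast
    then obtain c where "\<And>i. e i = (\<Sum>j<n. \<iota> (c i j) * h ^ j)" by metis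
    then have "v = (\<Oplus>\<^bsub>V\<^esub>p\<in>I \<times> {..<n}. \<iota> (c (fst p) (snd p)) \<odot>\<^bsub>V\<^esub> (h ^ snd p \<odot>\<^bsub>V\<^esub> b (fst p)))"
      using sum[of "\<lambda>p. c (fst p) (snd p)"] e by simp
    then show "\<exists>c. v = (\<Oplus>\<^bsub>V\<^esub>p\<in>I \<times> {..<n}. c p \<odot>\<^bsub>restrict_scalars \<iota> V\<^esub> (h ^ snd p \<odot>\<^bsub>V\<^esub> b (fst p)))"
      by (intro exI[of _ "\<lambda>p. c (fst p) (snd p)"]) (simp add: restrict_scalars_def)
  next
    fix c p assume *: "(\<Oplus>\<^bsub>V\<^esub>p\<in>I \<times> {..<n}. c p \<odot>\<^bsub>restrict_scalars \<iota> V\<^esub> (h ^ snd p \<odot>\<^bsub>V\<^esub> b (fst p))) = \<zero>\<^bsub>restrict_scalars \<iota> V\<^esub>"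
      and p: "p \<in> I \<times> {..<n}"
    have "(\<Oplus>\<^bsub>V\<^esub>i\<in>I. (\<Sum>j<n. \<iota> (c (i, j)) * h ^ j) \<odot>\<^bsub>V\<^esub> b i) = \<zero>\<^bsub>V\<^esub>"
      using * unfolding sum[symmetric] by (simp add: restrict_scalars_def)
    from D(4)[OF this, of "fst p"] h_indep[of "\<lambda>j. c (fst p, j)" "snd p"] p show "c p = 0" by auto
  qed (use D in \<open>auto simp: restrict_scalars_def\<close>)
qed

lemma E_mat_alg_restrict: "E_mat_alg \<iota> d = restrict_scalars \<iota> (module_mat TYPE('e) d d)"
  by (simp add: E_mat_alg_def restrict_scalars_def module_mat_def)

lemma E_mat_alg_fin_dim: "vectorspace.fin_dim (class_ring :: 'f ring) (E_mat_alg \<iota> d)"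
  using vspace.family_basis_dim(1)[OF E_mat_alg_vspace
    family_basis_restrict[OF module_mat_vspace family_basis_module_mat, folded E_mat_alg_restrict]] .

end

context norm_matrix
begin

text \<open>Expand each coefficient in powers of \<open>h\<close> and collect: an
  \<open>E\<close>-combination becomes a sum of \<open>h^j w_j\<close> with \<open>w_j\<close> in
  \<open>D\<close>, and by descent such \<open>w_j\<close> exist and are unique.\<close>

lemma D_basis_E:
  assumes b: "family_basis (D_alg \<iota> \<sigma> d A) I \<beta>"
  shows "family_basis (module_mat TYPE('e) d d) I \<beta>"
proof -
  note D = family_basisD[OF b]
  have \<beta>: "\<beta> i \<in> D" "\<beta> i \<in> carrier_mat d d" if "i \<in> I" for i
    using D(2)[OF that] D_carrier by (auto simp: D_alg_simps)
  then have \<beta>d: "dim_row (\<beta> i) = d" "dim_col (\<beta> i) = d" if "i \<in> I" for i using that by (auto dest: carrier_matD)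
  have sumD: "(\<Oplus>\<^bsub>D_alg \<iota> \<sigma> d A\<^esub>i\<in>I. c i \<odot>\<^bsub>D_alg \<iota> \<sigma> d A\<^esub> \<beta> i) = mat d d (\<lambda>p. \<Sum>i\<in>I. \<iota> (c i) * \<beta> i $$ p)" for c
    using \<beta> by (subst finsum_D_alg) (auto simp: D_alg_simps D_closed \<beta>d intro!: eq_matI sum.cong)
  have sumE: "(\<Oplus>\<^bsub>module_mat TYPE('e) d d\<^esub>i\<in>I. e i \<odot>\<^bsub>module_mat TYPE('e) d d\<^esub> \<beta> i) = mat d d (\<lambda>p. \<Sum>i\<in>I. e i * \<beta> i $$ p)" for e
    using \<beta> by (subst finsum_module_mat) (auto simp: module_mat_simps \<beta>d intro!: eq_matI sum.cong)
  have sumh: "finsum (module_mat TYPE('e) d d) (\<lambda>j. h ^ j \<cdot>\<^sub>m w j) {..<n} = mat d d (\<lambda>p. \<Sum>j<n. h ^ j * w j $$ p)"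
    if "\<And>j. j < n \<Longrightarrow> w j \<in> D" for w
  proof -
    have w: "w j \<in> carrier_mat d d" if "j < n" for j using \<open>\<And>j. j < n \<Longrightarrow> w j \<in> D\<close> that D_carrier by blast
    moreover from this have "dim_row (w j) = d" "dim_col (w j) = d" if "j < n" for j using that by (auto dest: carrier_matD)
    ultimately show ?thesis
      by (subst finsum_module_mat) (auto intro!: eq_matI sum.cong)
  qed
  show ?thesis unfolding family_basis_def
  proof (intro conjI ballI allI impI)
    fix M assume "M \<in> carrier (module_mat TYPE('e) d d)"
    then have M: "M \<in> carrier_mat d d" by (simp add: module_mat_simps)
    obtain w where w: "\<And>j. w j \<in> D" "M = finsum (module_mat TYPE('e) d d) (\<lambda>j. h ^ j \<cdot>\<^sub>m w j) {..<n}"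
      using mat_decomp[OF M] by auto
    have "\<exists>c. w j = mat d d (\<lambda>p. \<Sum>i\<in>I. \<iota> (c i) * \<beta> i $$ p)" for j
      using D(3)[of "w j"] w(1) unfolding sumD by (simp add: D_alg_simps)
    then obtain c where c: "\<And>j. w j = mat d d (\<lambda>p. \<Sum>i\<in>I. \<iota> (c j i) * \<beta> i $$ p)" by metis
    have "M = mat d d (\<lambda>p. \<Sum>j<n. h ^ j * w j $$ p)" using w sumh by simp
    also have "\<dots> = mat d d (\<lambda>p. \<Sum>i\<in>I. (\<Sum>j<n. h ^ j * \<iota> (c j i)) * \<beta> i $$ p)"
    proof (rule eq_matI, goal_cases)
      case (1 r k)
      then have "(\<Sum>j<n. h ^ j * w j $$ (r, k)) = (\<Sum>j<n. \<Sum>i\<in>I. h ^ j * \<iota> (c j i) * \<beta> i $$ (r, k))"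
        by (simp add: c sum_distrib_left mult.assoc)
      also have "\<dots> = (\<Sum>i\<in>I. (\<Sum>j<n. h ^ j * \<iota> (c j i)) * \<beta> i $$ (r, k))"
        by (subst sum.swap) (simp add: sum_distrib_right)
      finally show ?case using 1 by simp
    qed auto
    also have "\<dots> = (\<Oplus>\<^bsub>module_mat TYPE('e) d d\<^esub>i\<in>I. (\<Sum>j<n. h ^ j * \<iota> (c j i)) \<odot>\<^bsub>module_mat TYPE('e) d d\<^esub> \<beta> i)"
      unfolding sumE ..
    finally show "\<exists>e. M = (\<Oplus>\<^bsub>module_mat TYPE('e) d d\<^esub>i\<in>I. e i \<odot>\<^bsub>module_mat TYPE('e) d d\<^esub> \<beta> i)"
      by (intro exI[of _ "\<lambda>i. \<Sum>j<n. h ^ j * \<iota> (c j i)"])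
  next
    fix e i assume "(\<Oplus>\<^bsub>module_mat TYPE('e) d d\<^esub>i\<in>I. e i \<odot>\<^bsub>module_mat TYPE('e) d d\<^esub> \<beta> i) = \<zero>\<^bsub>module_mat TYPE('e) d d\<^esub>" and i: "i \<in> I"
    then have e0: "mat d d (\<lambda>p. \<Sum>i\<in>I. e i * \<beta> i $$ p) = 0\<^sub>m d d" unfolding sumE by (simp add: module_mat_simps)
    have "\<forall>i. \<exists>c. e i = (\<Sum>j<n. \<iota> (c j) * h ^ j)" using h_span by blast
    then obtain c where c: "\<And>i. e i = (\<Sum>j<n. \<iota> (c i j) * h ^ j)" by metis
    define w where "w j = (\<Oplus>\<^bsub>D_alg \<iota> \<sigma> d A\<^esub>i\<in>I. c i j \<odot>\<^bsub>D_alg \<iota> \<sigma> d A\<^esub> \<beta> i)" for j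
    interpret DV: vspace "D_alg \<iota> \<sigma> d A" by (rule D_vspace)
    have wD: "w j \<in> D" for j
      using DV.finsum_closed[of "\<lambda>i. c i j \<odot>\<^bsub>D_alg \<iota> \<sigma> d A\<^esub> \<beta> i" I] D(2) by (simp add: w_def D_alg_simps D_closed Pi_def)
    have "finsum (module_mat TYPE('e) d d) (\<lambda>j. h ^ j \<cdot>\<^sub>m w j) {..<n} = mat d d (\<lambda>p. \<Sum>i\<in>I. e i * \<beta> i $$ p)"
      unfolding sumh[OF wD]
    proof (rule eq_matI, goal_cases)
      case (1 r k)
      then have "(\<Sum>j<n. h ^ j * w j $$ (r, k)) = (\<Sum>j<n. \<Sum>i\<in>I. \<iota> (c i j) * h ^ j * \<beta> i $$ (r, k))"
        by (simp add: w_def sumD sum_distrib_left ac_simps)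
      also have "\<dots> = (\<Sum>i\<in>I. e i * \<beta> i $$ (r, k))"
        by (subst sum.swap) (simp add: c sum_distrib_right)
      finally show ?case using 1 by simp
    qed auto
    then have "w j = 0\<^sub>m d d" if "j < n" for j using mat_decomp_unique[OF wD _ that] e0 by simp
    then have "c i j = 0" if "j < n" for j
      using D(4)[of "\<lambda>i. c i j" i] i that by (simp add: w_def D_alg_simps)
    then show "e i = 0" by (simp add: c \<iota>_zero)
  qed (use D(1) \<beta>(2) in \<open>auto simp: module_mat_simps\<close>)
qed

text \<open>Finite dimension comes from the embedding in matrices; the value \<open>d^2\<close>
  comes from a comparison over \<open>E\<close> with the basis of matrix units.\<close>

lemma D_basis_exists: "\<exists>\<beta>. family_basis (D_alg \<iota> \<sigma> d A) {..<d\<^sup>2} \<beta>"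
proof -
  interpret M: vspace "module_mat TYPE('e) d d" by (rule module_mat_vspace)
  have "Module.submodule D (class_ring :: 'f ring) (E_mat_alg \<iota> d)"
    using D_subalgebra by (simp add: F_subalgebra_def)
  from vspace.subspace_basis[OF E_mat_alg_vspace this E_mat_alg_fin_dim, folded D_alg_eq]
  obtain k :: nat and \<beta> where \<beta>: "family_basis (D_alg \<iota> \<sigma> d A) {..<k} \<beta>"
    by (elim exE conjE) (rule that)
  have "k = d\<^sup>2"
    using M.family_basis_dim(2)[OF D_basis_E[OF \<beta>]]
      M.family_basis_dim(2)[OF family_basis_module_mat] by (simp add: power2_eq_square)
  with \<beta> show ?thesis by auto
qed

end

section \<open>The double centralizer property of the row space\<close>

sublocale norm_matrix \<subseteq> rep: semilinear n q s a \<iota> h \<sigma> "module_vec TYPE('e) d" "kummer.Tm \<sigma> A" "\<iota> a"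
  by (rule Tm_semilinear[OF A norm_A]) (simp add: a_neq_0 \<iota>_eq_0)

context norm_matrix
begin

lemma Tm_D:
  assumes M: "M \<in> D" and v: "v \<in> carrier_vec d" shows "Tm A (rvm v M) = rvm (Tm A v) M"
proof -
  have Mc: "M \<in> carrier_mat d d" "map_mat \<sigma> M * A = A * M" using M by (auto simp: D_iff)
  have v': "map_vec \<sigma> v \<in> carrier_vec d" using v by simp
  show ?thesis
    unfolding Tm_def map_vec_rvm[OF Mc(1) v]
    using rvm_simps(5)[OF _ A v' v', of "map_mat \<sigma> M"] rvm_simps(5)[OF A Mc(1) v' v'] Mc by simp
qed

lemma double_centralizer:
  assumes G: "\<And>v. v \<in> carrier_vec d \<Longrightarrow> G v \<in> carrier_vec d"
    "\<And>v w. v \<in> carrier_vec d \<Longrightarrow> w \<in> carrier_vec d \<Longrightarrow> G (v + w) = G v + G w"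
    "\<And>v M. v \<in> carrier_vec d \<Longrightarrow> M \<in> D \<Longrightarrow> G (rvm v M) = rvm (G v) M"
  shows "\<exists>p. \<forall>v\<in>carrier_vec d. G v = rep.act p v"
proof -
  let ?V = "module_vec TYPE('e) d"
  \<comment> \<open>Linearity over \<open>F\<close> is commutation with the scalar matrices in
    \<open>D\<close>.\<close>
  have G\<iota>: "G (\<iota> c \<cdot>\<^sub>v v) = \<iota> c \<cdot>\<^sub>v G v" if v: "v \<in> carrier_vec d" for c v
  proof -
    have *: "rvm u (\<iota> c \<cdot>\<^sub>m 1\<^sub>m d) = \<iota> c \<cdot>\<^sub>v u" if "u \<in> carrier_vec d" for u
      using rvm_simps(4,6)[of "1\<^sub>m d" d "1\<^sub>m d" u u] that by simp
    from G(3)[OF v D_closed(6)[OF D_closed(2)], of c] show ?thesis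
      using v G(1) by (simp add: *)
  qed
  have "\<exists>e. \<forall>v\<in>carrier ?V. G v = (\<Oplus>\<^bsub>?V\<^esub>i\<in>{..<n}. e i \<odot>\<^bsub>?V\<^esub> (Tm A ^^ i) v)"
  proof (rule rep.centralizer[of "{\<lambda>v. rvm v M |M. M \<in> D}"])
    fix S :: "'e vec \<Rightarrow> 'e vec"
    assume "\<And>v. v \<in> carrier ?V \<Longrightarrow> S v \<in> carrier ?V"
      "\<And>v w. v \<in> carrier ?V \<Longrightarrow> w \<in> carrier ?V \<Longrightarrow> S (v \<oplus>\<^bsub>?V\<^esub> w) = S v \<oplus>\<^bsub>?V\<^esub> S w"
      "\<And>v. v \<in> carrier ?V \<Longrightarrow> S (h \<odot>\<^bsub>?V\<^esub> v) = h \<odot>\<^bsub>?V\<^esub> S v"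
      "\<And>\<delta> v. \<delta> \<in> {\<lambda>v. rvm v M |M. M \<in> D} \<Longrightarrow> v \<in> carrier ?V \<Longrightarrow> S (\<delta> v) = \<delta> (S v)"
    note S = this[unfolded module_vec_simps]
    have "\<exists>e. \<forall>v\<in>carrier_vec d. S v = e \<cdot>\<^sub>v v"
    proof (rule commutant_scalar)
      fix v :: "'e vec" and M assume "v \<in> carrier_vec d" "M \<in> D"
      then show "S (rvm v M) = rvm (S v) M" using S(4)[of "\<lambda>v. rvm v M" v] by blast
    qed (use S(1-3) in auto)
    then show "\<exists>e. \<forall>v\<in>carrier ?V. S v = e \<odot>\<^bsub>?V\<^esub> v" by (simp add: module_vec_simps)
  qed (use G G\<iota> D_carrier in \<open>auto simp: module_vec_simps rvm_closed rvm_add_left[of _ d] rvm_smult_left[of _ d] Tm_D\<close>)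
  then obtain e where e: "\<And>v. v \<in> carrier_vec d \<Longrightarrow> G v = (\<Oplus>\<^bsub>?V\<^esub>i\<in>{..<n}. e i \<odot>\<^bsub>?V\<^esub> (Tm A ^^ i) v)"
    by (auto simp: module_vec_simps)
  define p where "p = (\<Sum>i<n. Polynomial.monom (e i) i)"
  have coeff: "Polynomial.coeff p i = (if i < n then e i else 0)" for i by (simp add: p_def coeff_sum)
  have "G v = rep.act p v" if v: "v \<in> carrier_vec d" for v
  proof -
    have v': "v \<in> carrier ?V" using v by (simp add: module_vec_simps)
    have "rep.act p v = (\<Oplus>\<^bsub>?V\<^esub>i\<in>{..<n}. Polynomial.coeff p i \<odot>\<^bsub>?V\<^esub> (Tm A ^^ i) v)"
      by (rule rep.act_eq[OF v']) (simp add: coeff)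
    also have "\<dots> = G v"
      unfolding e[OF v] using rep.T_pow_closed[OF v'] by (intro rep.finsum_cong') (auto simp: coeff)
    finally show ?thesis ..
  qed
  then show ?thesis by blast
qed

text \<open>After reduction to degree below \<open>n\<close>, the independence of the operators
  \<open>T^i\<close> applies, tested at the first unit vector.\<close>

lemma act_faithful:
  assumes "\<And>v. v \<in> carrier_vec d \<Longrightarrow> rep.act p v = rep.act r v"
  shows "cls p = cls r"
proof -
  let ?V = "module_vec TYPE('e) d"
  obtain u where u: "cls (p - r) = cls u" "\<And>i. i \<ge> n \<Longrightarrow> Polynomial.coeff u i = 0"
    using alg_normal_form[of "cls (p - r)"] by (auto simp: alg_simps)
  have "rep.act u v = \<zero>\<^bsub>?V\<^esub>" if v: "v \<in> carrier ?V" for v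
  proof -
    have "rep.act p v = rep.act (p - r) v \<oplus>\<^bsub>?V\<^esub> rep.act r v" using rep.act_add[OF v, of "p - r" r] by simp
    moreover have "rep.act p v = rep.act r v" using assms v by (simp add: module_vec_simps)
    ultimately have "rep.act (p - r) v = \<zero>\<^bsub>?V\<^esub>" using rep.act_closed[OF v] by simp
    then show ?thesis using rep.act_eq_if_cls_eq[OF refl u(1) v] by simp
  qed
  then have "(\<Oplus>\<^bsub>?V\<^esub>i\<in>{..<n}. Polynomial.coeff u i \<odot>\<^bsub>?V\<^esub> (Tm A ^^ i) v) = \<zero>\<^bsub>?V\<^esub>" if "v \<in> carrier ?V" for v
    using rep.act_eq[OF that u(2)] that by simp
  moreover have "unit_vec d 0 \<in> carrier ?V" "unit_vec d 0 \<noteq> \<zero>\<^bsub>?V\<^esub>"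
    using d_pos by (auto simp: module_vec_simps)
  ultimately have "Polynomial.coeff u i = 0" if "i < n" for i
    using rep.faithful[of "unit_vec d 0" "Polynomial.coeff u"] that by blast
  with u(2) have "u = 0" by (intro poly_eqI) (metis coeff_0 not_le)
  with u(1) have "p - r \<in> J" by (simp add: cls_eq_iff)
  then show ?thesis by (simp add: cls_eq_iff)
qed

end


section \<open>Automorphisms of algebras\<close>

lemma alg_homD:
  assumes "f \<in> alg_hom A B"
  shows "x \<in> carrier A \<Longrightarrow> f x \<in> carrier B"
    "x \<in> carrier A \<Longrightarrow> y \<in> carrier A \<Longrightarrow> f (x \<otimes>\<^bsub>A\<^esub> y) = f x \<otimes>\<^bsub>B\<^esub> f y"
    "x \<in> carrier A \<Longrightarrow> y \<in> carrier A \<Longrightarrow> f (x \<oplus>\<^bsub>A\<^esub> y) = f x \<oplus>\<^bsub>B\<^esub> f y"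
    "f \<one>\<^bsub>A\<^esub> = \<one>\<^bsub>B\<^esub>" "x \<in> carrier A \<Longrightarrow> f (c \<odot>\<^bsub>A\<^esub> x) = c \<odot>\<^bsub>B\<^esub> f x"
  using assms by (auto simp: alg_hom_def Ring.ring_hom_def)

lemma alg_homI:
  assumes "\<And>x. x \<in> carrier A \<Longrightarrow> f x \<in> carrier B"
    "\<And>x y. x \<in> carrier A \<Longrightarrow> y \<in> carrier A \<Longrightarrow> f (x \<otimes>\<^bsub>A\<^esub> y) = f x \<otimes>\<^bsub>B\<^esub> f y"
    "\<And>x y. x \<in> carrier A \<Longrightarrow> y \<in> carrier A \<Longrightarrow> f (x \<oplus>\<^bsub>A\<^esub> y) = f x \<oplus>\<^bsub>B\<^esub> f y"
    "f \<one>\<^bsub>A\<^esub> = \<one>\<^bsub>B\<^esub>" "\<And>c x. x \<in> carrier A \<Longrightarrow> f (c \<odot>\<^bsub>A\<^esub> x) = c \<odot>\<^bsub>B\<^esub> f x"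
  shows "f \<in> alg_hom A B"
  using assms by (auto simp: alg_hom_def Ring.ring_hom_def)

lemma F_algebraD:
  fixes A :: "('f::field, 'a) module"
  assumes "F_algebra A"
  shows "ring A" "vspace A" "x \<in> carrier A \<Longrightarrow> c \<odot>\<^bsub>A\<^esub> x \<in> carrier A"
    "x \<in> carrier A \<Longrightarrow> y \<in> carrier A \<Longrightarrow> x \<otimes>\<^bsub>A\<^esub> y \<in> carrier A"
    "x \<in> carrier A \<Longrightarrow> y \<in> carrier A \<Longrightarrow> x \<oplus>\<^bsub>A\<^esub> y \<in> carrier A" "\<one>\<^bsub>A\<^esub> \<in> carrier A"
proof -
  show r: "ring A" and v: "vspace A" using assms by (auto simp: F_algebra_def vspace_def)
  interpret ring A by (rule r)
  interpret V: vspace A by (rule v)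
  show "x \<in> carrier A \<Longrightarrow> c \<odot>\<^bsub>A\<^esub> x \<in> carrier A"
    "x \<in> carrier A \<Longrightarrow> y \<in> carrier A \<Longrightarrow> x \<otimes>\<^bsub>A\<^esub> y \<in> carrier A"
    "x \<in> carrier A \<Longrightarrow> y \<in> carrier A \<Longrightarrow> x \<oplus>\<^bsub>A\<^esub> y \<in> carrier A" "\<one>\<^bsub>A\<^esub> \<in> carrier A" by auto
qed

lemma alg_hom_cong:
  assumes A: "F_algebra A" and f: "f \<in> alg_hom A B" and eq: "\<And>x. x \<in> carrier A \<Longrightarrow> g x = f x"
  shows "g \<in> alg_hom A B"
  by (rule alg_homI) (simp_all add: eq F_algebraD[OF A] alg_homD[OF f])

lemma alg_hom_comp: "f \<in> alg_hom A B \<Longrightarrow> g \<in> alg_hom B C \<Longrightarrow> (\<lambda>x. g (f x)) \<in> alg_hom A C"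
  by (rule alg_homI) (simp_all add: alg_homD[of f A B] alg_homD[of g B C])

lemma alg_iso_comp: "f \<in> alg_iso A B \<Longrightarrow> g \<in> alg_iso B C \<Longrightarrow> (\<lambda>x. g (f x)) \<in> alg_iso A C"
  using alg_hom_comp[of f A B g C] bij_betw_trans[of f "carrier A" "carrier B" g "carrier C"]
  by (auto simp: alg_iso_def comp_def)

lemma alg_iso_inv:
  assumes A: "F_algebra A" and f: "f \<in> alg_iso A B"
  shows "inv_into (carrier A) f \<in> alg_iso B A"
proof -
  have fh: "f \<in> alg_hom A B" and bij: "bij_betw f (carrier A) (carrier B)" using f by (auto simp: alg_iso_def)
  let ?g = "inv_into (carrier A) f"
  have fg: "f (?g y) = y" "?g y \<in> carrier A" if "y \<in> carrier B" for y
    using bij that by (auto simp: bij_betw_def f_inv_into_f inv_into_into)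
  have gf: "?g y = x" if "x \<in> carrier A" "f x = y" for x y
    using bij that by (auto simp: bij_betw_def inv_into_f_f)
  note h = alg_homD[OF fh] F_algebraD[OF A]
  have "?g \<in> alg_hom B A"
    by (rule alg_homI) (auto intro!: gf simp: h fg)
  then show ?thesis using bij_betw_inv_into[OF bij] by (simp add: alg_iso_def)
qed

lemma alg_hom_module_hom:
  "f \<in> alg_hom A B \<Longrightarrow> f \<in> LinearCombinations.module_hom class_ring A B"
  using alg_homD[of f A B] by (auto simp: LinearCombinations.module_hom_def)

lemma BijGroup_simps:
  "carrier (BijGroup S) = Bij S" "\<one>\<^bsub>BijGroup S\<^esub> = (\<lambda>x\<in>S. x)"
  "f \<in> Bij S \<Longrightarrow> g \<in> Bij S \<Longrightarrow> f \<otimes>\<^bsub>BijGroup S\<^esub> g = compose S f g"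
  by (simp_all add: BijGroup_def)

lemma alg_Aut_subgroup:
  assumes A: "F_algebra A"
  shows "subgroup (Bij (carrier A) \<inter> alg_hom A A) (BijGroup (carrier A))"
proof (rule group.subgroupI[OF group_BijGroup])
  let ?S = "carrier A"
  show "Bij ?S \<inter> alg_hom A A \<subseteq> carrier (BijGroup ?S)" by (simp add: BijGroup_simps)
  have "(\<lambda>x. x) \<in> alg_hom A A" by (rule alg_homI) auto
  then have "(\<lambda>x\<in>?S. x) \<in> alg_hom A A" by (rule alg_hom_cong[OF A]) simp
  then show "Bij ?S \<inter> alg_hom A A \<noteq> {}" using id_Bij by blast
  fix f assume f: "f \<in> Bij ?S \<inter> alg_hom A A"
  then have "f \<in> alg_iso A A" by (auto simp: alg_iso_def Bij_def)
  then have "inv_into ?S f \<in> alg_hom A A" using alg_iso_inv[OF A] by (auto simp: alg_iso_def)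
  then have "(\<lambda>x\<in>?S. inv_into ?S f x) \<in> alg_hom A A" by (rule alg_hom_cong[OF A]) simp
  then show "inv\<^bsub>BijGroup ?S\<^esub> f \<in> Bij ?S \<inter> alg_hom A A"
    using f restrict_inv_into_Bij[of f ?S] by (auto simp: inv_BijGroup)
  fix g assume g: "g \<in> Bij ?S \<inter> alg_hom A A"
  have "(\<lambda>x. f (g x)) \<in> alg_hom A A" using f g by (auto intro: alg_hom_comp)
  then have "compose ?S f g \<in> alg_hom A A" by (rule alg_hom_cong[OF A]) (simp add: compose_def)
  then show "f \<otimes>\<^bsub>BijGroup ?S\<^esub> g \<in> Bij ?S \<inter> alg_hom A A"
    using f g compose_Bij[of f ?S g] by (auto simp: BijGroup_simps)
qed

text \<open>Inner automorphisms are the image of a homomorphism from the unit group, so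
  \<open>Inn\<close> and the stabilizer are subgroups as images of subgroups.\<close>

lemma inner_aut_hom:
  fixes A :: "('f::field, 'a) module" (structure)
  assumes "F_algebra A" shows "group_hom (units_of A) (BijGroup (carrier A)) (inner_aut A)"
proof -
  interpret ring A by (rule F_algebraD(1)[OF assms])
  have comp: "compose (carrier A) (inner_aut A y) (inner_aut A z) = inner_aut A (y \<otimes> z)"
    if "y \<in> Units A" "z \<in> Units A" for y z
  proof -
    have inv: "inv (y \<otimes> z) = inv z \<otimes> inv y"
    proof (rule inv_unique'[symmetric])
      have "y \<otimes> z \<otimes> (inv z \<otimes> inv y) = y \<otimes> (z \<otimes> inv z) \<otimes> inv y"
        using that by (simp add: m_assoc Units_closed del: Units_r_inv)
      then show "y \<otimes> z \<otimes> (inv z \<otimes> inv y) = \<one>" using that by (simp add: Units_closed)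
      have "inv z \<otimes> inv y \<otimes> (y \<otimes> z) = inv z \<otimes> (inv y \<otimes> y) \<otimes> z"
        using that by (simp add: m_assoc Units_closed del: Units_l_inv)
      then show "inv z \<otimes> inv y \<otimes> (y \<otimes> z) = \<one>" using that by (simp add: Units_closed)
    qed (use that in \<open>auto simp: Units_closed\<close>)
    show ?thesis
      using that by (auto simp: compose_def inner_aut_def inv m_assoc Units_closed intro!: restrict_ext)
  qed
  have one: "inner_aut A \<one> = (\<lambda>x\<in>carrier A. x)"
    by (auto simp: inner_aut_def intro!: restrict_ext)
  have bij: "inner_aut A y \<in> Bij (carrier A)" if y: "y \<in> Units A" for y
  proof -
    have "compose (carrier A) (inner_aut A (inv y)) (inner_aut A y) = (\<lambda>x\<in>carrier A. x)"
      "compose (carrier A) (inner_aut A y) (inner_aut A (inv y)) = (\<lambda>x\<in>carrier A. x)"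
      using y by (simp_all add: comp one)
    then have *: "inner_aut A (inv y) (inner_aut A y x) = x" "inner_aut A y (inner_aut A (inv y) x) = x"
      if "x \<in> carrier A" for x using that by (simp_all add: compose_def fun_eq_iff) metis+
    have c: "inner_aut A z x \<in> carrier A" if "z \<in> Units A" "x \<in> carrier A" for z x
      using that by (simp add: inner_aut_def Units_closed)
    have "bij_betw (inner_aut A y) (carrier A) (carrier A)"
      by (rule bij_betwI[where g = "inner_aut A (inv y)"]) (use y c * in auto)
    then show ?thesis by (simp add: Bij_def inner_aut_def)
  qed
  show ?thesis
    by (intro group_hom.intro group_BijGroup units_group group_hom_axioms.intro homI)
      (simp_all add: units_of_carrier units_of_mult BijGroup_simps bij comp)
qed

text \<open>The hypothesis \<open>ext\<close> is the conclusion of a Skolem--Noether theorem.\<close>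

lemma alg_Aut_iso_stabilizer_quotient:
  fixes A :: "('f::field, 'a) module" (structure)
  assumes A: "F_algebra A" and S: "F_subalgebra S A"
    and ext: "\<And>f. f \<in> alg_hom (A\<lparr>carrier := S\<rparr>) (A\<lparr>carrier := S\<rparr>) \<Longrightarrow> bij_betw f S S \<Longrightarrow>
      \<exists>y \<in> Units A. \<forall>x\<in>S. y \<otimes>\<^bsub>A\<^esub> x \<otimes>\<^bsub>A\<^esub> inv\<^bsub>A\<^esub> y = f x"
  shows "subgroup (inn_stabilizer A S) (Inn A)" "subgroup (inn_fixer A S) (Inn A)"
    "inn_fixer A S \<lhd> (Inn A)\<lparr>carrier := inn_stabilizer A S\<rparr>"
    "alg_Aut (A\<lparr>carrier := S\<rparr>) \<cong> ((Inn A)\<lparr>carrier := inn_stabilizer A S\<rparr>) Mod inn_fixer A S"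
proof -
  interpret ring A by (rule F_algebraD(1)[OF A])
  interpret H: group_hom "units_of A" "BijGroup (carrier A)" "inner_aut A" by (rule inner_aut_hom[OF A])
  let ?B = "BijGroup (carrier A)" and ?N = "inn_stabilizer A S" and ?C = "inn_fixer A S"
  let ?D = "A\<lparr>carrier := S\<rparr>"
  have SA: "S \<subseteq> carrier A" using S subringE(1) by (auto simp: F_subalgebra_def)
  have D: "F_algebra ?D" by (rule F_algebraI_subalgebra[OF A S])
  have bij: "inner_aut A y \<in> Bij (carrier A)" if "y \<in> Units A" for y
    using H.hom_closed[of y] that by (simp add: units_of_carrier BijGroup_simps)
  have inj: "inj_on (inner_aut A y) S" if "y \<in> Units A" for y
    using bij[OF that] SA by (auto simp: Bij_def bij_betw_def intro: inj_on_subset)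
  have comp: "inner_aut A (y \<otimes> z) x = inner_aut A y (inner_aut A z x)"
    if "y \<in> Units A" "z \<in> Units A" "x \<in> carrier A" for y z x
    using H.hom_mult[of y z] that bij
    by (simp add: units_of_carrier units_of_mult BijGroup_simps compose_def)
  have one: "inner_aut A \<one> x = x" if "x \<in> carrier A" for x
    using H.hom_one that by (simp add: units_of_one BijGroup_simps)
  have invc: "inner_aut A (inv y) (inner_aut A y x) = x" if "y \<in> Units A" "x \<in> carrier A" for y x
    using comp[of "inv y" y x] that one by simp
  have Inn: "Inn A = ?B\<lparr>carrier := inner_aut A ` Units A\<rparr>" by (simp add: Inn_def)
  have Isub: "subgroup (inner_aut A ` Units A) ?B"
    using H.img_is_subgroup by (simp add: units_of_carrier)
  have inv_units: "inv\<^bsub>units_of A\<^esub> y = inv y" if "y \<in> Units A" for y using units_of_inv[OF that] .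
  have img_id: "g ` S = S" if "\<And>x. x \<in> S \<Longrightarrow> g x = x" for g :: "'a \<Rightarrow> 'a"
    using image_cong[of S S g "\<lambda>x. x"] that by simp
  \<comment> \<open>The stabilizer is treated as a subgroup of the units; its image is then a
    subgroup of the bijections of the carrier.\<close>
  have "subgroup {y \<in> Units A. inner_aut A y ` S = S} (units_of A)"
  proof (rule group.subgroupI[OF units_group])
    have "inner_aut A \<one> ` S = S" by (rule img_id) (rule one, use SA in blast)
    then show "{y \<in> Units A. inner_aut A y ` S = S} \<noteq> {}" by blast
  next
    fix y assume y: "y \<in> {y \<in> Units A. inner_aut A y ` S = S}"
    then have "inner_aut A (inv y) ` (inner_aut A y ` S) = S"
      unfolding image_image by (intro img_id invc) (use SA in auto)
    with y show "inv\<^bsub>units_of A\<^esub> y \<in> {y \<in> Units A. inner_aut A y ` S = S}" by (simp add: inv_units)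
    fix z assume z: "z \<in> {y \<in> Units A. inner_aut A y ` S = S}"
    have "inner_aut A (y \<otimes> z) ` S = inner_aut A y ` (inner_aut A z ` S)"
      unfolding image_image using y z comp SA by (intro image_cong) auto
    with y z show "y \<otimes>\<^bsub>units_of A\<^esub> z \<in> {y \<in> Units A. inner_aut A y ` S = S}"
      by (simp add: units_of_mult)
  qed (auto simp: units_of_carrier)
  note img = H.subgroup_img_is_subgroup[OF this]
  have "?N = inner_aut A ` {y \<in> Units A. inner_aut A y ` S = S}"
    by (auto simp: inn_stabilizer_def)
  with img have NB: "subgroup ?N ?B" by (simp only:)
  have Cfix: "inner_aut A y ` S = S" if "\<forall>x\<in>S. inner_aut A y x = x" for y
    by (rule img_id) (use that in blast)
  have NI: "?N \<subseteq> inner_aut A ` Units A" by (auto simp: inn_stabilizer_def)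
  show N: "subgroup ?N (Inn A)"
    unfolding Inn by (rule group.subgroup_incl[OF group_BijGroup NB Isub NI])
  define G where "G = ?B\<lparr>carrier := ?N\<rparr>"
  have G: "(Inn A)\<lparr>carrier := ?N\<rparr> = G" by (simp add: Inn G_def)
  have grpG: "group G" unfolding G_def by (rule subgroup.subgroup_is_group[OF NB group_BijGroup])
  have Aut: "alg_Aut ?D = (BijGroup S)\<lparr>carrier := Bij S \<inter> alg_hom ?D ?D\<rparr>" by (simp add: alg_Aut_def)
  have grpAut: "group (alg_Aut ?D)"
    unfolding Aut using subgroup.subgroup_is_group[OF alg_Aut_subgroup[OF D] group_BijGroup] by simp
  have Gmult: "f \<otimes>\<^bsub>G\<^esub> g = compose (carrier A) f g" if "f \<in> ?N" "g \<in> ?N" for f g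
    using that bij by (auto simp: G_def inn_stabilizer_def BijGroup_simps)
  have NE: "\<exists>y. f = inner_aut A y \<and> y \<in> Units A \<and> inner_aut A y ` S = S" if "f \<in> ?N" for f
    using that unfolding inn_stabilizer_def by (rule CollectD)
  have Nim: "f ` S = S" if "f \<in> ?N" for f using NE[OF that] by (elim exE conjE) simp
  have Nf: "f x \<in> S" if "f \<in> ?N" "x \<in> S" for f x
    using imageI[OF that(2), of f] Nim[OF that(1)] by simp
  have restr_bij: "restrict f S \<in> Bij S" if "f \<in> ?N" for f
  proof -
    from NE[OF that] obtain y where y: "f = inner_aut A y" "y \<in> Units A" by (elim exE conjE)
    have "bij_betw f S S" using inj[OF y(2)] Nim[OF that] by (simp add: bij_betw_def y(1))
    then show ?thesis by (simp add: Bij_def bij_betw_restrict_eq)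
  qed
  have restr_hom: "restrict f S \<in> alg_hom ?D ?D" if f: "f \<in> ?N" for f
  proof -
    from NE[OF f] obtain y where y: "f = inner_aut A y" "y \<in> Units A" by (elim exE conjE)
    have yc: "y \<in> carrier A" "inv y \<in> carrier A" using y by auto
    have val: "f x = y \<otimes> x \<otimes> inv y" if "x \<in> carrier A" for x using y that by (simp add: inner_aut_def)
    have "y \<otimes> (u \<otimes> v) \<otimes> inv y = y \<otimes> u \<otimes> inv y \<otimes> (y \<otimes> v \<otimes> inv y)"
      if "u \<in> carrier A" "v \<in> carrier A" for u v
    proof -
      define i where "i = inv y"
      have i: "i \<in> carrier A" "i \<otimes> y = \<one>" using y yc by (auto simp: i_def)
      have cancel: "i \<otimes> (y \<otimes> w) = w" if "w \<in> carrier A" for w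
        using that i yc by (simp add: m_assoc[symmetric])
      show ?thesis unfolding i_def[symmetric] using that yc(1) i(1) by (simp add: m_assoc cancel)
    qed
    moreover have "y \<otimes> (u \<oplus> v) \<otimes> inv y = y \<otimes> u \<otimes> inv y \<oplus> y \<otimes> v \<otimes> inv y"
      if "u \<in> carrier A" "v \<in> carrier A" for u v using that yc by (simp add: l_distr r_distr)
    moreover have "y \<otimes> (c \<odot>\<^bsub>A\<^esub> u) \<otimes> inv y = c \<odot>\<^bsub>A\<^esub> (y \<otimes> u \<otimes> inv y)" if "u \<in> carrier A" for u c
      using that yc A by (simp add: F_algebra_def)
    moreover have "y \<otimes> \<one> \<otimes> inv y = \<one>" using y yc by simp
    ultimately have "f \<in> alg_hom ?D ?D"
      using SA Nf[OF f] F_algebraD(3-6)[OF D] F_algebraD(3-6)[OF A]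
      by (intro alg_homI) (auto simp: val subsetD[OF SA])
    then show ?thesis by (rule alg_hom_cong[OF D]) simp
  qed
  \<comment> \<open>Restriction to \<open>S\<close> is the map to which the first isomorphism
    theorem is applied: its kernel is the fixer, and \<open>ext\<close> makes it surjective.\<close>
  have hom: "group_hom G (alg_Aut ?D) (\<lambda>f. restrict f S)"
  proof (intro group_hom.intro grpG grpAut group_hom_axioms.intro homI)
    fix f assume f: "f \<in> carrier G"
    then have f: "f \<in> ?N" by (simp add: G_def)
    show "restrict f S \<in> carrier (alg_Aut ?D)" using restr_bij[OF f] restr_hom[OF f] by (simp add: Aut)
    fix g assume "g \<in> carrier G"
    then have g: "g \<in> ?N" by (simp add: G_def)
    have "restrict (compose (carrier A) f g) S = compose S (restrict f S) (restrict g S)"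
      using Nf[OF g] SA by (auto simp: compose_def fun_eq_iff)
    then show "restrict (f \<otimes>\<^bsub>G\<^esub> g) S = restrict f S \<otimes>\<^bsub>alg_Aut ?D\<^esub> restrict g S"
      using Gmult[OF f g] restr_bij[OF f] restr_bij[OF g] by (simp add: Aut BijGroup_simps)
  qed
  interpret R: group_hom G "alg_Aut ?D" "\<lambda>f. restrict f S" by (rule hom)
  have ker: "kernel G (alg_Aut ?D) (\<lambda>f. restrict f S) = ?C"
  proof -
    have "restrict f S = \<one>\<^bsub>alg_Aut ?D\<^esub> \<longleftrightarrow> (\<forall>x\<in>S. f x = x)" for f
      by (auto simp: Aut BijGroup_simps fun_eq_iff)
    then have "kernel G (alg_Aut ?D) (\<lambda>f. restrict f S) = {f \<in> ?N. \<forall>x\<in>S. f x = x}"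
      by (auto simp: kernel_def G_def)
    also have "\<dots> = ?C" using Cfix by (auto simp: inn_stabilizer_def inn_fixer_def)
    finally show ?thesis .
  qed
  have surj: "(\<lambda>f. restrict f S) ` carrier G = carrier (alg_Aut ?D)"
  proof
    show "(\<lambda>f. restrict f S) ` carrier G \<subseteq> carrier (alg_Aut ?D)" by auto
    show "carrier (alg_Aut ?D) \<subseteq> (\<lambda>f. restrict f S) ` carrier G"
    proof
      fix f assume "f \<in> carrier (alg_Aut ?D)"
      then have f: "f \<in> alg_hom ?D ?D" "bij_betw f S S" "f \<in> extensional S" by (auto simp: Aut Bij_def)
      from ext[OF f(1,2)] obtain y where y: "y \<in> Units A" "\<And>x. x \<in> S \<Longrightarrow> y \<otimes> x \<otimes> inv y = f x" by auto
      then have eq: "inner_aut A y x = f x" if "x \<in> S" for x using SA that by (auto simp: inner_aut_def)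
      then have "inner_aut A y ` S = S" using f(2) by (force simp: bij_betw_def)
      with y have "inner_aut A y \<in> carrier G" by (auto simp: G_def inn_stabilizer_def)
      moreover have "restrict (inner_aut A y) S = f"
        using eq f(3) by (auto simp: fun_eq_iff extensional_def)
      ultimately show "f \<in> (\<lambda>f. restrict f S) ` carrier G" by force
    qed
  qed
  show "?C \<lhd> (Inn A)\<lparr>carrier := ?N\<rparr>" using R.normal_kernel by (simp add: ker G)
  have "subgroup ?C G" using R.subgroup_kernel by (simp add: ker)
  then have "subgroup ?C ?B" unfolding G_def by (rule group.incl_subgroup[OF group_BijGroup NB])
  moreover have "?C \<subseteq> inner_aut A ` Units A" by (auto simp: inn_fixer_def)
  ultimately show "subgroup ?C (Inn A)"
    unfolding Inn by (rule group.subgroup_incl[OF group_BijGroup _ Isub])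
  have "group (G Mod ?C)" using normal.factorgroup_is_group R.normal_kernel by (auto simp: ker)
  moreover have "(G Mod ?C) \<cong> alg_Aut ?D" using R.FactGroup_iso[OF surj] by (simp add: ker)
  ultimately show "alg_Aut ?D \<cong> ((Inn A)\<lparr>carrier := ?N\<rparr>) Mod ?C"
    unfolding G by (rule group.iso_sym)
qed

section \<open>The Skolem--Noether theorem for matrix algebras\<close>

lemma mat_eq_if_mult_vec:
  fixes M N :: "'e::field mat"
  assumes "M \<in> carrier_mat d d" "N \<in> carrier_mat d d" "\<And>w. w \<in> carrier_vec d \<Longrightarrow> M *\<^sub>v w = N *\<^sub>v w"
  shows "M = N"
proof -
  have "transpose_mat M = transpose_mat N"
    by (rule rvm_ext[of _ d]) (use assms in \<open>auto simp: rvm_def\<close>)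
  then show ?thesis by (metis transpose_transpose)
qed

text \<open>\<open>W w\<close> is the matrix with first column \<open>w\<close>, and
  \<open>M W(w) = W(M w)\<close>: the column space sits in the matrix algebra as a left ideal. Hence
  \<open>Y w = \<phi>(W w) v\<close> defines a map with \<open>Y M = \<phi>(M) Y\<close>; the vector
  \<open>v\<close> is chosen so that \<open>Y\<close> is nonzero.\<close>

lemma endomorphism_of_mat_inner:
  fixes \<phi> :: "'e::field mat \<Rightarrow> 'e mat"
  assumes d: "0 < d"
    and closed: "\<And>M. M \<in> carrier_mat d d \<Longrightarrow> \<phi> M \<in> carrier_mat d d"
    and add: "\<And>M N. M \<in> carrier_mat d d \<Longrightarrow> N \<in> carrier_mat d d \<Longrightarrow> \<phi> (M + N) = \<phi> M + \<phi> N"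
    and smult: "\<And>e M. M \<in> carrier_mat d d \<Longrightarrow> \<phi> (e \<cdot>\<^sub>m M) = e \<cdot>\<^sub>m \<phi> M"
    and mult: "\<And>M N. M \<in> carrier_mat d d \<Longrightarrow> N \<in> carrier_mat d d \<Longrightarrow> \<phi> (M * N) = \<phi> M * \<phi> N"
    and inj: "\<And>M. M \<in> carrier_mat d d \<Longrightarrow> \<phi> M = 0\<^sub>m d d \<Longrightarrow> M = 0\<^sub>m d d"
  shows "\<exists>Y \<in> carrier_mat d d. \<exists>Z \<in> carrier_mat d d. Z * Y = 1\<^sub>m d \<and> (\<forall>M\<in>carrier_mat d d. Y * M = \<phi> M * Y)"
proof -
  define W where "W w = mat d d (\<lambda>(i, j). if j = 0 then w $ i else 0)" for w :: "'e vec"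
  have W: "W w \<in> carrier_mat d d" for w by (simp add: W_def)
  have W_mult: "M * W w = W (M *\<^sub>v w)" if "M \<in> carrier_mat d d" "w \<in> carrier_vec d" for M w
    using that d by (intro eq_matI) (auto simp: W_def scalar_prod_def)
  have W_add: "W (v + w) = W v + W w" if "v \<in> carrier_vec d" "w \<in> carrier_vec d" for v w
    using that by (intro eq_matI) (auto simp: W_def)
  have W_smult: "W (e \<cdot>\<^sub>v v) = e \<cdot>\<^sub>m W v" if "v \<in> carrier_vec d" for e v
    using that by (intro eq_matI) (auto simp: W_def)
  let ?u = "unit_vec d 0 :: 'e vec"
  have "W ?u $$ (0, 0) = 1" using d by (simp add: W_def)
  then have "W ?u \<noteq> 0\<^sub>m d d" using d by auto
  then have "\<phi> (W ?u) \<noteq> 0\<^sub>m d d" using inj W by blast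
  then obtain v where v: "v \<in> carrier_vec d" "\<phi> (W ?u) *\<^sub>v v \<noteq> 0\<^sub>v d"
    using mat_eq_if_mult_vec[OF closed[OF W[of ?u]], of "0\<^sub>m d d"] by force
  have "\<exists>L \<in> carrier_mat d d. \<forall>w\<in>carrier_vec d. \<phi> (W w) *\<^sub>v v = rvm w L"
  proof (rule linear_vec_eq_rvm)
    fix w w' :: "'e vec" and e assume w: "w \<in> carrier_vec d"
    show "\<phi> (W w) *\<^sub>v v \<in> carrier_vec d" using closed[OF W] v by (metis mult_mat_vec_carrier)
    show "\<phi> (W (e \<cdot>\<^sub>v w)) *\<^sub>v v = e \<cdot>\<^sub>v (\<phi> (W w) *\<^sub>v v)"
      unfolding W_smult[OF w] smult[OF W] using closed[OF W, of w] v by (intro eq_vecI) auto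
    assume w': "w' \<in> carrier_vec d"
    show "\<phi> (W (w + w')) *\<^sub>v v = \<phi> (W w) *\<^sub>v v + \<phi> (W w') *\<^sub>v v"
      unfolding W_add[OF w w'] add[OF W W]
      using closed[OF W] v by (intro add_mult_distrib_mat_vec[of _ d d]) auto
  qed
  then obtain L where L: "L \<in> carrier_mat d d" "\<And>w. w \<in> carrier_vec d \<Longrightarrow> \<phi> (W w) *\<^sub>v v = rvm w L" by auto
  define Y where "Y = transpose_mat L"
  have Y: "Y \<in> carrier_mat d d" using L by (simp add: Y_def)
  have Yw: "Y *\<^sub>v w = \<phi> (W w) *\<^sub>v v" if "w \<in> carrier_vec d" for w
    using L(2)[OF that] by (simp add: Y_def rvm_def)
  have comm: "Y * M = \<phi> M * Y" if M: "M \<in> carrier_mat d d" for M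
  proof (rule mat_eq_if_mult_vec)
    fix w :: "'e vec" assume w: "w \<in> carrier_vec d"
    have Mw: "M *\<^sub>v w \<in> carrier_vec d" using M w by simp
    have "(Y * M) *\<^sub>v w = Y *\<^sub>v (M *\<^sub>v w)" by (rule assoc_mult_mat_vec[OF Y M w])
    also have "\<dots> = \<phi> (M * W w) *\<^sub>v v" by (simp only: Yw[OF Mw] W_mult[OF M w])
    also have "\<dots> = \<phi> M *\<^sub>v (\<phi> (W w) *\<^sub>v v)"
      unfolding mult[OF M W] by (rule assoc_mult_mat_vec[OF closed[OF M] closed[OF W] v(1)])
    also have "\<dots> = (\<phi> M * Y) *\<^sub>v w"
      unfolding Yw[OF w, symmetric] by (rule assoc_mult_mat_vec[OF closed[OF M] Y w, symmetric])
    finally show "(Y * M) *\<^sub>v w = (\<phi> M * Y) *\<^sub>v w" .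
  qed (use Y M closed[OF M] in auto)
  have "det Y \<noteq> 0"
  proof
    assume "det Y = 0"
    then obtain w where w: "w \<in> carrier_vec d" "w \<noteq> 0\<^sub>v d" "Y *\<^sub>v w = 0\<^sub>v d"
      using det_0_iff_vec_prod_zero_field[OF Y] by auto
    then obtain l where l: "l < d" "w $ l \<noteq> 0" by (metis carrier_vecD eq_vecI index_zero_vec)
    \<comment> \<open>The matrix unit that moves the nonzero entry \<open>w_l\<close> to the first
      position. A nonzero kernel vector thus forces \<open>Y\<close> to kill the first unit vector,
      against the choice of \<open>v\<close>.\<close>
    define M :: "'e mat" where "M = mat_unit d 0 l"
    have M: "M \<in> carrier_mat d d" by (simp add: M_def mat_unit_carrier)
    have "M *\<^sub>v w = w $ l \<cdot>\<^sub>v ?u"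
      using w l d by (intro eq_vecI) (auto simp: M_def mat_unit_def scalar_prod_def if_distrib if_distribR cong: if_cong)
    then have "w $ l \<cdot>\<^sub>v (Y *\<^sub>v ?u) = Y *\<^sub>v (M *\<^sub>v w)" using mult_mat_vec[OF Y unit_vec_carrier] by simp
    also have "\<dots> = (\<phi> M * Y) *\<^sub>v w" unfolding comm[OF M, symmetric] by (rule assoc_mult_mat_vec[OF Y M w(1), symmetric])
    also have "\<dots> = \<phi> M *\<^sub>v (Y *\<^sub>v w)" by (rule assoc_mult_mat_vec[OF closed[OF M] Y w(1)])
    also have "\<dots> = 0\<^sub>v d" unfolding w(3) using closed[OF M] by (intro eq_vecI) auto
    finally have z: "w $ l \<cdot>\<^sub>v (Y *\<^sub>v ?u) = 0\<^sub>v d" .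
    have "Y *\<^sub>v ?u = inverse (w $ l) \<cdot>\<^sub>v (w $ l \<cdot>\<^sub>v (Y *\<^sub>v ?u))"
      using l by (intro eq_vecI) auto
    also have "\<dots> = 0\<^sub>v d" unfolding z by (intro eq_vecI) auto
    finally show False using v(2) Yw[of ?u] by simp
  qed
  from det_non_zero_imp_unit[OF Y this, of "()"] obtain Z where "Z \<in> carrier_mat d d" "Z * Y = 1\<^sub>m d"
    by (auto simp: Units_def ring_mat_simps)
  with Y comm show ?thesis by blast
qed

context norm_matrix
begin

text \<open>Extend \<open>f\<close> linearly over \<open>E\<close> by means of a basis of
  \<open>D\<close>. The extension is injective because the images of the basis form again a basis of
  \<open>D\<close> over \<open>F\<close>, hence of the matrices over \<open>E\<close>.\<close>

lemma skolem_noether: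
  assumes f: "f \<in> alg_hom (D_alg \<iota> \<sigma> d A) (D_alg \<iota> \<sigma> d A)" and bij: "bij_betw f D D"
  shows "\<exists>Y \<in> Units (E_mat_alg \<iota> d). \<forall>M\<in>D. Y * M * inv\<^bsub>E_mat_alg \<iota> d\<^esub> Y = f M"
proof -
  let ?D = "D_alg \<iota> \<sigma> d A" and ?M = "module_mat TYPE('e) d d"
  interpret MV: vspace ?M by (rule module_mat_vspace)
  interpret R: ring "E_mat_alg \<iota> d" by (rule E_mat_alg_ring)
  obtain \<beta> where \<beta>: "family_basis ?D {..<d\<^sup>2} \<beta>" using D_basis_exists by auto
  have f\<beta>: "family_basis ?D {..<d\<^sup>2} (\<lambda>i. f (\<beta> i))"
    by (rule family_basis_image[OF D_vspace D_vspace alg_hom_module_hom[OF f] _ \<beta>])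
      (use bij in \<open>simp add: D_alg_simps\<close>)
  note E\<beta> = D_basis_E[OF \<beta>] and Ef\<beta> = D_basis_E[OF f\<beta>]
  obtain \<phi> where \<phi>: "\<phi> \<in> LinearCombinations.module_hom class_ring ?M ?M"
    "\<And>c. \<phi> (\<Oplus>\<^bsub>?M\<^esub>i\<in>{..<d\<^sup>2}. c i \<odot>\<^bsub>?M\<^esub> \<beta> i) = (\<Oplus>\<^bsub>?M\<^esub>i\<in>{..<d\<^sup>2}. c i \<odot>\<^bsub>?M\<^esub> f (\<beta> i))"
    using linear_extension[OF module_mat_vspace module_mat_vspace E\<beta>, of "\<lambda>i. f (\<beta> i)"]
      family_basisD(2)[OF Ef\<beta>] by blast
  have \<phi>D: "\<phi> M = f M" if M: "M \<in> D" for M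
  proof -
    have sum: "(\<Oplus>\<^bsub>?D\<^esub>i\<in>{..<d\<^sup>2}. c i \<odot>\<^bsub>?D\<^esub> \<gamma> i) = (\<Oplus>\<^bsub>?M\<^esub>i\<in>{..<d\<^sup>2}. \<iota> (c i) \<odot>\<^bsub>?M\<^esub> \<gamma> i)"
      if "\<And>i. i < d\<^sup>2 \<Longrightarrow> \<gamma> i \<in> D" for \<gamma> c
      using that D_carrier
      by (subst finsum_D_alg, simp add: D_alg_simps D_closed, subst finsum_module_mat)
        (auto simp: D_alg_simps module_mat_simps intro!: eq_matI)
    have \<beta>D: "\<beta> i \<in> D" "f (\<beta> i) \<in> D" if "i < d\<^sup>2" for i
      using family_basisD(2)[OF \<beta>, of i] family_basisD(2)[OF f\<beta>, of i] that by (auto simp: D_alg_simps)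
    obtain c where c: "M = (\<Oplus>\<^bsub>?D\<^esub>i\<in>{..<d\<^sup>2}. c i \<odot>\<^bsub>?D\<^esub> \<beta> i)"
      using family_basisD(3)[OF \<beta>, of M] M by (auto simp: D_alg_simps)
    have "f M = (\<Oplus>\<^bsub>?D\<^esub>i\<in>{..<d\<^sup>2}. c i \<odot>\<^bsub>?D\<^esub> f (\<beta> i))"
      unfolding c by (rule module_hom_lincomb[OF D_vspace D_vspace alg_hom_module_hom[OF f] family_basisD(2)[OF \<beta>]])
    also have "\<dots> = (\<Oplus>\<^bsub>?M\<^esub>i\<in>{..<d\<^sup>2}. \<iota> (c i) \<odot>\<^bsub>?M\<^esub> f (\<beta> i))"
      by (rule sum) (rule \<beta>D(2))
    also have "\<dots> = \<phi> (\<Oplus>\<^bsub>?M\<^esub>i\<in>{..<d\<^sup>2}. \<iota> (c i) \<odot>\<^bsub>?M\<^esub> \<beta> i)" by (rule \<phi>(2)[symmetric])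
    also have "(\<Oplus>\<^bsub>?M\<^esub>i\<in>{..<d\<^sup>2}. \<iota> (c i) \<odot>\<^bsub>?M\<^esub> \<beta> i) = M"
      unfolding c by (rule sum[symmetric]) (rule \<beta>D(1))
    finally show ?thesis ..
  qed
  have \<phi>c: "\<phi> M \<in> carrier_mat d d" if "M \<in> carrier_mat d d" for M
    using module_homD(1)[OF \<phi>(1), of M] that by (simp add: module_mat_simps)
  have \<phi>a: "\<phi> (M + N) = \<phi> M + \<phi> N" if "M \<in> carrier_mat d d" "N \<in> carrier_mat d d" for M N
    using module_homD(2)[OF \<phi>(1), of M N] that by (simp add: module_mat_simps)
  have \<phi>s: "\<phi> (e \<cdot>\<^sub>m M) = e \<cdot>\<^sub>m \<phi> M" if "M \<in> carrier_mat d d" for M e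
    using module_homD(3)[OF \<phi>(1), of M e] that by (simp add: module_mat_simps)
  \<comment> \<open>Multiplicativity passes from \<open>D\<close> to all matrices one factor at a
    time, first for the left factor.\<close>
  have m1: "\<phi> (M * N) = \<phi> M * \<phi> N" if M: "M \<in> carrier_mat d d" and N: "N \<in> D" for M N
    using M
  proof (rule mat_induct)
    fix M assume "M \<in> D"
    then show "\<phi> (M * N) = \<phi> M * \<phi> N"
      using N D_closed(4) alg_homD(2)[OF f, of M N] by (simp add: \<phi>D D_alg_simps)
  qed (use D_carrier[OF N] in \<open>auto simp: \<phi>a \<phi>s \<phi>c add_mult_distrib_mat[of _ d d _ _ d]
      mult_smult_assoc_mat[of _ d d _ d]\<close>)
  have \<phi>m: "\<phi> (M * N) = \<phi> M * \<phi> N" if M: "M \<in> carrier_mat d d" and N: "N \<in> carrier_mat d d" for M N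
    using N
  proof (rule mat_induct)
    fix N assume "N \<in> D"
    then show "\<phi> (M * N) = \<phi> M * \<phi> N" by (rule m1[OF M])
  qed (use M in \<open>auto simp: \<phi>a \<phi>s \<phi>c mult_add_distrib_mat[of _ d d _ d] mult_smult_distrib[of _ d d _ d]\<close>)
  have \<phi>i: "M = 0\<^sub>m d d" if M: "M \<in> carrier_mat d d" and z: "\<phi> M = 0\<^sub>m d d" for M
  proof -
    obtain c where c: "M = (\<Oplus>\<^bsub>?M\<^esub>i\<in>{..<d\<^sup>2}. c i \<odot>\<^bsub>?M\<^esub> \<beta> i)"
      using family_basisD(3)[OF E\<beta>, of M] M by (auto simp: module_mat_simps)
    have "(\<Oplus>\<^bsub>?M\<^esub>i\<in>{..<d\<^sup>2}. c i \<odot>\<^bsub>?M\<^esub> f (\<beta> i)) = 0\<^sub>m d d"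
      using z unfolding c \<phi>(2) .
    then have "(\<Oplus>\<^bsub>?M\<^esub>i\<in>{..<d\<^sup>2}. c i \<odot>\<^bsub>?M\<^esub> f (\<beta> i)) = \<zero>\<^bsub>?M\<^esub>"
      by (simp only: module_mat_simps)
    then have c0: "c i = 0" if "i \<in> {..<d\<^sup>2}" for i using family_basisD(4)[OF Ef\<beta> _ that] by simp
    have "M = (\<Oplus>\<^bsub>?M\<^esub>i\<in>{..<d\<^sup>2}. \<zero>\<^bsub>?M\<^esub>)"
      unfolding c using family_basisD(2)[OF E\<beta>] c0 by (intro MV.finsum_cong') auto
    then show ?thesis by (simp add: module_mat_simps)
  qed
  obtain Y Z where Y: "Y \<in> carrier_mat d d" "Z \<in> carrier_mat d d" "Z * Y = 1\<^sub>m d"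
    "\<And>M. M \<in> carrier_mat d d \<Longrightarrow> Y * M = \<phi> M * Y"
    using endomorphism_of_mat_inner[OF d_pos \<phi>c \<phi>a \<phi>s \<phi>m \<phi>i] by blast
  have YU: "Y \<in> Units (E_mat_alg \<iota> d)" by (rule E_mat_alg_UnitsI[OF Y(1-3)])
  have Yi: "inv\<^bsub>E_mat_alg \<iota> d\<^esub> Y \<in> carrier_mat d d" "Y * inv\<^bsub>E_mat_alg \<iota> d\<^esub> Y = 1\<^sub>m d"
    using R.Units_inv_closed[OF YU] R.Units_r_inv[OF YU] by (auto simp: E_mat_alg_simps)
  have "Y * M * inv\<^bsub>E_mat_alg \<iota> d\<^esub> Y = f M" if M: "M \<in> D" for M
    using Y(4)[OF D_carrier[OF M]] Y(1) Yi \<phi>c[OF D_carrier[OF M]] \<phi>D[OF M]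
    by (simp add: assoc_mult_mat[of _ d d _ d _ d])
  with YU show ?thesis by blast
qed

lemma alg_Aut_D:
  "subgroup (inn_stabilizer (E_mat_alg \<iota> d) D) (Inn (E_mat_alg \<iota> d))"
  "subgroup (inn_fixer (E_mat_alg \<iota> d) D) (Inn (E_mat_alg \<iota> d))"
  "inn_fixer (E_mat_alg \<iota> d) D \<lhd> (Inn (E_mat_alg \<iota> d))\<lparr>carrier := inn_stabilizer (E_mat_alg \<iota> d) D\<rparr>"
  "alg_Aut (D_alg \<iota> \<sigma> d A) \<cong>
    ((Inn (E_mat_alg \<iota> d))\<lparr>carrier := inn_stabilizer (E_mat_alg \<iota> d) D\<rparr>) Mod inn_fixer (E_mat_alg \<iota> d) D"
  using alg_Aut_iso_stabilizer_quotient[OF E_mat_alg_F_algebra D_subalgebra]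
    skolem_noether[unfolded D_alg_eq] by (simp_all add: D_alg_eq E_mat_alg_simps)

lemma omega_sigma_eq: "omega_sigma \<iota> \<sigma> d A = restrict \<tau> (carrier_mat d d)"
proof -
  interpret R: ring "E_mat_alg \<iota> d" by (rule E_mat_alg_ring)
  have "inv\<^bsub>E_mat_alg \<iota> d\<^esub> (inv\<^bsub>E_mat_alg \<iota> d\<^esub> A) = A" by (rule R.Units_inv_inv[OF A_unit])
  then show ?thesis
    by (auto simp: omega_sigma_def compose_def inner_aut_def E_mat_alg_simps \<tau>_def Ai_def fun_eq_iff)
qed

lemma omega_sigma_in_alg_Aut: "omega_sigma \<iota> \<sigma> d A \<in> carrier (alg_Aut (E_mat_alg \<iota> d))"
proof -
  note sl = \<tau>_semilinear
  have c: "(\<tau> ^^ k) M \<in> carrier_mat d d" if "M \<in> carrier_mat d d" for M k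
    using that by (induct k) (auto simp: \<tau>_closed)
  have pow: "(\<tau> ^^ n) M = M" if "M \<in> carrier_mat d d" for M
  proof -
    have "1 \<cdot>\<^sub>m M = M" by (rule eq_matI) auto
    then show ?thesis using semilinear.T_pow[OF sl, of M] that by (simp add: module_mat_simps)
  qed
  obtain m where m: "n = Suc m" using n_pos by (cases n) auto
  \<comment> \<open>As \<open>\<tau>^n\<close> is the identity, \<open>\<tau>^(n - 1)\<close> is the
    inverse map.\<close>
  have "bij_betw \<tau> (carrier_mat d d) (carrier_mat d d)"
    by (rule bij_betwI[where g = "\<tau> ^^ m"])
      (use c \<tau>_closed pow in \<open>auto simp: m funpow_swap1\<close>)
  then have "restrict \<tau> (carrier_mat d d) \<in> Bij (carrier_mat d d)"
    by (simp add: Bij_def bij_betw_restrict_eq)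
  moreover have "\<tau> \<in> alg_hom (E_mat_alg \<iota> d) (E_mat_alg \<iota> d)"
  proof (rule alg_homI; simp only: E_mat_alg_simps)
    fix M N :: "'e mat" assume M: "M \<in> carrier_mat d d" and N: "N \<in> carrier_mat d d"
    let ?M = "map_mat \<sigma> M" and ?N = "map_mat \<sigma> N"
    have "\<tau> M * \<tau> N = Ai * ?M * (A * (Ai * (?N * A)))"
      using M N A Ai by (simp add: \<tau>_def assoc_mult_mat[of _ d d _ d _ d])
    also have "\<dots> = \<tau> (M * N)"
      using M N A Ai mult_cancel(4)[of "?N * A"]
      by (simp add: \<tau>_def map_mat_mult'[of _ d] assoc_mult_mat[of _ d d _ d _ d])
    finally show "\<tau> (M * N) = \<tau> M * \<tau> N" ..
    show "\<tau> (M + N) = \<tau> M + \<tau> N" using semilinear.T_add[OF sl, of M N] M N by (simp add: module_mat_simps)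
  next
    fix c and M :: "'e mat" assume "M \<in> carrier_mat d d"
    then show "\<tau> (\<iota> c \<cdot>\<^sub>m M) = \<iota> c \<cdot>\<^sub>m \<tau> M" using semilinear.T_smult[OF sl, of M "\<iota> c"] by (simp add: module_mat_simps \<sigma>_\<iota>)
  next
    show "\<tau> (1\<^sub>m d) = 1\<^sub>m d" using Ai by (simp add: \<tau>_def map_mat_simps)
  qed (rule \<tau>_closed)
  then have "restrict \<tau> (carrier_mat d d) \<in> alg_hom (E_mat_alg \<iota> d) (E_mat_alg \<iota> d)"
    by (rule alg_hom_cong[OF E_mat_alg_F_algebra]) (simp add: E_mat_alg_simps)
  ultimately show ?thesis by (simp add: omega_sigma_eq alg_Aut_def E_mat_alg_simps)
qed

lemma D_alg_fixed_alg: "D_alg \<iota> \<sigma> d A \<simeq>\<^sub>a fixed_alg (E_mat_alg \<iota> d) (omega_sigma \<iota> \<sigma> d A)"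
proof -
  have "D_alg \<iota> \<sigma> d A = fixed_alg (E_mat_alg \<iota> d) (omega_sigma \<iota> \<sigma> d A)"
    unfolding fixed_alg_def D_alg_eq omega_sigma_eq E_mat_alg_simps
    by (rule arg_cong[where f = "\<lambda>S. (E_mat_alg \<iota> d)\<lparr>carrier := S\<rparr>"]) (auto simp: D_iff_\<tau>)
  moreover have "(\<lambda>x. x) \<in> alg_iso (D_alg \<iota> \<sigma> d A) (D_alg \<iota> \<sigma> d A)"
    by (auto simp: alg_iso_def bij_betw_def intro: alg_homI)
  ultimately show ?thesis by (auto simp: is_alg_iso_def)
qed

end


section \<open>Simple modules over a ring with a primitive idempotent\<close>

context left_module
begin

lemma zero_smult: "u \<in> carrier M \<Longrightarrow> \<zero> \<odot>\<^bsub>M\<^esub> u = \<zero>\<^bsub>M\<^esub>"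
  using smult_l_distr[of \<zero> \<zero> u] smult_closed[of \<zero> u] by (simp add: M.add.r_cancel_one')

lemma smult_zero: "r \<in> carrier R \<Longrightarrow> r \<odot>\<^bsub>M\<^esub> \<zero>\<^bsub>M\<^esub> = \<zero>\<^bsub>M\<^esub>"
  using smult_r_distr[of r "\<zero>\<^bsub>M\<^esub>" "\<zero>\<^bsub>M\<^esub>"] smult_closed[of r "\<zero>\<^bsub>M\<^esub>"] by (simp add: M.add.r_cancel_one')

lemma minus_smult:
  assumes "r \<in> carrier R" "u \<in> carrier M" shows "(\<ominus> r) \<odot>\<^bsub>M\<^esub> u = \<ominus>\<^bsub>M\<^esub> (r \<odot>\<^bsub>M\<^esub> u)"
proof -
  have "(\<ominus> r) \<odot>\<^bsub>M\<^esub> u \<oplus>\<^bsub>M\<^esub> r \<odot>\<^bsub>M\<^esub> u = (\<ominus> r \<oplus> r) \<odot>\<^bsub>M\<^esub> u"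
    using assms by (intro smult_l_distr[symmetric]) auto
  also have "\<dots> = \<zero>\<^bsub>M\<^esub>" using assms by (simp add: R.l_neg zero_smult)
  finally show ?thesis using assms by (intro M.minus_equality[symmetric]) (auto simp: smult_closed)
qed

lemma finsum_smult:
  assumes "u \<in> carrier M" "f \<in> I \<rightarrow> carrier R"
  shows "(\<Oplus>i\<in>I. f i) \<odot>\<^bsub>M\<^esub> u = (\<Oplus>\<^bsub>M\<^esub>i\<in>I. f i \<odot>\<^bsub>M\<^esub> u)"
  using assms(2)
proof (induct I rule: infinite_finite_induct)
  case (insert x F)
  then have "f \<in> F \<rightarrow> carrier R" "f x \<in> carrier R" "(\<lambda>i. f i \<odot>\<^bsub>M\<^esub> u) \<in> F \<rightarrow> carrier M"
    using assms(1) smult_closed by auto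
  with insert assms(1) show ?case by (simp add: smult_l_distr smult_closed)
qed (use assms(1) in \<open>auto simp: zero_smult R.finsum_infinite M.finsum_infinite\<close>)

end

lemma simple_module_left_module: "simple_module R U \<Longrightarrow> left_module R U"
  by (simp add: simple_module_def)

text \<open>\<open>R u\<close> is a nonzero submodule.\<close>

lemma simple_cyclic:
  assumes U: "simple_module R U" and u: "u \<in> carrier U" "u \<noteq> \<zero>\<^bsub>U\<^esub>" and w: "w \<in> carrier U"
  shows "\<exists>x\<in>carrier R. w = x \<odot>\<^bsub>U\<^esub> u"
proof -
  interpret left_module R U by (rule simple_module_left_module[OF U])
  let ?H = "{x \<odot>\<^bsub>U\<^esub> u |x. x \<in> carrier R}"
  have "Module.submodule ?H R U"
  proof (intro Module.submodule.intro Module.submodule_axioms.intro M.add.subgroupI)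
    fix v assume "v \<in> ?H"
    then obtain x where x: "x \<in> carrier R" "v = x \<odot>\<^bsub>U\<^esub> u" by auto
    then show "\<ominus>\<^bsub>U\<^esub> v \<in> ?H"
      using u by (auto simp: minus_smult[symmetric])
    fix v' assume "v' \<in> ?H"
    then obtain x' where "x' \<in> carrier R" "v' = x' \<odot>\<^bsub>U\<^esub> u" by auto
    with x u show "v \<oplus>\<^bsub>U\<^esub> v' \<in> ?H"
      by (auto simp: smult_l_distr[symmetric])
  qed (use u in \<open>auto simp: smult_closed smult_assoc[symmetric]\<close>)
  moreover have "u \<in> ?H" using u smult_one[of u] by force
  ultimately have "?H = carrier U" using U u(2) by (auto simp: simple_module_def)
  with w show ?thesis by auto
qed

text \<open>\<open>prim\<close> says that the left ideal \<open>R e\<close> is minimal,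
  \<open>full\<close> that the two-sided ideal of \<open>e\<close> contains \<open>1\<close>. The
  model is a diagonal matrix unit over a division algebra.\<close>

locale primitive_idempotent = ring R for R (structure) +
  fixes e :: 'a and m :: nat and l r :: "nat \<Rightarrow> 'a"
  assumes e_closed: "e \<in> carrier R" and e_idem: "e \<otimes> e = e" and e_nz: "e \<noteq> \<zero>"
    and prim: "x \<in> carrier R \<Longrightarrow> x \<otimes> e \<noteq> \<zero> \<Longrightarrow> \<exists>t\<in>carrier R. t \<otimes> (x \<otimes> e) = e"
    and lr_closed: "i < m \<Longrightarrow> l i \<in> carrier R" "i < m \<Longrightarrow> r i \<in> carrier R"
    and full: "\<one> = (\<Oplus>i\<in>{..<m}. l i \<otimes> e \<otimes> r i)"
begin

text \<open>If \<open>e\<close> annihilated the module, so would every \<open>l_i e r_i\<close>, and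
  hence \<open>1\<close>.\<close>

lemma generator_exists:
  assumes U: "left_module R U" and nz: "carrier U \<noteq> {\<zero>\<^bsub>U\<^esub>}"
  shows "\<exists>u\<in>carrier U. u \<noteq> \<zero>\<^bsub>U\<^esub> \<and> e \<odot>\<^bsub>U\<^esub> u = u"
proof -
  interpret U: left_module R U by (rule U)
  obtain w where w: "w \<in> carrier U" "w \<noteq> \<zero>\<^bsub>U\<^esub>" using nz U.M.zero_closed by blast
  have "\<exists>v\<in>carrier U. e \<odot>\<^bsub>U\<^esub> v \<noteq> \<zero>\<^bsub>U\<^esub>"
  proof (rule ccontr)
    assume *: "\<not> ?thesis"
    have "w = (\<Oplus>\<^bsub>U\<^esub>i\<in>{..<m}. (l i \<otimes> e \<otimes> r i) \<odot>\<^bsub>U\<^esub> w)"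
      using U.smult_one[OF w(1)] lr_closed e_closed w(1) by (subst U.finsum_smult[symmetric]) (auto simp: full[symmetric])
    also have "\<dots> = (\<Oplus>\<^bsub>U\<^esub>i\<in>{..<m}. \<zero>\<^bsub>U\<^esub>)"
      using lr_closed e_closed w(1) *
      by (intro U.M.finsum_cong') (auto simp: U.smult_assoc U.smult_closed U.smult_zero)
    finally show False using w(2) by simp
  qed
  then obtain v where "v \<in> carrier U" "e \<odot>\<^bsub>U\<^esub> v \<noteq> \<zero>\<^bsub>U\<^esub>" by auto
  then show ?thesis
    using e_closed e_idem by (intro bexI[of _ "e \<odot>\<^bsub>U\<^esub> v"]) (auto simp: U.smult_closed U.smult_assoc[symmetric])
qed

text \<open>The annihilator of \<open>u\<close> depends on \<open>e\<close> only, not on the module.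
  This is why any two simple modules are isomorphic.\<close>

lemma annihilator:
  assumes U: "left_module R U" and u: "u \<in> carrier U" "u \<noteq> \<zero>\<^bsub>U\<^esub>" "e \<odot>\<^bsub>U\<^esub> u = u" and x: "x \<in> carrier R"
  shows "x \<odot>\<^bsub>U\<^esub> u = \<zero>\<^bsub>U\<^esub> \<longleftrightarrow> x \<otimes> e = \<zero>"
proof -
  interpret U: left_module R U by (rule U)
  have xe: "(x \<otimes> e) \<odot>\<^bsub>U\<^esub> u = x \<odot>\<^bsub>U\<^esub> u" using x u e_closed by (simp add: U.smult_assoc)
  show ?thesis
  proof
    assume "x \<odot>\<^bsub>U\<^esub> u = \<zero>\<^bsub>U\<^esub>"
    show "x \<otimes> e = \<zero>"
    proof (rule ccontr)
      assume "x \<otimes> e \<noteq> \<zero>"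
      from prim[OF x this] obtain t where t: "t \<in> carrier R" "t \<otimes> (x \<otimes> e) = e" by auto
      have "u = t \<odot>\<^bsub>U\<^esub> ((x \<otimes> e) \<odot>\<^bsub>U\<^esub> u)" using t x u e_closed by (simp add: U.smult_assoc[symmetric])
      with \<open>x \<odot>\<^bsub>U\<^esub> u = \<zero>\<^bsub>U\<^esub>\<close> xe t u show False by (simp add: U.smult_zero)
    qed
  next
    assume "x \<otimes> e = \<zero>"
    with xe show "x \<odot>\<^bsub>U\<^esub> u = \<zero>\<^bsub>U\<^esub>" using u by (simp add: U.zero_smult)
  qed
qed

text \<open>Sending \<open>x u\<close> to \<open>x v\<close> is well defined: \<open>x u = 0\<close>
  gives \<open>x e = 0\<close>, and \<open>v\<close> is fixed by \<open>e\<close>.\<close>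

lemma hom_exists:
  assumes U: "simple_module R U" and u: "u \<in> carrier U" "u \<noteq> \<zero>\<^bsub>U\<^esub>" "e \<odot>\<^bsub>U\<^esub> u = u"
    and V: "left_module R V" and v: "v \<in> carrier V" "e \<odot>\<^bsub>V\<^esub> v = v"
  shows "\<exists>f \<in> LinearCombinations.module_hom R U V. \<forall>x\<in>carrier R. f (x \<odot>\<^bsub>U\<^esub> u) = x \<odot>\<^bsub>V\<^esub> v"
proof -
  note UL = simple_module_left_module[OF U]
  interpret U: left_module R U by (rule UL)
  interpret V: left_module R V by (rule V)
  have wd: "x \<odot>\<^bsub>V\<^esub> v = y \<odot>\<^bsub>V\<^esub> v" if "x \<in> carrier R" "y \<in> carrier R" "x \<odot>\<^bsub>U\<^esub> u = y \<odot>\<^bsub>U\<^esub> u" for x y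
  proof -
    have "(x \<oplus> \<ominus> y) \<odot>\<^bsub>U\<^esub> u = \<zero>\<^bsub>U\<^esub>"
      using that u by (simp add: U.smult_l_distr U.minus_smult U.M.r_neg U.smult_closed)
    then have "(x \<oplus> \<ominus> y) \<otimes> e = \<zero>" using annihilator[OF UL u] that by simp
    then have "(x \<oplus> \<ominus> y) \<odot>\<^bsub>V\<^esub> v = \<zero>\<^bsub>V\<^esub>"
      using that v e_closed V.smult_assoc[of "x \<oplus> \<ominus> y" e v] by (simp add: V.zero_smult)
    then have eq: "x \<odot>\<^bsub>V\<^esub> v \<oplus>\<^bsub>V\<^esub> \<ominus>\<^bsub>V\<^esub> (y \<odot>\<^bsub>V\<^esub> v) = \<zero>\<^bsub>V\<^esub>"
      using that v by (simp add: V.smult_l_distr V.minus_smult)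
    have "x \<odot>\<^bsub>V\<^esub> v = \<ominus>\<^bsub>V\<^esub> (\<ominus>\<^bsub>V\<^esub> (y \<odot>\<^bsub>V\<^esub> v))"
      using that v eq by (intro V.M.minus_equality[symmetric]) (auto simp: V.smult_closed)
    with that v show ?thesis by (simp add: V.smult_closed)
  qed
  define f where "f w = (SOME x. x \<in> carrier R \<and> w = x \<odot>\<^bsub>U\<^esub> u) \<odot>\<^bsub>V\<^esub> v" for w
  have f: "f (x \<odot>\<^bsub>U\<^esub> u) = x \<odot>\<^bsub>V\<^esub> v" if x: "x \<in> carrier R" for x
  proof -
    define y where "y = (SOME y. y \<in> carrier R \<and> x \<odot>\<^bsub>U\<^esub> u = y \<odot>\<^bsub>U\<^esub> u)"
    have "y \<in> carrier R \<and> x \<odot>\<^bsub>U\<^esub> u = y \<odot>\<^bsub>U\<^esub> u"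
      unfolding y_def by (rule someI[of _ x]) (use x in simp)
    then have "x \<odot>\<^bsub>V\<^esub> v = y \<odot>\<^bsub>V\<^esub> v" by (intro wd x) auto
    then show ?thesis by (simp only: f_def y_def)
  qed
  note cyc = simple_cyclic[OF U u(1,2)]
  have "f \<in> LinearCombinations.module_hom R U V"
    unfolding LinearCombinations.module_hom_def
  proof (intro CollectI conjI allI impI)
    show "f \<in> carrier U \<rightarrow> carrier V"
    proof
      fix w assume "w \<in> carrier U"
      from cyc[OF this] obtain x where "x \<in> carrier R" "w = x \<odot>\<^bsub>U\<^esub> u" by auto
      then show "f w \<in> carrier V" using f v V.smult_closed by simp
    qed
  next
    fix w w' assume "w \<in> carrier U \<and> w' \<in> carrier U"
    with cyc obtain x y where "x \<in> carrier R" "w = x \<odot>\<^bsub>U\<^esub> u" "y \<in> carrier R" "w' = y \<odot>\<^bsub>U\<^esub> u" by metis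
    then show "f (w \<oplus>\<^bsub>U\<^esub> w') = f w \<oplus>\<^bsub>V\<^esub> f w'"
      using u v f[of "x \<oplus> y"] f[of x] f[of y] by (simp add: U.smult_l_distr V.smult_l_distr)
  next
    fix y w assume "y \<in> carrier R \<and> w \<in> carrier U"
    with cyc obtain x where "x \<in> carrier R" "w = x \<odot>\<^bsub>U\<^esub> u" "y \<in> carrier R" by metis
    then show "f (y \<odot>\<^bsub>U\<^esub> w) = y \<odot>\<^bsub>V\<^esub> f w"
      using u v f[of "y \<otimes> x"] f[of x] by (simp add: U.smult_assoc V.smult_assoc)
  qed
  with f show ?thesis by auto
qed

lemma simple_modules_iso:
  assumes U: "simple_module R U" and V: "simple_module R V" shows "module_iso R U V"
proof -
  note UL = simple_module_left_module[OF U] and VL = simple_module_left_module[OF V]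
  interpret U: left_module R U by (rule UL)
  interpret V: left_module R V by (rule VL)
  obtain u where u: "u \<in> carrier U" "u \<noteq> \<zero>\<^bsub>U\<^esub>" "e \<odot>\<^bsub>U\<^esub> u = u"
    using generator_exists[OF UL] U by (auto simp: simple_module_def)
  obtain v where v: "v \<in> carrier V" "v \<noteq> \<zero>\<^bsub>V\<^esub>" "e \<odot>\<^bsub>V\<^esub> v = v"
    using generator_exists[OF VL] V by (auto simp: simple_module_def)
  obtain f where f: "f \<in> LinearCombinations.module_hom R U V" "\<And>x. x \<in> carrier R \<Longrightarrow> f (x \<odot>\<^bsub>U\<^esub> u) = x \<odot>\<^bsub>V\<^esub> v"
    using hom_exists[OF U u VL v(1,3)] by auto
  obtain g where g: "g \<in> LinearCombinations.module_hom R V U" "\<And>x. x \<in> carrier R \<Longrightarrow> g (x \<odot>\<^bsub>V\<^esub> v) = x \<odot>\<^bsub>U\<^esub> u"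
    using hom_exists[OF V v UL u(1,3)] by auto
  have "bij_betw f (carrier U) (carrier V)"
  proof (rule bij_betwI[where g = g])
    show "f \<in> carrier U \<rightarrow> carrier V" "g \<in> carrier V \<rightarrow> carrier U"
      using f(1) g(1) by (auto simp: LinearCombinations.module_hom_def)
    fix w assume "w \<in> carrier U"
    from simple_cyclic[OF U u(1,2) this] f(2) g(2) show "g (f w) = w" by auto
  next
    fix w assume "w \<in> carrier V"
    from simple_cyclic[OF V v(1,2) this] f(2) g(2) show "f (g w) = w" by auto
  qed
  with f(1) show ?thesis by (auto simp: module_iso_def)
qed

text \<open>The left ideal \<open>R e\<close> works, being minimal by \<open>prim\<close>.\<close>

lemma simple_module_exists: "\<exists>U :: ('a, 'a) module. simple_module R U"
proof -
  let ?L = "(\<lambda>x. x \<otimes> e) ` carrier R"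
  define U :: "('a, 'a) module" where "U = \<lparr>carrier = ?L, mult = monoid.mult R, one = \<one>, zero = \<zero>, add = add R,
    smult = monoid.mult R\<rparr>"
  have Us: "carrier U = ?L" "\<zero>\<^bsub>U\<^esub> = \<zero>" "x \<oplus>\<^bsub>U\<^esub> y = x \<oplus> y" "x \<odot>\<^bsub>U\<^esub> y = x \<otimes> y" for x y
    by (simp_all add: U_def)
  have L: "x \<in> carrier R" if "x \<in> ?L" for x using that e_closed by auto
  have L_add: "x \<oplus> y \<in> ?L" if xL: "x \<in> ?L" and yL: "y \<in> ?L" for x y
  proof -
    obtain x' y' where "x' \<in> carrier R" "y' \<in> carrier R" "x = x' \<otimes> e" "y = y' \<otimes> e"
      using xL yL by (elim imageE)
    then show ?thesis using e_closed by (intro image_eqI[of _ _ "x' \<oplus> y'"]) (simp_all add: l_distr)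
  qed
  have L_smult: "x \<otimes> y \<in> ?L" if xR: "x \<in> carrier R" and yL: "y \<in> ?L" for x y
  proof -
    from yL obtain y' where y': "y = y' \<otimes> e" "y' \<in> carrier R" by (rule imageE)
    have "x \<otimes> y = x \<otimes> y' \<otimes> e" by (simp only: y'(1) m_assoc[OF xR y'(2) e_closed])
    then show ?thesis by (rule image_eqI) (rule m_closed[OF xR y'(2)])
  qed
  have "abelian_group U"
  proof (rule abelian_groupI; simp only: Us)
    show "\<zero> \<in> ?L" using e_closed by (intro image_eqI[of _ _ \<zero>]) simp_all
    fix x assume x: "x \<in> ?L"
    have "\<ominus> \<one> \<otimes> x \<in> ?L" by (rule L_smult[OF _ x]) simp
    then show "\<exists>y\<in>?L. y \<oplus> x = \<zero>" using L[OF x] by (intro bexI[of _ "\<ominus> \<one> \<otimes> x"]) (simp_all add: l_minus l_neg)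
    show "\<zero> \<oplus> x = x" by (rule l_zero[OF L[OF x]])
    fix y assume y: "y \<in> ?L"
    show "x \<oplus> y \<in> ?L" by (rule L_add[OF x y])
    show "x \<oplus> y = y \<oplus> x" by (rule a_comm[OF L[OF x] L[OF y]])
    fix z assume z: "z \<in> ?L"
    show "x \<oplus> y \<oplus> z = x \<oplus> (y \<oplus> z)" by (rule a_assoc[OF L[OF x] L[OF y] L[OF z]])
  qed
  then interpret U: abelian_group U .
  have UL: "left_module R U"
    by unfold_locales (simp_all only: Us, use L L_smult in \<open>simp_all add: l_distr r_distr m_assoc\<close>)
  have eL: "e \<in> ?L" using e_idem e_closed by (intro image_eqI[of _ _ e]) simp_all
  have "simple_module R U"
    unfolding simple_module_def
  proof (intro conjI UL allI impI)
    show "carrier U \<noteq> {\<zero>\<^bsub>U\<^esub>}" using eL e_nz by (auto simp only: Us)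
    fix H assume H: "Module.submodule H R U"
    interpret H: Module.submodule H R U by (rule H)
    have HL: "H \<subseteq> ?L" using H.subset by (simp add: U_def)
    show "H = {\<zero>\<^bsub>U\<^esub>} \<or> H = carrier U"
    proof (cases "H = {\<zero>\<^bsub>U\<^esub>}")
      case False
      moreover have "\<zero> \<in> H" using H.one_closed by (simp add: U_def)
      ultimately obtain y where y: "y \<in> H" "y \<noteq> \<zero>" by (auto simp: Us)
      then obtain x where x: "x \<in> carrier R" "y = x \<otimes> e" using HL by auto
      from prim[OF x(1)] y(2) x(2) obtain t where t: "t \<in> carrier R" "t \<otimes> y = e" by auto
      have "e \<in> H" using H.smult_closed[OF t(1) y(1)] t(2) by (simp add: Us)
      then have "?L \<subseteq> H" using H.smult_closed[of _ e] by (auto simp: Us)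
      with HL show ?thesis by (simp add: Us)
    qed simp
  qed
  then show ?thesis by blast
qed

lemma module_hom_eqI:
  assumes U: "simple_module R U" and u: "u \<in> carrier U" "u \<noteq> \<zero>\<^bsub>U\<^esub>"
    and f: "f \<in> LinearCombinations.module_hom R U U \<inter> extensional (carrier U)"
    and g: "g \<in> LinearCombinations.module_hom R U U \<inter> extensional (carrier U)" and eq: "f u = g u"
  shows "f = g"
proof
  fix w
  show "f w = g w"
  proof (cases "w \<in> carrier U")
    case True
    from simple_cyclic[OF U u this] obtain x where "x \<in> carrier R" "w = x \<odot>\<^bsub>U\<^esub> u" by auto
    then show ?thesis using f g u eq by (auto simp: LinearCombinations.module_hom_def)
  qed (use f g in \<open>auto simp: extensional_def\<close>)
qed

end

section \<open>Simple modules over a matrix algebra\<close>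

text \<open>On \<open>R\<close>, scalars are only required to act as multiplication by
  \<open>c 1\<close>, which holds in the cyclic algebra by construction. Centrality of
  \<open>c 1\<close> is obtained through \<psi>.\<close>

locale matrix_alg_iso =
  fixes R :: "('f::field, 'r) module" (structure) and D :: "('f, 'd) module" and m :: nat and \<psi> :: "'r \<Rightarrow> 'd mat"
  assumes R_ring: "ring R"
    and R_smult: "x \<in> carrier R \<Longrightarrow> c \<odot> x = (c \<odot> \<one>) \<otimes> x" "c \<odot> \<one> \<in> carrier R"
    and D: "central_division D" and m: "1 \<le> m" and \<psi>: "\<psi> \<in> alg_iso R (mat_alg D m)"

sublocale matrix_alg_iso \<subseteq> R: ring R by (rule R_ring)

sublocale matrix_alg_iso \<subseteq> D: ring D
  using D F_algebraD(1) by (auto simp: central_division_def)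

context matrix_alg_iso
begin

lemma D_F_algebra: "F_algebra D" using D by (simp add: central_division_def)

lemma \<psi>_hom: "\<psi> \<in> alg_hom R (mat_alg D m)" and \<psi>_bij: "bij_betw \<psi> (carrier R) (carrier (mat_alg D m))"
  using \<psi> by (auto simp: alg_iso_def)

lemma \<psi>_carrier:
  assumes "x \<in> carrier R"
  shows "\<psi> x \<in> carrier_mat m m" "i < m \<Longrightarrow> j < m \<Longrightarrow> \<psi> x $$ (i, j) \<in> carrier D"
  using alg_homD(1)[OF \<psi>_hom assms] by (auto simp: mat_alg_def)

lemma \<psi>_eqI:
  assumes "x \<in> carrier R" "y \<in> carrier R" "\<And>i j. i < m \<Longrightarrow> j < m \<Longrightarrow> \<psi> x $$ (i, j) = \<psi> y $$ (i, j)"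
  shows "x = y"
proof -
  have "\<psi> x = \<psi> y"
    using \<psi>_carrier(1)[OF assms(1)] \<psi>_carrier(1)[OF assms(2)] assms(3) by (intro eq_matI) auto
  with assms \<psi>_bij show ?thesis by (auto simp: bij_betw_def inj_on_def)
qed

lemma \<psi>_mult: "x \<in> carrier R \<Longrightarrow> y \<in> carrier R \<Longrightarrow> i < m \<Longrightarrow> j < m \<Longrightarrow>
    \<psi> (x \<otimes> y) $$ (i, j) = (\<Oplus>\<^bsub>D\<^esub>k\<in>{..<m}. \<psi> x $$ (i, k) \<otimes>\<^bsub>D\<^esub> \<psi> y $$ (k, j))"
  using alg_homD(2)[OF \<psi>_hom, of x y] by (simp add: mat_alg_def)

lemma \<psi>_add: "x \<in> carrier R \<Longrightarrow> y \<in> carrier R \<Longrightarrow> i < m \<Longrightarrow> j < m \<Longrightarrow>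
    \<psi> (x \<oplus> y) $$ (i, j) = \<psi> x $$ (i, j) \<oplus>\<^bsub>D\<^esub> \<psi> y $$ (i, j)"
  using alg_homD(3)[OF \<psi>_hom, of x y] by (simp add: mat_alg_def)

lemma \<psi>_one: "i < m \<Longrightarrow> j < m \<Longrightarrow> \<psi> \<one> $$ (i, j) = (if i = j then \<one>\<^bsub>D\<^esub> else \<zero>\<^bsub>D\<^esub>)"
  using alg_homD(4)[OF \<psi>_hom] by (simp add: mat_alg_def)

lemma \<psi>_smult: "x \<in> carrier R \<Longrightarrow> i < m \<Longrightarrow> j < m \<Longrightarrow> \<psi> (c \<odot> x) $$ (i, j) = c \<odot>\<^bsub>D\<^esub> \<psi> x $$ (i, j)"
  using alg_homD(5)[OF \<psi>_hom, of x c] by (simp add: mat_alg_def)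

lemma \<psi>_zero: "i < m \<Longrightarrow> j < m \<Longrightarrow> \<psi> \<zero> $$ (i, j) = \<zero>\<^bsub>D\<^esub>"
  using \<psi>_add[of \<zero> \<zero> i j] \<psi>_carrier(2)[of \<zero> i j] by (simp add: D.add.r_cancel_one')

lemma \<psi>_finsum:
  assumes "f \<in> I \<rightarrow> carrier R" "i < m" "j < m" "finite I"
  shows "\<psi> (\<Oplus>k\<in>I. f k) $$ (i, j) = (\<Oplus>\<^bsub>D\<^esub>k\<in>I. \<psi> (f k) $$ (i, j))"
  using assms(4,1)
proof (induct I)
  case (insert x F)
  then have "f \<in> F \<rightarrow> carrier R" "f x \<in> carrier R" "(\<lambda>k. \<psi> (f k) $$ (i, j)) \<in> F \<rightarrow> carrier D"
    "\<psi> (f x) $$ (i, j) \<in> carrier D"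
    using \<psi>_carrier(2) assms(2,3) by auto
  with insert assms(2,3) show ?case by (simp add: \<psi>_add)
qed (use assms in \<open>simp add: \<psi>_zero\<close>)

text \<open>Matrix units with a coefficient, pulled back to \<open>R\<close>.\<close>

definition eu :: "nat \<Rightarrow> nat \<Rightarrow> 'd \<Rightarrow> 'r" where
  "eu i j \<delta> = inv_into (carrier R) \<psi> (mat m m (\<lambda>(k, l). if k = i \<and> l = j then \<delta> else \<zero>\<^bsub>D\<^esub>))"

lemma eu:
  assumes "\<delta> \<in> carrier D"
  shows "eu i j \<delta> \<in> carrier R"
    "k < m \<Longrightarrow> l < m \<Longrightarrow> \<psi> (eu i j \<delta>) $$ (k, l) = (if k = i \<and> l = j then \<delta> else \<zero>\<^bsub>D\<^esub>)"
proof -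
  let ?M = "mat m m (\<lambda>(k, l). if k = i \<and> l = j then \<delta> else \<zero>\<^bsub>D\<^esub>)"
  have "?M \<in> carrier (mat_alg D m)" using assms by (auto simp: mat_alg_def)
  then have "?M \<in> \<psi> ` carrier R" using \<psi>_bij by (simp add: bij_betw_def)
  then show "eu i j \<delta> \<in> carrier R"
    "k < m \<Longrightarrow> l < m \<Longrightarrow> \<psi> (eu i j \<delta>) $$ (k, l) = (if k = i \<and> l = j then \<delta> else \<zero>\<^bsub>D\<^esub>)"
    unfolding eu_def by (auto simp: inv_into_into f_inv_into_f)
qed

lemma D_delta:
  "i < m \<Longrightarrow> v \<in> carrier D \<Longrightarrow> (\<Oplus>\<^bsub>D\<^esub>k\<in>{..<m}. if k = i then v else \<zero>\<^bsub>D\<^esub>) = v"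
  using vspace.finsum_delta[OF F_algebraD(2)[OF D_F_algebra], of "{..<m}" i v] by simp

lemma mult_eu:
  assumes "x \<in> carrier R" "\<delta> \<in> carrier D" "p < m" "i < m" "j < m"
  shows "\<psi> (x \<otimes> eu p l \<delta>) $$ (i, j) = (if j = l then \<psi> x $$ (i, p) \<otimes>\<^bsub>D\<^esub> \<delta> else \<zero>\<^bsub>D\<^esub>)"
proof -
  have "\<psi> (x \<otimes> eu p l \<delta>) $$ (i, j)
      = (\<Oplus>\<^bsub>D\<^esub>k\<in>{..<m}. if k = p then (if j = l then \<psi> x $$ (i, p) \<otimes>\<^bsub>D\<^esub> \<delta> else \<zero>\<^bsub>D\<^esub>) else \<zero>\<^bsub>D\<^esub>)"
    unfolding \<psi>_mult[OF assms(1) eu(1)[OF assms(2)] assms(4,5)] using assms \<psi>_carrier(2)[OF assms(1)]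
    by (intro D.finsum_cong') (auto simp: eu(2)[OF assms(2)])
  also have "\<dots> = (if j = l then \<psi> x $$ (i, p) \<otimes>\<^bsub>D\<^esub> \<delta> else \<zero>\<^bsub>D\<^esub>)"
    using assms \<psi>_carrier(2)[OF assms(1)] by (intro D_delta) auto
  finally show ?thesis .
qed

lemma eu_mult:
  assumes "x \<in> carrier R" "\<delta> \<in> carrier D" "l < m" "i < m" "j < m"
  shows "\<psi> (eu p l \<delta> \<otimes> x) $$ (i, j) = (if i = p then \<delta> \<otimes>\<^bsub>D\<^esub> \<psi> x $$ (l, j) else \<zero>\<^bsub>D\<^esub>)"
proof -
  have "\<psi> (eu p l \<delta> \<otimes> x) $$ (i, j)
      = (\<Oplus>\<^bsub>D\<^esub>k\<in>{..<m}. if k = l then (if i = p then \<delta> \<otimes>\<^bsub>D\<^esub> \<psi> x $$ (l, j) else \<zero>\<^bsub>D\<^esub>) else \<zero>\<^bsub>D\<^esub>)"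
    unfolding \<psi>_mult[OF eu(1)[OF assms(2)] assms(1,4,5)] using assms \<psi>_carrier(2)[OF assms(1)]
    by (intro D.finsum_cong') (auto simp: eu(2)[OF assms(2)])
  also have "\<dots> = (if i = p then \<delta> \<otimes>\<^bsub>D\<^esub> \<psi> x $$ (l, j) else \<zero>\<^bsub>D\<^esub>)"
    using assms \<psi>_carrier(2)[OF assms(1)] by (intro D_delta) auto
  finally show ?thesis .
qed

lemma eu_eu:
  assumes "\<delta> \<in> carrier D" "\<epsilon> \<in> carrier D" "j < m"
  shows "eu i j \<delta> \<otimes> eu j l \<epsilon> = eu i l (\<delta> \<otimes>\<^bsub>D\<^esub> \<epsilon>)"
proof (rule \<psi>_eqI)
  fix k k' assume k: "k < m" "k' < m"
  show "\<psi> (eu i j \<delta> \<otimes> eu j l \<epsilon>) $$ (k, k') = \<psi> (eu i l (\<delta> \<otimes>\<^bsub>D\<^esub> \<epsilon>)) $$ (k, k')"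
    unfolding eu_mult[OF eu(1)[OF assms(2)] assms(1,3) k]
    using k assms by (simp add: eu(2))
qed (use assms eu(1) in auto)

lemma eu_add:
  assumes "\<delta> \<in> carrier D" "\<epsilon> \<in> carrier D" shows "eu i j \<delta> \<oplus> eu i j \<epsilon> = eu i j (\<delta> \<oplus>\<^bsub>D\<^esub> \<epsilon>)"
proof (rule \<psi>_eqI)
  fix k l assume kl: "k < m" "l < m"
  show "\<psi> (eu i j \<delta> \<oplus> eu i j \<epsilon>) $$ (k, l) = \<psi> (eu i j (\<delta> \<oplus>\<^bsub>D\<^esub> \<epsilon>)) $$ (k, l)"
    using assms kl by (simp add: \<psi>_add eu(1) eu(2)[OF _ kl])
qed (use assms in \<open>simp_all add: eu(1)\<close>)

lemma D_smult_closed: "\<delta> \<in> carrier D \<Longrightarrow> c \<odot>\<^bsub>D\<^esub> \<delta> \<in> carrier D"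
  by (rule F_algebraD(3)[OF D_F_algebra])

lemma D_smult_zero: "c \<odot>\<^bsub>D\<^esub> \<zero>\<^bsub>D\<^esub> = \<zero>\<^bsub>D\<^esub>"
proof -
  interpret vspace D by (rule F_algebraD(2)[OF D_F_algebra])
  show ?thesis by simp
qed

lemma eu_smult:
  assumes "\<delta> \<in> carrier D" shows "eu i j (c \<odot>\<^bsub>D\<^esub> \<delta>) = (c \<odot> \<one>) \<otimes> eu i j \<delta>"
proof -
  have c: "c \<odot> eu i j \<delta> \<in> carrier R"
    unfolding R_smult(1)[OF eu(1)[OF assms]] by (rule R.m_closed[OF R_smult(2) eu(1)[OF assms]])
  have "eu i j (c \<odot>\<^bsub>D\<^esub> \<delta>) = c \<odot> eu i j \<delta>"
  proof (rule \<psi>_eqI)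
    fix k l assume kl: "k < m" "l < m"
    show "\<psi> (eu i j (c \<odot>\<^bsub>D\<^esub> \<delta>)) $$ (k, l) = \<psi> (c \<odot> eu i j \<delta>) $$ (k, l)"
      using assms kl by (simp add: eu(1) eu(2)[OF _ kl] \<psi>_smult D_smult_closed D_smult_zero)
  qed (use assms c in \<open>simp_all add: eu(1) D_smult_closed\<close>)
  then show ?thesis using R_smult(1)[OF eu(1)[OF assms]] by simp
qed

abbreviation "e \<equiv> eu 0 0 \<one>\<^bsub>D\<^esub>"

lemma D_one_nz: "\<one>\<^bsub>D\<^esub> \<noteq> \<zero>\<^bsub>D\<^esub>"
proof -
  have "\<one>\<^bsub>D\<^esub> \<in> Units D" by simp
  then have "\<one>\<^bsub>D\<^esub> \<in> carrier D - {\<zero>\<^bsub>D\<^esub>}" using D unfolding central_division_def by metis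
  then show ?thesis by simp
qed

text \<open>A nonzero \<open>x e\<close> has a nonzero entry in its first column. Dividing by it,
  with a matrix unit that moves its row to the top, returns \<open>e\<close>; this is where
  \<open>D\<close> must be a division algebra.\<close>

lemma primitive: "primitive_idempotent R e m (\<lambda>i. eu i 0 \<one>\<^bsub>D\<^esub>) (\<lambda>i. eu 0 i \<one>\<^bsub>D\<^esub>)"
proof
  show e: "e \<in> carrier R" by (simp add: eu)
  show "e \<otimes> e = e" using m by (simp add: eu_eu)
  show "e \<noteq> \<zero>" using eu(2)[OF D.one_closed, of 0 0 0 0] \<psi>_zero[of 0 0] m D_one_nz by auto
  show "eu i 0 \<one>\<^bsub>D\<^esub> \<in> carrier R" "eu 0 i \<one>\<^bsub>D\<^esub> \<in> carrier R" for i by (simp_all add: eu)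
  show "\<one> = (\<Oplus>i\<in>{..<m}. eu i 0 \<one>\<^bsub>D\<^esub> \<otimes> e \<otimes> eu 0 i \<one>\<^bsub>D\<^esub>)"
  proof (rule \<psi>_eqI)
    fix i j assume ij: "i < m" "j < m"
    have "\<psi> (\<Oplus>k\<in>{..<m}. eu k 0 \<one>\<^bsub>D\<^esub> \<otimes> e \<otimes> eu 0 k \<one>\<^bsub>D\<^esub>) $$ (i, j)
        = (\<Oplus>\<^bsub>D\<^esub>k\<in>{..<m}. \<psi> (eu k 0 \<one>\<^bsub>D\<^esub> \<otimes> e \<otimes> eu 0 k \<one>\<^bsub>D\<^esub>) $$ (i, j))"
      using ij by (intro \<psi>_finsum) (auto simp: eu)
    also have "\<dots> = (\<Oplus>\<^bsub>D\<^esub>k\<in>{..<m}. if k = i then (if i = j then \<one>\<^bsub>D\<^esub> else \<zero>\<^bsub>D\<^esub>) else \<zero>\<^bsub>D\<^esub>)"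
      using ij m by (intro D.finsum_cong') (auto simp: eu_eu eu)
    also have "\<dots> = \<psi> \<one> $$ (i, j)" using ij by (subst D_delta) (auto simp: \<psi>_one)
    finally show "\<psi> \<one> $$ (i, j) = \<psi> (\<Oplus>k\<in>{..<m}. eu k 0 \<one>\<^bsub>D\<^esub> \<otimes> e \<otimes> eu 0 k \<one>\<^bsub>D\<^esub>) $$ (i, j)" ..
  qed (auto simp: eu intro!: R.finsum_closed)
  fix x assume x: "x \<in> carrier R" and xe: "x \<otimes> e \<noteq> \<zero>"
  have xe_entries: "\<psi> (x \<otimes> e) $$ (i, j) = (if j = 0 then \<psi> x $$ (i, 0) else \<zero>\<^bsub>D\<^esub>)" if "i < m" "j < m" for i j
    using mult_eu[OF x D.one_closed, of 0 i j 0] that m \<psi>_carrier(2)[OF x, of i 0] by simp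
  have "\<exists>i<m. \<psi> x $$ (i, 0) \<noteq> \<zero>\<^bsub>D\<^esub>"
  proof (rule ccontr)
    assume "\<not> ?thesis"
    then have "x \<otimes> e = \<zero>" using x e xe_entries by (intro \<psi>_eqI) (auto simp: \<psi>_zero)
    with xe show False by simp
  qed
  then obtain i where i: "i < m" "\<psi> x $$ (i, 0) \<noteq> \<zero>\<^bsub>D\<^esub>" by auto
  then have "\<psi> x $$ (i, 0) \<in> Units D" using D \<psi>_carrier(2)[OF x, of i 0] m by (simp add: central_division_def)
  then have inv: "inv\<^bsub>D\<^esub> (\<psi> x $$ (i, 0)) \<in> carrier D" "inv\<^bsub>D\<^esub> (\<psi> x $$ (i, 0)) \<otimes>\<^bsub>D\<^esub> \<psi> x $$ (i, 0) = \<one>\<^bsub>D\<^esub>" by auto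
  show "\<exists>t\<in>carrier R. t \<otimes> (x \<otimes> e) = e"
  proof (intro bexI[of _ "eu 0 i (inv\<^bsub>D\<^esub> (\<psi> x $$ (i, 0)))"] \<psi>_eqI)
    fix k l assume kl: "k < m" "l < m"
    show "\<psi> (eu 0 i (inv\<^bsub>D\<^esub> (\<psi> x $$ (i, 0))) \<otimes> (x \<otimes> e)) $$ (k, l) = \<psi> e $$ (k, l)"
      using x e inv i kl by (simp add: eu_mult[OF _ inv(1)] xe_entries eu)
  qed (use x e inv eu(1)[OF inv(1)] in auto)
qed

end

sublocale matrix_alg_iso \<subseteq> P: primitive_idempotent R "matrix_alg_iso.eu R D m \<psi> 0 0 \<one>\<^bsub>D\<^esub>" m
    "\<lambda>i. matrix_alg_iso.eu R D m \<psi> i 0 \<one>\<^bsub>D\<^esub>" "\<lambda>i. matrix_alg_iso.eu R D m \<psi> 0 i \<one>\<^bsub>D\<^esub>"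
  by (rule primitive)

context matrix_alg_iso
begin

text \<open>The corner ring \<open>e R e\<close> is a copy of \<open>D\<close>.\<close>

lemma corner: "x \<in> carrier R \<Longrightarrow> e \<otimes> (x \<otimes> e) = eu 0 0 (\<psi> x $$ (0, 0))"
proof (rule \<psi>_eqI)
  assume x: "x \<in> carrier R"
  fix k l assume kl: "k < m" "l < m"
  have "x \<otimes> e \<in> carrier R" using x by (simp add: eu)
  from eu_mult[OF this D.one_closed, of 0 k l 0] mult_eu[OF x D.one_closed, of 0 0 l 0] kl m
  show "\<psi> (e \<otimes> (x \<otimes> e)) $$ (k, l) = \<psi> (eu 0 0 (\<psi> x $$ (0, 0))) $$ (k, l)"
    using \<psi>_carrier(2)[OF x, of 0 0] by (cases "l = 0") (simp_all add: eu)
qed (use m \<psi>_carrier(2) in \<open>auto simp: eu\<close>)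

text \<open>An endomorphism is determined by its value at \<open>u\<close>, which lies in
  \<open>e U = e R e u\<close>, a copy of \<open>D\<close>. As endomorphisms are written on the
  right, the product of \<delta> and \<epsilon> means first \<delta>, then \<epsilon>, so
  \<open>D\<close> itself appears and not its opposite.\<close>

lemma End_right_iso:
  assumes U: "simple_module R U" shows "D \<simeq>\<^sub>a End_right R U"
proof -
  note UL = simple_module_left_module[OF U]
  interpret U: left_module R U by (rule UL)
  obtain u where u: "u \<in> carrier U" "u \<noteq> \<zero>\<^bsub>U\<^esub>" "e \<odot>\<^bsub>U\<^esub> u = u"
    using P.generator_exists[OF UL] U by (auto simp: simple_module_def)
  let ?End = "End_right R U"
  have eue: "e \<otimes> eu 0 0 \<delta> = eu 0 0 \<delta>" "eu 0 0 \<delta> \<otimes> e = eu 0 0 \<delta>" if "\<delta> \<in> carrier D" for \<delta>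
    using that m by (simp_all add: eu_eu)
  have ex: "\<exists>f\<in>carrier ?End. f u = eu 0 0 \<delta> \<odot>\<^bsub>U\<^esub> u" if \<delta>: "\<delta> \<in> carrier D" for \<delta>
  proof -
    have "e \<odot>\<^bsub>U\<^esub> (eu 0 0 \<delta> \<odot>\<^bsub>U\<^esub> u) = eu 0 0 \<delta> \<odot>\<^bsub>U\<^esub> u"
      using \<delta> u eue by (simp add: U.smult_assoc[symmetric] eu)
    from P.hom_exists[OF U u UL _ this] \<delta> u obtain f where
      f: "f \<in> LinearCombinations.module_hom R U U" "\<And>x. x \<in> carrier R \<Longrightarrow> f (x \<odot>\<^bsub>U\<^esub> u) = x \<odot>\<^bsub>U\<^esub> (eu 0 0 \<delta> \<odot>\<^bsub>U\<^esub> u)"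
      by (auto simp: U.smult_closed eu)
    have "f u = eu 0 0 \<delta> \<odot>\<^bsub>U\<^esub> u"
      using f(2)[of \<one>] \<delta> u by (simp add: U.smult_one U.smult_closed eu)
    moreover have "restrict f (carrier U) \<in> carrier ?End"
      using f(1) by (auto simp: End_right_def LinearCombinations.module_hom_def U.smult_closed)
    ultimately show ?thesis using u by (intro bexI[of _ "restrict f (carrier U)"]) simp_all
  qed
  define \<phi> where "\<phi> \<delta> = (SOME f. f \<in> carrier ?End \<and> f u = eu 0 0 \<delta> \<odot>\<^bsub>U\<^esub> u)" for \<delta>
  have \<phi>: "\<phi> \<delta> \<in> carrier ?End" "\<phi> \<delta> u = eu 0 0 \<delta> \<odot>\<^bsub>U\<^esub> u" if "\<delta> \<in> carrier D" for \<delta>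
    using someI_ex[of "\<lambda>f. f \<in> carrier ?End \<and> f u = eu 0 0 \<delta> \<odot>\<^bsub>U\<^esub> u"] ex[OF that] by (auto simp: \<phi>_def)
  have End: "f (x \<odot>\<^bsub>U\<^esub> w) = x \<odot>\<^bsub>U\<^esub> f w" "f w \<in> carrier U" "f (w \<oplus>\<^bsub>U\<^esub> w') = f w \<oplus>\<^bsub>U\<^esub> f w'"
    if "f \<in> carrier ?End" "x \<in> carrier R" "w \<in> carrier U" "w' \<in> carrier U" for f x w w'
    using that by (auto simp: End_right_def LinearCombinations.module_hom_def)
  have eqI: "f = g" if "f \<in> carrier ?End" "g \<in> carrier ?End" "f u = g u" for f g
    by (rule P.module_hom_eqI[OF U u(1,2)]) (use that in \<open>simp_all add: End_right_def\<close>)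
  have End_comp: "compose (carrier U) g f \<in> carrier ?End" if "f \<in> carrier ?End" "g \<in> carrier ?End" for f g
    using that by (auto simp: End_right_def LinearCombinations.module_hom_def compose_def U.smult_closed Pi_def)
  have End_add: "(\<lambda>w\<in>carrier U. f w \<oplus>\<^bsub>U\<^esub> g w) \<in> carrier ?End" if "f \<in> carrier ?End" "g \<in> carrier ?End" for f g
    using that by (auto simp: End_right_def LinearCombinations.module_hom_def U.smult_closed Pi_def
        U.smult_r_distr U.M.a_ac)
  have "\<phi> \<in> alg_hom D ?End"
  proof (rule alg_homI)
    fix \<delta> assume \<delta>: "\<delta> \<in> carrier D"
    then show "\<phi> \<delta> \<in> carrier ?End" by (rule \<phi>(1))
    fix c
    obtain g where g: "g \<in> carrier ?End" "g u = \<phi> (c \<odot>\<^bsub>D\<^esub> \<delta>) u" using \<phi>(1)[OF D_smult_closed[OF \<delta>]] by blast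
    have gE: "g = \<phi> (c \<odot>\<^bsub>D\<^esub> \<delta>)" by (rule eqI) (use g \<phi>(1)[OF D_smult_closed[OF \<delta>]] in auto)
    show "\<phi> (c \<odot>\<^bsub>D\<^esub> \<delta>) = c \<odot>\<^bsub>?End\<^esub> \<phi> \<delta>"
    proof
      fix w show "\<phi> (c \<odot>\<^bsub>D\<^esub> \<delta>) w = (c \<odot>\<^bsub>?End\<^esub> \<phi> \<delta>) w"
      proof (cases "w \<in> carrier U")
        case True
        from simple_cyclic[OF U u(1,2) this] obtain x where x: "x \<in> carrier R" "w = x \<odot>\<^bsub>U\<^esub> u" by auto
        \<comment> \<open>Scalars are central in \<open>R\<close>: through \<psi> this is the
          compatibility of scalars with products in \<open>D\<close>.\<close>
        have comm: "(c \<odot> \<one>) \<otimes> x = x \<otimes> (c \<odot> \<one>)" if "x \<in> carrier R" for x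
        proof (rule \<psi>_eqI)
          have xc: "x \<otimes> (c \<odot> \<one>) \<in> carrier R" "c \<odot> x \<in> carrier R"
            using that R_smult(2) by (auto simp: R_smult(1)[OF that])
          fix i j assume ij: "i < m" "j < m"
          interpret DV: vspace D by (rule F_algebraD(2)[OF D_F_algebra])
          have "\<psi> (x \<otimes> (c \<odot> \<one>)) $$ (i, j)
              = (\<Oplus>\<^bsub>D\<^esub>k\<in>{..<m}. if k = j then c \<odot>\<^bsub>D\<^esub> \<psi> x $$ (i, j) else \<zero>\<^bsub>D\<^esub>)"
            unfolding \<psi>_mult[OF that R_smult(2) ij]
            using ij \<psi>_carrier(2)[OF that] D_F_algebra
            by (intro D.finsum_cong') (auto simp: \<psi>_smult \<psi>_one D_smult_zero D_smult_closed F_algebra_def)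
          also have "\<dots> = c \<odot>\<^bsub>D\<^esub> \<psi> x $$ (i, j)" using ij \<psi>_carrier(2)[OF that] by (intro D_delta) (auto simp: D_smult_closed)
          also have "\<dots> = \<psi> ((c \<odot> \<one>) \<otimes> x) $$ (i, j)"
            using ij that by (simp add: R_smult(1)[OF that, symmetric] \<psi>_smult)
          finally show "\<psi> ((c \<odot> \<one>) \<otimes> x) $$ (i, j) = \<psi> (x \<otimes> (c \<odot> \<one>)) $$ (i, j)" ..
        qed (use that R_smult(2) in auto)
        have "\<phi> (c \<odot>\<^bsub>D\<^esub> \<delta>) w = x \<odot>\<^bsub>U\<^esub> (((c \<odot> \<one>) \<otimes> eu 0 0 \<delta>) \<odot>\<^bsub>U\<^esub> u)"
          using End(1)[OF \<phi>(1)[OF D_smult_closed[OF \<delta>]] x(1) u(1) u(1)] \<delta>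
          by (simp add: x(2) \<phi>(2) D_smult_closed eu_smult)
        also have "\<dots> = (x \<otimes> ((c \<odot> \<one>) \<otimes> eu 0 0 \<delta>)) \<odot>\<^bsub>U\<^esub> u"
          using x \<delta> u R_smult(2) by (simp add: U.smult_assoc eu)
        also have "x \<otimes> ((c \<odot> \<one>) \<otimes> eu 0 0 \<delta>) = (c \<odot> \<one>) \<otimes> (x \<otimes> eu 0 0 \<delta>)"
          by (simp only: R.m_assoc[OF x(1) R_smult(2) eu(1)[OF \<delta>], symmetric] comm[OF x(1), symmetric]
              R.m_assoc[OF R_smult(2) x(1) eu(1)[OF \<delta>]])
        also have "\<dots> \<odot>\<^bsub>U\<^esub> u = (c \<odot> \<one>) \<odot>\<^bsub>U\<^esub> \<phi> \<delta> w"
          using End(1)[OF \<phi>(1)[OF \<delta>] x(1) u(1) u(1)] x \<delta> u R_smult(2)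
          by (simp add: U.smult_assoc eu \<phi>(2))
        finally show ?thesis using True by (simp add: End_right_def)
      next
        case False
        with \<phi>(1)[OF D_smult_closed[OF \<delta>]] show ?thesis by (auto simp: End_right_def extensional_def)
      qed
    qed
    fix \<epsilon> assume \<epsilon>: "\<epsilon> \<in> carrier D"
    have "compose (carrier U) (\<phi> \<epsilon>) (\<phi> \<delta>) u = eu 0 0 (\<delta> \<otimes>\<^bsub>D\<^esub> \<epsilon>) \<odot>\<^bsub>U\<^esub> u"
      using u \<delta> \<epsilon> End(1)[OF \<phi>(1)[OF \<epsilon>] eu(1)[OF \<delta>] u(1) u(1)] m
      by (simp add: compose_def \<phi>(2) U.smult_assoc[symmetric] eu eu_eu)
    then have "\<phi> (\<delta> \<otimes>\<^bsub>D\<^esub> \<epsilon>) = compose (carrier U) (\<phi> \<epsilon>) (\<phi> \<delta>)"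
      using \<delta> \<epsilon> by (intro eqI) (auto simp: \<phi> End_comp)
    then show "\<phi> (\<delta> \<otimes>\<^bsub>D\<^esub> \<epsilon>) = \<phi> \<delta> \<otimes>\<^bsub>?End\<^esub> \<phi> \<epsilon>" by (simp add: End_right_def)
    have "\<phi> (\<delta> \<oplus>\<^bsub>D\<^esub> \<epsilon>) = (\<lambda>w\<in>carrier U. \<phi> \<delta> w \<oplus>\<^bsub>U\<^esub> \<phi> \<epsilon> w)"
      using \<delta> \<epsilon> u by (intro eqI) (auto simp: \<phi> End_add eu_add[symmetric] U.smult_l_distr eu)
    then show "\<phi> (\<delta> \<oplus>\<^bsub>D\<^esub> \<epsilon>) = \<phi> \<delta> \<oplus>\<^bsub>?End\<^esub> \<phi> \<epsilon>" by (simp add: End_right_def)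
  next
    have "(\<lambda>w\<in>carrier U. w) \<in> carrier ?End"
      by (auto simp: End_right_def LinearCombinations.module_hom_def U.smult_closed)
    then have "\<phi> \<one>\<^bsub>D\<^esub> = (\<lambda>w\<in>carrier U. w)" using u by (intro eqI) (auto simp: \<phi>)
    then show "\<phi> \<one>\<^bsub>D\<^esub> = \<one>\<^bsub>?End\<^esub>" by (simp add: End_right_def)
  qed
  moreover have "bij_betw \<phi> (carrier D) (carrier ?End)"
    unfolding bij_betw_def
  proof (intro conjI equalityI subsetI inj_onI)
    fix \<delta> \<epsilon> assume \<delta>: "\<delta> \<in> carrier D" and \<epsilon>: "\<epsilon> \<in> carrier D" and eq: "\<phi> \<delta> = \<phi> \<epsilon>"
    have "eu 0 0 \<delta> \<odot>\<^bsub>U\<^esub> u = eu 0 0 \<epsilon> \<odot>\<^bsub>U\<^esub> u" using \<phi>(2)[OF \<delta>] \<phi>(2)[OF \<epsilon>] eq by simp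
    then have "(eu 0 0 \<delta> \<oplus> \<ominus> eu 0 0 \<epsilon>) \<odot>\<^bsub>U\<^esub> u = \<zero>\<^bsub>U\<^esub>"
      using \<delta> \<epsilon> u by (simp add: U.smult_l_distr U.minus_smult U.M.r_neg U.smult_closed eu)
    then have "(eu 0 0 \<delta> \<oplus> \<ominus> eu 0 0 \<epsilon>) \<otimes> e = \<zero>"
      using P.annihilator[OF UL u, of "eu 0 0 \<delta> \<oplus> \<ominus> eu 0 0 \<epsilon>"] \<delta> \<epsilon> by (simp add: eu)
    then have "eu 0 0 \<delta> \<oplus> \<ominus> eu 0 0 \<epsilon> = \<zero>" using \<delta> \<epsilon> eue by (simp add: R.l_distr R.l_minus eu)
    then have "eu 0 0 \<delta> = \<ominus> (\<ominus> eu 0 0 \<epsilon>)" using \<delta> \<epsilon> by (intro R.minus_equality[symmetric]) (auto simp: eu)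
    then have "eu 0 0 \<delta> = eu 0 0 \<epsilon>" using \<epsilon> by (simp add: eu)
    then have eq: "\<psi> (eu 0 0 \<delta>) $$ (0, 0) = \<psi> (eu 0 0 \<epsilon>) $$ (0, 0)" by simp
    have "0 < m" using m by simp
    from eq show "\<delta> = \<epsilon>"
      unfolding eu(2)[OF \<delta> \<open>0 < m\<close> \<open>0 < m\<close>] eu(2)[OF \<epsilon> \<open>0 < m\<close> \<open>0 < m\<close>] by simp
  next
    fix f assume f: "f \<in> carrier ?End"
    have "f u \<in> carrier U" using End(2)[OF f R.one_closed u(1) u(1)] .
    from simple_cyclic[OF U u(1,2) this] obtain x where x: "x \<in> carrier R" "f u = x \<odot>\<^bsub>U\<^esub> u" by auto
    have "f u = e \<odot>\<^bsub>U\<^esub> f u" using End(1)[OF f eu(1)[OF D.one_closed] u(1) u(1), of 0 0] u(3) by simp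
    also have "\<dots> = (e \<otimes> (x \<otimes> e)) \<odot>\<^bsub>U\<^esub> u" using x u by (simp add: U.smult_assoc eu U.smult_closed)
    also have "\<dots> = \<phi> (\<psi> x $$ (0, 0)) u" using x m \<psi>_carrier(2)[OF x(1), of 0 0] by (simp add: corner \<phi>)
    finally have "f = \<phi> (\<psi> x $$ (0, 0))"
      using f m \<psi>_carrier(2)[OF x(1), of 0 0] by (intro eqI) (auto simp: \<phi>)
    then show "f \<in> \<phi> ` carrier D" using m \<psi>_carrier(2)[OF x(1), of 0 0] by auto
  qed (use \<phi>(1) in auto)
  ultimately show ?thesis by (auto simp: is_alg_iso_def alg_iso_def)
qed

text \<open>\<open>x u = (x e) u\<close>, and \<open>x e\<close> retains only the first column of
  \<open>x\<close>: the simple module is a space of columns of length \<open>m\<close> over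
  \<open>D\<close>.\<close>

lemma simple_decomp:
  assumes U: "simple_module R U" and u: "u \<in> carrier U" "u \<noteq> \<zero>\<^bsub>U\<^esub>" "e \<odot>\<^bsub>U\<^esub> u = u" and w: "w \<in> carrier U"
  shows "\<exists>\<delta>. \<delta> \<in> {..<m} \<rightarrow> carrier D \<and> w = (\<Oplus>\<^bsub>U\<^esub>i\<in>{..<m}. eu i 0 (\<delta> i) \<odot>\<^bsub>U\<^esub> u)"
proof -
  interpret U: left_module R U by (rule simple_module_left_module[OF U])
  obtain x where x: "x \<in> carrier R" "w = x \<odot>\<^bsub>U\<^esub> u" using simple_cyclic[OF U u(1,2) w] by auto
  let ?\<delta> = "\<lambda>i. \<psi> x $$ (i, 0)"
  have \<delta>: "?\<delta> i \<in> carrier D" if "i < m" for i using \<psi>_carrier(2)[OF x(1)] that m by simp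
  have "x \<otimes> e = (\<Oplus>i\<in>{..<m}. eu i 0 (?\<delta> i))"
  proof (rule \<psi>_eqI)
    fix k l assume kl: "k < m" "l < m"
    have "\<psi> (\<Oplus>i\<in>{..<m}. eu i 0 (?\<delta> i)) $$ (k, l) = (\<Oplus>\<^bsub>D\<^esub>i\<in>{..<m}. \<psi> (eu i 0 (?\<delta> i)) $$ (k, l))"
      using \<delta> kl by (intro \<psi>_finsum) (auto simp: eu)
    also have "\<dots> = (\<Oplus>\<^bsub>D\<^esub>i\<in>{..<m}. if i = k then (if l = 0 then ?\<delta> k else \<zero>\<^bsub>D\<^esub>) else \<zero>\<^bsub>D\<^esub>)"
      using \<delta> kl by (intro D.finsum_cong') (auto simp: eu)
    also have "\<dots> = (if l = 0 then ?\<delta> k else \<zero>\<^bsub>D\<^esub>)" using \<delta> kl by (intro D_delta) auto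
    also have "\<dots> = \<psi> (x \<otimes> e) $$ (k, l)"
      using mult_eu[OF x(1) D.one_closed, of 0 k l 0] kl m \<delta> by simp
    finally show "\<psi> (x \<otimes> e) $$ (k, l) = \<psi> (\<Oplus>i\<in>{..<m}. eu i 0 (?\<delta> i)) $$ (k, l)" ..
  qed (use x \<delta> in \<open>auto simp: eu intro!: R.finsum_closed\<close>)
  moreover have "w = (x \<otimes> e) \<odot>\<^bsub>U\<^esub> u" using x u by (simp add: U.smult_assoc eu)
  ultimately have "w = (\<Oplus>\<^bsub>U\<^esub>i\<in>{..<m}. eu i 0 (?\<delta> i) \<odot>\<^bsub>U\<^esub> u)"
    using \<delta> u by (simp add: U.finsum_smult eu Pi_def)
  then show ?thesis using \<delta> by (intro exI[of _ ?\<delta>]) auto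
qed

lemma simple_decomp_unique:
  assumes U: "simple_module R U" and u: "u \<in> carrier U" "u \<noteq> \<zero>\<^bsub>U\<^esub>" "e \<odot>\<^bsub>U\<^esub> u = u"
    and \<delta>: "\<And>i. i < m \<Longrightarrow> \<delta> i \<in> carrier D"
    and eq: "(\<Oplus>\<^bsub>U\<^esub>i\<in>{..<m}. eu i 0 (\<delta> i) \<odot>\<^bsub>U\<^esub> u) = \<zero>\<^bsub>U\<^esub>" and i: "i < m"
  shows "\<delta> i = \<zero>\<^bsub>D\<^esub>"
proof -
  note UL = simple_module_left_module[OF U]
  interpret U: left_module R U by (rule UL)
  let ?x = "\<Oplus>i\<in>{..<m}. eu i 0 (\<delta> i)"
  have x: "?x \<in> carrier R" using \<delta> by (auto simp: eu intro!: R.finsum_closed)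
  have "?x \<odot>\<^bsub>U\<^esub> u = \<zero>\<^bsub>U\<^esub>" using \<delta> u eq by (simp add: U.finsum_smult eu Pi_def)
  then have "?x \<otimes> e = \<zero>" using P.annihilator[OF UL u x] by simp
  then have "\<psi> (?x \<otimes> e) $$ (i, 0) = \<zero>\<^bsub>D\<^esub>" using i m by (simp add: \<psi>_zero)
  moreover have "\<psi> (?x \<otimes> e) $$ (i, 0) = \<psi> ?x $$ (i, 0)"
    using mult_eu[OF x D.one_closed, of 0 i 0 0] i m \<psi>_carrier(2)[OF x, of i 0] by simp
  moreover have "\<psi> ?x $$ (i, 0) = (\<Oplus>\<^bsub>D\<^esub>k\<in>{..<m}. \<psi> (eu k 0 (\<delta> k)) $$ (i, 0))"
    using \<delta> i m by (intro \<psi>_finsum) (auto simp: eu)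
  moreover have "\<dots> = (\<Oplus>\<^bsub>D\<^esub>k\<in>{..<m}. if k = i then \<delta> i else \<zero>\<^bsub>D\<^esub>)"
    using \<delta> i m by (intro D.finsum_cong') (auto simp: eu)
  moreover have "\<dots> = \<delta> i" using \<delta> i by (intro D_delta) auto
  ultimately show ?thesis by simp
qed

end


section \<open>The endomorphism algebra in coordinates\<close>

lemma additive_finsum:
  assumes G: "abelian_group G" and H: "abelian_group H"
    and closed: "\<And>x. x \<in> carrier G \<Longrightarrow> f x \<in> carrier H"
    and add: "\<And>x y. x \<in> carrier G \<Longrightarrow> y \<in> carrier G \<Longrightarrow> f (x \<oplus>\<^bsub>G\<^esub> y) = f x \<oplus>\<^bsub>H\<^esub> f y"
    and g: "\<And>i. i \<in> I \<Longrightarrow> g i \<in> carrier G"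
  shows "f (finsum G g I) = finsum H (\<lambda>i. f (g i)) I"
proof -
  interpret G: abelian_group G by fact
  interpret H: abelian_group H by fact
  have zero: "f \<zero>\<^bsub>G\<^esub> = \<zero>\<^bsub>H\<^esub>"
    using add[of "\<zero>\<^bsub>G\<^esub>" "\<zero>\<^bsub>G\<^esub>"] closed[of "\<zero>\<^bsub>G\<^esub>"] by (simp add: H.add.r_cancel_one')
  show ?thesis using g
  proof (induct I rule: infinite_finite_induct)
    case (insert x F)
    then have g: "g \<in> F \<rightarrow> carrier G" "g x \<in> carrier G" by auto
    then have fg: "(\<lambda>i. f (g i)) \<in> F \<rightarrow> carrier H" "f (g x) \<in> carrier H" using closed by auto
    have "f (finsum G g (insert x F)) = f (g x) \<oplus>\<^bsub>H\<^esub> f (finsum G g F)"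
      using insert(1,2) g add[OF g(2) G.finsum_closed[OF g(1)]] by (simp add: G.finsum_insert)
    also have "f (finsum G g F) = finsum H (\<lambda>i. f (g i)) F" by (rule insert(3)) (use insert(4) in auto)
    also have "f (g x) \<oplus>\<^bsub>H\<^esub> \<dots> = finsum H (\<lambda>i. f (g i)) (insert x F)"
      using insert(1,2) fg by (simp add: H.finsum_insert)
    finally show ?case .
  qed (auto simp: zero G.finsum_infinite H.finsum_infinite)
qed

lemma vspace_abelian_group: "vspace V \<Longrightarrow> abelian_group V"
proof -
  assume "vspace V"
  then interpret vspace V .
  show ?thesis by unfold_locales
qed

text \<open>\<open>E\<close> and \<open>x\<close> generate the algebra, so linearity over
  \<open>E\<close> and commutation with \<open>x\<close> suffice.\<close>

lemma (in kummer) semilinear_module_hom: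
  fixes U :: "('e poly set, 'u) module" and U' :: "('e poly set, 'w) module"
  assumes U: "left_module alg U" and U': "left_module alg U'"
    and f: "\<And>u. u \<in> carrier U \<Longrightarrow> f u \<in> carrier U'"
      "\<And>u w. u \<in> carrier U \<Longrightarrow> w \<in> carrier U \<Longrightarrow> f (u \<oplus>\<^bsub>U\<^esub> w) = f u \<oplus>\<^bsub>U'\<^esub> f w"
      "\<And>u e. u \<in> carrier U \<Longrightarrow> f (aemb e \<odot>\<^bsub>U\<^esub> u) = aemb e \<odot>\<^bsub>U'\<^esub> f u"
      "\<And>u. u \<in> carrier U \<Longrightarrow> f (ax \<odot>\<^bsub>U\<^esub> u) = ax \<odot>\<^bsub>U'\<^esub> f u"
  shows "f \<in> LinearCombinations.module_hom alg U U'"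
proof -
  interpret U: left_module alg U by (rule U)
  interpret U': left_module alg U' by (rule U')
  interpret C: cyclic_module n q s a \<iota> h \<sigma> U by unfold_locales
  interpret C': cyclic_module n q s a \<iota> h \<sigma> U' by unfold_locales
  have "f (cls p \<odot>\<^bsub>U\<^esub> u) = cls p \<odot>\<^bsub>U'\<^esub> f u" if "u \<in> carrier U" for p u
    using that
  proof (induct p arbitrary: u)
    case 0
    have "f \<zero>\<^bsub>U\<^esub> = \<zero>\<^bsub>U'\<^esub>"
      using f(2)[of "\<zero>\<^bsub>U\<^esub>" "\<zero>\<^bsub>U\<^esub>"] f(1)[of "\<zero>\<^bsub>U\<^esub>"] by (simp add: U'.M.add.r_cancel_one')
    then show ?case using C.smult_zero[OF 0] C'.smult_zero[OF f(1)[OF 0]] by (simp add: alg_simps)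
  next
    case (pCons e p)
    have x: "ax \<odot>\<^bsub>U\<^esub> u \<in> carrier U" using pCons(3) by (simp add: U.smult_closed aemb_simps)
    have c: "cls p \<odot>\<^bsub>U\<^esub> (ax \<odot>\<^bsub>U\<^esub> u) \<in> carrier U" "aemb e \<odot>\<^bsub>U\<^esub> u \<in> carrier U"
      using x pCons(3) by (simp_all add: U.smult_closed aemb_simps)
    show ?case
      unfolding C.cls_smult_pCons[OF pCons(3)] C'.cls_smult_pCons[OF f(1)[OF pCons(3)]]
      by (simp only: f(2)[OF c(2,1)] f(3)[OF pCons(3)] pCons(2)[OF x] f(4)[OF pCons(3)])
  qed
  with f show ?thesis by (auto simp: LinearCombinations.module_hom_def alg_simps)
qed

text \<open>Linearity over \<open>E\<close> makes an endomorphism right multiplication by a matrix;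
  commuting with \<open>x\<close> is exactly the equation that defines \<open>D_set\<close>.\<close>

lemma (in cyclic_module) right_act_iso:
  assumes b: "family_basis V {..<d} b" and A: "is_structure_matrix V xact d b A" and d: "0 < d"
  shows "right_act V d b \<in> alg_iso (D_alg \<iota> \<sigma> d A) (End_right alg U)"
proof -
  have Ac: "A \<in> carrier_mat d d" using A by (simp add: is_structure_matrix_def)
  interpret N: norm_matrix n q s a \<iota> h \<sigma> d A
    by unfold_locales (rule d Ac sl.structure_matrix_norm[OF b A])+
  have UL: "left_module alg U" by unfold_locales
  let ?K = "comb V d b" and ?End = "End_right alg U" and ?D = "D_alg \<iota> \<sigma> d A"
  let ?I = "inv_into (carrier_vec d) ?K"
  note bij = Vsp.comb_bij[OF b]
  have K: "?K v \<in> carrier U" for v using Vsp.comb_closed[OF b, of v] by (simp add: V_simps)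
  have IK: "?I (?K v) = v" if "v \<in> carrier_vec d" for v
    using bij that by (simp add: bij_betw_def inv_into_f_f)
  have I: "?I w \<in> carrier_vec d" "?K (?I w) = w" if "w \<in> carrier U" for w
    using bij that by (auto simp: bij_betw_def V_simps inv_into_into f_inv_into_f)
  have K_add: "?K (v + w) = ?K v \<oplus>\<^bsub>U\<^esub> ?K w" if "v \<in> carrier_vec d" "w \<in> carrier_vec d" for v w
    using Vsp.comb_add[OF b that] by (simp add: V_simps)
  have K_smult: "?K (e \<cdot>\<^sub>v v) = aemb e \<odot>\<^bsub>U\<^esub> ?K v" if "v \<in> carrier_vec d" for v e
    using Vsp.comb_smult[OF b that] by (simp add: V_simps)
  have K_T: "?K (Tm A v) = ax \<odot>\<^bsub>U\<^esub> ?K v" if "v \<in> carrier_vec d" for v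
    using sl.comb_Tm[OF b A that] .
  have I_eq: "?I w = v" if "?K v = w" "v \<in> carrier_vec d" for v w using IK[OF that(2)] that(1) by simp
  have I_add: "?I (w \<oplus>\<^bsub>U\<^esub> w') = ?I w + ?I w'" if "w \<in> carrier U" "w' \<in> carrier U" for w w'
    by (rule I_eq) (use that I K_add in auto)
  have I_smult: "?I (aemb e \<odot>\<^bsub>U\<^esub> w) = e \<cdot>\<^sub>v ?I w" if "w \<in> carrier U" for w e
    by (rule I_eq) (use that I K_smult in auto)
  have Tc: "Tm A v \<in> carrier_vec d" for v using rvm_closed[OF Ac] by (simp add: Tm_def)
  have I_T: "?I (ax \<odot>\<^bsub>U\<^esub> w) = Tm A (?I w)" if "w \<in> carrier U" for w
    by (rule I_eq) (use that I K_T Tc in auto)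
  have ra: "right_act V d b M w = ?K (rvm (?I w) M)" if "w \<in> carrier U" for M w
    using that by (simp add: right_act_def rvm_def V_simps)
  have ra_ext: "right_act V d b M \<in> extensional (carrier U)" for M
    by (simp add: right_act_def V_simps)
  have ra_End: "right_act V d b M \<in> carrier ?End" if M: "M \<in> N.D" for M
  proof -
    have Mc: "M \<in> carrier_mat d d" by (rule N.D_carrier[OF M])
    have "right_act V d b M \<in> LinearCombinations.module_hom alg U U"
    proof (rule semilinear_module_hom[OF UL UL])
      fix w assume w: "w \<in> carrier U"
      show "right_act V d b M w \<in> carrier U" by (simp add: ra[OF w] K)
      fix e
      have ew: "aemb e \<odot>\<^bsub>U\<^esub> w \<in> carrier U" "ax \<odot>\<^bsub>U\<^esub> w \<in> carrier U" using w by (simp_all add: smult_closed aemb_simps)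
      show "right_act V d b M (aemb e \<odot>\<^bsub>U\<^esub> w) = aemb e \<odot>\<^bsub>U\<^esub> right_act V d b M w"
        by (simp only: ra[OF w] ra[OF ew(1)] I_smult[OF w] rvm_smult_left[OF Mc I(1)[OF w]] K_smult[OF rvm_closed[OF Mc]])
      show "right_act V d b M (ax \<odot>\<^bsub>U\<^esub> w) = ax \<odot>\<^bsub>U\<^esub> right_act V d b M w"
        by (simp only: ra[OF w] ra[OF ew(2)] I_T[OF w] N.Tm_D[OF M I(1)[OF w], symmetric] K_T[OF rvm_closed[OF Mc]])
    next
      fix w w' assume w: "w \<in> carrier U" "w' \<in> carrier U"
      have c: "w \<oplus>\<^bsub>U\<^esub> w' \<in> carrier U" using w by simp
      show "right_act V d b M (w \<oplus>\<^bsub>U\<^esub> w') = right_act V d b M w \<oplus>\<^bsub>U\<^esub> right_act V d b M w'"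
        by (simp only: ra[OF w(1)] ra[OF w(2)] ra[OF c] I_add[OF w]
            rvm_add_left[OF Mc I(1)[OF w(1)] I(1)[OF w(2)]] K_add[OF rvm_closed[OF Mc] rvm_closed[OF Mc]])
    qed
    then show ?thesis using ra_ext by (simp add: End_right_def)
  qed
  have "right_act V d b \<in> alg_hom ?D ?End"
  proof (rule alg_homI; (simp only: N.D_alg_simps)?)
    fix M N assume M: "M \<in> N.D" and N: "N \<in> N.D"
    note c = N.D_carrier[OF M] N.D_carrier[OF N]
    have "right_act V d b (M * N) w = (right_act V d b M \<otimes>\<^bsub>?End\<^esub> right_act V d b N) w" for w
    proof (cases "w \<in> carrier U")
      case True
      have "right_act V d b N (right_act V d b M w) = ?K (rvm (rvm (?I w) M) N)"
        unfolding ra[OF True] ra[OF K] IK[OF rvm_closed[OF c(1)]] ..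
      also have "\<dots> = right_act V d b (M * N) w"
        unfolding ra[OF True] rvm_simps(5)[OF c I(1)[OF True] I(1)[OF True]] ..
      finally show ?thesis using True by (simp add: End_right_def compose_def)
    qed (simp add: End_right_def compose_def right_act_def V_simps)
    then show "right_act V d b (M * N) = right_act V d b M \<otimes>\<^bsub>?End\<^esub> right_act V d b N" by (rule ext)
    have "right_act V d b (M + N) w = (right_act V d b M \<oplus>\<^bsub>?End\<^esub> right_act V d b N) w" for w
    proof (cases "w \<in> carrier U")
      case True
      have "right_act V d b (M + N) w = right_act V d b M w \<oplus>\<^bsub>U\<^esub> right_act V d b N w"
        unfolding ra[OF True] rvm_simps(2)[OF c I(1)[OF True] I(1)[OF True]]
        by (rule K_add[OF rvm_closed[OF c(1)] rvm_closed[OF c(2)]])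
      then show ?thesis using True by (simp add: End_right_def)
    qed (simp add: End_right_def right_act_def V_simps)
    then show "right_act V d b (M + N) = right_act V d b M \<oplus>\<^bsub>?End\<^esub> right_act V d b N" by (rule ext)
  next
    have "right_act V d b (1\<^sub>m d) w = \<one>\<^bsub>?End\<^esub> w" for w
    proof (cases "w \<in> carrier U")
      case True
      then show ?thesis
        unfolding ra[OF True] rvm_simps(6)[OF Ac Ac I(1)[OF True] I(1)[OF True]]
        by (simp add: I(2) End_right_def)
    qed (simp add: End_right_def right_act_def V_simps)
    then show "right_act V d b (1\<^sub>m d) = \<one>\<^bsub>?End\<^esub>" by (rule ext)
  next
    fix c M assume M: "M \<in> N.D"
    note Mc = N.D_carrier[OF M]
    have "right_act V d b (\<iota> c \<cdot>\<^sub>m M) w = (c \<odot>\<^bsub>?End\<^esub> right_act V d b M) w" for w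
    proof (cases "w \<in> carrier U")
      case True
      have "right_act V d b (\<iota> c \<cdot>\<^sub>m M) w = aemb (\<iota> c) \<odot>\<^bsub>U\<^esub> right_act V d b M w"
        unfolding ra[OF True] rvm_simps(4)[OF Mc Mc I(1)[OF True] I(1)[OF True]]
        by (rule K_smult[OF rvm_closed[OF Mc]])
      moreover have "c \<odot>\<^bsub>alg\<^esub> \<one>\<^bsub>alg\<^esub> = aemb (\<iota> c)" using alg_ring by (simp add: alg_simps(6) aemb_simps ring.ring_simprules)
      ultimately show ?thesis using True by (simp add: End_right_def)
    qed (simp add: End_right_def right_act_def V_simps)
    then show "right_act V d b (\<iota> c \<cdot>\<^sub>m M) = c \<odot>\<^bsub>?End\<^esub> right_act V d b M" by (rule ext)
  qed (rule ra_End)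
  moreover have "bij_betw (right_act V d b) (carrier ?D) (carrier ?End)"
    unfolding bij_betw_def N.D_alg_simps
  proof (intro conjI equalityI subsetI inj_onI)
    fix M N assume M: "M \<in> N.D" and N: "N \<in> N.D" and eq: "right_act V d b M = right_act V d b N"
    show "M = N"
    proof (rule rvm_ext[OF N.D_carrier[OF M] N.D_carrier[OF N]])
      fix v :: "'e vec" assume v: "v \<in> carrier_vec d"
      have "?K (rvm v M) = ?K (rvm v N)"
        using fun_cong[OF eq, of "?K v"] unfolding ra[OF K] IK[OF v] .
      then have "?I (?K (rvm v M)) = ?I (?K (rvm v N))" by simp
      then show "rvm v M = rvm v N"
        unfolding IK[OF rvm_closed[OF N.D_carrier[OF M]]] IK[OF rvm_closed[OF N.D_carrier[OF N]]] .
    qed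
  next
    fix f assume f: "f \<in> carrier ?End"
    then have fh: "f w \<in> carrier U" "f (w \<oplus>\<^bsub>U\<^esub> w') = f w \<oplus>\<^bsub>U\<^esub> f w'" "f (r \<odot>\<^bsub>U\<^esub> w) = r \<odot>\<^bsub>U\<^esub> f w"
      if "w \<in> carrier U" "w' \<in> carrier U" "r \<in> carrier alg" for w w' r
      using that by (auto simp: End_right_def LinearCombinations.module_hom_def)
    have fext: "f \<in> extensional (carrier U)" using f by (simp add: End_right_def)
    note ec = aemb_simps(1,2)
    have "\<exists>M \<in> carrier_mat d d. \<forall>v\<in>carrier_vec d. ?I (f (?K v)) = rvm v M"
    proof (rule linear_vec_eq_rvm)
      fix v w :: "'e vec" and e assume v: "v \<in> carrier_vec d"
      show "?I (f (?K v)) \<in> carrier_vec d" by (rule I(1)[OF fh(1)[OF K K ec(2)]])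
      show "?I (f (?K (e \<cdot>\<^sub>v v))) = e \<cdot>\<^sub>v ?I (f (?K v))"
        by (simp only: K_smult[OF v] fh(3)[OF K K ec(1)] I_smult[OF fh(1)[OF K K ec(2)]])
      assume w: "w \<in> carrier_vec d"
      show "?I (f (?K (v + w))) = ?I (f (?K v)) + ?I (f (?K w))"
        by (simp only: K_add[OF v w] fh(2)[OF K K ec(2)] I_add[OF fh(1)[OF K K ec(2)] fh(1)[OF K K ec(2)]])
    qed
    then obtain M where M: "M \<in> carrier_mat d d" "\<And>v. v \<in> carrier_vec d \<Longrightarrow> ?I (f (?K v)) = rvm v M" by auto
    have "map_mat \<sigma> M * A = A * M"
    proof (rule rvm_ext)
      fix v :: "'e vec" assume v: "v \<in> carrier_vec d"
      \<comment> \<open>The preimage of \<open>v\<close> under \<sigma>, so that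
        \<open>Tm A w\<close> is \<open>v A\<close>: every row vector arises as a twisted
        one.\<close>
      define w where "w = map_vec (\<sigma> ^^ (n - 1)) v"
      have w: "w \<in> carrier_vec d" using v by (simp add: w_def)
      have vw: "v = map_vec \<sigma> w"
      proof (rule eq_vecI)
        fix i assume "i < dim_vec (map_vec \<sigma> w)"
        then have "i < dim_vec v" by (simp add: w_def)
        moreover have "\<sigma> ((\<sigma> ^^ (n - 1)) (v $ i)) = v $ i"
          using \<sigma>_pow_n[of "v $ i"] n_pos by (cases n) auto
        ultimately show "v $ i = map_vec \<sigma> w $ i" by (simp add: w_def)
      qed (simp add: w_def)
      have "rvm (Tm A w) M = ?I (f (?K (Tm A w)))" by (rule M(2)[OF Tc, symmetric])
      also have "\<dots> = Tm A (rvm w M)"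
        by (simp only: K_T[OF w] fh(3)[OF K K ec(2)] I_T[OF fh(1)[OF K K ec(2)]] M(2)[OF w])
      finally have "rvm (rvm v A) M = rvm (rvm v (map_mat \<sigma> M)) A"
        unfolding Tm_def map_vec_rvm[OF M(1) w] vw .
      then show "rvm v (map_mat \<sigma> M * A) = rvm v (A * M)"
        using rvm_simps(5)[OF Ac M(1) v v] rvm_simps(5)[OF _ Ac v v, of "map_mat \<sigma> M"] M(1) by simp
    qed (use Ac M(1) in auto)
    with M(1) have MD: "M \<in> N.D" by (simp add: N.D_iff)
    have "f w = right_act V d b M w" for w
    proof (cases "w \<in> carrier U")
      case True
      have "right_act V d b M w = ?K (?I (f (?K (?I w))))"
        unfolding ra[OF True] M(2)[OF I(1)[OF True]] ..
      also have "\<dots> = f w" unfolding I(2)[OF True] by (rule I(2)[OF fh(1)[OF True True ec(2)]])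
      finally show ?thesis ..
    next
      case False
      then show ?thesis using fext ra_ext[of M] by (simp add: extensional_def)
    qed
    then have "f = right_act V d b M" by (rule ext)
    then show "f \<in> right_act V d b ` N.D" using MD by (rule image_eqI)
  qed (use ra_End in auto)
  ultimately show ?thesis by (simp add: alg_iso_def)
qed

section \<open>A matrix of minimal size\<close>

lemma (in semilinear) restrict_semilinear:
  assumes H: "Module.submodule H (class_ring :: 'e ring) V" and T: "\<And>v. v \<in> H \<Longrightarrow> T v \<in> H"
  shows "semilinear n q s a \<iota> h \<sigma> (V\<lparr>carrier := H\<rparr>) T t"
proof -
  interpret H: vspace "V\<lparr>carrier := H\<rparr>" by (rule subspace_vspace[OF H])
  have HV: "v \<in> carrier V" if "v \<in> H" for v using submoduleE(1)[of H] H that by auto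
  show ?thesis by unfold_locales (auto simp: t_neq_0 T T_add T_smult T_pow HV)
qed

context norm_matrix
begin

abbreviation "U \<equiv> rep.umod"

lemma U_left_module: "left_module alg U" by (rule rep.umod_left_module[OF refl])

lemma U_simps:
  "carrier U = carrier_vec d" "\<zero>\<^bsub>U\<^esub> = 0\<^sub>v d" "u \<oplus>\<^bsub>U\<^esub> w = u + w"
  "v \<in> carrier_vec d \<Longrightarrow> cls p \<odot>\<^bsub>U\<^esub> v = rep.act p v"
  "v \<in> carrier_vec d \<Longrightarrow> aemb e \<odot>\<^bsub>U\<^esub> v = e \<cdot>\<^sub>v v" "v \<in> carrier_vec d \<Longrightarrow> ax \<odot>\<^bsub>U\<^esub> v = Tm A v"
  by (simp_all add: rep.umod_simps rep.umod_smult module_vec_simps aemb_def ax_def rep.act_const rep.act_x)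

lemma submodule_iff_subspace:
  assumes H: "Module.submodule H alg U"
  shows "Module.submodule H (class_ring :: 'e ring) (module_vec TYPE('e) d)" "v \<in> H \<Longrightarrow> Tm A v \<in> H"
proof -
  interpret H: Module.submodule H alg U by (rule H)
  interpret UL: left_module alg U by (rule U_left_module)
  have sub: "v \<in> H \<Longrightarrow> v \<in> carrier_vec d" for v using H.subset by (auto simp: U_simps)
  have smult: "e \<cdot>\<^sub>v v \<in> H" if "v \<in> H" for e v
    using H.smult_closed[OF aemb_simps(1) that, of e] sub[OF that] by (simp add: U_simps)
  show "Module.submodule H (class_ring :: 'e ring) (module_vec TYPE('e) d)"
  proof (rule rep.submoduleI; (simp only: module_vec_simps)?)
    fix v assume v: "v \<in> H"
    have "\<ominus>\<^bsub>module_vec TYPE('e) d\<^esub> v = (- 1) \<cdot>\<^sub>v v"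
      using sub[OF v] rep.smult_l_minus[of v 1] rep.smult_one[of v] by (simp add: module_vec_simps)
    with smult[OF v] show "\<ominus>\<^bsub>module_vec TYPE('e) d\<^esub> v \<in> H" by simp
  next
    show "H \<subseteq> carrier_vec d" using sub by auto
    show "0\<^sub>v d \<in> H" using H.one_closed by (simp add: U_simps)
    show "v + w \<in> H" if "v \<in> H" "w \<in> H" for v w
      using H.m_closed[OF that] by (simp add: U_simps)
  qed (auto intro: smult)
  show "v \<in> H \<Longrightarrow> Tm A v \<in> H"
    using H.smult_closed[OF aemb_simps(2), of v] sub[of v] by (simp add: U_simps)
qed

text \<open>A nonzero submodule is a space of some dimension \<open>k\<close> stable under
  \<open>x\<close>. Its structure matrix has norm \<open>a\<close>, so minimality leaves only
  \<open>k = d\<close>.\<close>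

lemma simple_if_minimal:
  assumes min: "\<And>k B. 0 < k \<Longrightarrow> k < d \<Longrightarrow> B \<in> carrier_mat k k \<Longrightarrow> twisted_norm \<sigma> n B \<noteq> \<iota> a \<cdot>\<^sub>m 1\<^sub>m k"
  shows "simple_module alg U"
  unfolding simple_module_def
proof (intro conjI U_left_module allI impI)
  have "unit_vec d 0 \<in> carrier U" "unit_vec d 0 \<noteq> (0\<^sub>v d :: 'e vec)" using d_pos by (auto simp: U_simps)
  then show "carrier U \<noteq> {\<zero>\<^bsub>U\<^esub>}" by (auto simp: U_simps(2))
  fix H assume "Module.submodule H alg U"
  note H = submodule_iff_subspace[OF this]
  note dim = rep.family_basis_dim[OF family_basis_module_vec]
  from rep.subspace_basis[OF H(1) dim(1)] obtain k :: nat and b where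
    kb: "k \<le> d" "family_basis (module_vec TYPE('e) d\<lparr>carrier := H\<rparr>) {..<k} b" "k = d \<longrightarrow> H = carrier_vec d"
    using dim(2) by (auto simp: module_vec_simps)
  interpret S: semilinear n q s a \<iota> h \<sigma> "module_vec TYPE('e) d\<lparr>carrier := H\<rparr>" "Tm A" "\<iota> a"
    by (rule rep.restrict_semilinear[OF H])
  show "H = {\<zero>\<^bsub>U\<^esub>} \<or> H = carrier U"
  proof (cases "k = 0")
    case True
    have "v = 0\<^sub>v d" if "v \<in> H" for v
      using family_basisD(3)[OF kb(2), of v] that True by (simp add: module_vec_simps)
    moreover have "0\<^sub>v d \<in> H" using S.zero_closed by (simp add: module_vec_simps)
    ultimately have "H = {0\<^sub>v d}" by blast
    then show ?thesis by (simp only: U_simps(2) simp_thms)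
  next
    case False
    obtain B where B: "is_structure_matrix (module_vec TYPE('e) d\<lparr>carrier := H\<rparr>) (Tm A) k b B"
      using S.structure_matrix_exists[OF kb(2)] by auto
    have "\<not> k < d" using min[of k B] False S.structure_matrix_norm[OF kb(2) B] B by (auto simp: is_structure_matrix_def)
    with kb(1,3) show ?thesis by (simp add: U_simps)
  qed
qed

text \<open>The actions of the cyclic algebra and of \<open>D\<close> commute because those of
  \<open>x\<close> and of \<open>D\<close> do.\<close>

lemma act_rvm:
  assumes M: "M \<in> D" and "v \<in> carrier_vec d" shows "rep.act p (rvm v M) = rvm (rep.act p v) M"
  using assms(2)
proof (induct p arbitrary: v)
  case (pCons e p)
  note Mc = D_carrier[OF M]
  have c: "Tm A v \<in> carrier_vec d" using rvm_closed[OF A] by (simp add: Tm_def)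
  have ac: "rep.act p (Tm A v) \<in> carrier_vec d" using rep.act_closed[of "Tm A v" p] c by (simp add: module_vec_simps)
  show ?case
    using pCons(2)[OF c] rep.act_pCons[of v e p] rep.act_pCons[of "rvm v M" e p] pCons(3) rvm_closed[OF Mc, of v]
      rvm_add_left[OF Mc smult_carrier_vec[THEN iffD2, OF pCons(3)] ac, of e] rvm_smult_left[OF Mc pCons(3), of e]
    by (simp add: module_vec_simps Tm_D[OF M pCons(3)])
qed (use rep.act_0 rvm_closed[OF D_carrier[OF M]] rvm_simps(8)[OF D_carrier[OF M] D_carrier[OF M]] in \<open>auto simp: module_vec_simps\<close>)

text \<open>Schur's lemma: the kernel of right multiplication by \<open>M\<close> is a submodule, so
  a nonzero \<open>M\<close> is an invertible matrix.\<close>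

lemma division_if_simple:
  assumes simple: "simple_module alg U" shows "central_division (D_alg \<iota> \<sigma> d A)"
proof -
  have inv: "\<exists>N\<in>D. N * M = 1\<^sub>m d \<and> M * N = 1\<^sub>m d" if M: "M \<in> D" and nz: "M \<noteq> 0\<^sub>m d d" for M
  proof -
    note Mc = D_carrier[OF M]
    let ?H = "{v \<in> carrier_vec d. rvm v M = 0\<^sub>v d}"
    interpret UL: left_module alg U by (rule U_left_module)
    note act = act_rvm[OF M]
    have "Module.submodule ?H alg U"
    proof (intro Module.submodule.intro Module.submodule_axioms.intro UL.M.add.subgroupI)
      show "?H \<noteq> {}" using rvm_simps(8)[OF Mc Mc, of "0\<^sub>v d" "0\<^sub>v d"] by (auto intro: exI[of _ "0\<^sub>v d"])
      fix v assume v: "v \<in> ?H"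
      have e: "aemb (- 1) \<odot>\<^bsub>U\<^esub> v = \<ominus>\<^bsub>U\<^esub> v"
      proof (rule UL.M.minus_equality[symmetric])
        show "aemb (- 1) \<odot>\<^bsub>U\<^esub> v \<oplus>\<^bsub>U\<^esub> v = \<zero>\<^bsub>U\<^esub>" using v by (auto simp: U_simps intro!: eq_vecI)
      qed (use v in \<open>auto simp: U_simps\<close>)
      have "rvm (- 1 \<cdot>\<^sub>v v) M = 0\<^sub>v d" using v rvm_smult_left[OF Mc, of v "- 1"] by (auto intro!: eq_vecI)
      then show "\<ominus>\<^bsub>U\<^esub> v \<in> ?H" unfolding e[symmetric] using v by (simp add: U_simps)
      fix w assume "w \<in> ?H"
      with v show "v \<oplus>\<^bsub>U\<^esub> w \<in> ?H" using rvm_add_left[OF Mc, of v w] by (simp add: U_simps)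
    next
      fix r v assume "r \<in> carrier alg" and v: "v \<in> ?H"
      then obtain p where p: "r = cls p" by (auto simp: alg_simps)
      have z: "rep.act p (0\<^sub>v d) = 0\<^sub>v d"
        using UL.smult_zero[OF aemb_simps(3), of p] by (simp add: U_simps)
      have "rep.act p v \<in> carrier_vec d" using rep.act_closed[of v p] v by (simp add: module_vec_simps)
      moreover have "rvm (rep.act p v) M = 0\<^sub>v d" using act[of v p] v z by simp
      ultimately show "r \<odot>\<^bsub>U\<^esub> v \<in> ?H" using v p by (simp add: U_simps)
    qed (auto simp: U_simps)
    then have "?H = {0\<^sub>v d} \<or> ?H = carrier_vec d" using simple by (simp add: simple_module_def U_simps)
    moreover have "?H \<noteq> carrier_vec d"
    proof
      assume all: "?H = carrier_vec d"
      have "M = 0\<^sub>m d d"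
      proof (rule rvm_ext[OF Mc])
        fix v :: "'e vec" assume v: "v \<in> carrier_vec d"
        then have "v \<in> ?H" using all by simp
        then show "rvm v M = rvm v (0\<^sub>m d d)" using rvm_simps(7)[OF Mc Mc v v] by simp
      qed simp
      with nz show False by simp
    qed
    ultimately have ker: "?H = {0\<^sub>v d}" by auto
    have Mt: "transpose_mat M \<in> carrier_mat d d" using Mc by simp
    have "det (transpose_mat M) \<noteq> 0"
    proof
      assume "det (transpose_mat M) = 0"
      then obtain v where "v \<in> carrier_vec d" "v \<noteq> 0\<^sub>v d" "transpose_mat M *\<^sub>v v = 0\<^sub>v d"
        using det_0_iff_vec_prod_zero_field[OF Mt] by auto
      then have "v \<in> ?H" "v \<noteq> 0\<^sub>v d" by (auto simp: rvm_def)
      with ker show False by auto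
    qed
    then have "det M \<noteq> 0" using det_transpose[OF Mc] by simp
    from det_non_zero_imp_unit[OF Mc this, of "()"] obtain N where
      N: "N \<in> carrier_mat d d" "N * M = 1\<^sub>m d" "M * N = 1\<^sub>m d" by (auto simp: Units_def ring_mat_simps)
    \<comment> \<open>The inverse again lies in \<open>D\<close>: insert \<open>M N = 1\<close>,
      move \<open>A\<close> past \<open>M\<close>, and cancel
      \<open>\<sigma>(N M) = 1\<close>.\<close>
    have "map_mat \<sigma> N * A = map_mat \<sigma> N * (A * (M * N))" using N A by simp
    also have "\<dots> = map_mat \<sigma> N * (A * M) * N" using N Mc A by (simp add: assoc_mult_mat[of _ d d _ d _ d])
    also have "A * M = map_mat \<sigma> M * A" using M by (simp add: D_iff)
    also have "map_mat \<sigma> N * (map_mat \<sigma> M * A) = map_mat \<sigma> (N * M) * A"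
      using N(1) Mc A by (simp add: map_mat_mult'[OF N(1) Mc] assoc_mult_mat[of _ d d _ d _ d])
    also have "\<dots> * N = A * N" using N A by (simp add: map_mat_simps)
    finally have "N \<in> D" using N by (simp add: D_iff)
    with N show ?thesis by auto
  qed
  have "0\<^sub>m d d \<noteq> (1\<^sub>m d :: 'e mat)"
  proof
    assume "0\<^sub>m d d = (1\<^sub>m d :: 'e mat)"
    then have "(0\<^sub>m d d :: 'e mat) $$ (0, 0) = 1\<^sub>m d $$ (0, 0)" by simp
    then show False using d_pos by simp
  qed
  moreover have "N * 0\<^sub>m d d = 0\<^sub>m d d" if "N \<in> D" for N using D_carrier[OF that] by simp
  ultimately have "Units (D_alg \<iota> \<sigma> d A) = D - {0\<^sub>m d d}"
    using inv unfolding Units_def D_alg_simps by auto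
  then show ?thesis using D_F_algebra D_central by (simp add: central_division_def D_alg_simps)
qed

end


section \<open>A right basis over the division algebra\<close>

context norm_matrix
begin

abbreviation "W \<equiv> module_vec TYPE('e) d"

text \<open>\<open>E^d\<close> as a right vector space over \<open>D\<close>: coefficients stand to
  the right of the vectors and so commute with the action of the cyclic algebra.\<close>

abbreviation "right_comb I b \<Lambda> \<equiv> finsum W (\<lambda>i. rvm (b i) (\<Lambda> i)) I"

lemma right_comb_closed: "(\<And>i. i \<in> I \<Longrightarrow> \<Lambda> i \<in> D) \<Longrightarrow> right_comb I b \<Lambda> \<in> carrier_vec d"
  using rep.finsum_closed[of "\<lambda>i. rvm (b i) (\<Lambda> i)" I] rvm_closed[OF D_carrier]
  by (auto simp: module_vec_simps)

lemma rvm_finsum_W: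
  assumes "M \<in> carrier_mat d d" "\<And>i. i \<in> I \<Longrightarrow> f i \<in> carrier_vec d"
  shows "rvm (finsum W f I) M = finsum W (\<lambda>i. rvm (f i) M) I"
  by (rule additive_finsum[where f = "\<lambda>v. rvm v M", OF vspace_abelian_group vspace_abelian_group])
    (use assms rvm_closed[OF assms(1)] rvm_add_left[OF assms(1)] in \<open>simp_all add: module_vec_vspace module_vec_simps\<close>)

lemma right_comb_rvm:
  assumes M: "M \<in> D" and L: "\<And>i. i \<in> I \<Longrightarrow> \<Lambda> i \<in> D" and b: "\<And>i. i \<in> I \<Longrightarrow> b i \<in> carrier_vec d"
  shows "rvm (right_comb I b \<Lambda>) M = right_comb I b (\<lambda>i. \<Lambda> i * M)"
proof -
  have "rvm (right_comb I b \<Lambda>) M = finsum W (\<lambda>i. rvm (rvm (b i) (\<Lambda> i)) M) I"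
    by (rule rvm_finsum_W[OF D_carrier[OF M]]) (rule rvm_closed[OF D_carrier[OF L]])
  also have "\<dots> = right_comb I b (\<lambda>i. \<Lambda> i * M)"
    by (rule rep.finsum_cong')
      (use rvm_simps(5)[OF D_carrier[OF L] D_carrier[OF M] b b] rvm_closed[OF D_carrier[OF D_closed(4)[OF L M]]] in
        \<open>auto simp: module_vec_simps\<close>)
  finally show ?thesis .
qed

lemma right_comb_add:
  assumes "\<And>i. i \<in> I \<Longrightarrow> \<Lambda> i \<in> D" "\<And>i. i \<in> I \<Longrightarrow> \<Lambda>' i \<in> D" and b: "\<And>i. i \<in> I \<Longrightarrow> b i \<in> carrier_vec d"
  shows "right_comb I b \<Lambda> + right_comb I b \<Lambda>' = right_comb I b (\<lambda>i. \<Lambda> i + \<Lambda>' i)"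
proof -
  note c = D_carrier[OF assms(1)] D_carrier[OF assms(2)]
  have "right_comb I b (\<lambda>i. \<Lambda> i + \<Lambda>' i) = finsum W (\<lambda>i. rvm (b i) (\<Lambda> i) \<oplus>\<^bsub>W\<^esub> rvm (b i) (\<Lambda>' i)) I"
    by (rule rep.finsum_cong')
      (use rvm_simps(2)[OF c b b] rvm_closed[OF c(1)] rvm_closed[OF c(2)] in \<open>auto simp: module_vec_simps\<close>)
  also have "\<dots> = right_comb I b \<Lambda> \<oplus>\<^bsub>W\<^esub> right_comb I b \<Lambda>'"
    by (rule rep.finsum_addf) (use rvm_closed[OF c(1)] rvm_closed[OF c(2)] in \<open>auto simp: module_vec_simps\<close>)
  finally show ?thesis by (simp add: module_vec_simps)
qed

lemma right_comb_0: "right_comb I b (\<lambda>i. 0\<^sub>m d d) = 0\<^sub>v d" if "\<And>i. i \<in> I \<Longrightarrow> b i \<in> carrier_vec d"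
proof -
  have z: "rvm (b i) (0\<^sub>m d d) = \<zero>\<^bsub>W\<^esub>" if "i \<in> I" for i
    using rvm_simps(7)[OF A A] \<open>i \<in> I \<Longrightarrow> b i \<in> carrier_vec d\<close> that by (simp add: module_vec_simps)
  have "right_comb I b (\<lambda>i. 0\<^sub>m d d) = finsum W (\<lambda>i. \<zero>\<^bsub>W\<^esub>) I"
    by (rule rep.finsum_cong') (use z in auto)
  then show ?thesis by (simp add: module_vec_simps)
qed

lemma right_comb_unit:
  assumes "finite I" "j \<in> I" "\<And>i. i \<in> I \<Longrightarrow> b i \<in> carrier_vec d" "M \<in> D"
  shows "right_comb I b (\<lambda>i. if i = j then M else 0\<^sub>m d d) = rvm (b j) M"
proof -
  have "right_comb I b (\<lambda>i. if i = j then M else 0\<^sub>m d d)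
      = finsum W (\<lambda>i. if i = j then rvm (b j) M else \<zero>\<^bsub>W\<^esub>) I"
    by (rule rep.finsum_cong') 
      (use rvm_simps(7)[OF A A assms(3) assms(3)] rvm_closed[OF D_carrier[OF assms(4)]] in \<open>auto simp: module_vec_simps\<close>)
  also have "\<dots> = rvm (b j) M"
    using rep.finsum_delta[OF assms(1,2), of "rvm (b j) M"] rvm_closed[OF D_carrier[OF assms(4)]]
    by (simp add: module_vec_simps)
  finally show ?thesis .
qed

definition right_span :: "nat set \<Rightarrow> (nat \<Rightarrow> 'e vec) \<Rightarrow> bool" where
  "right_span I b \<longleftrightarrow> (\<forall>v\<in>carrier_vec d. \<exists>\<Lambda>. (\<forall>i. \<Lambda> i \<in> D) \<and> v = right_comb I b \<Lambda>)"

definition right_indep :: "nat set \<Rightarrow> (nat \<Rightarrow> 'e vec) \<Rightarrow> bool" where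
  "right_indep I b \<longleftrightarrow> (\<forall>\<Lambda>. (\<forall>i. \<Lambda> i \<in> D) \<and> right_comb I b \<Lambda> = 0\<^sub>v d \<longrightarrow> (\<forall>i\<in>I. \<Lambda> i = 0\<^sub>m d d))"

text \<open>Every row vector is the image of the first unit vector under some matrix, and
  \<open>M_d(E)\<close> is the sum of the \<open>h^j D\<close>.\<close>

lemma right_span_powers: "right_span {..<n} (\<lambda>j. h ^ j \<cdot>\<^sub>v unit_vec d 0)"
  unfolding right_span_def
proof
  fix v :: "'e vec" assume v: "v \<in> carrier_vec d"
  let ?e = "unit_vec d 0 :: 'e vec"
  define M where "M = mat d d (\<lambda>(i, j). if i = 0 then v $ j else 0)"
  have M: "M \<in> carrier_mat d d" by (simp add: M_def)
  obtain w where w: "\<And>j. w j \<in> D" "M = finsum (module_mat TYPE('e) d d) (\<lambda>j. h ^ j \<cdot>\<^sub>m w j) {..<n}"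
    using mat_decomp[OF M] by auto
  note wc = D_carrier[OF w(1)]
  have "v = rvm ?e M"
    unfolding rvm_unit[OF M d_pos] using v d_pos by (auto simp: M_def intro!: eq_vecI)
  also have "\<dots> = finsum W (\<lambda>j. rvm ?e (h ^ j \<cdot>\<^sub>m w j)) {..<n}"
    unfolding w(2)
    by (rule additive_finsum[where f = "rvm ?e", OF vspace_abelian_group vspace_abelian_group])
      (use wc rvm_closed[of _ d ?e] rvm_simps(2)[of _ d _ ?e ?e] in
        \<open>simp_all add: module_vec_vspace module_vec_simps module_mat_vspace module_mat_simps\<close>)
  also have "\<dots> = right_comb {..<n} (\<lambda>j. h ^ j \<cdot>\<^sub>v ?e) w"
    by (rule rep.finsum_cong')
      (use rvm_simps(3,4)[OF wc wc, of ?e ?e] rvm_closed[OF wc] in \<open>simp_all add: module_vec_simps\<close>)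
  finally show "\<exists>\<Lambda>. (\<forall>i. \<Lambda> i \<in> D) \<and> v = right_comb {..<n} (\<lambda>j. h ^ j \<cdot>\<^sub>v ?e) \<Lambda>" using w(1) by blast
qed

lemma right_basis_exists:
  assumes dv: "central_division (D_alg \<iota> \<sigma> d A)"
  shows "\<exists>m b. 1 \<le> m \<and> (\<forall>i. b i \<in> carrier_vec d) \<and> right_span {..<m} b \<and> right_indep {..<m} b"
proof -
  define u :: "nat \<Rightarrow> 'e vec" where "u j = h ^ j \<cdot>\<^sub>v unit_vec d 0" for j
  have u: "u j \<in> carrier_vec d" for j by (simp add: u_def)
  let ?P = "\<lambda>I. I \<subseteq> {..<n} \<and> right_span I u"
  have P0: "?P {..<n}" using right_span_powers by (simp add: u_def[abs_def])
  obtain I where I: "?P I" and min: "\<And>J. ?P J \<Longrightarrow> card I \<le> card J"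
    using ex_has_least_nat[of ?P, OF P0, of card] by blast
  have fin: "finite I" using I finite_subset by blast
  have indep: "right_indep I u"
    unfolding right_indep_def
  proof (intro allI impI ballI, elim conjE, rule ccontr)
    fix \<Lambda> k assume L: "\<forall>i. \<Lambda> i \<in> D" and z: "right_comb I u \<Lambda> = 0\<^sub>v d" and k: "k \<in> I" and nz: "\<Lambda> k \<noteq> 0\<^sub>m d d"
    note LD = L[rule_format]
    have "\<Lambda> k \<in> Units (D_alg \<iota> \<sigma> d A)" using dv nz LD by (simp add: central_division_def D_alg_simps)
    then obtain N where N: "N \<in> D" "\<Lambda> k * N = 1\<^sub>m d" by (auto simp: Units_def D_alg_simps)
    note Nc = D_carrier[OF N(1)]
    let ?J = "I - {k}"
    have J: "finite ?J" "k \<notin> ?J" "insert k ?J = I" using fin k by auto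
    \<comment> \<open>After multiplication by \<open>N\<close> from the right, the coefficient of
      \<open>u k\<close> is \<open>1\<close>, which expresses \<open>u k\<close> by the other
      vectors.\<close>
    have uk: "u k = right_comb ?J u (\<lambda>i. - (\<Lambda> i * N))"
    proof -
      have c: "right_comb ?J u (\<lambda>i. \<Lambda> i * N) \<in> carrier_vec d" by (rule right_comb_closed) (rule D_closed(4)[OF LD N(1)])
      have c': "right_comb ?J u (\<lambda>i. - (\<Lambda> i * N)) \<in> carrier_vec d" by (rule right_comb_closed) (rule D_closed(7)[OF D_closed(4)[OF LD N(1)]])
      have "0\<^sub>v d = rvm (right_comb I u \<Lambda>) N" using z rvm_simps(8)[OF Nc Nc u u] by simp
      also have "\<dots> = right_comb I u (\<lambda>i. \<Lambda> i * N)" by (rule right_comb_rvm[OF N(1) LD u])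
      also have "\<dots> = right_comb (insert k ?J) u (\<lambda>i. \<Lambda> i * N)" by (simp only: J(3))
      also have "\<dots> = rvm (u k) (\<Lambda> k * N) \<oplus>\<^bsub>W\<^esub> right_comb ?J u (\<lambda>i. \<Lambda> i * N)"
        by (rule rep.finsum_insert[OF J(1,2)])
          (use rvm_closed[OF D_carrier[OF D_closed(4)[OF LD N(1)]]] in \<open>auto simp: module_vec_simps\<close>)
      also have "\<dots> = u k + right_comb ?J u (\<lambda>i. \<Lambda> i * N)"
        by (simp only: N(2) rvm_simps(6)[OF A A u u] module_vec_simps)
      finally have eq: "u k + right_comb ?J u (\<lambda>i. \<Lambda> i * N) = 0\<^sub>v d" ..
      have "right_comb ?J u (\<lambda>i. \<Lambda> i * N) + right_comb ?J u (\<lambda>i. - (\<Lambda> i * N))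
          = right_comb ?J u (\<lambda>i. \<Lambda> i * N + - (\<Lambda> i * N))"
        by (rule right_comb_add) (use D_closed(4)[OF LD N(1)] D_closed(7) u in auto)
      also have "(\<lambda>i. \<Lambda> i * N + - (\<Lambda> i * N)) = (\<lambda>i. 0\<^sub>m d d)"
        using D_carrier[OF D_closed(4)[OF LD N(1)]] by (intro ext) (metis add_uminus_minus_mat minus_r_inv_mat uminus_carrier_mat)
      also have "right_comb ?J u (\<lambda>i. 0\<^sub>m d d) = 0\<^sub>v d" by (rule right_comb_0) (rule u)
      finally have eq': "right_comb ?J u (\<lambda>i. \<Lambda> i * N) + right_comb ?J u (\<lambda>i. - (\<Lambda> i * N)) = 0\<^sub>v d" .
      have "u k = u k + (right_comb ?J u (\<lambda>i. \<Lambda> i * N) + right_comb ?J u (\<lambda>i. - (\<Lambda> i * N)))"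
        unfolding eq' using u[of k] by simp
      also have "\<dots> = (u k + right_comb ?J u (\<lambda>i. \<Lambda> i * N)) + right_comb ?J u (\<lambda>i. - (\<Lambda> i * N))"
        by (rule assoc_add_vec[OF u c c', symmetric])
      also have "\<dots> = right_comb ?J u (\<lambda>i. - (\<Lambda> i * N))" unfolding eq using c' by simp
      finally show ?thesis .
    qed
    have "right_span ?J u"
      unfolding right_span_def
    proof
      fix v :: "'e vec" assume v: "v \<in> carrier_vec d"
      obtain w where w: "\<And>i. w i \<in> D" "v = right_comb I u w" using I v unfolding right_span_def by blast
      have "v = right_comb (insert k ?J) u w" by (simp only: w(2) J(3))
      also have "\<dots> = rvm (u k) (w k) \<oplus>\<^bsub>W\<^esub> right_comb ?J u w"
        by (rule rep.finsum_insert[OF J(1,2)]) (use rvm_closed[OF D_carrier[OF w(1)]] in \<open>auto simp: module_vec_simps\<close>)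
      also have "rvm (u k) (w k) = right_comb ?J u (\<lambda>i. - (\<Lambda> i * N) * w k)"
        by (subst uk, rule right_comb_rvm[OF w(1) D_closed(7)[OF D_closed(4)[OF LD N(1)]] u])
      also have "\<dots> \<oplus>\<^bsub>W\<^esub> right_comb ?J u w = right_comb ?J u (\<lambda>i. - (\<Lambda> i * N) * w k + w i)"
        unfolding module_vec_simps
        by (rule right_comb_add[OF D_closed(4)[OF D_closed(7)[OF D_closed(4)[OF LD N(1)]] w(1)] w(1) u])
      finally show "\<exists>\<Lambda>. (\<forall>i. \<Lambda> i \<in> D) \<and> v = right_comb ?J u \<Lambda>"
        by (intro exI[of _ "\<lambda>i. - (\<Lambda> i * N) * w k + w i"] conjI allI
            D_closed(5)[OF D_closed(4)[OF D_closed(7)[OF D_closed(4)[OF LD N(1)]] w(1)] w(1)])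
    qed
    with I have "?P ?J" by blast
    from min[OF this] show False using card_Diff1_less[OF fin k] by simp
  qed
  obtain g where g: "bij_betw g {..<card I} I" using ex_bij_betw_nat_finite[OF fin] by (auto simp: atLeast0LessThan)
  have re: "right_comb I u \<Lambda> = right_comb {..<card I} (\<lambda>i. u (g i)) (\<lambda>i. \<Lambda> (g i))" if "\<And>i. \<Lambda> i \<in> D" for \<Lambda>
    using rep.add.finprod_reindex[of "\<lambda>i. rvm (u i) (\<Lambda> i)" g "{..<card I}"] g rvm_closed[OF D_carrier[OF that]]
    by (auto simp: bij_betw_def module_vec_simps finsum_def)
  have "right_span {..<card I} (\<lambda>i. u (g i))"
    unfolding right_span_def
  proof
    fix v :: "'e vec" assume v: "v \<in> carrier_vec d"
    obtain w where w: "\<And>i. w i \<in> D" "v = right_comb I u w" using I v unfolding right_span_def by blast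
    then show "\<exists>\<Lambda>. (\<forall>i. \<Lambda> i \<in> D) \<and> v = right_comb {..<card I} (\<lambda>i. u (g i)) \<Lambda>"
      using re[OF w(1)] by (intro exI[of _ "\<lambda>i. w (g i)"]) simp
  qed
  moreover have "right_indep {..<card I} (\<lambda>i. u (g i))"
    unfolding right_indep_def
  proof (intro allI impI ballI, elim conjE)
    fix \<Lambda> k assume L: "\<forall>i. \<Lambda> i \<in> D" and z: "right_comb {..<card I} (\<lambda>i. u (g i)) \<Lambda> = 0\<^sub>v d" and k: "k \<in> {..<card I}"
    \<comment> \<open>Coefficients are moved along the renumbering. Outside \<open>I\<close> the
      inverse is arbitrary, but the value is still in \<open>D\<close>, as every \<Lambda>
      \<open>i\<close> is.\<close>
    define M where "M i = \<Lambda> (inv_into {..<card I} g i)" for i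
    have MD: "M i \<in> D" for i using L by (simp add: M_def)
    have Mg: "M (g i) = \<Lambda> i" if "i \<in> {..<card I}" for i
      using g that by (simp add: M_def bij_betw_def)
    have "right_comb I u M = right_comb {..<card I} (\<lambda>i. u (g i)) (\<lambda>i. M (g i))" by (rule re[OF MD])
    also have "\<dots> = right_comb {..<card I} (\<lambda>i. u (g i)) \<Lambda>"
      by (rule rep.finsum_cong') (use Mg rvm_closed[OF D_carrier] L in \<open>auto simp: module_vec_simps\<close>)
    finally have "right_comb I u M = 0\<^sub>v d" using z by simp
    then have "\<forall>i\<in>I. M i = 0\<^sub>m d d" using indep MD unfolding right_indep_def by blast
    moreover have "g k \<in> I" using g k by (auto simp: bij_betw_def)
    ultimately show "\<Lambda> k = 0\<^sub>m d d" using Mg[OF k] by auto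
  qed
  moreover have "1 \<le> card I"
  proof (rule ccontr)
    assume "\<not> 1 \<le> card I"
    then have "I = {}" using fin by (simp add: not_less_eq_eq)
    obtain w where "unit_vec d 0 = right_comb I u w" using I unfolding right_span_def by (meson unit_vec_carrier)
    with \<open>I = {}\<close> have "unit_vec d 0 = (0\<^sub>v d :: 'e vec)" by (simp add: module_vec_simps)
    then have "(unit_vec d 0 :: 'e vec) $ 0 = 0\<^sub>v d $ 0" by simp
    with d_pos show False by simp
  qed
  ultimately show ?thesis using u by (intro exI[of _ "card I"] exI[of _ "\<lambda>i. u (g i)"]) simp
qed

end


section \<open>The isomorphism with a matrix algebra over D\<close>

locale right_basis = norm_matrix +
  fixes m :: nat and b :: "nat \<Rightarrow> 'b vec"
  assumes b: "b i \<in> carrier_vec d" and span: "right_span {..<m} b" and indep: "right_indep {..<m} b"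
begin

abbreviation "rc \<equiv> right_comb {..<m} b"

text \<open>Only the values at indices below \<open>m\<close> are determined; the others are
  arbitrary elements of \<open>D\<close>.\<close>

definition coord :: "'b vec \<Rightarrow> nat \<Rightarrow> 'b mat" where
  "coord v = (SOME \<Lambda>. (\<forall>i. \<Lambda> i \<in> D) \<and> v = rc \<Lambda>)"

lemma coord:
  assumes "v \<in> carrier_vec d" shows coord_D: "coord v i \<in> D" and coord_eq: "v = rc (coord v)"
proof -
  have "\<exists>\<Lambda>. (\<forall>i. \<Lambda> i \<in> D) \<and> v = rc \<Lambda>" using span assms unfolding right_span_def by blast
  from someI_ex[OF this] have "(\<forall>i. coord v i \<in> D) \<and> v = rc (coord v)" unfolding coord_def .
  then show "coord v i \<in> D" "v = rc (coord v)" by blast+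
qed

lemma rc_inj:
  assumes L: "\<And>i. \<Lambda> i \<in> D" "\<And>i. \<Lambda>' i \<in> D" and eq: "rc \<Lambda> = rc \<Lambda>'" and i: "i < m"
  shows "\<Lambda> i = \<Lambda>' i"
proof -
  note c = D_carrier[OF L(1)] D_carrier[OF L(2)]
  have "rc (\<lambda>i. \<Lambda> i + - \<Lambda>' i) = rc \<Lambda> + rc (\<lambda>i. - \<Lambda>' i)"
    by (rule right_comb_add[symmetric]) (rule L D_closed(7)[OF L(2)] b)+
  also have "\<dots> = rc (\<lambda>i. \<Lambda>' i + - \<Lambda>' i)"
    unfolding eq by (rule right_comb_add) (rule L D_closed(7)[OF L(2)] b)+
  also have "(\<lambda>i. \<Lambda>' i + - \<Lambda>' i) = (\<lambda>i. 0\<^sub>m d d)"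
    using c(2) by (intro ext) (metis add_uminus_minus_mat minus_r_inv_mat uminus_carrier_mat)
  also have "rc (\<lambda>i. 0\<^sub>m d d) = 0\<^sub>v d" by (rule right_comb_0) (rule b)
  finally have "\<forall>i\<in>{..<m}. \<Lambda> i + - \<Lambda>' i = 0\<^sub>m d d"
    using indep[unfolded right_indep_def, rule_format, of "\<lambda>i. \<Lambda> i + - \<Lambda>' i"] D_closed(5)[OF L(1) D_closed(7)[OF L(2)]]
    by blast
  with i have z: "\<Lambda> i + - \<Lambda>' i = 0\<^sub>m d d" by blast
  show ?thesis
  proof (rule eq_matI)
    fix j k assume "j < dim_row (\<Lambda>' i)" "k < dim_col (\<Lambda>' i)"
    with c(1)[of i] c(2)[of i] have jk: "j < d" "k < d" by auto
    have "(\<Lambda> i + - \<Lambda>' i) $$ (j, k) = 0\<^sub>m d d $$ (j, k)" by (simp only: z)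
    then show "\<Lambda> i $$ (j, k) = \<Lambda>' i $$ (j, k)" using c(1)[of i] c(2)[of i] jk by simp
  qed (use c(1)[of i] c(2)[of i] in auto)
qed

lemma coord_unique:
  assumes "\<And>i. \<Lambda> i \<in> D" "i < m" shows "coord (rc \<Lambda>) i = \<Lambda> i"
proof -
  have c: "rc \<Lambda> \<in> carrier_vec d" by (rule right_comb_closed) (rule assms(1))
  show ?thesis by (rule rc_inj[OF coord_D[OF c] assms(1) coord_eq[OF c, symmetric] assms(2)])
qed

lemma coord_add:
  assumes "v \<in> carrier_vec d" "w \<in> carrier_vec d" "i < m"
  shows "coord (v + w) i = coord v i + coord w i"
proof -
  have "v + w = rc (\<lambda>i. coord v i + coord w i)"
    using right_comb_add[of "{..<m}" "coord v" "coord w" b] coord_D[OF assms(1)] coord_D[OF assms(2)] b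
      coord_eq[OF assms(1)] coord_eq[OF assms(2)] by metis
  then show ?thesis using coord_unique[of "\<lambda>i. coord v i + coord w i" i] D_closed(5)[OF coord_D coord_D] assms by simp
qed

lemma coord_rvm:
  assumes "v \<in> carrier_vec d" "M \<in> D" "i < m"
  shows "coord (rvm v M) i = coord v i * M"
proof -
  have "rvm v M = rc (\<lambda>i. coord v i * M)"
    using right_comb_rvm[OF assms(2), of "{..<m}" "coord v" b] coord_D[OF assms(1)] b coord_eq[OF assms(1)] by metis
  then show ?thesis using coord_unique[of "\<lambda>i. coord v i * M" i] D_closed(4)[OF coord_D assms(2)] assms by simp
qed

lemma coord_b: "i < m \<Longrightarrow> j < m \<Longrightarrow> coord (b j) i = (if i = j then 1\<^sub>m d else 0\<^sub>m d d)"
proof -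
  assume ij: "i < m" "j < m"
  let ?L = "\<lambda>i. if i = j then 1\<^sub>m d else (0\<^sub>m d d :: 'b mat)"
  have "rc ?L = rvm (b j) (1\<^sub>m d)" by (rule right_comb_unit) (use ij b D_closed(2) in auto)
  then have "b j = rc ?L" using rvm_simps(6)[OF A A b b] by simp
  then show ?thesis using coord_unique[of ?L i] ij D_closed(2,3) by simp
qed

lemma coord_finsum:
  assumes "\<And>k. k \<in> K \<Longrightarrow> f k \<in> carrier_vec d" "i < m"
  shows "coord (finsum W f K) i = finsum (D_alg \<iota> \<sigma> d A) (\<lambda>k. coord (f k) i) K"
  by (rule additive_finsum[where f = "\<lambda>v. coord v i", OF vspace_abelian_group vspace_abelian_group])
    (use assms coord_D coord_add in \<open>simp_all add: module_vec_vspace module_vec_simps D_vspace D_alg_simps\<close>)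

text \<open>The action commutes with \<open>D\<close>, so it is determined by the images of the
  right basis.\<close>

lemma act_expand:
  assumes "v \<in> carrier_vec d"
  shows "rep.act p v = finsum W (\<lambda>j. rvm (rep.act p (b j)) (coord v j)) {..<m}"
proof -
  have ac: "rep.act p v \<in> carrier_vec d" if "v \<in> carrier_vec d" for v
    using rep.act_closed[of v p] that by (simp add: module_vec_simps)
  have "rep.act p v = rep.act p (rc (coord v))" using coord_eq[OF assms] by simp
  also have "\<dots> = finsum W (\<lambda>j. rep.act p (rvm (b j) (coord v j))) {..<m}"
    by (rule additive_finsum[where f = "rep.act p", OF vspace_abelian_group vspace_abelian_group])
      (use ac rep.act_add_right rvm_closed[OF D_carrier[OF coord_D[OF assms]]] in
        \<open>simp_all add: module_vec_vspace module_vec_simps\<close>)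
  also have "\<dots> = finsum W (\<lambda>j. rvm (rep.act p (b j)) (coord v j)) {..<m}"
    by (rule rep.finsum_cong')
      (use act_rvm[OF coord_D[OF assms] b] rvm_closed[OF D_carrier[OF coord_D[OF assms]]] in
        \<open>auto simp: module_vec_simps\<close>)
  finally show ?thesis .
qed

text \<open>Column \<open>j\<close> holds the coordinates of \<open>r b_j\<close>. With coefficients
  on the right, the matrix of a composite is the product in the same order.\<close>

definition \<psi> :: "'b poly set \<Rightarrow> 'b mat mat" where
  "\<psi> r = mat m m (\<lambda>(i, j). coord (r \<odot>\<^bsub>U\<^esub> b j) i)"

lemma \<psi>_cls: "\<psi> (cls p) = mat m m (\<lambda>(i, j). coord (rep.act p (b j)) i)"
  unfolding \<psi>_def by (simp only: U_simps(4)[OF b])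

text \<open>Injectivity is faithfulness of the action. Surjectivity is the double centralizer
  property, applied to the right linear map with a prescribed matrix.\<close>

lemma \<psi>_iso: "\<psi> \<in> alg_iso alg (mat_alg (D_alg \<iota> \<sigma> d A) m)"
proof -
  let ?D = "D_alg \<iota> \<sigma> d A" and ?M = "mat_alg (D_alg \<iota> \<sigma> d A) m"
  have ac: "rep.act p v \<in> carrier_vec d" if "v \<in> carrier_vec d" for v p
    using rep.act_closed[of v p] that by (simp add: module_vec_simps)
  interpret UL: left_module alg U by (rule U_left_module)
  have ab: "r \<odot>\<^bsub>U\<^esub> b j \<in> carrier_vec d" if "r \<in> carrier alg" for r j
    using UL.smult_closed[OF that, of "b j"] b by (simp add: U_simps)
  note cD = coord_D[OF ab]
  have M_carrier: "X \<in> carrier ?M \<longleftrightarrow> X \<in> carrier_mat m m \<and> (\<forall>i<m. \<forall>j<m. X $$ (i, j) \<in> D)" for X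
    by (simp add: mat_alg_def D_alg_simps)
  have \<psi>_closed: "\<psi> r \<in> carrier ?M" if "r \<in> carrier alg" for r
    unfolding M_carrier using cD[OF that] by (simp add: \<psi>_def)
  have \<psi>_ind: "\<psi> r $$ (i, j) = coord (r \<odot>\<^bsub>U\<^esub> b j) i" if "i < m" "j < m" for r i j
    using that by (simp add: \<psi>_def)
  have smult_const: "c \<odot>\<^bsub>alg\<^esub> r \<odot>\<^bsub>U\<^esub> v = rvm (r \<odot>\<^bsub>U\<^esub> v) (\<iota> c \<cdot>\<^sub>m 1\<^sub>m d)"
    if "r \<in> carrier alg" "v \<in> carrier_vec d" for c r v
  proof -
    have "r \<odot>\<^bsub>U\<^esub> v \<in> carrier_vec d" using UL.smult_closed[OF that(1), of v] that(2) by (simp add: U_simps)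
    then show ?thesis
      using that UL.smult_assoc[OF aemb_simps(1) that(1), of v "\<iota> c"] rvm_simps(4,6)[OF one_carrier_mat one_carrier_mat, of "r \<odot>\<^bsub>U\<^esub> v" d "r \<odot>\<^bsub>U\<^esub> v"]
      by (simp add: alg_simps(6) U_simps)
  qed
  have "\<psi> \<in> alg_hom alg ?M"
  proof (rule alg_homI)
    fix r r' assume r: "r \<in> carrier alg" and r': "r' \<in> carrier alg"
    obtain p where p: "r = cls p" using r by (auto simp: alg_simps)
    show "\<psi> (r \<otimes>\<^bsub>alg\<^esub> r') = \<psi> r \<otimes>\<^bsub>?M\<^esub> \<psi> r'"
    proof (rule eq_matI)
      fix i j assume "i < dim_row (\<psi> r \<otimes>\<^bsub>?M\<^esub> \<psi> r')" "j < dim_col (\<psi> r \<otimes>\<^bsub>?M\<^esub> \<psi> r')"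
      then have ij: "i < m" "j < m" by (auto simp: mat_alg_def)
      have "\<psi> (r \<otimes>\<^bsub>alg\<^esub> r') $$ (i, j) = coord (r \<odot>\<^bsub>U\<^esub> (r' \<odot>\<^bsub>U\<^esub> b j)) i"
        unfolding \<psi>_ind[OF ij] using UL.smult_assoc[OF r r', of "b j"] b by (simp add: U_simps)
      also have "r \<odot>\<^bsub>U\<^esub> (r' \<odot>\<^bsub>U\<^esub> b j) = rep.act p (r' \<odot>\<^bsub>U\<^esub> b j)" unfolding p by (rule U_simps(4)[OF ab[OF r']])
      also have "\<dots> = finsum W (\<lambda>k. rvm (rep.act p (b k)) (coord (r' \<odot>\<^bsub>U\<^esub> b j) k)) {..<m}"
        by (rule act_expand[OF ab[OF r']])
      also have "coord \<dots> i = finsum ?D (\<lambda>k. coord (rvm (rep.act p (b k)) (coord (r' \<odot>\<^bsub>U\<^esub> b j) k)) i) {..<m}"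
        by (rule coord_finsum[OF rvm_closed[OF D_carrier[OF cD[OF r']]] ij(1)])
      also have "\<dots> = finsum ?D (\<lambda>k. \<psi> r $$ (i, k) \<otimes>\<^bsub>?D\<^esub> \<psi> r' $$ (k, j)) {..<m}"
      proof (rule abelian_monoid.finsum_cong')
        show "abelian_monoid ?D" using vspace_abelian_group[OF D_vspace] by (simp add: abelian_group_def)
        fix k assume k: "k \<in> {..<m}"
        then have k': "k < m" by simp
        have "rep.act p (b k) = r \<odot>\<^bsub>U\<^esub> b k" unfolding p by (rule U_simps(4)[OF b, symmetric])
        then show "coord (rvm (rep.act p (b k)) (coord (r' \<odot>\<^bsub>U\<^esub> b j) k)) i = \<psi> r $$ (i, k) \<otimes>\<^bsub>?D\<^esub> \<psi> r' $$ (k, j)"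
          by (simp only: coord_rvm[OF ab[OF r] cD[OF r'] ij(1)] \<psi>_ind[OF ij(1) k'] \<psi>_ind[OF k' ij(2)] D_alg_simps)
      qed (use \<psi>_closed[OF r] \<psi>_closed[OF r'] ij D_closed(4) in \<open>auto simp: M_carrier D_alg_simps\<close>)
      finally show "\<psi> (r \<otimes>\<^bsub>alg\<^esub> r') $$ (i, j) = (\<psi> r \<otimes>\<^bsub>?M\<^esub> \<psi> r') $$ (i, j)"
        using ij by (simp add: mat_alg_def)
    qed (simp_all add: \<psi>_def mat_alg_def)
    show "\<psi> (r \<oplus>\<^bsub>alg\<^esub> r') = \<psi> r \<oplus>\<^bsub>?M\<^esub> \<psi> r'"
    proof (rule eq_matI)
      fix i j assume "i < dim_row (\<psi> r \<oplus>\<^bsub>?M\<^esub> \<psi> r')" "j < dim_col (\<psi> r \<oplus>\<^bsub>?M\<^esub> \<psi> r')"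
      then have ij: "i < m" "j < m" by (auto simp: mat_alg_def)
      have "(r \<oplus>\<^bsub>alg\<^esub> r') \<odot>\<^bsub>U\<^esub> b j = r \<odot>\<^bsub>U\<^esub> b j + r' \<odot>\<^bsub>U\<^esub> b j"
        using UL.smult_l_distr[OF r r', of "b j"] b by (simp add: U_simps)
      then show "\<psi> (r \<oplus>\<^bsub>alg\<^esub> r') $$ (i, j) = (\<psi> r \<oplus>\<^bsub>?M\<^esub> \<psi> r') $$ (i, j)"
        using ij coord_add[OF ab[OF r] ab[OF r'] ij(1)] by (simp add: \<psi>_ind[OF ij] mat_alg_def D_alg_simps)
    qed (simp_all add: \<psi>_def mat_alg_def)
  next
    show "\<psi> \<one>\<^bsub>alg\<^esub> = \<one>\<^bsub>?M\<^esub>"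
    proof (rule eq_matI)
      fix i j assume "i < dim_row \<one>\<^bsub>?M\<^esub>" "j < dim_col \<one>\<^bsub>?M\<^esub>"
      then have ij: "i < m" "j < m" by (auto simp: mat_alg_def)
      have "\<one>\<^bsub>alg\<^esub> \<odot>\<^bsub>U\<^esub> b j = b j" using UL.smult_one[of "b j"] b by (simp add: U_simps)
      then show "\<psi> \<one>\<^bsub>alg\<^esub> $$ (i, j) = \<one>\<^bsub>?M\<^esub> $$ (i, j)"
        using ij by (simp add: \<psi>_ind[OF ij] coord_b[OF ij] mat_alg_def D_alg_simps)
    qed (simp_all add: \<psi>_def mat_alg_def)
  next
    fix c r assume r: "r \<in> carrier alg"
    show "\<psi> (c \<odot>\<^bsub>alg\<^esub> r) = c \<odot>\<^bsub>?M\<^esub> \<psi> r"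
    proof (rule eq_matI)
      fix i j assume "i < dim_row (c \<odot>\<^bsub>?M\<^esub> \<psi> r)" "j < dim_col (c \<odot>\<^bsub>?M\<^esub> \<psi> r)"
      then have ij: "i < m" "j < m" by (auto simp: mat_alg_def)
      note cc = D_carrier[OF cD[OF r]]
      have "coord (c \<odot>\<^bsub>alg\<^esub> r \<odot>\<^bsub>U\<^esub> b j) i = coord (r \<odot>\<^bsub>U\<^esub> b j) i * (\<iota> c \<cdot>\<^sub>m 1\<^sub>m d)"
        unfolding smult_const[OF r b] by (rule coord_rvm[OF ab[OF r] D_closed(6)[OF D_closed(2)] ij(1)])
      also have "\<dots> = \<iota> c \<cdot>\<^sub>m coord (r \<odot>\<^bsub>U\<^esub> b j) i"
        using cc[of j i] mult_smult_distrib[OF cc[of j i] one_carrier_mat, of "\<iota> c"] by simp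
      finally show "\<psi> (c \<odot>\<^bsub>alg\<^esub> r) $$ (i, j) = (c \<odot>\<^bsub>?M\<^esub> \<psi> r) $$ (i, j)"
        using ij by (simp add: \<psi>_ind[OF ij] mat_alg_def D_alg_simps)
    qed (simp_all add: \<psi>_def mat_alg_def)
  qed (rule \<psi>_closed)
  moreover have "bij_betw \<psi> (carrier alg) (carrier ?M)"
    unfolding bij_betw_def
  proof (intro conjI inj_onI)
    fix r r' assume r: "r \<in> carrier alg" and r': "r' \<in> carrier alg" and eq: "\<psi> r = \<psi> r'"
    obtain p p' where p: "r = cls p" and p': "r' = cls p'" using r r' by (auto simp: alg_simps)
    have e: "rep.act p (b j) = rep.act p' (b j)" if j: "j < m" for j
    proof -
      have ci: "coord (r \<odot>\<^bsub>U\<^esub> b j) i = coord (r' \<odot>\<^bsub>U\<^esub> b j) i" if "i < m" for i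
        unfolding \<psi>_ind[OF that j, symmetric] eq ..
      have "r \<odot>\<^bsub>U\<^esub> b j = rc (coord (r \<odot>\<^bsub>U\<^esub> b j))" by (rule coord_eq[OF ab[OF r]])
      also have "\<dots> = rc (coord (r' \<odot>\<^bsub>U\<^esub> b j))"
        by (rule rep.finsum_cong') (use ci rvm_closed[OF D_carrier[OF cD[OF r']]] in \<open>auto simp: module_vec_simps\<close>)
      also have "\<dots> = r' \<odot>\<^bsub>U\<^esub> b j" by (rule coord_eq[OF ab[OF r'], symmetric])
      finally show ?thesis unfolding p p' U_simps(4)[OF b] .
    qed
    have "rep.act p v = rep.act p' v" if v: "v \<in> carrier_vec d" for v
    proof -
      have "rep.act p v = finsum W (\<lambda>j. rvm (rep.act p (b j)) (coord v j)) {..<m}" by (rule act_expand[OF v])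
      also have "\<dots> = finsum W (\<lambda>j. rvm (rep.act p' (b j)) (coord v j)) {..<m}"
        by (rule rep.finsum_cong') (use e rvm_closed[OF D_carrier[OF coord_D[OF v]]] in \<open>auto simp: module_vec_simps\<close>)
      also have "\<dots> = rep.act p' v" by (rule act_expand[OF v, symmetric])
      finally show ?thesis .
    qed
    then show "r = r'" unfolding p p' by (rule act_faithful)
  next
    have "\<psi> ` carrier alg \<subseteq> carrier ?M" using \<psi>_closed by auto
    moreover have "C \<in> \<psi> ` carrier alg" if C: "C \<in> carrier ?M" for C
    proof -
      have CD: "C $$ (i, j) \<in> D" if "i < m" "j < m" for i j using C that by (simp add: M_carrier)
      \<comment> \<open>Padding by zero keeps all coefficients in \<open>D\<close>, also outside the
        index range.\<close>
      define C' where "C' j i = (if i < m \<and> j < m then C $$ (i, j) else 0\<^sub>m d d)" for i j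
      have C': "C' j i \<in> D" for i j using CD D_closed(3) by (simp add: C'_def)
      define w where "w j = rc (C' j)" for j
      have w: "w j \<in> carrier_vec d" for j unfolding w_def by (rule right_comb_closed) (rule C')
      \<comment> \<open>The map that commutes with \<open>D\<close> and sends \<open>b j\<close> to
        \<open>w j\<close>, the combination given by column \<open>j\<close> of
        \<open>C\<close>.\<close>
      define G where "G v = right_comb {..<m} w (coord v)" for v
      have G: "G v \<in> carrier_vec d" if "v \<in> carrier_vec d" for v
        unfolding G_def by (rule right_comb_closed) (rule coord_D[OF that])
      have "\<exists>p. \<forall>v\<in>carrier_vec d. G v = rep.act p v"
      proof (rule double_centralizer[OF G])
        fix v u :: "'b vec" assume v: "v \<in> carrier_vec d" and u: "u \<in> carrier_vec d"
        have "G (v + u) = right_comb {..<m} w (\<lambda>j. coord v j + coord u j)"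
          unfolding G_def
          by (rule rep.finsum_cong')
            (use coord_add[OF v u] rvm_closed[OF D_carrier[OF D_closed(5)[OF coord_D[OF v] coord_D[OF u]]]] in
              \<open>auto simp: module_vec_simps\<close>)
        then show "G (v + u) = G v + G u"
          unfolding G_def by (simp only: right_comb_add[OF coord_D[OF v] coord_D[OF u] w])
      next
        fix v :: "'b vec" and M assume v: "v \<in> carrier_vec d" and M: "M \<in> D"
        have "G (rvm v M) = right_comb {..<m} w (\<lambda>j. coord v j * M)"
          unfolding G_def
          by (rule rep.finsum_cong')
            (use coord_rvm[OF v M] rvm_closed[OF D_carrier[OF D_closed(4)[OF coord_D[OF v] M]]] in
              \<open>auto simp: module_vec_simps\<close>)
        then show "G (rvm v M) = rvm (G v) M"
          unfolding G_def by (simp only: right_comb_rvm[OF M coord_D[OF v] w])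
      qed
      then obtain p where p: "\<And>v. v \<in> carrier_vec d \<Longrightarrow> G v = rep.act p v" by blast
      have Gb: "G (b j) = w j" if j: "j < m" for j
      proof -
        have "G (b j) = right_comb {..<m} w (\<lambda>i. if i = j then 1\<^sub>m d else 0\<^sub>m d d)"
          unfolding G_def
          by (rule rep.finsum_cong')
            (use coord_b[OF _ j] rvm_closed[OF one_carrier_mat] rvm_closed[OF zero_carrier_mat] in \<open>auto simp: module_vec_simps\<close>)
        also have "\<dots> = rvm (w j) (1\<^sub>m d)" by (rule right_comb_unit) (use j w D_closed(2) in auto)
        also have "\<dots> = w j" by (rule rvm_simps(6)[OF A A w w])
        finally show ?thesis .
      qed
      have "C = \<psi> (cls p)"
      proof (rule eq_matI)
        fix i j assume "i < dim_row (\<psi> (cls p))" "j < dim_col (\<psi> (cls p))"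
        then have ij: "i < m" "j < m" by (auto simp: \<psi>_def)
        have "\<psi> (cls p) $$ (i, j) = coord (w j) i"
          using ij by (simp add: \<psi>_cls p[OF b, symmetric] Gb)
        also have "\<dots> = C' j i" unfolding w_def by (rule coord_unique[OF C' ij(1)])
        finally show "C $$ (i, j) = \<psi> (cls p) $$ (i, j)" using ij by (simp add: C'_def)
      qed (use C in \<open>auto simp: \<psi>_def M_carrier\<close>)
      then show "C \<in> \<psi> ` carrier alg" by (rule image_eqI) (rule aemb_simps(3))
    qed
    ultimately show "\<psi> ` carrier alg = carrier ?M" by auto
  qed
  ultimately show ?thesis by (simp add: alg_iso_def)
qed

end

lemma (in norm_matrix) alg_iso_mat_alg:
  assumes "central_division (D_alg \<iota> \<sigma> d A)"
  shows "\<exists>m. 1 \<le> m \<and> alg \<simeq>\<^sub>a mat_alg (D_alg \<iota> \<sigma> d A) m"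
proof -
  obtain m b where mb: "1 \<le> m" "\<forall>i. b i \<in> carrier_vec d" "right_span {..<m} b" "right_indep {..<m} b"
    using right_basis_exists[OF assms] by (elim exE conjE)
  interpret R: right_basis n q s a \<iota> h \<sigma> d A m b
    by unfold_locales (use mb in \<open>simp_all\<close>)
  show ?thesis using R.\<psi>_iso mb(1) by (auto simp: is_alg_iso_def)
qed


section \<open>The degree\<close>

text \<open>The regular representation: \<open>x\<close> sends \<open>\<Sum> v_j x^j\<close> to
  \<open>\<Sum> \<sigma>(v_j) x^(j + 1)\<close>, and the last term wraps around with the factor
  \<open>a\<close>.\<close>

lemma (in kummer) norm_matrix_exists:
  "\<exists>A\<in>carrier_mat n n. twisted_norm \<sigma> n A = \<iota> a \<cdot>\<^sub>m 1\<^sub>m n"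
proof -
  define A :: "'e mat" where
    "A = mat n n (\<lambda>(i, j). if j = 0 then (if i = n - 1 then \<iota> a else 0) else (if i = j - 1 then 1 else 0))"
  have A: "A \<in> carrier_mat n n" by (simp add: A_def)
  have T: "Tm A v = vec n (\<lambda>j. if j = 0 then \<iota> a * \<sigma> (v $ (n - 1)) else \<sigma> (v $ (j - 1)))"
    if v: "v \<in> carrier_vec n" for v
  proof (rule eq_vecI; simp)
    fix j assume j: "j < n"
    have "Tm A v $ j = (\<Sum>i<n. \<sigma> (v $ i) * A $$ (i, j))"
      using v j rvm_index[OF A _ j, of "map_vec \<sigma> v"] by (simp add: Tm_def)
    also have "\<dots> = (\<Sum>i<n. if i = (if j = 0 then n - 1 else j - 1)
        then \<sigma> (v $ i) * (if j = 0 then \<iota> a else 1) else 0)"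
      using j by (intro sum.cong) (auto simp: A_def)
    also have "\<dots> = (if j = 0 then \<iota> a * \<sigma> (v $ (n - 1)) else \<sigma> (v $ (j - 1)))"
      using j by (auto simp: sum.delta' mult.commute)
    finally show "(j = 0 \<longrightarrow> Tm A v $ 0 = \<iota> a * \<sigma> (v $ (n - Suc 0))) \<and> (0 < j \<longrightarrow> Tm A v $ j = \<sigma> (v $ (j - Suc 0)))"
      by auto
  next
    show "dim_vec (Tm A v) = n" using rvm_closed[OF A] by (simp add: Tm_def)
  qed
  \<comment> \<open>After \<open>k\<close> steps coordinate \<open>i\<close> comes from
    \<open>i - k\<close>; those with \<open>i < k\<close> have wrapped around once and carry the
    factor \<open>a\<close>.\<close>
  have pow: "(Tm A ^^ k) v = vec n (\<lambda>i. if k \<le> i then (\<sigma> ^^ k) (v $ (i - k)) else \<iota> a * (\<sigma> ^^ k) (v $ (n + i - k)))"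
    if "v \<in> carrier_vec n" "k \<le> n" for v k
    using that(2)
  proof (induct k)
    case 0
    show ?case using that(1) by (intro eq_vecI) auto
  next
    case (Suc k)
    then have IH: "(Tm A ^^ k) v = vec n (\<lambda>i. if k \<le> i then (\<sigma> ^^ k) (v $ (i - k)) else \<iota> a * (\<sigma> ^^ k) (v $ (n + i - k)))"
      by simp
    show ?case
      unfolding funpow.simps comp_def IH
    proof (subst T, simp, rule eq_vecI)
      let ?w = "vec n (\<lambda>i. if k \<le> i then (\<sigma> ^^ k) (v $ (i - k)) else \<iota> a * (\<sigma> ^^ k) (v $ (n + i - k)))"
      let ?r = "vec n (\<lambda>i. if Suc k \<le> i then \<sigma> ((\<sigma> ^^ k) (v $ (i - Suc k))) else \<iota> a * \<sigma> ((\<sigma> ^^ k) (v $ (n + i - Suc k))))"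
      fix j assume "j < dim_vec ?r"
      then have j: "j < n" by simp
      show "vec n (\<lambda>j. if j = 0 then \<iota> a * \<sigma> (?w $ (n - 1)) else \<sigma> (?w $ (j - 1))) $ j = ?r $ j"
      proof (cases "j = 0")
        case True
        moreover have "k \<le> n - 1" using Suc(2) by simp
        ultimately show ?thesis using j Suc(2) by simp
      next
        case False
        then have "n + (j - 1) - k = n + j - Suc k" "j - 1 - k = j - Suc k" using Suc(2) by auto
        with False j Suc(2) show ?thesis by (auto simp: \<sigma>_mult \<sigma>_\<iota>)
      qed
    qed simp
  qed
  have "twisted_norm \<sigma> n A = \<iota> a \<cdot>\<^sub>m 1\<^sub>m n"
  proof (rule twisted_norm_if_Tm_pow[OF A])
    fix v :: "'e vec" assume "v \<in> carrier_vec n"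
    then show "(Tm A ^^ n) v = \<iota> a \<cdot>\<^sub>v v" by (subst pow) (auto simp: \<sigma>_pow_n intro!: eq_vecI)
  qed
  with A show ?thesis by blast
qed

lemma central_simple_if_division: "central_division A \<Longrightarrow> central_simple A"
proof -
  assume A: "central_division A"
  then have FA: "F_algebra A" and U: "Units A = carrier A - {\<zero>\<^bsub>A\<^esub>}" by (auto simp: central_division_def)
  interpret A: ring A by (rule F_algebraD(1)[OF FA])
  have "I = {\<zero>\<^bsub>A\<^esub>} \<or> I = carrier A" if I: "ideal I A" for I
  proof (cases "I \<subseteq> {\<zero>\<^bsub>A\<^esub>}")
    case True
    have "\<zero>\<^bsub>A\<^esub> \<in> I" using additive_subgroup.zero_closed[OF ideal.axioms(1)[OF I]] .
    with True have "I = {\<zero>\<^bsub>A\<^esub>}" by blast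
    then show ?thesis ..
  next
    case False
    then obtain x where x: "x \<in> I" "x \<noteq> \<zero>\<^bsub>A\<^esub>" by blast
    have xA: "x \<in> carrier A" using additive_subgroup.a_subset[OF ideal.axioms(1)[OF I]] x(1) by blast
    then obtain y where y: "y \<in> carrier A" "y \<otimes>\<^bsub>A\<^esub> x = \<one>\<^bsub>A\<^esub>" using U x(2) by (auto simp: Units_def)
    have "\<one>\<^bsub>A\<^esub> \<in> I" using ideal.I_l_closed[OF I x(1) y(1)] y(2) by simp
    then have "I = carrier A" by (rule ideal.one_imp_carrier[OF I])
    then show ?thesis ..
  qed
  moreover have "\<one>\<^bsub>A\<^esub> \<in> Units A" by simp
  then have "carrier A \<noteq> {\<zero>\<^bsub>A\<^esub>}" using U by auto
  ultimately show ?thesis using A by (simp add: central_simple_def central_division_def)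
qed

lemma has_DegI:
  assumes A: "central_division A" and \<beta>: "family_basis A {..<k\<^sup>2} \<beta>" shows "has_Deg A k"
proof -
  interpret vspace A using A F_algebraD(2) by (auto simp: central_division_def)
  show ?thesis
    using central_simple_if_division[OF A] family_basis_dim[OF \<beta>] by (simp add: has_Deg_def)
qed

lemma (in kummer) matrix_alg_isoI:
  assumes "central_division D'" "1 \<le> m'" "alg \<simeq>\<^sub>a mat_alg D' m'"
  shows "\<exists>\<psi>. matrix_alg_iso alg D' m' \<psi>"
proof -
  obtain \<psi> where \<psi>: "\<psi> \<in> alg_iso alg (mat_alg D' m')" using assms(3) by (auto simp: is_alg_iso_def)
  interpret R: ring alg by (rule alg_ring)
  have "matrix_alg_iso alg D' m' \<psi>"
    by (rule matrix_alg_iso.intro) (use assms \<psi> alg_ring R.m_closed aemb_simps(1) in \<open>simp_all add: alg_simps(6)\<close>)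
  then show ?thesis by (rule exI[of _ \<psi>])
qed

lemma (in kummer) module_hom_restrict:
  assumes "f \<in> LinearCombinations.module_hom alg U U'"
  shows "f \<in> LinearCombinations.module_hom class_ring (restrict_scalars aemb U) (restrict_scalars aemb U')"
  using assms aemb_simps(1) by (auto simp: LinearCombinations.module_hom_def restrict_scalars_def)

lemma (in semilinear) umod_restrict:
  assumes "t = \<iota> a"
  shows "id \<in> LinearCombinations.module_hom class_ring V (restrict_scalars aemb umod)"
    "id \<in> LinearCombinations.module_hom class_ring (restrict_scalars aemb umod) V"
  using umod_smult[OF assms, of _ "[:_:]", folded aemb_def] act_const
  by (auto simp: LinearCombinations.module_hom_def restrict_scalars_def umod_simps class_ring_simps)

lemma module_hom_comp:
  "f \<in> LinearCombinations.module_hom R U V \<Longrightarrow> g \<in> LinearCombinations.module_hom R V W \<Longrightarrow>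
    (\<lambda>u. g (f u)) \<in> LinearCombinations.module_hom R U W"
  by (auto simp: LinearCombinations.module_hom_def Pi_iff)

locale minimal_norm_matrix = norm_matrix +
  assumes minimal: "\<And>k B. 0 < k \<Longrightarrow> k < d \<Longrightarrow> B \<in> carrier_mat k k \<Longrightarrow>
    twisted_norm \<sigma> n B \<noteq> \<iota> a \<cdot>\<^sub>m 1\<^sub>m k"
begin

lemma U_simple: "simple_module alg U" by (rule simple_if_minimal[OF minimal])

lemma D_division: "central_division (D_alg \<iota> \<sigma> d A)" by (rule division_if_simple[OF U_simple])

lemma D_Deg: "has_Deg (D_alg \<iota> \<sigma> d A) d"
  using D_basis_exists has_DegI[OF D_division] by blast

text \<open>A simple module is isomorphic to the model \<open>U\<close>, whose underlying space is
  \<open>E^d\<close>; the unit vectors are transported along the isomorphism.\<close>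

lemma simple_module_vec:
  fixes U' :: "('b poly set, 'u) module"
  assumes M: "matrix_alg_iso alg D' m' \<psi>'" and U': "simple_module alg U'"
  shows "module_iso class_ring (restrict_scalars aemb U') (module_vec TYPE('b) d)"
    "\<exists>b. family_basis (restrict_scalars aemb U') {..<d} b"
proof -
  interpret M: matrix_alg_iso alg D' m' \<psi>' by (rule M)
  interpret UL: left_module alg U' by (rule simple_module_left_module[OF U'])
  interpret C: cyclic_module n q s a \<iota> h \<sigma> U' by unfold_locales
  have c: "carrier (restrict_scalars aemb X) = carrier X" for X by (simp add: restrict_scalars_def)
  obtain f where f: "f \<in> LinearCombinations.module_hom alg U U'" "bij_betw f (carrier U) (carrier U')"
    using M.P.simple_modules_iso[OF U_simple U'] by (auto simp: module_iso_def)
  obtain g where g: "g \<in> LinearCombinations.module_hom alg U' U" "bij_betw g (carrier U') (carrier U)"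
    using M.P.simple_modules_iso[OF U' U_simple] by (auto simp: module_iso_def)
  have "(\<lambda>u. id (g u)) \<in> LinearCombinations.module_hom class_ring (restrict_scalars aemb U') W"
    by (rule module_hom_comp[OF module_hom_restrict[OF g(1)] rep.umod_restrict(2)[OF refl]])
  then show "module_iso class_ring (restrict_scalars aemb U') W"
    unfolding module_iso_def using g(2) by (intro bexI[of _ g]) (simp_all add: c rep.umod_simps)
  have "(\<lambda>u. f (id u)) \<in> LinearCombinations.module_hom class_ring W (restrict_scalars aemb U')"
    by (rule module_hom_comp[OF rep.umod_restrict(1)[OF refl] module_hom_restrict[OF f(1)]])
  then have fh: "f \<in> LinearCombinations.module_hom class_ring W (restrict_scalars aemb U')" by simp
  have "bij_betw f (carrier W) (carrier (restrict_scalars aemb U'))"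
    using f(2) by (simp add: c rep.umod_simps)
  from family_basis_image[OF module_vec_vspace C.V_vspace fh this family_basis_module_vec]
  show "\<exists>b. family_basis (restrict_scalars aemb U') {..<d} b" by blast
qed

text \<open>A structure matrix \<open>B\<close> of another simple module has the same size
  \<open>d\<close> and norm \<open>a\<close>, so it is minimal as well and all results for
  \<open>A\<close> hold for \<open>B\<close>. Both \<open>D'\<close> and the algebra of
  \<open>B\<close> are then the endomorphism algebra of that module.\<close>

lemma simple_D_iso:
  fixes U' :: "('b poly set, 'u) module"
  assumes M: "matrix_alg_iso alg D' m' \<psi>'" and U': "simple_module alg U'"
    and b: "family_basis (restrict_scalars aemb U') {..<d} b"
    and B: "is_structure_matrix (restrict_scalars aemb U') (\<lambda>u. ax \<odot>\<^bsub>U'\<^esub> u) d b B"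
  shows "minimal_norm_matrix n q s a \<iota> h \<sigma> d B" "D' \<simeq>\<^sub>a D_alg \<iota> \<sigma> d B"
    "right_act (restrict_scalars aemb U') d b \<in> alg_iso (D_alg \<iota> \<sigma> d B) (End_right alg U')"
proof -
  interpret M: matrix_alg_iso alg D' m' \<psi>' by (rule M)
  interpret UL: left_module alg U' by (rule simple_module_left_module[OF U'])
  interpret C: cyclic_module n q s a \<iota> h \<sigma> U' by unfold_locales
  have Bc: "B \<in> carrier_mat d d" using B by (simp add: is_structure_matrix_def)
  have N: "twisted_norm \<sigma> n B = \<iota> a \<cdot>\<^sub>m 1\<^sub>m d" by (rule C.sl.structure_matrix_norm[OF b B])
  show min: "minimal_norm_matrix n q s a \<iota> h \<sigma> d B"
    by unfold_locales (fact d_pos Bc N minimal)+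
  interpret B: minimal_norm_matrix n q s a \<iota> h \<sigma> d B by (rule min)
  show ra: "right_act (restrict_scalars aemb U') d b \<in> alg_iso (D_alg \<iota> \<sigma> d B) (End_right alg U')"
    by (rule C.right_act_iso[OF b B d_pos])
  obtain f where f: "f \<in> alg_iso D' (End_right alg U')"
    using M.End_right_iso[OF U'] by (auto simp: is_alg_iso_def)
  from alg_iso_comp[OF f alg_iso_inv[OF B.D_F_algebra ra]]
  show "D' \<simeq>\<^sub>a D_alg \<iota> \<sigma> d B" by (auto simp: is_alg_iso_def)
qed

text \<open>\<open>D'\<close> is isomorphic to the algebra of a structure matrix of
  \<open>U\<close>, whose dimension over \<open>F\<close> is known from descent.\<close>

lemma matrix_alg_basis:
  fixes D' :: "('a, 'k) module"
  assumes M: "matrix_alg_iso alg D' m' \<psi>'" shows "\<exists>\<beta>. family_basis D' {..<d\<^sup>2} \<beta>"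
proof -
  interpret M: matrix_alg_iso alg D' m' \<psi>' by (rule M)
  interpret UL: left_module alg U by (rule U_left_module)
  interpret C: cyclic_module n q s a \<iota> h \<sigma> U by unfold_locales
  obtain b where b: "family_basis (restrict_scalars aemb U) {..<d} b"
    using simple_module_vec(2)[OF M U_simple] by blast
  obtain B where B: "is_structure_matrix (restrict_scalars aemb U) (\<lambda>u. ax \<odot>\<^bsub>U\<^esub> u) d b B"
    using C.sl.structure_matrix_exists[OF b] by blast
  interpret B: minimal_norm_matrix n q s a \<iota> h \<sigma> d B by (rule simple_D_iso(1)[OF M U_simple b B])
  obtain f where f: "f \<in> alg_iso D' (D_alg \<iota> \<sigma> d B)"
    using simple_D_iso(2)[OF M U_simple b B] by (auto simp: is_alg_iso_def)
  note f' = alg_iso_inv[OF M.D_F_algebra f]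
  obtain \<beta> where \<beta>: "family_basis (D_alg \<iota> \<sigma> d B) {..<d\<^sup>2} \<beta>" using B.D_basis_exists by blast
  have "inv_into (carrier D') f \<in> alg_hom (D_alg \<iota> \<sigma> d B) D'"
    "bij_betw (inv_into (carrier D') f) (carrier (D_alg \<iota> \<sigma> d B)) (carrier D')"
    using f' by (simp_all add: alg_iso_def)
  from family_basis_image[OF B.D_vspace F_algebraD(2)[OF M.D_F_algebra] alg_hom_module_hom[OF this(1)] this(2) \<beta>]
  show ?thesis by (rule exI[of _ "\<lambda>i. inv_into (carrier D') f (\<beta> i)"])
qed

lemma matrix_alg_Deg: 
  assumes M: "matrix_alg_iso alg D' m' \<psi>'" shows "has_Deg D' d"
  using matrix_alg_basis[OF M] has_DegI[OF matrix_alg_iso.D[OF M]] by blast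

text \<open>The dimension of the simple module over \<open>F\<close> is counted twice:
  \<open>d n\<close> from \<open>E^d\<close>, and \<open>m' d^2\<close> from columns of length
  \<open>m'\<close> over \<open>D'\<close>.\<close>

lemma matrix_alg_size:
  fixes D' :: "('a, 'k) module"
  assumes M: "matrix_alg_iso alg D' m' \<psi>'" shows "n = m' * d"
proof -
  interpret M: matrix_alg_iso alg D' m' \<psi>' by (rule M)
  interpret UL: left_module alg U by (rule U_left_module)
  let ?W = "restrict_scalars \<iota> W"
  interpret W: vspace ?W by (rule restrict_vspace[OF module_vec_vspace])
  have Ws: "carrier ?W = carrier U" "zero ?W = zero U" "add ?W = add U" "finsum ?W = finsum U"
    by (simp_all add: restrict_scalars_def rep.umod_def finsum_def finprod_def fun_eq_iff)
  have W_smult: "c \<odot>\<^bsub>?W\<^esub> v = aemb (\<iota> c) \<odot>\<^bsub>U\<^esub> v" if "v \<in> carrier U" for c v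
    using that U_simps(5)[of v "\<iota> c"] by (simp add: restrict_scalars_def module_vec_simps U_simps(1))
  obtain u where u: "u \<in> carrier U" "u \<noteq> \<zero>\<^bsub>U\<^esub>" "M.e \<odot>\<^bsub>U\<^esub> u = u"
    using M.P.generator_exists[OF U_left_module] U_simple by (auto simp: simple_module_def)
  obtain \<beta> where \<beta>: "family_basis D' {..<d\<^sup>2} \<beta>" using matrix_alg_basis[OF M] by blast
  define f where "f i \<delta> = M.eu i 0 \<delta> \<odot>\<^bsub>U\<^esub> u" for i \<delta>
  have c1: "c \<odot>\<^bsub>alg\<^esub> \<one>\<^bsub>alg\<^esub> = aemb (\<iota> c)" for c
    using M.R.r_one[OF aemb_simps(1)] by (simp add: alg_simps(6))
  have fc: "f i \<delta> \<in> carrier U" if "\<delta> \<in> carrier D'" for i \<delta>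
    using UL.smult_closed[OF M.eu(1)[OF that] u(1)] by (simp add: f_def)
  have fh: "f i \<in> LinearCombinations.module_hom class_ring D' ?W" for i
  proof -
    have "f i (\<delta> \<oplus>\<^bsub>D'\<^esub> \<epsilon>) = f i \<delta> \<oplus>\<^bsub>?W\<^esub> f i \<epsilon>" if "\<delta> \<in> carrier D'" "\<epsilon> \<in> carrier D'" for \<delta> \<epsilon>
      unfolding f_def Ws M.eu_add[OF that, symmetric]
      by (rule UL.smult_l_distr[OF M.eu(1)[OF that(1)] M.eu(1)[OF that(2)] u(1)])
    moreover have "f i (c \<odot>\<^bsub>D'\<^esub> \<delta>) = c \<odot>\<^bsub>?W\<^esub> f i \<delta>" if \<delta>: "\<delta> \<in> carrier D'" for c \<delta>
      unfolding W_smult[OF fc[OF \<delta>]] unfolding f_def M.eu_smult[OF \<delta>] c1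
      by (rule UL.smult_assoc[OF aemb_simps(1) M.eu(1)[OF \<delta>] u(1)])
    ultimately show ?thesis using fc by (simp add: LinearCombinations.module_hom_def Ws)
  qed
  have span: "\<exists>w. w \<in> {..<m'} \<rightarrow> carrier D' \<and> v = finsum ?W (\<lambda>i. f i (w i)) {..<m'}" if "v \<in> carrier ?W" for v
    using M.simple_decomp[OF U_simple u, of v] that unfolding f_def Ws by blast
  have indep: "w i = \<zero>\<^bsub>D'\<^esub>"
    if "w \<in> {..<m'} \<rightarrow> carrier D'" "finsum ?W (\<lambda>i. f i (w i)) {..<m'} = \<zero>\<^bsub>?W\<^esub>" "i \<in> {..<m'}" for w i
    by (rule M.simple_decomp_unique[OF U_simple u]) (use that in \<open>auto simp: f_def Ws\<close>)
  have "family_basis ?W ({..<m'} \<times> {..<d\<^sup>2}) (\<lambda>p. f (fst p) (\<beta> (snd p)))"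
    by (rule W.family_basis_sum[OF F_algebraD(2)[OF M.D_F_algebra] \<beta>, where f = f and I = "{..<m'}"])
      (simp, rule fh, erule span, rule indep)
  from W.family_basis_dim(2)[OF this]
    W.family_basis_dim(2)[OF family_basis_restrict[OF module_vec_vspace family_basis_module_vec]]
  have "d * n = d * (m' * d)" by (simp add: power2_eq_square disj_commute)
  then show ?thesis using d_pos by simp
qed

text \<open>\<open>d\<close> lies in the set because \<open>n = m' d\<close>; it is a lower bound
  because it is least among all positive sizes, divisors of \<open>n\<close> or not.\<close>

lemma Min_degrees:
  assumes M: "matrix_alg_iso alg D' m' \<psi>'"
  defines "S \<equiv> {d'. 1 \<le> d' \<and> d' dvd n \<and> (\<exists>X \<in> carrier_mat d' d'. twisted_norm \<sigma> n X = \<iota> a \<cdot>\<^sub>m 1\<^sub>m d')}"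
  shows "S \<noteq> {}" "d = Min S"
proof -
  have d: "d \<in> S" using d_pos matrix_alg_size[OF M] A norm_A by (auto simp: S_def)
  then show "S \<noteq> {}" by blast
  have "finite S" using n_pos by (intro finite_subset[of S "{..n}"]) (auto simp: S_def dest: dvd_imp_le)
  moreover have "d \<le> k" if "k \<in> S" for k
  proof (rule ccontr)
    assume "\<not> d \<le> k"
    then have "k < d" by simp
    obtain X where "0 < k" "X \<in> carrier_mat k k" "twisted_norm \<sigma> n X = \<iota> a \<cdot>\<^sub>m 1\<^sub>m k"
      using \<open>k \<in> S\<close> unfolding S_def by auto
    with minimal[OF this(1) \<open>k < d\<close> this(2)] show False by blast
  qed
  ultimately show "d = Min S" using d by (intro Min_eqI[symmetric]) auto
qed

end

lemma (in kummer) minimal_norm_matrix_exists: "\<exists>d A. minimal_norm_matrix n q s a \<iota> h \<sigma> d A"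
proof -
  let ?P = "\<lambda>d. 0 < d \<and> (\<exists>A\<in>carrier_mat d d. twisted_norm \<sigma> n A = \<iota> a \<cdot>\<^sub>m 1\<^sub>m d)"
  define d where "d = (LEAST d. ?P d)"
  have Pn: "?P n" using norm_matrix_exists n_pos by blast
  have Pd: "?P d" unfolding d_def by (rule LeastI[of ?P, OF Pn])
  then obtain A where A: "A \<in> carrier_mat d d" "twisted_norm \<sigma> n A = \<iota> a \<cdot>\<^sub>m 1\<^sub>m d" by blast
  have min: "\<not> ?P k" if "k < d" for k using not_less_Least[of k ?P] that unfolding d_def by blast
  have "minimal_norm_matrix n q s a \<iota> h \<sigma> d A"
    by unfold_locales (use A Pd min in blast)+
  then show ?thesis by blast
qed


section \<open>The extension \<open>F[h]/(h\<^sup>n - s)\<close>\<close>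

text \<open>\<Phi> composed with the projection is a surjective homomorphism from polynomials that
  kills \<open>h^n - s\<close>; what is required of \<open>E\<close> is read off from it.\<close>

lemma kummer_of_quot:
  fixes \<Phi> :: "'f::field poly set \<Rightarrow> 'e::field" and \<sigma> :: "'e \<Rightarrow> 'e"
  assumes n: "n \<ge> 2" and q: "q ^ n = 1" "\<forall>k. 0 < k \<and> k < n \<longrightarrow> q ^ k \<noteq> 1"
    and s: "s \<noteq> 0" and a: "a \<noteq> 0"
    and E: "\<Phi> \<in> ring_iso (kummer_quot n s) (class_ring :: 'e ring)"
    and \<iota>: "\<iota> = (\<lambda>c. \<Phi> (kummer_class n s [:c:]))"
    and h: "h = \<Phi> (kummer_class n s [:0, 1:])"
    and \<sigma>: "\<sigma> \<in> alg_iso (E_alg \<iota>) (E_alg \<iota>)" "\<sigma> h = \<iota> q * h"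
  shows "kummer n q s a \<iota> h \<sigma>"
proof -
  let ?P = "class_ring :: 'f poly ring" and ?I = "kummer_ideal n s"
  interpret I: ideal ?I ?P unfolding kummer_ideal_def by (rule cring.cgenideal_ideal[OF class_cring.cring_axioms]) simp
  define \<rho> where "\<rho> p = \<Phi> (kummer_class n s p)" for p
  have \<Phi>: "\<Phi> \<in> Ring.ring_hom (?P Quot ?I) (class_ring :: 'e ring)"
    "bij_betw \<Phi> (carrier (?P Quot ?I)) UNIV"
    using E by (auto simp: ring_iso_def kummer_quot_def class_ring_simps)
  have "\<rho> \<in> Ring.ring_hom ?P (class_ring :: 'e ring)"
    using ring_hom_trans[OF I.rcos_ring_hom \<Phi>(1)] by (simp add: \<rho>_def[abs_def] kummer_class_def comp_def)
  then have \<rho>: "\<rho> (p + r) = \<rho> p + \<rho> r" "\<rho> (p * r) = \<rho> p * \<rho> r" "\<rho> 1 = 1" for p r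
    by (auto simp: Ring.ring_hom_def class_ring_simps)
  have \<rho>0: "\<rho> 0 = 0" by (metis \<rho>(1) add.right_neutral add_left_cancel)
  have \<iota>\<rho>: "\<iota> c = \<rho> [:c:]" and h\<rho>: "h = \<rho> [:0, 1:]" for c by (simp_all add: \<iota> h \<rho>_def)
  have mem: "\<rho> p = 0" if "p \<in> ?I" for p
    using I.a_rcos_const[OF that] I.a_rcos_const[OF I.zero_closed] \<rho>0 by (simp add: \<rho>_def kummer_class_def class_ring_simps)
  have \<iota>_hom: "\<iota> 1 = 1" "\<iota> (c + c') = \<iota> c + \<iota> c'" "\<iota> (c * c') = \<iota> c * \<iota> c'" for c c'
    using \<rho>(1)[of "[:c:]" "[:c':]"] \<rho>(2)[of "[:c:]" "[:c':]"] \<rho>(3) by (simp_all add: \<iota>\<rho> one_pCons mult.commute)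
  have \<iota>0: "\<iota> 0 = 0" using \<rho>0 by (simp add: \<iota>\<rho>)
  have "h ^ k = \<rho> (Polynomial.monom 1 k)" for k
  proof (induct k)
    case (Suc k)
    have "h ^ Suc k = \<rho> ([:0, 1:] * Polynomial.monom 1 k)" by (simp only: power_Suc Suc \<rho>(2) flip: h\<rho>)
    also have "[:0, 1:] * Polynomial.monom 1 k = Polynomial.monom (1 :: 'f) (Suc k)" by (simp add: monom_Suc)
    finally show ?case .
  qed (simp add: \<rho>(3))
  moreover have "\<rho> (Polynomial.monom 1 n - [:s:]) = 0"
    by (rule mem) (simp add: kummer_ideal_def ring.cgenideal_self[OF class_ring.ring_axioms])
  then have "\<rho> (Polynomial.monom 1 n) = \<iota> s"
    using \<rho>(1)[of "Polynomial.monom 1 n - [:s:]" "[:s:]"] by (simp add: \<iota>\<rho>)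
  ultimately have h_pow: "h ^ n = \<iota> s" by simp
  have span: "\<exists>c. e = (\<Sum>j<n. \<iota> (c j) * h ^ j)" for e
  proof -
    obtain C where C: "C \<in> carrier (?P Quot ?I)" "e = \<Phi> C"
      using \<Phi>(2) by (metis UNIV_I bij_betw_def imageE)
    then obtain p where "e = \<rho> p"
      by (auto simp: FactRing_def A_RCOSETS_def' \<rho>_def kummer_class_def)
    moreover have "\<exists>c. \<rho> p = (\<Sum>j<n. \<iota> (c j) * h ^ j)"
    proof (induct p)
      case 0
      show ?case by (rule exI[of _ "\<lambda>_. 0"]) (simp add: \<rho>0 \<iota>0)
    next
      case (pCons b p)
      then obtain c where c: "\<rho> p = (\<Sum>j<n. \<iota> (c j) * h ^ j)" by (elim exE)
      \<comment> \<open>Coefficients of \<open>b + h p\<close>: multiplication by \<open>h\<close>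
        shifts them by one, and the top term falls back into the constant coefficient through
        \<open>h^n = s\<close>.\<close>
      define c' where "c' j = (if j = 0 then b + c (n - 1) * s else c (j - 1))" for j
      obtain k where k: "n = Suc k" using n by (cases n) auto
      have "\<rho> (pCons b p) = \<rho> ([:b:] + [:0, 1:] * p)" by simp
      also have "\<dots> = \<iota> b + h * (\<Sum>j<n. \<iota> (c j) * h ^ j)" by (simp only: \<rho> \<iota>\<rho> h\<rho> c)
      also have "\<dots> = \<iota> b + (\<Sum>j<k. \<iota> (c j) * h ^ Suc j) + \<iota> (c k) * h ^ n"
        by (simp add: k sum_distrib_left algebra_simps)
      also have "\<dots> = \<iota> (c' 0) * h ^ 0 + (\<Sum>j<k. \<iota> (c' (Suc j)) * h ^ Suc j)"
        unfolding h_pow by (simp add: c'_def k \<iota>_hom)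
      also have "\<dots> = (\<Sum>j<n. \<iota> (c' j) * h ^ j)" unfolding k sum.lessThan_Suc_shift ..
      finally show ?case by (rule exI[of _ c'])
    qed
    ultimately show ?thesis by simp
  qed
  have \<sigma>h: "\<sigma> \<in> alg_hom (E_alg \<iota>) (E_alg \<iota>)" using \<sigma>(1) by (simp add: alg_iso_def)
  have \<sigma>_hom: "\<sigma> 1 = 1" "\<sigma> (e + e') = \<sigma> e + \<sigma> e'" "\<sigma> (e * e') = \<sigma> e * \<sigma> e'" "\<sigma> (\<iota> c * e) = \<iota> c * \<sigma> e" for e e' c
    using \<sigma>h by (auto simp: alg_hom_def Ring.ring_hom_def E_alg_def)
  \<comment> \<open>Linearity of \<sigma> at the element \<open>1\<close> says that \<sigma> fixes
    the image of \<open>F\<close>.\<close>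
  show ?thesis
    by unfold_locales
      (use n q s a \<iota>_hom \<sigma>_hom(1-3) \<sigma>_hom(4)[of _ 1] \<sigma>(2) h_pow span in \<open>simp_all\<close>)
qed

theorem theorem2p20:
  fixes n :: nat and q s a :: "'f::field"
    and \<Phi> :: "'f poly set \<Rightarrow> 'e::field"
    and \<iota> :: "'f \<Rightarrow> 'e" and h :: 'e and \<sigma> :: "'e \<Rightarrow> 'e"
    and \<E> :: "('f, 'e poly set) module"
    and emb :: "'e \<Rightarrow> 'e poly set" and x :: "'e poly set"
  assumes n: "n \<ge> 2"
    and q: "q ^ n = 1" "\<forall>k. 0 < k \<and> k < n \<longrightarrow> q ^ k \<noteq> 1"
    and s: "s \<noteq> 0" and a: "a \<noteq> 0"
    and E: "\<Phi> \<in> ring_iso (kummer_quot n s) (class_ring :: 'e ring)"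
    and \<iota>: "\<iota> = (\<lambda>c. \<Phi> (kummer_class n s [:c:]))"
    and h: "h = \<Phi> (kummer_class n s [:0, 1:])"
    and \<sigma>: "\<sigma> \<in> alg_iso (E_alg \<iota>) (E_alg \<iota>)" "\<sigma> h = \<iota> q * h"
    and \<E>: "\<E> = cyclic_algebra \<iota> \<sigma> n a"
    and emb: "emb = (\<lambda>e. cyclic_class \<sigma> n (\<iota> a) [:e:])"
    and x: "x = cyclic_class \<sigma> n (\<iota> a) [:0, 1:]"
  shows
    "(\<exists>(D :: ('f, 'e mat) module) m k.
        central_division D \<and> 1 \<le> m \<and> \<E> \<simeq>\<^sub>a mat_alg D m \<and> has_Deg D k \<and> n = m * k) \<and>
     (\<exists>U :: ('e poly set, 'e poly set) module. simple_module \<E> U) \<and>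
     (\<forall>(U :: ('e poly set, 'u) module) (V :: ('e poly set, 'v) module).
        simple_module \<E> U \<and> simple_module \<E> V \<longrightarrow> module_iso \<E> U V) \<and>
     (\<forall>(D :: ('f, 'd) module) m.
        central_division D \<and> 1 \<le> m \<and> \<E> \<simeq>\<^sub>a mat_alg D m \<longrightarrow>
        (\<exists>d. has_Deg D d \<and> n = m * d \<and>
          (let S = {d'. 1 \<le> d' \<and> d' dvd n \<and>
                     (\<exists>X \<in> carrier_mat d' d'. twisted_norm \<sigma> n X = \<iota> a \<cdot>\<^sub>m 1\<^sub>m d')}
           in S \<noteq> {} \<and> d = Min S) \<and>
          (\<forall>d' X. 1 \<le> d' \<and> d' dvd n \<and> X \<in> carrier_mat d' d' \<and>
             twisted_norm \<sigma> n X = \<iota> a \<cdot>\<^sub>m 1\<^sub>m d' \<longrightarrow> X \<in> Units (E_mat_alg \<iota> d')) \<and>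
          m = n div d \<and>
          (\<forall>U :: ('e poly set, 'u) module. simple_module \<E> U \<longrightarrow>
             module_iso class_ring (restrict_scalars emb U) (module_vec TYPE('e) d) \<and>
             (\<forall>b. ordered_basis (restrict_scalars emb U) d b \<longrightarrow>
               (\<exists>X. is_structure_matrix (restrict_scalars emb U) (\<lambda>u. x \<odot>\<^bsub>U\<^esub> u) d b X) \<and>
               (\<forall>X. is_structure_matrix (restrict_scalars emb U) (\<lambda>u. x \<odot>\<^bsub>U\<^esub> u) d b X \<longrightarrow>
                 X \<in> Units (E_mat_alg \<iota> d) \<and>
                 twisted_norm \<sigma> n X = \<iota> a \<cdot>\<^sub>m 1\<^sub>m d \<and>
                 central_division (D_alg \<iota> \<sigma> d X) \<and>
                 D \<simeq>\<^sub>a D_alg \<iota> \<sigma> d X \<and>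
                 right_act (restrict_scalars emb U) d b
                   \<in> alg_iso (D_alg \<iota> \<sigma> d X) (End_right \<E> U) \<and>
                 F_subalgebra (D_set \<iota> \<sigma> d X) (E_mat_alg \<iota> d) \<and>
                 omega_sigma \<iota> \<sigma> d X \<in> carrier (alg_Aut (E_mat_alg \<iota> d)) \<and>
                 D_alg \<iota> \<sigma> d X \<simeq>\<^sub>a fixed_alg (E_mat_alg \<iota> d) (omega_sigma \<iota> \<sigma> d X) \<and>
                 (let I = Inn (E_mat_alg \<iota> d);
                      N = inn_stabilizer (E_mat_alg \<iota> d) (D_set \<iota> \<sigma> d X);
                      C = inn_fixer (E_mat_alg \<iota> d) (D_set \<iota> \<sigma> d X)
                  in subgroup N I \<and> subgroup C I \<and> C \<lhd> I\<lparr>carrier := N\<rparr> \<and>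
                     alg_Aut (D_alg \<iota> \<sigma> d X) \<cong> (I\<lparr>carrier := N\<rparr>) Mod C))))))"
proof -
  interpret K: kummer n q s a \<iota> h \<sigma> by (rule kummer_of_quot[OF n q s a E \<iota> h \<sigma>])
  have emb': "emb = K.aemb" and x': "x = K.ax" by (simp_all add: emb x K.aemb_def[abs_def] K.ax_def K.cls_def)
  have \<E>': "\<E> = K.alg" by (simp add: \<E> K.alg_def)
  obtain d A where "minimal_norm_matrix n q s a \<iota> h \<sigma> d A" using K.minimal_norm_matrix_exists by (elim exE)
  then interpret M: minimal_norm_matrix n q s a \<iota> h \<sigma> d A .
  obtain m where m: "1 \<le> m" "\<E> \<simeq>\<^sub>a mat_alg (D_alg \<iota> \<sigma> d A) m"
    using M.alg_iso_mat_alg[OF M.D_division] unfolding \<E>' by (elim exE conjE)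
  obtain \<psi> where \<psi>: "matrix_alg_iso \<E> (D_alg \<iota> \<sigma> d A) m \<psi>"
    using K.matrix_alg_isoI[OF M.D_division m(1) m(2)[unfolded \<E>']] unfolding \<E>' by (elim exE) 
  \<comment> \<open>This presentation puts a primitive idempotent into \<E>; existence and
    uniqueness of simple modules follow, for carriers of any type.\<close>
  interpret A: matrix_alg_iso \<E> "D_alg \<iota> \<sigma> d A" m \<psi> by (rule \<psi>)
  show ?thesis
  proof (intro conjI, goal_cases)
    case 1
    show ?case
      using M.D_division m M.D_Deg M.matrix_alg_size[OF \<psi>[unfolded \<E>']]
      by (intro exI[of _ "D_alg \<iota> \<sigma> d A"] exI[of _ m] exI[of _ d] conjI)
  next
    case 2
    show ?case by (rule A.P.simple_module_exists)
  next
    case 3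
    show ?case using A.P.simple_modules_iso by blast
  next
    case 4
    show ?case
    proof (intro allI impI, elim conjE, goal_cases)
      case (1 D m')
      \<comment> \<open>The given presentation over \<open>D\<close> need not be the one
        constructed; the size \<open>d\<close> remains that of the minimal matrix.\<close>
      obtain \<psi>' where \<psi>': "matrix_alg_iso K.alg D m' \<psi>'"
        using K.matrix_alg_isoI[OF 1(1,2) 1(3)[unfolded \<E>']] by (elim exE)
      have size: "n = m' * d" by (rule M.matrix_alg_size[OF \<psi>'])
      \<comment> \<open>The structure matrix \<open>X\<close> of an arbitrary simple module in an
        arbitrary basis differs from \<open>A\<close> in general. It is again a norm matrix of least
        size, so the results for such matrices apply to it.\<close>
      have N: "norm_matrix n q s a \<iota> h \<sigma> d X" and div: "central_division (D_alg \<iota> \<sigma> d X)"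
        and D: "D \<simeq>\<^sub>a D_alg \<iota> \<sigma> d X"
        and End: "right_act (restrict_scalars emb U) d b \<in> alg_iso (D_alg \<iota> \<sigma> d X) (End_right \<E> U)"
        if U: "simple_module \<E> U" and b: "ordered_basis (restrict_scalars emb U) d b"
          and X: "is_structure_matrix (restrict_scalars emb U) (\<lambda>u. x \<odot>\<^bsub>U\<^esub> u) d b X"
        for U :: "('e poly set, 'u) module" and b X
      proof -
        note U' = U[unfolded \<E>']
        interpret UL: left_module K.alg U by (rule simple_module_left_module[OF U'])
        interpret C: cyclic_module n q s a \<iota> h \<sigma> U by unfold_locales
        note b' = b[unfolded emb' C.Vsp.ordered_basis_iff] and X' = X[unfolded emb' x']
        interpret B: minimal_norm_matrix n q s a \<iota> h \<sigma> d X by (rule M.simple_D_iso(1)[OF \<psi>' U' b' X'])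
        show "norm_matrix n q s a \<iota> h \<sigma> d X" by (rule B.norm_matrix_axioms)
        show "central_division (D_alg \<iota> \<sigma> d X)" by (rule B.D_division)
        show "D \<simeq>\<^sub>a D_alg \<iota> \<sigma> d X" by (rule M.simple_D_iso(2)[OF \<psi>' U' b' X'])
        show "right_act (restrict_scalars emb U) d b \<in> alg_iso (D_alg \<iota> \<sigma> d X) (End_right \<E> U)"
          unfolding emb' \<E>' by (rule M.simple_D_iso(3)[OF \<psi>' U' b' X'])
      qed
      note N' = norm_matrix.A_unit[OF N] norm_matrix.norm_A[OF N] norm_matrix.D_subalgebra[OF N]
        norm_matrix.omega_sigma_in_alg_Aut[OF N] norm_matrix.D_alg_fixed_alg[OF N] norm_matrix.alg_Aut_D[OF N]
      show ?case
        unfolding Let_def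
      proof (rule exI[of _ d], intro conjI allI impI, goal_cases)
        case 1 show ?case by (rule M.matrix_alg_Deg[OF \<psi>'])
      next
        case 2 show ?case by (rule size)
      next
        case 3 show ?case by (rule M.Min_degrees(1)[OF \<psi>'])
      next
        case 4 show ?case by (rule M.Min_degrees(2)[OF \<psi>'])
      next
        case 5 then show ?case by (elim conjE) (rule K.twisted_norm_unit)
      next
        case 6 show ?case using size M.d_pos by simp
      next
        case (7 U)
        then show ?case unfolding \<E>' emb' by (rule M.simple_module_vec(1)[OF \<psi>'])
      next
        case (8 U b)
        interpret UL: left_module K.alg U by (rule simple_module_left_module[OF 8(1)[unfolded \<E>']])
        interpret C: cyclic_module n q s a \<iota> h \<sigma> U by unfold_locales
        show ?case
          unfolding emb' x' by (rule C.sl.structure_matrix_exists[OF 8(2)[unfolded emb' C.Vsp.ordered_basis_iff]])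
      qed (rule div D End N'; assumption)+
    qed
  qed
qed

end
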